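(* Let $V$ be a lextensive category and let $E$ be a distributive cartesian multitensor on $V$. Then the functor $\Gamma_E$ gives an equivalence of categories $$E\text{-Mult}\simeq\Gamma E\text{-Op}_0$$ between the category of $E$-multitensors and the category of $\Gamma E$-operads over $\mathbf{Set}$.
   Context: A category $V$ is extensive when it has small coproducts and for every small family $(X_i)_{i\in I}$ the coproduct functor $\prod_iV/X_i\to V/\coprod_iX_i$ is an equivalence; it is lextensive when moreover it has finite limits. Enriched graphs. A $V$-graph $X$ consists of a set $X_0$ and objects $X(a,b)$ of $V$ for $(a,b)\in X_0\times X_0$; a morphism $f:X\to Y$ is a function $f_0:X_0\to Y_0$ with maps $f_{a,b}:X(a,b)\to Y(fa,fb)$. They form $\mathcal{G}V$, with forgetful functor $(-)_0$ to $\mathbf{Set}$. A monad on $\mathcal{G}V$ is over $\mathbf{Set}$ when its functor preserves object sets and object functions strictly and its unit and multiplication components are identities on objects. Multitensors. Let $MV=\coprod_nV^n$ be the category of finite sequences in $V$. A multitensor $(E,u,\sigma)$ is a functor $E:MV\to V$, $E(X_1,\dots,X_n)=E_iX_i$, with natural families $u_X:X\to E_1X$, $\sigma:E_iE_jX_{ij}\to E_{ij}X_{ij}$ (target: $E$ of the concatenated sequence) with $\sigma\circ u_{E_iX_i}=1$, $\sigma\circ E_i(u_{X_i})=1$ and the two composites $E_iE_jE_kX_{ijk}\to E_{ijk}X_{ijk}$ equal. It is distributive when each $V^n\to V$ preserves coproducts in each variable. It is cartesian when $E:MV\to V$ preserves pullbacks and $u,\sigma$ are cartesian (naturality squares are pullbacks).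 A multitensor map $\theta:(A,v,\rho)\to(E,u,\sigma)$ is a natural transformation $\theta:A\to E$ with $\theta v=u$ and $\theta\rho=\sigma\circ(\theta\theta)$. $\Gamma E$ is the monad on $\mathcal{G}V$ over $\mathbf{Set}$ with $\Gamma E(X)_0=X_0$ and $\Gamma E(X)(a,b)=\coprod_{a=x_0,\dots,x_n=b}E_iX(x_{i-1},x_i)$ (over all finite sequences of objects from $a$ to $b$), with unit and multiplication induced on homs by $u$ and $\sigma$ on summands (using distributivity to write $(\Gamma E)^2(X)(a,b)$ as the coproduct of the $E_iE_jX(x_{ij-1},x_{ij})$). $E\text{-Mult}$: objects are $E$-multitensors, i.e. multitensors $A$ on $V$ with a cartesian natural multitensor map $\alpha:A\to E$; morphisms $(A,\alpha)\to(B,\beta)$ are multitensor maps $\gamma:A\to B$ with $\beta\gamma=\alpha$. (Such an $A$ is distributive, by extensivity of $V$.) $\Gamma E\text{-Op}_0$: objects are $\Gamma E$-operads over $\mathbf{Set}$, i.e. monads $A$ on $\mathcal{G}V$ over $\mathbf{Set}$ with a monad morphism $\alpha:A\to\Gamma E$ that is a cartesian transformation with components identities on objects; morphisms $(A,\alpha)\to(B,\beta)$ are monad morphisms $\gamma:A\to B$ with $\beta\gamma=\alpha$. The functor $\Gamma_E$ sends $\alpha:A\to E$ to $\Gamma\alpha:\Gamma A\to\Gamma E$, the identity-on-objects transformation with hom maps $\coprod_{a=x_0,\dots,x_n=b}\alpha_{X(x_{i-1},x_i)}:\coprod A_iX(x_{i-1},x_i)\to\coprod E_iX(x_{i-1},x_i)$,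 and similarly on morphisms. *)

theory Defs
  imports "HOL-Library.Equipollence"
begin

section \<open>Categories\<close>

text \<open>
  Objects and arrows are carried by sets, and composition is written in the order
  \<open>g \<cdot> f\<close>. Functors and natural transformations are required to be extensional
  (\<open>undefined\<close> outside the carriers), so that HOL equality of functors and of natural
  transformations is the mathematical equality.
\<close>

record ('o, 'm) cat =
  Obj :: "'o set"
  Arr :: "'m set"
  Dom :: "'m \<Rightarrow> 'o"
  Cod :: "'m \<Rightarrow> 'o"
  Ide :: "'o \<Rightarrow> 'm"
  Comp :: "'m \<Rightarrow> 'm \<Rightarrow> 'm"  (infixl "\<cdot>\<index>" 70)

definition Hom :: "('o, 'm) cat \<Rightarrow> 'o \<Rightarrow> 'o \<Rightarrow> 'm set" where
  "Hom C a b = {f \<in> Arr C. Dom C f = a \<and> Cod C f = b}"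

locale category =
  fixes C :: "('o, 'm) cat" (structure)
  assumes dom_in: "f \<in> Arr C \<Longrightarrow> Dom C f \<in> Obj C"
    and cod_in: "f \<in> Arr C \<Longrightarrow> Cod C f \<in> Obj C"
    and ide_in: "a \<in> Obj C \<Longrightarrow> Ide C a \<in> Hom C a a"
    and comp_in: "f \<in> Hom C a b \<Longrightarrow> g \<in> Hom C b c \<Longrightarrow> g \<cdot> f \<in> Hom C a c"
    and ide_right: "f \<in> Hom C a b \<Longrightarrow> f \<cdot> Ide C a = f"
    and ide_left: "f \<in> Hom C a b \<Longrightarrow> Ide C b \<cdot> f = f"
    and assoc: "f \<in> Hom C a b \<Longrightarrow> g \<in> Hom C b c \<Longrightarrow> h \<in> Hom C c d
                  \<Longrightarrow> h \<cdot> (g \<cdot> f) = (h \<cdot> g) \<cdot> f"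

definition is_iso :: "('o, 'm) cat \<Rightarrow> 'm \<Rightarrow> bool" where
  "is_iso C f \<longleftrightarrow> f \<in> Arr C \<and>
     (\<exists>g \<in> Hom C (Cod C f) (Dom C f).
        g \<cdot>\<^bsub>C\<^esub> f = Ide C (Dom C f) \<and> f \<cdot>\<^bsub>C\<^esub> g = Ide C (Cod C f))"

record ('o1, 'm1, 'o2, 'm2) func =
  obj_map :: "'o1 \<Rightarrow> 'o2"
  arr_map :: "'m1 \<Rightarrow> 'm2"

locale cat_functor = C: category C + D: category D
  for C :: "('o1, 'm1) cat" and D :: "('o2, 'm2) cat" +
  fixes F :: "('o1, 'm1, 'o2, 'm2) func"
  assumes obj_map: "obj_map F \<in> Obj C \<rightarrow>\<^sub>E Obj D"
    and arr_map_ext: "arr_map F \<in> extensional (Arr C)"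
    and arr_map: "f \<in> Hom C a b \<Longrightarrow> arr_map F f \<in> Hom D (obj_map F a) (obj_map F b)"
    and map_ide: "a \<in> Obj C \<Longrightarrow> arr_map F (Ide C a) = Ide D (obj_map F a)"
    and map_comp: "f \<in> Hom C a b \<Longrightarrow> g \<in> Hom C b c
                     \<Longrightarrow> arr_map F (g \<cdot>\<^bsub>C\<^esub> f) = arr_map F g \<cdot>\<^bsub>D\<^esub> arr_map F f"

definition id_functor :: "('o, 'm) cat \<Rightarrow> ('o, 'm, 'o, 'm) func" where
  "id_functor C = \<lparr>obj_map = (\<lambda>a\<in>Obj C. a), arr_map = (\<lambda>f\<in>Arr C. f)\<rparr>"

definition comp_functor ::
  "('o1, 'm1) cat \<Rightarrow> ('o2, 'm2, 'o3, 'm3) func \<Rightarrow> ('o1, 'm1, 'o2, 'm2) func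
     \<Rightarrow> ('o1, 'm1, 'o3, 'm3) func" where
  "comp_functor C G F =
     \<lparr>obj_map = (\<lambda>a\<in>Obj C. obj_map G (obj_map F a)),
      arr_map = (\<lambda>f\<in>Arr C. arr_map G (arr_map F f))\<rparr>"

locale nat_trans = F: cat_functor C D F + G: cat_functor C D G
  for C :: "('o1, 'm1) cat" and D :: "('o2, 'm2) cat"
    and F G :: "('o1, 'm1, 'o2, 'm2) func" +
  fixes \<tau> :: "'o1 \<Rightarrow> 'm2"
  assumes ext: "\<tau> \<in> extensional (Obj C)"
    and component: "a \<in> Obj C \<Longrightarrow> \<tau> a \<in> Hom D (obj_map F a) (obj_map G a)"
    and naturality: "f \<in> Hom C a b
                       \<Longrightarrow> arr_map G f \<cdot>\<^bsub>D\<^esub> \<tau> a = \<tau> b \<cdot>\<^bsub>D\<^esub> arr_map F f"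

definition nat_iso ::
  "('o1, 'm1) cat \<Rightarrow> ('o2, 'm2) cat \<Rightarrow> ('o1, 'm1, 'o2, 'm2) func
     \<Rightarrow> ('o1, 'm1, 'o2, 'm2) func \<Rightarrow> ('o1 \<Rightarrow> 'm2) \<Rightarrow> bool" where
  "nat_iso C D F G \<tau> \<longleftrightarrow> nat_trans C D F G \<tau> \<and> (\<forall>a\<in>Obj C. is_iso D (\<tau> a))"

definition is_equivalence ::
  "('o1, 'm1) cat \<Rightarrow> ('o2, 'm2) cat \<Rightarrow> ('o1, 'm1, 'o2, 'm2) func \<Rightarrow> bool" where
  "is_equivalence C D F \<longleftrightarrow> cat_functor C D F \<and>
     (\<exists>G \<eta> \<epsilon>. cat_functor D C G \<and>
        nat_iso C C (id_functor C) (comp_functor C G F) \<eta> \<and>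
        nat_iso D D (comp_functor D F G) (id_functor D) \<epsilon>)"

definition vert_comp ::
  "('o1, 'm1) cat \<Rightarrow> ('o2, 'm2) cat \<Rightarrow> ('o1 \<Rightarrow> 'm2) \<Rightarrow> ('o1 \<Rightarrow> 'm2) \<Rightarrow> ('o1 \<Rightarrow> 'm2)" where
  "vert_comp C D \<beta> \<alpha> = (\<lambda>a\<in>Obj C. \<beta> a \<cdot>\<^bsub>D\<^esub> \<alpha> a)"

definition id_trans ::
  "('o1, 'm1) cat \<Rightarrow> ('o2, 'm2) cat \<Rightarrow> ('o1, 'm1, 'o2, 'm2) func \<Rightarrow> ('o1 \<Rightarrow> 'm2)" where
  "id_trans C D F = (\<lambda>a\<in>Obj C. Ide D (obj_map F a))"


section \<open>Pullbacks, finite limits, coproducts\<close>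

text \<open>The square \<open>f \<cdot> p = g \<cdot> q\<close> is a pullback.\<close>

definition is_pullback :: "('o, 'm) cat \<Rightarrow> 'm \<Rightarrow> 'm \<Rightarrow> 'm \<Rightarrow> 'm \<Rightarrow> bool" where
  "is_pullback C p q f g \<longleftrightarrow>
     p \<in> Arr C \<and> q \<in> Arr C \<and> f \<in> Arr C \<and> g \<in> Arr C \<and>
     Dom C p = Dom C q \<and> Cod C p = Dom C f \<and> Cod C q = Dom C g \<and> Cod C f = Cod C g \<and>
     f \<cdot>\<^bsub>C\<^esub> p = g \<cdot>\<^bsub>C\<^esub> q \<and>
     (\<forall>w\<in>Obj C. \<forall>r \<in> Hom C w (Dom C f). \<forall>s \<in> Hom C w (Dom C g).
        f \<cdot>\<^bsub>C\<^esub> r = g \<cdot>\<^bsub>C\<^esub> s \<longrightarrow>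
        (\<exists>!h. h \<in> Hom C w (Dom C p) \<and> p \<cdot>\<^bsub>C\<^esub> h = r \<and> q \<cdot>\<^bsub>C\<^esub> h = s))"

definition preserves_pullbacks ::
  "('o1, 'm1) cat \<Rightarrow> ('o2, 'm2) cat \<Rightarrow> ('o1, 'm1, 'o2, 'm2) func \<Rightarrow> bool" where
  "preserves_pullbacks C D F \<longleftrightarrow>
     (\<forall>p q f g. is_pullback C p q f g \<longrightarrow>
        is_pullback D (arr_map F p) (arr_map F q) (arr_map F f) (arr_map F g))"

definition cartesian_trans ::
  "('o1, 'm1) cat \<Rightarrow> ('o2, 'm2) cat \<Rightarrow> ('o1, 'm1, 'o2, 'm2) func
     \<Rightarrow> ('o1, 'm1, 'o2, 'm2) func \<Rightarrow> ('o1 \<Rightarrow> 'm2) \<Rightarrow> bool" where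
  "cartesian_trans C D F G \<tau> \<longleftrightarrow> nat_trans C D F G \<tau> \<and>
     (\<forall>f\<in>Arr C. is_pullback D (arr_map F f) (\<tau> (Dom C f)) (\<tau> (Cod C f)) (arr_map G f))"

definition is_cone ::
  "('j, 'k) cat \<Rightarrow> ('o, 'm) cat \<Rightarrow> ('j, 'k, 'o, 'm) func \<Rightarrow> 'o \<Rightarrow> ('j \<Rightarrow> 'm) \<Rightarrow> bool" where
  "is_cone J C D w \<pi> \<longleftrightarrow> w \<in> Obj C \<and> (\<forall>j\<in>Obj J. \<pi> j \<in> Hom C w (obj_map D j)) \<and>
     (\<forall>k\<in>Arr J. arr_map D k \<cdot>\<^bsub>C\<^esub> \<pi> (Dom J k) = \<pi> (Cod J k))"

definition is_limit ::
  "('j, 'k) cat \<Rightarrow> ('o, 'm) cat \<Rightarrow> ('j, 'k, 'o, 'm) func \<Rightarrow> 'o \<Rightarrow> ('j \<Rightarrow> 'm) \<Rightarrow> bool" where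
  "is_limit J C D l \<pi> \<longleftrightarrow> is_cone J C D l \<pi> \<and>
     (\<forall>w \<rho>. is_cone J C D w \<rho> \<longrightarrow>
        (\<exists>!h. h \<in> Hom C w l \<and> (\<forall>j\<in>Obj J. \<pi> j \<cdot>\<^bsub>C\<^esub> h = \<rho> j)))"

text \<open>
  Every finite category is isomorphic to one whose objects and arrows are natural numbers,
  so the type of the diagram shapes is no restriction.
\<close>

definition has_finite_limits :: "('o, 'm) cat \<Rightarrow> bool" where
  "has_finite_limits C \<longleftrightarrow>
     (\<forall>(J :: (nat, nat) cat) D.
        category J \<and> finite (Obj J) \<and> finite (Arr J) \<and> cat_functor J C D \<longrightarrow>
        (\<exists>l \<pi>. is_limit J C D l \<pi>))"

definition is_coproduct ::
  "('o, 'm) cat \<Rightarrow> 'i set \<Rightarrow> ('i \<Rightarrow> 'o) \<Rightarrow> 'o \<Rightarrow> ('i \<Rightarrow> 'm) \<Rightarrow> bool" where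
  "is_coproduct C I X c \<iota> \<longleftrightarrow>
     (\<forall>i\<in>I. X i \<in> Obj C) \<and> c \<in> Obj C \<and> (\<forall>i\<in>I. \<iota> i \<in> Hom C (X i) c) \<and>
     (\<forall>d\<in>Obj C. \<forall>f. (\<forall>i\<in>I. f i \<in> Hom C (X i) d) \<longrightarrow>
        (\<exists>!h. h \<in> Hom C c d \<and> (\<forall>i\<in>I. h \<cdot>\<^bsub>C\<^esub> \<iota> i = f i)))"

text \<open>A choice of coproducts (which depends only on the values of \<open>X\<close> on \<open>I\<close>).\<close>

definition chosen_coprod ::
  "('o, 'm) cat \<Rightarrow> 'i set \<Rightarrow> ('i \<Rightarrow> 'o) \<Rightarrow> 'o \<times> ('i \<Rightarrow> 'm)" where
  "chosen_coprod C I X = (SOME (c, \<iota>). is_coproduct C I X c \<iota>)"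

definition coprod :: "('o, 'm) cat \<Rightarrow> 'i set \<Rightarrow> ('i \<Rightarrow> 'o) \<Rightarrow> 'o" where
  "coprod C I X = fst (chosen_coprod C I X)"

definition coprod_inj :: "('o, 'm) cat \<Rightarrow> 'i set \<Rightarrow> ('i \<Rightarrow> 'o) \<Rightarrow> 'i \<Rightarrow> 'm" where
  "coprod_inj C I X = snd (chosen_coprod C I X)"

definition cotuple ::
  "('o, 'm) cat \<Rightarrow> 'i set \<Rightarrow> ('i \<Rightarrow> 'o) \<Rightarrow> 'o \<Rightarrow> ('i \<Rightarrow> 'm) \<Rightarrow> 'm" where
  "cotuple C I X d f =
     (THE h. h \<in> Hom C (coprod C I X) d \<and> (\<forall>i\<in>I. h \<cdot>\<^bsub>C\<^esub> coprod_inj C I X i = f i))"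

definition coprod_map ::
  "('o, 'm) cat \<Rightarrow> 'i set \<Rightarrow> ('i \<Rightarrow> 'o) \<Rightarrow> ('i \<Rightarrow> 'o) \<Rightarrow> ('i \<Rightarrow> 'm) \<Rightarrow> 'm" where
  "coprod_map C I X Y f =
     cotuple C I X (coprod C I Y) (\<lambda>i. coprod_inj C I Y i \<cdot>\<^bsub>C\<^esub> f i)"


section \<open>Lextensive categories\<close>

text \<open>
  Small sets: \<open>U\<close> is the collection of all subsets of the type \<open>'u\<close> that count as small.
  The conditions say that smallness depends only on cardinality, with a regular
  uncountable cardinal as strict bound. If \<open>'u\<close> has the cardinality of a Grothendieck
  universe, the sets of smaller cardinality than \<open>'u\<close> form such a collection; for every
  infinite type, so do all its subsets.
\<close>

locale small_sets =
  fixes U :: "'u set set"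
  assumes small_lepoll: "A \<in> U \<Longrightarrow> B \<lesssim> A \<Longrightarrow> B \<in> U"
    and small_infinite: "\<exists>A\<in>U. infinite A"
    and small_UN: "A \<in> U \<Longrightarrow> (\<And>a. a \<in> A \<Longrightarrow> F a \<in> U) \<Longrightarrow> (\<Union>a\<in>A. F a) \<in> U"

definition product_cat :: "'i set \<Rightarrow> ('i \<Rightarrow> ('o, 'm) cat) \<Rightarrow> ('i \<Rightarrow> 'o, 'i \<Rightarrow> 'm) cat" where
  "product_cat I C =
     \<lparr>Obj = (\<Pi>\<^sub>E i\<in>I. Obj (C i)),
      Arr = (\<Pi>\<^sub>E i\<in>I. Arr (C i)),
      Dom = (\<lambda>f. \<lambda>i\<in>I. Dom (C i) (f i)),
      Cod = (\<lambda>f. \<lambda>i\<in>I. Cod (C i) (f i)),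
      Ide = (\<lambda>a. \<lambda>i\<in>I. Ide (C i) (a i)),
      Comp = (\<lambda>g f. \<lambda>i\<in>I. g i \<cdot>\<^bsub>C i\<^esub> f i)\<rparr>"

text \<open>
  The slice \<open>C/X\<close>: the triple \<open>(p, h, q)\<close> is the morphism \<open>h\<close> from \<open>p\<close> to \<open>q\<close>.
\<close>

definition slice_cat :: "('o, 'm) cat \<Rightarrow> 'o \<Rightarrow> ('m, 'm \<times> 'm \<times> 'm) cat" where
  "slice_cat C X =
     \<lparr>Obj = {p \<in> Arr C. Cod C p = X},
      Arr = {(p, h, q). p \<in> Arr C \<and> Cod C p = X \<and> q \<in> Arr C \<and> Cod C q = X \<and>
               h \<in> Hom C (Dom C p) (Dom C q) \<and> q \<cdot>\<^bsub>C\<^esub> h = p},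
      Dom = (\<lambda>(p, h, q). p),
      Cod = (\<lambda>(p, h, q). q),
      Ide = (\<lambda>p. (p, Ide C (Dom C p), p)),
      Comp = (\<lambda>(q', k, r) (p, h, q). (p, k \<cdot>\<^bsub>C\<^esub> h, r))\<rparr>"

definition coprod_functor ::
  "('o, 'm) cat \<Rightarrow> 'i set \<Rightarrow> ('i \<Rightarrow> 'o)
     \<Rightarrow> ('i \<Rightarrow> 'm, 'i \<Rightarrow> 'm \<times> 'm \<times> 'm, 'm, 'm \<times> 'm \<times> 'm) func" where
  "coprod_functor C I X =
     (let P = product_cat I (\<lambda>i. slice_cat C (X i));
          T = (\<lambda>p. coprod_map C I (\<lambda>i. Dom C (p i)) X p)
      in \<lparr>obj_map = (\<lambda>p\<in>Obj P. T p),
          arr_map = (\<lambda>t\<in>Arr P.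
             (T (Dom P t),
              coprod_map C I (\<lambda>i. Dom C (Dom P t i)) (\<lambda>i. Dom C (Cod P t i))
                (\<lambda>i. fst (snd (t i))),
              T (Cod P t)))\<rparr>)"

definition extensive :: "'u set set \<Rightarrow> ('o, 'm) cat \<Rightarrow> bool" where
  "extensive U V \<longleftrightarrow> category V \<and>
     (\<forall>I\<in>U. \<forall>X. (\<forall>i\<in>I. X i \<in> Obj V) \<longrightarrow> (\<exists>c \<iota>. is_coproduct V I X c \<iota>)) \<and>
     (\<forall>I\<in>U. \<forall>X. (\<forall>i\<in>I. X i \<in> Obj V) \<longrightarrow>
        is_equivalence (product_cat I (\<lambda>i. slice_cat V (X i))) (slice_cat V (coprod V I X))
          (coprod_functor V I X))"

definition lextensive :: "'u set set \<Rightarrow> ('o, 'm) cat \<Rightarrow> bool" where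
  "lextensive U V \<longleftrightarrow> extensive U V \<and> has_finite_limits V"


section \<open>Finite sequences and multitensors\<close>

text \<open>
  The category \<open>MC\<close> of finite sequences, i.e. the disjoint union of the powers of \<open>C\<close>.
  An arrow is a list of arrows, so its domain and codomain have the same length.
\<close>

definition seq_cat :: "('o, 'm) cat \<Rightarrow> ('o list, 'm list) cat" where
  "seq_cat C =
     \<lparr>Obj = lists (Obj C),
      Arr = lists (Arr C),
      Dom = map (Dom C),
      Cod = map (Cod C),
      Ide = map (Ide C),
      Comp = map2 (Comp C)\<rparr>"

definition seq_functor ::
  "('o1, 'm1) cat \<Rightarrow> ('o1, 'm1, 'o2, 'm2) func
     \<Rightarrow> ('o1 list, 'm1 list, 'o2 list, 'm2 list) func" where
  "seq_functor C F =
     \<lparr>obj_map = (\<lambda>Xs\<in>Obj (seq_cat C). map (obj_map F) Xs),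
      arr_map = (\<lambda>fs\<in>Arr (seq_cat C). map (arr_map F) fs)\<rparr>"

definition singleton_functor :: "('o, 'm) cat \<Rightarrow> ('o, 'm, 'o list, 'm list) func" where
  "singleton_functor C =
     \<lparr>obj_map = (\<lambda>X\<in>Obj C. [X]), arr_map = (\<lambda>f\<in>Arr C. [f])\<rparr>"

definition concat_functor ::
  "('o, 'm) cat \<Rightarrow> ('o list list, 'm list list, 'o list, 'm list) func" where
  "concat_functor C =
     \<lparr>obj_map = (\<lambda>Xss\<in>Obj (seq_cat (seq_cat C)). concat Xss),
      arr_map = (\<lambda>fss\<in>Arr (seq_cat (seq_cat C)). concat fss)\<rparr>"

record ('o, 'm) multitensor =
  tensor :: "('o list, 'm list, 'o, 'm) func"
  tunit :: "'o \<Rightarrow> 'm"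
  tsubst :: "'o list list \<Rightarrow> 'm"

abbreviation tens :: "('o, 'm) multitensor \<Rightarrow> 'o list \<Rightarrow> 'o" where
  "tens E \<equiv> obj_map (tensor E)"

abbreviation tens_arr :: "('o, 'm) multitensor \<Rightarrow> 'm list \<Rightarrow> 'm" where
  "tens_arr E \<equiv> arr_map (tensor E)"

text \<open>The functors \<open>X \<mapsto> E\<^sub>1 X\<close>, \<open>X\<^sub>i\<^sub>j \<mapsto> E\<^sub>i E\<^sub>j X\<^sub>i\<^sub>j\<close> and \<open>X\<^sub>i\<^sub>j \<mapsto> E\<^sub>i\<^sub>j X\<^sub>i\<^sub>j\<close>.\<close>

definition tensor_one :: "('o, 'm) cat \<Rightarrow> ('o, 'm) multitensor \<Rightarrow> ('o, 'm, 'o, 'm) func" where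
  "tensor_one V E = comp_functor V (tensor E) (singleton_functor V)"

definition tensor_iter ::
  "('o, 'm) cat \<Rightarrow> ('o, 'm) multitensor \<Rightarrow> ('o list list, 'm list list, 'o, 'm) func" where
  "tensor_iter V E =
     comp_functor (seq_cat (seq_cat V)) (tensor E) (seq_functor (seq_cat V) (tensor E))"

definition tensor_concat ::
  "('o, 'm) cat \<Rightarrow> ('o, 'm) multitensor \<Rightarrow> ('o list list, 'm list list, 'o, 'm) func" where
  "tensor_concat V E = comp_functor (seq_cat (seq_cat V)) (tensor E) (concat_functor V)"

locale multitensor =
  fixes V :: "('o, 'm) cat" and E :: "('o, 'm) multitensor"
  assumes tensor_functor: "cat_functor (seq_cat V) V (tensor E)"
    and unit_natural: "nat_trans V V (id_functor V) (tensor_one V E) (tunit E)"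
    and subst_natural:
      "nat_trans (seq_cat (seq_cat V)) V (tensor_iter V E) (tensor_concat V E) (tsubst E)"
    and unit_outer: "Xs \<in> Obj (seq_cat V)
      \<Longrightarrow> tsubst E [Xs] \<cdot>\<^bsub>V\<^esub> tunit E (tens E Xs) = Ide V (tens E Xs)"
    and unit_inner: "Xs \<in> Obj (seq_cat V)
      \<Longrightarrow> tsubst E (map (\<lambda>X. [X]) Xs) \<cdot>\<^bsub>V\<^esub> tens_arr E (map (tunit E) Xs) = Ide V (tens E Xs)"
    and subst_assoc: "Xsss \<in> Obj (seq_cat (seq_cat (seq_cat V)))
      \<Longrightarrow> tsubst E (concat Xsss) \<cdot>\<^bsub>V\<^esub> tsubst E (map (map (tens E)) Xsss)
        = tsubst E (map concat Xsss) \<cdot>\<^bsub>V\<^esub> tens_arr E (map (tsubst E) Xsss)"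

definition distributive_multitensor ::
  "'u set set \<Rightarrow> ('o, 'm) cat \<Rightarrow> ('o, 'm) multitensor \<Rightarrow> bool" where
  "distributive_multitensor U V E \<longleftrightarrow>
     (\<forall>Xs\<in>Obj (seq_cat V). \<forall>k<length Xs. \<forall>I\<in>U. \<forall>Y c \<iota>.
        is_coproduct V I Y c \<iota> \<longrightarrow>
        is_coproduct V I (\<lambda>i. tens E (Xs[k := Y i])) (tens E (Xs[k := c]))
          (\<lambda>i. tens_arr E ((map (Ide V) Xs)[k := \<iota> i])))"

definition cartesian_multitensor :: "('o, 'm) cat \<Rightarrow> ('o, 'm) multitensor \<Rightarrow> bool" where
  "cartesian_multitensor V E \<longleftrightarrow>
     preserves_pullbacks (seq_cat V) V (tensor E) \<and>
     cartesian_trans V V (id_functor V) (tensor_one V E) (tunit E) \<and>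
     cartesian_trans (seq_cat (seq_cat V)) V (tensor_iter V E) (tensor_concat V E) (tsubst E)"

locale multitensor_map = A: multitensor V A + E: multitensor V E
  for V :: "('o, 'm) cat" and A E :: "('o, 'm) multitensor" +
  fixes \<theta> :: "'o list \<Rightarrow> 'm"
  assumes natural: "nat_trans (seq_cat V) V (tensor A) (tensor E) \<theta>"
    and map_unit: "X \<in> Obj V \<Longrightarrow> \<theta> [X] \<cdot>\<^bsub>V\<^esub> tunit A X = tunit E X"
    and map_subst: "Xss \<in> Obj (seq_cat (seq_cat V))
      \<Longrightarrow> \<theta> (concat Xss) \<cdot>\<^bsub>V\<^esub> tsubst A Xss
        = tsubst E Xss \<cdot>\<^bsub>V\<^esub> (tens_arr E (map \<theta> Xss) \<cdot>\<^bsub>V\<^esub> \<theta> (map (tens A) Xss))"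

type_synonym ('o, 'm) mult_over = "('o, 'm) multitensor \<times> ('o list \<Rightarrow> 'm)"

definition Mult_objects ::
  "('o, 'm) cat \<Rightarrow> ('o, 'm) multitensor \<Rightarrow> ('o, 'm) mult_over set" where
  "Mult_objects V E = {(A, \<alpha>). multitensor_map V A E \<alpha> \<and>
     cartesian_trans (seq_cat V) V (tensor A) (tensor E) \<alpha>}"

definition Mult ::
  "('o, 'm) cat \<Rightarrow> ('o, 'm) multitensor
     \<Rightarrow> (('o, 'm) mult_over, ('o, 'm) mult_over \<times> ('o list \<Rightarrow> 'm) \<times> ('o, 'm) mult_over) cat" where
  "Mult V E =
     \<lparr>Obj = Mult_objects V E,
      Arr = {((A, \<alpha>), \<gamma>, (B, \<beta>)). (A, \<alpha>) \<in> Mult_objects V E \<and> (B, \<beta>) \<in> Mult_objects V E \<and>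
               multitensor_map V A B \<gamma> \<and> vert_comp (seq_cat V) V \<beta> \<gamma> = \<alpha>},
      Dom = (\<lambda>(a, \<gamma>, b). a),
      Cod = (\<lambda>(a, \<gamma>, b). b),
      Ide = (\<lambda>(A, \<alpha>). ((A, \<alpha>), id_trans (seq_cat V) V (tensor A), (A, \<alpha>))),
      Comp = (\<lambda>(b', \<delta>, c) (a, \<gamma>, b). (a, vert_comp (seq_cat V) V \<delta> \<gamma>, c))\<rparr>"


section \<open>Enriched graphs\<close>

record ('u, 'o) vgraph =
  verts :: "'u set"
  homs :: "'u \<times> 'u \<Rightarrow> 'o"

record ('u, 'o, 'm) vgraph_mor =
  source :: "('u, 'o) vgraph"
  target :: "('u, 'o) vgraph"
  vmap :: "'u \<Rightarrow> 'u"
  hmap :: "'u \<times> 'u \<Rightarrow> 'm"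

definition vgraphs :: "'u set set \<Rightarrow> ('o, 'm) cat \<Rightarrow> ('u, 'o) vgraph set" where
  "vgraphs U V = {X. verts X \<in> U \<and> homs X \<in> verts X \<times> verts X \<rightarrow>\<^sub>E Obj V}"

definition graph_cat ::
  "'u set set \<Rightarrow> ('o, 'm) cat \<Rightarrow> (('u, 'o) vgraph, ('u, 'o, 'm) vgraph_mor) cat" where
  "graph_cat U V =
     \<lparr>Obj = vgraphs U V,
      Arr = {f. source f \<in> vgraphs U V \<and> target f \<in> vgraphs U V \<and>
               vmap f \<in> verts (source f) \<rightarrow>\<^sub>E verts (target f) \<and>
               hmap f \<in> (\<Pi>\<^sub>E (a, b) \<in> verts (source f) \<times> verts (source f).
                  Hom V (homs (source f) (a, b)) (homs (target f) (vmap f a, vmap f b)))},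
      Dom = source,
      Cod = target,
      Ide = (\<lambda>X. \<lparr>source = X, target = X, vmap = (\<lambda>a\<in>verts X. a),
                   hmap = (\<lambda>(a, b)\<in>verts X \<times> verts X. Ide V (homs X (a, b)))\<rparr>),
      Comp = (\<lambda>g f. \<lparr>source = source f, target = target g,
                   vmap = (\<lambda>a\<in>verts (source f). vmap g (vmap f a)),
                   hmap = (\<lambda>(a, b)\<in>verts (source f) \<times> verts (source f).
                      hmap g (vmap f a, vmap f b) \<cdot>\<^bsub>V\<^esub> hmap f (a, b))\<rparr>)\<rparr>"


section \<open>Monads and operads\<close>

record ('o, 'm) monad =
  endo :: "('o, 'm, 'o, 'm) func"
  munit :: "'o \<Rightarrow> 'm"
  mmult :: "'o \<Rightarrow> 'm"

locale monad =
  fixes C :: "('o, 'm) cat" (structure) and T :: "('o, 'm) monad"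
  assumes endofunctor: "cat_functor C C (endo T)"
    and unit_natural: "nat_trans C C (id_functor C) (endo T) (munit T)"
    and mult_natural: "nat_trans C C (comp_functor C (endo T) (endo T)) (endo T) (mmult T)"
    and unit_outer: "X \<in> Obj C
      \<Longrightarrow> mmult T X \<cdot> munit T (obj_map (endo T) X) = Ide C (obj_map (endo T) X)"
    and unit_inner: "X \<in> Obj C
      \<Longrightarrow> mmult T X \<cdot> arr_map (endo T) (munit T X) = Ide C (obj_map (endo T) X)"
    and mult_assoc: "X \<in> Obj C
      \<Longrightarrow> mmult T X \<cdot> mmult T (obj_map (endo T) X)
        = mmult T X \<cdot> arr_map (endo T) (mmult T X)"

locale monad_morphism = S: monad C S + T: monad C T
  for C :: "('o, 'm) cat" (structure) and S T :: "('o, 'm) monad" +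
  fixes \<gamma> :: "'o \<Rightarrow> 'm"
  assumes natural: "nat_trans C C (endo S) (endo T) \<gamma>"
    and map_unit: "X \<in> Obj C \<Longrightarrow> \<gamma> X \<cdot> munit S X = munit T X"
    and map_mult: "X \<in> Obj C
      \<Longrightarrow> \<gamma> X \<cdot> mmult S X
        = mmult T X \<cdot> (arr_map (endo T) (\<gamma> X) \<cdot> \<gamma> (obj_map (endo S) X))"

type_synonym ('u, 'o, 'm) graph_monad = "(('u, 'o) vgraph, ('u, 'o, 'm) vgraph_mor) monad"

definition identity_on_objects ::
  "'u set set \<Rightarrow> ('o, 'm) cat \<Rightarrow> (('u, 'o) vgraph \<Rightarrow> ('u, 'o, 'm) vgraph_mor) \<Rightarrow> bool" where
  "identity_on_objects U V \<tau> \<longleftrightarrow> (\<forall>X\<in>Obj (graph_cat U V). vmap (\<tau> X) = (\<lambda>a\<in>verts X. a))"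

definition monad_over_Set ::
  "'u set set \<Rightarrow> ('o, 'm) cat \<Rightarrow> ('u, 'o, 'm) graph_monad \<Rightarrow> bool" where
  "monad_over_Set U V T \<longleftrightarrow> monad (graph_cat U V) T \<and>
     (\<forall>X\<in>Obj (graph_cat U V). verts (obj_map (endo T) X) = verts X) \<and>
     (\<forall>f\<in>Arr (graph_cat U V). vmap (arr_map (endo T) f) = vmap f) \<and>
     identity_on_objects U V (munit T) \<and> identity_on_objects U V (mmult T)"

type_synonym ('u, 'o, 'm) monad_over =
  "('u, 'o, 'm) graph_monad \<times> (('u, 'o) vgraph \<Rightarrow> ('u, 'o, 'm) vgraph_mor)"

definition Op_objects ::
  "'u set set \<Rightarrow> ('o, 'm) cat \<Rightarrow> ('u, 'o, 'm) graph_monad \<Rightarrow> ('u, 'o, 'm) monad_over set" where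
  "Op_objects U V T = {(A, \<alpha>). monad_over_Set U V A \<and>
     monad_morphism (graph_cat U V) A T \<alpha> \<and>
     cartesian_trans (graph_cat U V) (graph_cat U V) (endo A) (endo T) \<alpha> \<and>
     identity_on_objects U V \<alpha>}"

definition Op ::
  "'u set set \<Rightarrow> ('o, 'm) cat \<Rightarrow> ('u, 'o, 'm) graph_monad
     \<Rightarrow> (('u, 'o, 'm) monad_over,
         ('u, 'o, 'm) monad_over \<times> (('u, 'o) vgraph \<Rightarrow> ('u, 'o, 'm) vgraph_mor)
           \<times> ('u, 'o, 'm) monad_over) cat" where
  "Op U V T =
     (let G = graph_cat U V in
      \<lparr>Obj = Op_objects U V T,
       Arr = {((A, \<alpha>), \<gamma>, (B, \<beta>)). (A, \<alpha>) \<in> Op_objects U V T \<and> (B, \<beta>) \<in> Op_objects U V T \<and>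
                monad_morphism G A B \<gamma> \<and> vert_comp G G \<beta> \<gamma> = \<alpha>},
       Dom = (\<lambda>(a, \<gamma>, b). a),
       Cod = (\<lambda>(a, \<gamma>, b). b),
       Ide = (\<lambda>(A, \<alpha>). ((A, \<alpha>), id_trans G G (endo A), (A, \<alpha>))),
       Comp = (\<lambda>(b', \<delta>, c) (a, \<gamma>, b). (a, vert_comp G G \<delta> \<gamma>, c))\<rparr>)"


section \<open>The monad of a distributive multitensor\<close>

text \<open>
  A sequence \<open>a = x\<^sub>0, \<dots>, x\<^sub>n = b\<close> is a nonempty list; its steps are the pairs
  \<open>(x\<^sub>i\<^sub>-\<^sub>1, x\<^sub>i)\<close>.
\<close>

definition paths :: "'u set \<Rightarrow> 'u \<Rightarrow> 'u \<Rightarrow> 'u list set" where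
  "paths S a b = {xs. xs \<noteq> [] \<and> set xs \<subseteq> S \<and> hd xs = a \<and> last xs = b}"

definition steps :: "'u list \<Rightarrow> ('u \<times> 'u) list" where
  "steps xs = zip xs (tl xs)"

definition path_homs :: "('u, 'o) vgraph \<Rightarrow> 'u list \<Rightarrow> 'o list" where
  "path_homs X xs = map (homs X) (steps xs)"

definition path_tensor :: "('o, 'm) multitensor \<Rightarrow> ('u, 'o) vgraph \<Rightarrow> 'u list \<Rightarrow> 'o" where
  "path_tensor E X xs = tens E (path_homs X xs)"

definition path_inj ::
  "('o, 'm) cat \<Rightarrow> ('o, 'm) multitensor \<Rightarrow> ('u, 'o) vgraph \<Rightarrow> 'u list \<Rightarrow> 'm" where
  "path_inj V E X xs =
     coprod_inj V (paths (verts X) (hd xs) (last xs)) (path_tensor E X) xs"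

definition Gamma_graph ::
  "('o, 'm) cat \<Rightarrow> ('o, 'm) multitensor \<Rightarrow> ('u, 'o) vgraph \<Rightarrow> ('u, 'o) vgraph" where
  "Gamma_graph V E X =
     \<lparr>verts = verts X,
      homs = (\<lambda>(a, b)\<in>verts X \<times> verts X. coprod V (paths (verts X) a b) (path_tensor E X))\<rparr>"

definition Gamma_mor ::
  "('o, 'm) cat \<Rightarrow> ('o, 'm) multitensor \<Rightarrow> ('u, 'o, 'm) vgraph_mor \<Rightarrow> ('u, 'o, 'm) vgraph_mor" where
  "Gamma_mor V E f =
     (let X = source f; Y = target f in
      \<lparr>source = Gamma_graph V E X,
       target = Gamma_graph V E Y,
       vmap = vmap f,
       hmap = (\<lambda>(a, b)\<in>verts X \<times> verts X.
         cotuple V (paths (verts X) a b) (path_tensor E X)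
           (homs (Gamma_graph V E Y) (vmap f a, vmap f b))
           (\<lambda>xs. path_inj V E Y (map (vmap f) xs) \<cdot>\<^bsub>V\<^esub> tens_arr E (map (hmap f) (steps xs))))\<rparr>)"

definition Gamma_functor ::
  "'u set set \<Rightarrow> ('o, 'm) cat \<Rightarrow> ('o, 'm) multitensor
     \<Rightarrow> (('u, 'o) vgraph, ('u, 'o, 'm) vgraph_mor, ('u, 'o) vgraph, ('u, 'o, 'm) vgraph_mor) func"
  where
  "Gamma_functor U V E =
     \<lparr>obj_map = (\<lambda>X\<in>Obj (graph_cat U V). Gamma_graph V E X),
      arr_map = (\<lambda>f\<in>Arr (graph_cat U V). Gamma_mor V E f)\<rparr>"

definition Gamma_unit ::
  "'u set set \<Rightarrow> ('o, 'm) cat \<Rightarrow> ('o, 'm) multitensor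
     \<Rightarrow> ('u, 'o) vgraph \<Rightarrow> ('u, 'o, 'm) vgraph_mor" where
  "Gamma_unit U V E = (\<lambda>X\<in>Obj (graph_cat U V).
     \<lparr>source = X,
      target = Gamma_graph V E X,
      vmap = (\<lambda>a\<in>verts X. a),
      hmap = (\<lambda>(a, b)\<in>verts X \<times> verts X. path_inj V E X [a, b] \<cdot>\<^bsub>V\<^esub> tunit E (homs X (a, b)))\<rparr>)"

text \<open>
  A summand of the hom from \<open>a\<close> to \<open>b\<close> in the twofold application is given by a path
  \<open>ys\<close> from \<open>a\<close> to \<open>b\<close> and, for each step \<open>(c, d)\<close> of \<open>ys\<close>, a path from \<open>c\<close> to \<open>d\<close>. By
  distributivity, these summands form a coproduct, with injections
  \<open>path_inj V E (Gamma_graph V E X) ys \<cdot> E (path_inj V E X xs\<^sub>i)\<close>, so that the arrow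
  described below exists and is unique. The list \<open>path_join ys xss\<close> is the composite path.
\<close>

definition path_join :: "'u list \<Rightarrow> 'u list list \<Rightarrow> 'u list" where
  "path_join ys xss = hd ys # concat (map tl xss)"

definition Gamma_mult ::
  "'u set set \<Rightarrow> ('o, 'm) cat \<Rightarrow> ('o, 'm) multitensor
     \<Rightarrow> ('u, 'o) vgraph \<Rightarrow> ('u, 'o, 'm) vgraph_mor" where
  "Gamma_mult U V E = (\<lambda>X\<in>Obj (graph_cat U V).
     let TX = Gamma_graph V E X; TTX = Gamma_graph V E TX in
     \<lparr>source = TTX,
      target = TX,
      vmap = (\<lambda>a\<in>verts X. a),
      hmap = (\<lambda>(a, b)\<in>verts X \<times> verts X.
        (THE m. m \<in> Hom V (homs TTX (a, b)) (homs TX (a, b)) \<and>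
           (\<forall>ys\<in>paths (verts X) a b. \<forall>xss.
              list_all2 (\<lambda>(c, d) xs. xs \<in> paths (verts X) c d) (steps ys) xss \<longrightarrow>
              m \<cdot>\<^bsub>V\<^esub> (path_inj V E TX ys \<cdot>\<^bsub>V\<^esub> tens_arr E (map (path_inj V E X) xss))
                = path_inj V E X (path_join ys xss) \<cdot>\<^bsub>V\<^esub> tsubst E (map (path_homs X) xss))))\<rparr>)"

definition Gamma ::
  "'u set set \<Rightarrow> ('o, 'm) cat \<Rightarrow> ('o, 'm) multitensor \<Rightarrow> ('u, 'o, 'm) graph_monad" where
  "Gamma U V E =
     \<lparr>endo = Gamma_functor U V E, munit = Gamma_unit U V E, mmult = Gamma_mult U V E\<rparr>"

definition Gamma_trans ::
  "'u set set \<Rightarrow> ('o, 'm) cat \<Rightarrow> ('o, 'm) multitensor \<Rightarrow> ('o, 'm) multitensor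
     \<Rightarrow> ('o list \<Rightarrow> 'm) \<Rightarrow> ('u, 'o) vgraph \<Rightarrow> ('u, 'o, 'm) vgraph_mor" where
  "Gamma_trans U V A B \<theta> = (\<lambda>X\<in>Obj (graph_cat U V).
     \<lparr>source = Gamma_graph V A X,
      target = Gamma_graph V B X,
      vmap = (\<lambda>a\<in>verts X. a),
      hmap = (\<lambda>(a, b)\<in>verts X \<times> verts X.
        coprod_map V (paths (verts X) a b) (path_tensor A X) (path_tensor B X)
          (\<lambda>xs. \<theta> (path_homs X xs)))\<rparr>)"

definition Gamma_over ::
  "'u set set \<Rightarrow> ('o, 'm) cat \<Rightarrow> ('o, 'm) multitensor
     \<Rightarrow> (('o, 'm) mult_over, ('o, 'm) mult_over \<times> ('o list \<Rightarrow> 'm) \<times> ('o, 'm) mult_over,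
         ('u, 'o, 'm) monad_over,
         ('u, 'o, 'm) monad_over \<times> (('u, 'o) vgraph \<Rightarrow> ('u, 'o, 'm) vgraph_mor)
           \<times> ('u, 'o, 'm) monad_over) func" where
  "Gamma_over U V E =
     (let on_obj = (\<lambda>(A, \<alpha>). (Gamma U V A, Gamma_trans U V A E \<alpha>)) in
      \<lparr>obj_map = (\<lambda>a\<in>Obj (Mult V E). on_obj a),
       arr_map = (\<lambda>(a, \<gamma>, b)\<in>Arr (Mult V E).
         (on_obj a, Gamma_trans U V (fst a) (fst b) \<gamma>, on_obj b))\<rparr>)"

end

theory Submission
  imports Defs
begin

text \<open>
  A multitensor is recovered from its monad by evaluation at linear graphs. For objects
  \<open>X\<^sub>1, \<dots>, X\<^sub>n\<close> let \<open>line\<close> be the graph with vertices \<open>0, \<dots>, n\<close>, with \<open>X\<^sub>i\<close> as the hom from \<open>i - 1\<close> to \<open>i\<close>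
  and with all other homs initial. By distributivity every path from \<open>0\<close> to \<open>n\<close> except \<open>0, 1, \<dots>, n\<close>
  contributes an initial summand to \<open>\<Gamma>A(line)(0, n)\<close>, which is therefore \<open>A(X\<^sub>1, \<dots>, X\<^sub>n)\<close> (\<open>eta\<close>).
  For any monad \<open>T\<close> over Set the objects \<open>T(line)(0, n)\<close> form a multitensor \<open>psi\<close>: its unit is the unit of \<open>T\<close>,
  and its substitution extends the map \<open>kappa\<close> that sends the line on the values of the blocks
  into \<open>T\<close> of the concatenated line.

  A path of length \<open>n\<close> from \<open>a\<close> to \<open>b\<close> in \<open>X\<close> is a map from a line to \<open>X\<close>. Applying \<open>T\<close> to these maps (\<open>jota\<close>)
  gives a monad morphism \<open>eps\<close> from \<open>\<Gamma>psi\<close> to \<open>T\<close>. When \<open>T\<close> is cartesian over \<open>\<Gamma>E\<close>, the components of \<open>jota\<close> are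
  pullbacks of the coproduct injections of \<open>\<Gamma>E(X)(a, b)\<close>, so by extensivity they are again the injections
  of a coproduct, and \<open>eps\<close> is invertible. Distributivity of \<open>psi\<close> follows from that of \<open>E\<close> in the same way.
\<close>

section \<open>Categories\<close>

text \<open>The homs of \<open>\<Gamma> X\<close> are chosen coproducts, and those of its iterates
  decompose only through distributivity. Identities of graph maps are therefore checked on summands:
  paths for one application of \<Gamma>, refined paths for two, twice refined paths for three. The
  substitution of \<open>psi\<close> is a Kleisli extension (\<open>lift\<close>) of
  \<open>T\<close>, so the associativity of \<open>T\<close> enters its laws only through
  \<open>lift_lift\<close>, and each law of \<open>psi\<close> is an identity of graph maps out of
  lines, evaluated at the two end vertices. Lines of all lengths need an unlimited supply of
  vertices inside the fixed vertex type. An infinite member of \<open>U\<close> provides it, as an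
  injection \<open>e\<close> of the natural numbers. Evaluating a structure map from
  \<open>T\<close> to \<Gamma>E on lines does not give a map from \<open>psi\<close> to
  \<open>E\<close>: it lands in the multitensor recovered from \<Gamma>E. Inverting
  \<open>eta\<close> for \<open>E\<close> leads back to \<open>E\<close>, and the same change of
  corner turns the evaluated cartesian squares into pullbacks of coproduct injections.\<close>

lemma HomD:
  assumes "f \<in> Hom C a b"
  shows "f \<in> Arr C" "Dom C f = a" "Cod C f = b"
  using assms by (simp_all add: Hom_def)

lemma Hom_cong_arr: "f \<in> Arr C \<Longrightarrow> f \<in> Hom C (Dom C f) (Cod C f)"
  by (simp add: Hom_def)

section \<open>Composition and isomorphisms\<close>

context category
begin

lemma hom_obj:
  assumes "f \<in> Hom C a b"
  shows "a \<in> Obj C" "b \<in> Obj C"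
  using assms dom_in cod_in by (auto simp: Hom_def)

lemma arr_comp [simp]:
  assumes "f \<in> Arr C" "g \<in> Arr C" "Dom C g = Cod C f"
  shows "g \<cdot> f \<in> Arr C" "Dom C (g \<cdot> f) = Dom C f" "Cod C (g \<cdot> f) = Cod C g"
  using comp_in[of f "Dom C f" "Cod C f" g "Cod C g"] assms by (simp_all add: Hom_def)

lemma arr_ide [simp]:
  assumes "a \<in> Obj C"
  shows "Ide C a \<in> Arr C" "Dom C (Ide C a) = a" "Cod C (Ide C a) = a"
  using ide_in[OF assms] by (simp_all add: Hom_def)

lemma comp_ide [simp]:
  assumes "f \<in> Arr C"
  shows "Dom C f = a \<Longrightarrow> f \<cdot> Ide C a = f" "Cod C f = b \<Longrightarrow> Ide C b \<cdot> f = f"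
  using ide_right ide_left assms by (auto simp: Hom_def)

lemma comp_assoc:
  assumes "f \<in> Arr C" "g \<in> Arr C" "h \<in> Arr C" "Dom C g = Cod C f" "Dom C h = Cod C g"
  shows "(h \<cdot> g) \<cdot> f = h \<cdot> (g \<cdot> f)"
  using assms assoc[of f "Dom C f" "Cod C f" g "Cod C g" h "Cod C h"] by (simp add: Hom_def)

lemma comp_assoc_hom:
  assumes "f \<in> Hom C a b" "g \<in> Hom C b c" "h \<in> Hom C c d"
  shows "(h \<cdot> g) \<cdot> f = h \<cdot> (g \<cdot> f)"
  using assms assoc by metis

lemma comp_extend:
  assumes "g \<cdot> f = x" "f \<in> Arr C" "g \<in> Arr C" "Dom C g = Cod C f" "h \<in> Arr C" "Dom C f = Cod C h"
  shows "g \<cdot> (f \<cdot> h) = x \<cdot> h"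
  using comp_assoc[of h f g] assms by simp

lemma comp_ext:
  assumes "h \<in> Hom C z a" "f \<in> Hom C a b" "g \<in> Hom C b c" "g \<cdot> f = x"
  shows "g \<cdot> (f \<cdot> h) = x \<cdot> h"
  using comp_assoc_hom[OF assms(1-3)] assms(4) by simp

lemma comp_extend2:
  assumes "g \<cdot> f = g' \<cdot> f'" "f \<in> Arr C" "g \<in> Arr C" "Dom C g = Cod C f"
    "h \<in> Arr C" "Dom C f = Cod C h" "f' \<in> Arr C" "g' \<in> Arr C" "Dom C g' = Cod C f'" "Dom C f' = Cod C h"
  shows "g \<cdot> (f \<cdot> h) = g' \<cdot> (f' \<cdot> h)"
  using comp_assoc[of h f g] comp_assoc[of h f' g'] assms by simp

lemma iso_inverse:
  assumes "is_iso C f" "f \<in> Hom C a b"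
  obtains g where "g \<in> Hom C b a" "g \<cdot> f = Ide C a" "f \<cdot> g = Ide C b" "is_iso C g"
  using assms unfolding is_iso_def by (auto simp: Hom_def)

lemma is_isoI:
  assumes "f \<in> Hom C a b" "g \<in> Hom C b a" "g \<cdot> f = Ide C a" "f \<cdot> g = Ide C b"
  shows "is_iso C f"
  using assms unfolding is_iso_def by (auto simp: Hom_def)

lemma is_iso_ide: "a \<in> Obj C \<Longrightarrow> is_iso C (Ide C a)"
  by (rule is_isoI[of _ a a "Ide C a"]) (auto intro: ide_in)

lemma iso_monic:
  assumes "is_iso C f" "f \<in> Hom C b c" "g \<in> Hom C a b" "h \<in> Hom C a b" "f \<cdot> g = f \<cdot> h"
  shows "g = h"
proof -
  obtain k where k: "k \<in> Hom C c b" "k \<cdot> f = Ide C b" using iso_inverse[OF assms(1,2)] by metis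
  have "k \<cdot> (f \<cdot> g) = k \<cdot> (f \<cdot> h)" using assms(5) by simp
  thus ?thesis using comp_extend[OF k(2), of g] comp_extend[OF k(2), of h] k(1) assms(2-4)
    by (simp add: Hom_def)
qed

lemma iso_epic:
  assumes "is_iso C f" "f \<in> Hom C a b" "g \<in> Hom C b c" "h \<in> Hom C b c" "g \<cdot> f = h \<cdot> f"
  shows "g = h"
proof -
  obtain k where k: "k \<in> Hom C b a" "f \<cdot> k = Ide C b" using iso_inverse[OF assms(1,2)] by metis
  have "(g \<cdot> f) \<cdot> k = (h \<cdot> f) \<cdot> k" using assms(5) by simp
  thus ?thesis using comp_assoc[of k f g] comp_assoc[of k f h] k assms(2-4)
    by (simp add: Hom_def)
qed

end

context cat_functor
begin

lemma obj_in [simp]: "a \<in> Obj C \<Longrightarrow> obj_map F a \<in> Obj D"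
  using obj_map by auto

lemma arr_in [simp]:
  assumes "f \<in> Arr C"
  shows "arr_map F f \<in> Arr D" "Dom D (arr_map F f) = obj_map F (Dom C f)"
    "Cod D (arr_map F f) = obj_map F (Cod C f)"
  using arr_map[OF Hom_cong_arr[OF assms]] by (auto simp: Hom_def)

lemma arr_comp_map:
  "f \<in> Arr C \<Longrightarrow> g \<in> Arr C \<Longrightarrow> Dom C g = Cod C f
     \<Longrightarrow> arr_map F (g \<cdot>\<^bsub>C\<^esub> f) = arr_map F g \<cdot>\<^bsub>D\<^esub> arr_map F f"
  using map_comp[of f "Dom C f" "Cod C f" g "Cod C g"] by (auto simp: Hom_def)

end

lemma id_functor_cat_functor:
  assumes "category C"
  shows "cat_functor C C (id_functor C)"
proof -
  interpret category C by fact
  show ?thesis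
    by unfold_locales (auto simp: id_functor_def Hom_def dom_in cod_in)
qed

lemma comp_functor_cat_functor:
  assumes "cat_functor C D F" "cat_functor D E G"
  shows "cat_functor C E (comp_functor C G F)"
proof -
  interpret F: cat_functor C D F by fact
  interpret G: cat_functor D E G by fact
  show ?thesis
    by unfold_locales
      (auto simp: comp_functor_def Hom_def F.C.dom_in F.C.cod_in F.map_ide G.map_ide
        F.arr_comp_map G.arr_comp_map)
qed

subsection \<open>Equivalences are full, faithful and essentially surjective\<close>

text \<open>Naturality recovers \<open>f\<close> from its image under \<open>H\<close> and two
  invertible components. Both directions of \<tau> are allowed because the unit and the counit of an
  equivalence point in opposite ways.\<close>

lemma nat_iso_id_faithful:
  assumes "nat_trans C C (id_functor C) H \<tau> \<or> nat_trans C C H (id_functor C) \<tau>"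
    and iso: "\<forall>a\<in>Obj C. is_iso C (\<tau> a)"
    and "f \<in> Hom C a b" "g \<in> Hom C a b" "arr_map H f = arr_map H g"
  shows "f = g"
  using assms(1)
proof
  assume "nat_trans C C (id_functor C) H \<tau>"
  then interpret nat_trans C C "id_functor C" H \<tau> .
  have ab: "a \<in> Obj C" "b \<in> Obj C" using F.C.hom_obj assms(3) by auto
  have "\<tau> b \<cdot>\<^bsub>C\<^esub> f = \<tau> b \<cdot>\<^bsub>C\<^esub> g"
    using naturality[OF assms(3)] naturality[OF assms(4)] assms(3-5)
    by (simp add: id_functor_def Hom_def)
  thus ?thesis
    using F.C.iso_monic[of "\<tau> b" b _ f a g] iso ab component[of b] assms(3,4)
    by (simp add: id_functor_def)
next
  assume "nat_trans C C H (id_functor C) \<tau>"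
  then interpret nat_trans C C H "id_functor C" \<tau> .
  have ab: "a \<in> Obj C" "b \<in> Obj C" using F.C.hom_obj assms(3) by auto
  have "f \<cdot>\<^bsub>C\<^esub> \<tau> a = g \<cdot>\<^bsub>C\<^esub> \<tau> a"
    using naturality[OF assms(3)] naturality[OF assms(4)] assms(3-5)
    by (simp add: id_functor_def Hom_def)
  thus ?thesis
    using F.C.iso_epic[of "\<tau> a" _ a f b g] iso ab component[of a] assms(3,4)
    by (simp add: id_functor_def)
qed

lemma equivalence_faithful:
  assumes "is_equivalence C D F" "f \<in> Hom C a b" "g \<in> Hom C a b" "arr_map F f = arr_map F g"
  shows "f = g"
proof -
  obtain G \<eta> where "nat_iso C C (id_functor C) (comp_functor C G F) \<eta>"
    using assms(1) unfolding is_equivalence_def by auto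
  thus ?thesis using nat_iso_id_faithful[of C "comp_functor C G F" \<eta> f a b g] assms(2-4)
    by (simp add: nat_iso_def comp_functor_def Hom_def)
qed

lemma equivalence_full:
  assumes "is_equivalence C D F" "a \<in> Obj C" "b \<in> Obj C"
    and k: "k \<in> Hom D (obj_map F a) (obj_map F b)"
  obtains f where "f \<in> Hom C a b" "arr_map F f = k"
proof -
  obtain G \<eta> \<epsilon> where G: "cat_functor C D F" "cat_functor D C G"
    and \<eta>: "nat_iso C C (id_functor C) (comp_functor C G F) \<eta>"
    and \<epsilon>: "nat_iso D D (comp_functor D F G) (id_functor D) \<epsilon>"
    using assms(1) unfolding is_equivalence_def by auto
  interpret F: cat_functor C D F by fact
  interpret G: cat_functor D C G by fact
  interpret \<eta>: nat_trans C C "id_functor C" "comp_functor C G F" \<eta>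
    using \<eta> by (simp add: nat_iso_def)
  have \<eta>a: "\<eta> a \<in> Hom C a (obj_map G (obj_map F a))"
    and \<eta>b: "\<eta> b \<in> Hom C b (obj_map G (obj_map F b))"
    using \<eta>.component assms(2,3) by (auto simp: id_functor_def comp_functor_def)
  have isob: "is_iso C (\<eta> b)" "is_iso C (\<eta> a)" using \<eta> assms(2,3) by (auto simp: nat_iso_def)
  obtain j where j: "j \<in> Hom C (obj_map G (obj_map F b)) b"
      "\<eta> b \<cdot>\<^bsub>C\<^esub> j = Ide C (obj_map G (obj_map F b))"
    using F.C.iso_inverse[OF isob(1) \<eta>b] by metis
  \<comment> \<open>The naturality square of \<eta> at \<open>f\<close> should have
    \<open>arr_map G k\<close> as its opposite side, which forces \<open>f\<close> to be this
    conjugate. Then \<open>k\<close> is recovered because \<open>G\<close> is faithful, by the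
    counit.\<close>
  define f where "f = j \<cdot>\<^bsub>C\<^esub> (arr_map G k \<cdot>\<^bsub>C\<^esub> \<eta> a)"
  have Gk: "arr_map G k \<in> Hom C (obj_map G (obj_map F a)) (obj_map G (obj_map F b))"
    using G.arr_map[OF k] .
  have f: "f \<in> Hom C a b" unfolding f_def using j Gk \<eta>a by (simp add: Hom_def)
  have "\<eta> b \<cdot>\<^bsub>C\<^esub> f = (\<eta> b \<cdot>\<^bsub>C\<^esub> j) \<cdot>\<^bsub>C\<^esub> (arr_map G k \<cdot>\<^bsub>C\<^esub> \<eta> a)"
    unfolding f_def using j(1) Gk \<eta>a \<eta>b by (simp add: F.C.comp_assoc Hom_def)
  also have "\<dots> = arr_map G k \<cdot>\<^bsub>C\<^esub> \<eta> a"
    unfolding j(2) using Gk \<eta>a by (simp add: Hom_def)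
  finally have "arr_map G (arr_map F f) \<cdot>\<^bsub>C\<^esub> \<eta> a = arr_map G k \<cdot>\<^bsub>C\<^esub> \<eta> a"
    using \<eta>.naturality[OF f] f by (simp add: id_functor_def comp_functor_def Hom_def)
  hence "arr_map G (arr_map F f) = arr_map G k"
    using F.C.iso_epic[OF isob(2) \<eta>a, of "arr_map G (arr_map F f)" _ "arr_map G k"] Gk G.arr_map[OF F.arr_map[OF f]] by blast
  hence "arr_map F f = k"
    using nat_iso_id_faithful[of D "comp_functor D F G" \<epsilon> "arr_map F f" _ _ k] \<epsilon> k F.arr_map[OF f]
    by (simp add: nat_iso_def comp_functor_def Hom_def)
  thus thesis using f that by blast
qed

lemma equivalence_ess_surj:
  assumes "is_equivalence C D F" "d \<in> Obj D"
  obtains a h where "a \<in> Obj C" "h \<in> Hom D (obj_map F a) d" "is_iso D h"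
proof -
  obtain G \<epsilon> where G: "cat_functor C D F" "cat_functor D C G"
    and \<epsilon>: "nat_iso D D (comp_functor D F G) (id_functor D) \<epsilon>"
    using assms(1) unfolding is_equivalence_def by auto
  interpret G: cat_functor D C G by fact
  interpret \<epsilon>: nat_trans D D "comp_functor D F G" "id_functor D" \<epsilon>
    using \<epsilon> by (simp add: nat_iso_def)
  show thesis
    using that[of "obj_map G d" "\<epsilon> d"] \<epsilon>.component[OF assms(2)] assms(2) \<epsilon>
    by (simp add: id_functor_def comp_functor_def nat_iso_def)
qed

subsection \<open>Pullbacks\<close>

lemma pullbackD:
  assumes "is_pullback C p q f g"
  shows "p \<in> Arr C" "q \<in> Arr C" "f \<in> Arr C" "g \<in> Arr C"
    "Dom C q = Dom C p" "Cod C p = Dom C f" "Cod C q = Dom C g" "Cod C g = Cod C f"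
    "f \<cdot>\<^bsub>C\<^esub> p = g \<cdot>\<^bsub>C\<^esub> q"
  using assms unfolding is_pullback_def by auto

lemma pullback_ex:
  assumes "is_pullback C p q f g" "r \<in> Hom C w (Dom C f)" "s \<in> Hom C w (Dom C g)"
    "w \<in> Obj C" "f \<cdot>\<^bsub>C\<^esub> r = g \<cdot>\<^bsub>C\<^esub> s"
  obtains h where "h \<in> Hom C w (Dom C p)" "p \<cdot>\<^bsub>C\<^esub> h = r" "q \<cdot>\<^bsub>C\<^esub> h = s"
  using assms unfolding is_pullback_def by metis

context category
begin

lemma pullback_unique:
  assumes pb: "is_pullback C p q f g"
    and h: "h \<in> Hom C w (Dom C p)" "h' \<in> Hom C w (Dom C p)"
    and eq: "p \<cdot> h = p \<cdot> h'" "q \<cdot> h = q \<cdot> h'"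
  shows "h = h'"
proof -
  note D = pullbackD[OF pb]
  have w: "w \<in> Obj C" using hom_obj h by auto
  have e: "f \<cdot> (p \<cdot> h) = g \<cdot> (q \<cdot> h)"
    using comp_extend2[OF D(9), of h] D h by (simp add: Hom_def)
  have "\<exists>!k. k \<in> Hom C w (Dom C p) \<and> p \<cdot> k = p \<cdot> h \<and> q \<cdot> k = q \<cdot> h"
    using pb w e D h unfolding is_pullback_def by (simp add: Hom_def)
  thus ?thesis using h eq by metis
qed

lemma pullbackI:
  assumes p: "p \<in> Hom C P A" and q: "q \<in> Hom C P B" and f: "f \<in> Hom C A D" and g: "g \<in> Hom C B D"
    and comm: "f \<cdot> p = g \<cdot> q"
    and ex: "\<And>w r s. r \<in> Hom C w A \<Longrightarrow> s \<in> Hom C w B \<Longrightarrow> f \<cdot> r = g \<cdot> s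
      \<Longrightarrow> \<exists>h \<in> Hom C w P. p \<cdot> h = r \<and> q \<cdot> h = s"
    and un: "\<And>w h h'. h \<in> Hom C w P \<Longrightarrow> h' \<in> Hom C w P \<Longrightarrow> p \<cdot> h = p \<cdot> h' \<Longrightarrow> q \<cdot> h = q \<cdot> h' \<Longrightarrow> h = h'"
  shows "is_pullback C p q f g"
  unfolding is_pullback_def
proof (intro conjI ballI impI)
  fix w r s assume "w \<in> Obj C" "r \<in> Hom C w (Dom C f)" "s \<in> Hom C w (Dom C g)" "f \<cdot> r = g \<cdot> s"
  then obtain h where "h \<in> Hom C w P" "p \<cdot> h = r" "q \<cdot> h = s" using ex f g by (metis HomD(2))
  thus "\<exists>!h. h \<in> Hom C w (Dom C p) \<and> p \<cdot> h = r \<and> q \<cdot> h = s"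
    using un p by (metis HomD(2))
qed (use p q f g comm in \<open>auto simp: Hom_def\<close>)

text \<open>In \<open>is_pullback C p q f g\<close> the projections are \<open>p\<close> and
  \<open>q\<close> and the square reads \<open>f \<cdot> p = g \<cdot> q\<close>. The two squares
  are glued along the common edge \<open>g\<close>.\<close>

lemma pullback_paste:
  assumes 1: "is_pullback C p q f g" and 2: "is_pullback C g q' f' g'"
  shows "is_pullback C p (q' \<cdot> q) (f' \<cdot> f) g'"
proof -
  note D = pullbackD[OF 1] pullbackD[OF 2]
  show ?thesis
  proof (rule pullbackI[of _ "Dom C p" "Dom C f" _ "Cod C q'" _ "Cod C f'"])
    show "(f' \<cdot> f) \<cdot> p = g' \<cdot> (q' \<cdot> q)"
      using comp_extend2[OF D(18), of q] D by (simp add: comp_assoc)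
  next
    fix w r s assume r: "r \<in> Hom C w (Dom C f)" and s: "s \<in> Hom C w (Cod C q')"
      and e: "(f' \<cdot> f) \<cdot> r = g' \<cdot> s"
    have w: "w \<in> Obj C" using r hom_obj by auto
    have "f' \<cdot> (f \<cdot> r) = g' \<cdot> s" using e r D by (simp add: comp_assoc Hom_def)
    then obtain t where t: "t \<in> Hom C w (Dom C g)" "g \<cdot> t = f \<cdot> r" "q' \<cdot> t = s"
      using pullback_ex[OF 2, of "f \<cdot> r" w s] w D r s by (auto simp: Hom_def)
    then obtain h where "h \<in> Hom C w (Dom C p)" "p \<cdot> h = r" "q \<cdot> h = t"
      using pullback_ex[OF 1, of r w t] w r by auto
    thus "\<exists>h\<in>Hom C w (Dom C p). p \<cdot> h = r \<and> q' \<cdot> q \<cdot> h = s"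
      using t D by (intro bexI[of _ h]) (auto simp: comp_assoc Hom_def)
  next
    fix w h h' assume h: "h \<in> Hom C w (Dom C p)" "h' \<in> Hom C w (Dom C p)" "p \<cdot> h = p \<cdot> h'"
      and e: "q' \<cdot> q \<cdot> h = q' \<cdot> q \<cdot> h'"
    have "g \<cdot> (q \<cdot> h) = g \<cdot> (q \<cdot> h')"
      using comp_extend2[OF D(9), of h] comp_extend2[OF D(9), of h'] D h by (simp add: Hom_def)
    hence "q \<cdot> h = q \<cdot> h'"
      using pullback_unique[OF 2, of "q \<cdot> h" w "q \<cdot> h'"] h e D by (simp add: comp_assoc Hom_def)
    thus "h = h'" using pullback_unique[OF 1, of h w h'] h by simp
  qed (use D in \<open>auto simp: Hom_def\<close>)
qed

text \<open>The invertible maps \<open>q\<close> and \<open>f\<close> are opposite sides of the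
  square. The mediating map is the component into \<open>B\<close> followed by the inverse of
  \<open>q\<close>, and cancelling \<open>f\<close> makes the other triangle commute.\<close>

lemma pullback_iso:
  assumes "p \<in> Hom C P A" "g \<in> Hom C B D" "q \<in> Hom C P B" "f \<in> Hom C A D"
    and iso: "is_iso C q" "is_iso C f" and comm: "f \<cdot> p = g \<cdot> q"
  shows "is_pullback C p q f g"
proof -
  obtain q' where q': "q' \<in> Hom C B P" "q' \<cdot> q = Ide C P" "q \<cdot> q' = Ide C B"
    using iso_inverse[OF iso(1) assms(3)] by metis
  show ?thesis
  proof (rule pullbackI[OF assms(1,3,4,2) comm])
    fix w r s assume r: "r \<in> Hom C w A" and s: "s \<in> Hom C w B" and e: "f \<cdot> r = g \<cdot> s"
    have qs: "q \<cdot> (q' \<cdot> s) = s" using comp_extend[OF q'(3), of s] q'(1) s assms(3) by (simp add: Hom_def)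
    have "f \<cdot> (p \<cdot> (q' \<cdot> s)) = g \<cdot> (q \<cdot> (q' \<cdot> s))"
      using comp_extend2[OF comm, of "q' \<cdot> s"] q' s assms by (simp add: Hom_def)
    hence "f \<cdot> (p \<cdot> (q' \<cdot> s)) = f \<cdot> r" using qs e by simp
    hence "p \<cdot> (q' \<cdot> s) = r"
      using iso_monic[OF iso(2) assms(4), of "p \<cdot> (q' \<cdot> s)" w r] q' s r assms by (simp add: Hom_def)
    thus "\<exists>h\<in>Hom C w P. p \<cdot> h = r \<and> q \<cdot> h = s" using qs q' s
      by (intro bexI[of _ "q' \<cdot> s"]) (auto simp: Hom_def)
  next
    fix w h h' assume "h \<in> Hom C w P" "h' \<in> Hom C w P" "q \<cdot> h = q \<cdot> h'"
    thus "h = h'" using iso_monic[OF iso(1) assms(3)] by blast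
  qed
qed

end

section \<open>Coproducts\<close>

lemma coproductD:
  assumes "is_coproduct C I X c \<iota>"
  shows "i \<in> I \<Longrightarrow> X i \<in> Obj C" "c \<in> Obj C" "i \<in> I \<Longrightarrow> \<iota> i \<in> Hom C (X i) c"
  using assms unfolding is_coproduct_def by auto

lemma coproduct_ex:
  assumes "is_coproduct C I X c \<iota>" "d \<in> Obj C" "\<And>i. i \<in> I \<Longrightarrow> f i \<in> Hom C (X i) d"
  obtains h where "h \<in> Hom C c d" "\<And>i. i \<in> I \<Longrightarrow> h \<cdot>\<^bsub>C\<^esub> \<iota> i = f i"
proof -
  have "\<exists>!h. h \<in> Hom C c d \<and> (\<forall>i\<in>I. h \<cdot>\<^bsub>C\<^esub> \<iota> i = f i)"
    using assms unfolding is_coproduct_def by blast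
  thus thesis using that by blast
qed

lemma coproduct_cong:
  assumes "is_coproduct C I X c \<iota>" "\<And>i. i \<in> I \<Longrightarrow> X i = Y i" "\<And>i. i \<in> I \<Longrightarrow> \<iota> i = \<kappa> i"
  shows "is_coproduct C I Y c \<kappa>"
  using assms unfolding is_coproduct_def by simp

lemma chosen_coprod_is_coproduct:
  assumes "is_coproduct C I X c \<iota>"
  shows "is_coproduct C I X (coprod C I X) (coprod_inj C I X)"
proof -
  have "case chosen_coprod C I X of (c, \<iota>) \<Rightarrow> is_coproduct C I X c \<iota>"
    unfolding chosen_coprod_def by (rule someI[of _ "(c, \<iota>)"]) (use assms in simp)
  thus ?thesis by (simp add: coprod_def coprod_inj_def split: prod.splits)
qed

section \<open>The universal property of coproducts\<close>

context category
begin

lemma coproduct_eqI: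
  assumes cop: "is_coproduct C I X c \<iota>" and h: "h \<in> Hom C c d" "h' \<in> Hom C c d"
    and eq: "\<And>i. i \<in> I \<Longrightarrow> h \<cdot> \<iota> i = h' \<cdot> \<iota> i"
  shows "h = h'"
proof -
  have "\<forall>i\<in>I. h \<cdot> \<iota> i \<in> Hom C (X i) d"
    using coproductD(3)[OF cop] h by (auto simp: Hom_def)
  moreover have "d \<in> Obj C" using h hom_obj by auto
  moreover have "\<forall>d\<in>Obj C. \<forall>f. (\<forall>i\<in>I. f i \<in> Hom C (X i) d) \<longrightarrow>
      (\<exists>!h. h \<in> Hom C c d \<and> (\<forall>i\<in>I. h \<cdot> \<iota> i = f i))"
    using cop unfolding is_coproduct_def by blast
  ultimately have "\<exists>!k. k \<in> Hom C c d \<and> (\<forall>i\<in>I. k \<cdot> \<iota> i = h \<cdot> \<iota> i)"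
    by simp
  thus ?thesis using h eq by (metis (full_types))
qed

lemma coproductI:
  assumes "c \<in> Obj C" "\<And>i. i \<in> I \<Longrightarrow> \<iota> i \<in> Hom C (X i) c"
    and ex: "\<And>d f. d \<in> Obj C \<Longrightarrow> (\<And>i. i \<in> I \<Longrightarrow> f i \<in> Hom C (X i) d)
      \<Longrightarrow> \<exists>h \<in> Hom C c d. \<forall>i\<in>I. h \<cdot> \<iota> i = f i"
    and un: "\<And>d h h'. h \<in> Hom C c d \<Longrightarrow> h' \<in> Hom C c d
      \<Longrightarrow> (\<And>i. i \<in> I \<Longrightarrow> h \<cdot> \<iota> i = h' \<cdot> \<iota> i) \<Longrightarrow> h = h'"
  shows "is_coproduct C I X c \<iota>"
  unfolding is_coproduct_def
proof (intro conjI ballI allI impI)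
  fix d f assume "d \<in> Obj C" "\<forall>i\<in>I. f i \<in> Hom C (X i) d"
  then obtain h where "h \<in> Hom C c d" "\<forall>i\<in>I. h \<cdot> \<iota> i = f i" using ex by blast
  thus "\<exists>!h. h \<in> Hom C c d \<and> (\<forall>i\<in>I. h \<cdot> \<iota> i = f i)" using un by (metis (full_types))
qed (use assms(1,2) hom_obj in auto)

lemma coproduct_reindex:
  assumes b: "bij_betw b J I" and cop: "is_coproduct C I X c \<iota>"
  shows "is_coproduct C J (\<lambda>j. X (b j)) c (\<lambda>j. \<iota> (b j))"
proof (rule coproductI)
  note D = coproductD[OF cop]
  have bI: "b j \<in> I" if "j \<in> J" for j using b that bij_betwE by blast
  have inv: "the_inv_into J b i \<in> J" "b (the_inv_into J b i) = i" if "i \<in> I" for i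
    using that b by (auto simp: bij_betw_def the_inv_into_into f_the_inv_into_f)
  have inv2: "the_inv_into J b (b j) = j" if "j \<in> J" for j
    using that b by (auto simp: bij_betw_def the_inv_into_f_f)
  show "c \<in> Obj C" by (rule D)
  show "\<iota> (b j) \<in> Hom C (X (b j)) c" if "j \<in> J" for j using D(3) bI that by blast
  show "\<exists>h\<in>Hom C c d. \<forall>j\<in>J. h \<cdot> \<iota> (b j) = f j"
    if d: "d \<in> Obj C" and f: "\<And>j. j \<in> J \<Longrightarrow> f j \<in> Hom C (X (b j)) d" for d f
  proof -
    have "\<And>i. i \<in> I \<Longrightarrow> f (the_inv_into J b i) \<in> Hom C (X i) d"
      using f inv by (metis)
    then obtain h where "h \<in> Hom C c d" "\<And>i. i \<in> I \<Longrightarrow> h \<cdot> \<iota> i = f (the_inv_into J b i)"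
      by (rule coproduct_ex[OF cop d]) blast+
    thus ?thesis using bI inv2 by (intro bexI[of _ h]) auto
  qed
  show "h = h'" if "h \<in> Hom C c d" "h' \<in> Hom C c d" "\<And>j. j \<in> J \<Longrightarrow> h \<cdot> \<iota> (b j) = h' \<cdot> \<iota> (b j)" for d h h'
    using coproduct_eqI[OF cop that(1,2)] that(3) inv by metis
qed

lemma coproduct_iso_target:
  assumes cop: "is_coproduct C I X c \<iota>" and h: "h \<in> Hom C c d" "is_iso C h"
  shows "is_coproduct C I X d (\<lambda>i. h \<cdot> \<iota> i)"
proof -
  note D = coproductD[OF cop]
  obtain g where g: "g \<in> Hom C d c" "g \<cdot> h = Ide C c" "h \<cdot> g = Ide C d"
    using iso_inverse[OF h(2,1)] by metis
  show ?thesis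
  proof (rule coproductI)
    show "d \<in> Obj C" using hom_obj h by auto
    show "h \<cdot> \<iota> i \<in> Hom C (X i) d" if "i \<in> I" for i using D(3)[OF that] h by (simp add: Hom_def)
    show "\<exists>k\<in>Hom C d e. \<forall>i\<in>I. k \<cdot> (h \<cdot> \<iota> i) = f i"
      if f: "e \<in> Obj C" "\<And>i. i \<in> I \<Longrightarrow> f i \<in> Hom C (X i) e" for e f
    proof -
      obtain k where k: "k \<in> Hom C c e" "\<And>i. i \<in> I \<Longrightarrow> k \<cdot> \<iota> i = f i"
        using coproduct_ex[OF cop f] by metis
      have "(k \<cdot> g) \<cdot> (h \<cdot> \<iota> i) = f i" if "i \<in> I" for i
        using D(3)[OF that] k(1) g(1) h(1) k(2)[OF that] comp_extend[OF g(2), of "\<iota> i"]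
        by (simp add: comp_assoc Hom_def)
      thus ?thesis using k g by (intro bexI[of _ "k \<cdot> g"]) (auto simp: Hom_def)
    qed
    show "k = k'" if k: "k \<in> Hom C d e" "k' \<in> Hom C d e"
      "\<And>i. i \<in> I \<Longrightarrow> k \<cdot> (h \<cdot> \<iota> i) = k' \<cdot> (h \<cdot> \<iota> i)" for e k k'
    proof (rule iso_epic[OF h(2,1) k(1,2)], rule coproduct_eqI[OF cop])
      show "(k \<cdot> h) \<cdot> \<iota> i = (k' \<cdot> h) \<cdot> \<iota> i" if "i \<in> I" for i
        using k(3)[OF that] D(3)[OF that] k(1,2) h by (simp add: comp_assoc Hom_def)
    qed (use k h in \<open>auto simp: Hom_def\<close>)
  qed
qed

lemma coproduct_iso_source:
  assumes cop: "is_coproduct C I X c \<iota>"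
    and k: "\<And>i. i \<in> I \<Longrightarrow> k i \<in> Hom C (Y i) (X i)" "\<And>i. i \<in> I \<Longrightarrow> is_iso C (k i)"
  shows "is_coproduct C I Y c (\<lambda>i. \<iota> i \<cdot> k i)"
proof -
  note D = coproductD[OF cop]
  have "\<forall>i\<in>I. \<exists>g. g \<in> Hom C (X i) (Y i) \<and> g \<cdot> k i = Ide C (Y i) \<and> k i \<cdot> g = Ide C (X i)"
    using iso_inverse k by metis
  then obtain g where g: "\<And>i. i \<in> I \<Longrightarrow> g i \<in> Hom C (X i) (Y i)"
    "\<And>i. i \<in> I \<Longrightarrow> g i \<cdot> k i = Ide C (Y i)" by metis
  show ?thesis
  proof (rule coproductI)
    show "c \<in> Obj C" by (rule D)
    show "\<iota> i \<cdot> k i \<in> Hom C (Y i) c" if "i \<in> I" for i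
      using D(3)[OF that] k[OF that] by (simp add: Hom_def)
    show "\<exists>h\<in>Hom C c d. \<forall>i\<in>I. h \<cdot> (\<iota> i \<cdot> k i) = f i"
      if f: "d \<in> Obj C" "\<And>i. i \<in> I \<Longrightarrow> f i \<in> Hom C (Y i) d" for d f
    proof -
      have "f i \<cdot> g i \<in> Hom C (X i) d" if "i \<in> I" for i using f(2)[OF that] g[OF that] by (simp add: Hom_def)
      then obtain h where h: "h \<in> Hom C c d" "\<And>i. i \<in> I \<Longrightarrow> h \<cdot> \<iota> i = f i \<cdot> g i"
        by (rule coproduct_ex[OF cop f(1)]) blast+
      have "h \<cdot> (\<iota> i \<cdot> k i) = f i" if i: "i \<in> I" for i
      proof -
        have "h \<cdot> (\<iota> i \<cdot> k i) = (f i \<cdot> g i) \<cdot> k i"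
          by (rule comp_ext[OF k(1)[OF i] D(3)[OF i] h(1) h(2)[OF i]])
        also have "\<dots> = f i \<cdot> Ide C (Y i)"
          using comp_assoc_hom[OF k(1)[OF i] g(1)[OF i] f(2)[OF i]] g(2)[OF i] by simp
        finally show ?thesis using f(2)[OF i] by (simp add: Hom_def)
      qed
      thus ?thesis using h by blast
    qed
    show "h = h'" if h: "h \<in> Hom C c d" "h' \<in> Hom C c d"
      and eq: "\<And>i. i \<in> I \<Longrightarrow> h \<cdot> (\<iota> i \<cdot> k i) = h' \<cdot> (\<iota> i \<cdot> k i)" for d h h'
    proof (rule coproduct_eqI[OF cop h])
      fix i assume i: "i \<in> I"
      note t = k(1)[OF i] D(3)[OF i]
      have "(h \<cdot> \<iota> i) \<cdot> k i = (h' \<cdot> \<iota> i) \<cdot> k i"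
        unfolding comp_assoc_hom[OF t h(1)] comp_assoc_hom[OF t h(2)] by (rule eq[OF i])
      thus "h \<cdot> \<iota> i = h' \<cdot> \<iota> i"
        by (rule iso_epic[OF k(2)[OF i] t(1) comp_in[OF t(2) h(1)] comp_in[OF t(2) h(2)]])
    qed
  qed
qed

lemma coproduct_iso:
  assumes c: "is_coproduct C I X c \<iota>" and d: "is_coproduct C I X d \<kappa>"
    and h: "h \<in> Hom C c d" "\<And>i. i \<in> I \<Longrightarrow> h \<cdot> \<iota> i = \<kappa> i"
  shows "is_iso C h"
proof -
  note D = coproductD[OF c] coproductD[OF d]
  obtain g where g: "g \<in> Hom C d c" "\<And>i. i \<in> I \<Longrightarrow> g \<cdot> \<kappa> i = \<iota> i"
    using coproduct_ex[OF d D(2), of \<iota>] D(3) by metis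
  have "(g \<cdot> h) \<cdot> \<iota> i = Ide C c \<cdot> \<iota> i" if "i \<in> I" for i
    using h(2)[OF that] g(2)[OF that] comp_assoc_hom[OF D(3)[OF that] h(1) g(1)]
      ide_left[OF D(3)[OF that]] by simp
  hence 1: "g \<cdot> h = Ide C c"
    by (rule coproduct_eqI[OF c comp_in[OF h(1) g(1)] ide_in[OF D(2)]])
  have "(h \<cdot> g) \<cdot> \<kappa> i = Ide C d \<cdot> \<kappa> i" if "i \<in> I" for i
    using h(2)[OF that] g(2)[OF that] comp_assoc_hom[OF D(6)[OF that] g(1) h(1)]
      ide_left[OF D(6)[OF that]] by simp
  hence 2: "h \<cdot> g = Ide C d"
    by (rule coproduct_eqI[OF d comp_in[OF g(1) h(1)] ide_in[OF D(5)]])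
  show ?thesis by (rule is_isoI[OF h(1) g(1) 1 2])
qed

text \<open>A mediating map is built in two stages, first out of each \<open>c i\<close> and then
  out of \<open>d\<close>. The summands of iterated applications of \<Gamma> arise in this
  way.\<close>

lemma coproduct_sigma:
  assumes d: "is_coproduct C I c d \<kappa>"
    and c: "\<And>i. i \<in> I \<Longrightarrow> is_coproduct C (J i) (X i) (c i) (\<iota> i)"
  shows "is_coproduct C (Sigma I J) (\<lambda>(i, j). X i j) d (\<lambda>(i, j). \<kappa> i \<cdot> \<iota> i j)"
proof -
  note D = coproductD[OF d] coproductD(1,3)[OF c]
  show ?thesis
  proof (rule coproductI)
    show "d \<in> Obj C" by (rule D)
    show "(case p of (i, j) \<Rightarrow> \<kappa> i \<cdot> \<iota> i j) \<in> Hom C (case p of (i, j) \<Rightarrow> X i j) d"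
      if "p \<in> Sigma I J" for p
      using D(3) D(5) that by (force simp: Hom_def)
    show "\<exists>h\<in>Hom C d e. \<forall>p\<in>Sigma I J. h \<cdot> (case p of (i, j) \<Rightarrow> \<kappa> i \<cdot> \<iota> i j) = f p"
      if e: "e \<in> Obj C" and f: "\<And>p. p \<in> Sigma I J \<Longrightarrow> f p \<in> Hom C (case p of (i, j) \<Rightarrow> X i j) e" for e f
    proof -
      have "\<exists>g. g \<in> Hom C (c i) e \<and> (\<forall>j\<in>J i. g \<cdot> \<iota> i j = f (i, j))" if "i \<in> I" for i
        using coproduct_ex[OF c[OF that] e, of "\<lambda>j. f (i, j)"] f that
        by (metis (no_types, lifting) SigmaI case_prod_conv)
      then obtain g where g: "\<And>i. i \<in> I \<Longrightarrow> g i \<in> Hom C (c i) e"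
        "\<And>i j. i \<in> I \<Longrightarrow> j \<in> J i \<Longrightarrow> g i \<cdot> \<iota> i j = f (i, j)" by metis
      obtain h where h: "h \<in> Hom C d e" "\<And>i. i \<in> I \<Longrightarrow> h \<cdot> \<kappa> i = g i"
        using coproduct_ex[OF d e g(1)] by metis
      have "h \<cdot> (\<kappa> i \<cdot> \<iota> i j) = f (i, j)" if "i \<in> I" "j \<in> J i" for i j
        using comp_extend[OF h(2)[OF that(1)], of "\<iota> i j"] g(2)[OF that] D(3)[OF that(1)] D(5)[OF that] h(1)
        by (simp add: Hom_def)
      thus ?thesis using h(1) by auto
    qed
    show "h = h'" if h: "h \<in> Hom C d e" "h' \<in> Hom C d e"
      and eq: "\<And>p. p \<in> Sigma I J \<Longrightarrow> h \<cdot> (case p of (i, j) \<Rightarrow> \<kappa> i \<cdot> \<iota> i j) = h' \<cdot> (case p of (i, j) \<Rightarrow> \<kappa> i \<cdot> \<iota> i j)"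
      for e h h'
    proof (rule coproduct_eqI[OF d h])
      fix i assume i: "i \<in> I"
      show "h \<cdot> \<kappa> i = h' \<cdot> \<kappa> i"
      proof (rule coproduct_eqI[OF c[OF i]])
        show "h \<cdot> \<kappa> i \<cdot> \<iota> i j = h' \<cdot> \<kappa> i \<cdot> \<iota> i j" if "j \<in> J i" for j
          using eq[of "(i, j)"] i that D(3)[OF i] D(5)[OF i that] h by (simp add: comp_assoc Hom_def)
      qed (use D(3)[OF i] h in \<open>auto simp: Hom_def\<close>)
    qed
  qed
qed

lemma cotuple:
  assumes cop: "is_coproduct C I X (coprod C I X) (coprod_inj C I X)"
    and f: "d \<in> Obj C" "\<And>i. i \<in> I \<Longrightarrow> f i \<in> Hom C (X i) d"
  shows "cotuple C I X d f \<in> Hom C (coprod C I X) d"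
    "i \<in> I \<Longrightarrow> cotuple C I X d f \<cdot> coprod_inj C I X i = f i"
proof -
  have "\<exists>!h. h \<in> Hom C (coprod C I X) d \<and> (\<forall>i\<in>I. h \<cdot> coprod_inj C I X i = f i)"
    using cop f unfolding is_coproduct_def by auto
  from theI'[OF this]
  show "cotuple C I X d f \<in> Hom C (coprod C I X) d"
    "i \<in> I \<Longrightarrow> cotuple C I X d f \<cdot> coprod_inj C I X i = f i"
    unfolding cotuple_def by auto
qed

text \<open>Pullback squares obtained from different sources share the cospan but not the apex. Each
  pair of projections factors through the other, and uniqueness makes the two factorizations
  inverse.\<close>

lemma pullback_comparison:
  assumes 1: "is_pullback C p q f g" and 2: "is_pullback C p' q' f g"
  obtains k where "k \<in> Hom C (Dom C p) (Dom C p')" "is_iso C k" "p' \<cdot> k = p" "q' \<cdot> k = q"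
proof -
  note D = pullbackD[OF 1] pullbackD[OF 2]
  have w: "Dom C p \<in> Obj C" "Dom C p' \<in> Obj C" using D dom_in by auto
  obtain k where k: "k \<in> Hom C (Dom C p) (Dom C p')" "p' \<cdot> k = p" "q' \<cdot> k = q"
    using pullback_ex[OF 2, of p "Dom C p" q] D w by (auto simp: Hom_def)
  obtain l where l: "l \<in> Hom C (Dom C p') (Dom C p)" "p \<cdot> l = p'" "q \<cdot> l = q'"
    using pullback_ex[OF 1, of p' "Dom C p'" q'] D w by (auto simp: Hom_def)
  have "l \<cdot> k = Ide C (Dom C p)"
    using pullback_unique[OF 1, of "l \<cdot> k" "Dom C p" "Ide C (Dom C p)"] k l D w
      comp_extend[OF l(2), of k] comp_extend[OF l(3), of k]
    by (simp add: Hom_def)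
  moreover have "k \<cdot> l = Ide C (Dom C p')"
    using pullback_unique[OF 2, of "k \<cdot> l" "Dom C p'" "Ide C (Dom C p')"] k l D w
      comp_extend[OF k(2), of l] comp_extend[OF k(3), of l]
    by (simp add: Hom_def)
  ultimately have "is_iso C k" using is_isoI[OF k(1) l(1)] by blast
  thus thesis using that k by blast
qed

end

section \<open>Small index sets\<close>

text \<open>Extensivity and distributivity are postulated for index sets that are members of
  \<open>U\<close>, hence for sets of vertices. The coproducts below are indexed by paths and by
  tuples of paths, so smallness is extended to every type by embedding into a member of
  \<open>U\<close>.\<close>

definition small :: "'u set set \<Rightarrow> 'i set \<Rightarrow> bool" where
  "small U I \<longleftrightarrow> (\<exists>J\<in>U. I \<lesssim> J)"

lemma lepoll_Times_self:
  assumes "infinite A"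
  shows "A \<times> A \<lesssim> A"
proof -
  obtain f where "bij_betw f (A \<times> A) A"
    using card_of_Times_same_infinite[OF assms] card_of_ordIso by blast
  thus ?thesis unfolding lepoll_def bij_betw_def by auto
qed

text \<open>A pairing function on \<open>A\<close> folds a list into one element, injectively among
  lists of the same length. Pairing the result with a copy of the length inside \<open>A\<close>
  separates lists of different lengths.\<close>

lemma lepoll_lists_infinite:
  assumes A: "infinite A"
  shows "lists A \<lesssim> A"
proof -
  obtain g where g: "inj_on g (A \<times> A)" "g ` (A \<times> A) \<subseteq> A"
    using lepoll_Times_self[OF A] unfolding lepoll_def by blast
  obtain n :: "nat \<Rightarrow> 'a" where n: "inj n" "range n \<subseteq> A"
    using A infinite_countable_subset by blast
  \<comment> \<open>\<open>n 0\<close> serves as an arbitrary start value inside \<open>A\<close>;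
    \<open>n\<close> itself embeds the possible lengths.\<close>
  define F where "F = (\<lambda>xs. foldr (\<lambda>x y. g (x, y)) xs (n 0))"
  have FA: "F xs \<in> A" if "xs \<in> lists A" for xs
    using that by (induction xs) (use n g in \<open>auto simp: F_def\<close>)
  have inj: "xs \<in> lists A \<Longrightarrow> ys \<in> lists A \<Longrightarrow> length xs = length ys \<Longrightarrow> F xs = F ys \<Longrightarrow> xs = ys"
    for xs ys
  proof (induction xs arbitrary: ys)
    case (Cons x xs)
    then obtain y ys' where ys: "ys = y # ys'" by (cases ys) auto
    have "g (x, F xs) = g (y, F ys')" using Cons.prems by (simp add: F_def ys)
    hence "(x, F xs) = (y, F ys')"
      using Cons.prems ys FA g(1) by (intro inj_onD[OF g(1)]) auto
    thus ?case using Cons ys by auto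
  qed simp
  have "inj_on (\<lambda>xs. g (n (length xs), F xs)) (lists A)"
  proof (rule inj_onI)
    fix xs ys assume xy: "xs \<in> lists A" "ys \<in> lists A"
      and e: "g (n (length xs), F xs) = g (n (length ys), F ys)"
    have "(n (length xs), F xs) = (n (length ys), F ys)"
      by (rule inj_onD[OF g(1) e]) (use xy FA n in auto)
    thus "xs = ys" using inj[OF xy] n(1) by (auto dest: injD)
  qed
  moreover have "(\<lambda>xs. g (n (length xs), F xs)) ` lists A \<subseteq> A" using g n FA by blast
  ultimately show ?thesis unfolding lepoll_def by blast
qed

context small_sets
begin

lemma small_subset: "small U I \<Longrightarrow> J \<subseteq> I \<Longrightarrow> small U J"
  unfolding small_def by (meson lepoll_trans subset_imp_lepoll)

lemma small_mem: "I \<in> U \<Longrightarrow> small U I"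
  unfolding small_def by auto

lemma small_finite: "finite I \<Longrightarrow> small U I"
  unfolding small_def using small_infinite finite_lepoll_infinite by blast

lemma finite_in: "finite (A :: 'u set) \<Longrightarrow> A \<in> U" for A
  using small_finite small_lepoll unfolding small_def by blast

lemma small_infinite_bound:
  assumes "small U I"
  obtains J where "J \<in> U" "infinite J" "I \<lesssim> J"
proof -
  obtain A where A: "A \<in> U" "infinite A" using small_infinite by auto
  obtain J where J: "J \<in> U" "I \<lesssim> J" using assms unfolding small_def by auto
  show thesis
  proof (cases "infinite J")
    case True thus thesis using that J by blast
  next
    case False
    hence "I \<lesssim> A" using J A finite_lepoll_infinite lepoll_trans by blast
    thus thesis using that A by blast
  qed
qed

lemma small_lists:
  assumes "small U I"
  shows "small U (lists I)"
proof -
  obtain J where J: "J \<in> U" "infinite J" "I \<lesssim> J" using small_infinite_bound[OF assms] .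
  have "lists I \<lesssim> J" using lists_lepoll_mono[OF J(3)] lepoll_lists_infinite[OF J(2)] lepoll_trans by blast
  thus ?thesis unfolding small_def using J(1) by blast
qed

lemma small_reindex:
  assumes "small U I"
  obtains b J where "J \<in> U" "bij_betw b J I"
proof -
  obtain J f where J: "J \<in> U" and f: "inj_on f I" "f ` I \<subseteq> J"
    using assms unfolding small_def lepoll_def by blast
  have "f ` I \<in> U" using J f(2) small_lepoll subset_imp_lepoll by blast
  moreover have "bij_betw (the_inv_into I f) (f ` I) I"
    using f(1) by (intro bij_betw_the_inv_into) (simp add: bij_betw_def)
  ultimately show thesis using that by blast
qed

lemma small_times:
  assumes "small U I" "small U J"
  shows "small U (I \<times> J)"
proof -
  obtain A where A: "A \<in> U" "infinite A" "I \<lesssim> A" using small_infinite_bound[OF assms(1)] .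
  obtain B where B: "B \<in> U" "infinite B" "J \<lesssim> B" using small_infinite_bound[OF assms(2)] .
  have AB: "A \<union> B \<in> U"
  proof -
    \<comment> \<open>Only indexed unions are postulated. The binary union is the union over
      \<open>A\<close> of the family with value \<open>A\<close> at \<open>x\<close> and
      \<open>B\<close> elsewhere, and it takes two distinct indices for both values to
      occur.\<close>
    obtain x y where "x \<in> A" "y \<in> A" "x \<noteq> y"
      using A(2) by (metis finite.emptyI finite_insert insertI1 finite_subset subsetI)
    have *: "(\<Union>a\<in>A. if a = x then A else B) \<in> U"
      by (rule small_UN[OF A(1)]) (use A B in auto)
    have "A \<union> B \<subseteq> (\<Union>a\<in>A. if a = x then A else B)"
      using \<open>x \<in> A\<close> \<open>y \<in> A\<close> \<open>x \<noteq> y\<close> by auto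
    thus ?thesis using * small_lepoll subset_imp_lepoll by blast
  qed
  have "I \<times> J \<lesssim> (A \<union> B) \<times> (A \<union> B)"
    by (rule times_lepoll_mono) (meson A(3) B(3) lepoll_trans subset_imp_lepoll Un_upper1 Un_upper2)+
  also have "\<dots> \<lesssim> A \<union> B" using lepoll_Times_self A(2) by blast
  finally show ?thesis using AB unfolding small_def by blast
qed

end

section \<open>Extensive categories\<close>

lemma coprod_functor_obj:
  "p \<in> Obj (product_cat I (\<lambda>i. slice_cat C (X i))) \<Longrightarrow>
     obj_map (coprod_functor C I X) p = coprod_map C I (\<lambda>i. Dom C (p i)) X p"
  by (simp add: coprod_functor_def Let_def)

lemma coprod_functor_arr:
  "t \<in> Arr (product_cat I (\<lambda>i. slice_cat C (X i))) \<Longrightarrow>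
     fst (snd (arr_map (coprod_functor C I X) t)) =
       coprod_map C I (\<lambda>i. Dom C (Dom (product_cat I (\<lambda>i. slice_cat C (X i))) t i))
         (\<lambda>i. Dom C (Cod (product_cat I (\<lambda>i. slice_cat C (X i))) t i)) (\<lambda>i. fst (snd (t i)))"
  by (simp add: coprod_functor_def Let_def)

lemma product_slice_obj:
  "p \<in> Obj (product_cat I (\<lambda>i. slice_cat C (X i))) \<longleftrightarrow>
    p \<in> extensional I \<and> (\<forall>i\<in>I. p i \<in> Arr C \<and> Cod C (p i) = X i)"
  by (auto simp: product_cat_def slice_cat_def PiE_def)

lemma slice_hom:
  "t \<in> Hom (slice_cat C X) p q \<longleftrightarrow>
    (\<exists>h. t = (p, h, q) \<and> p \<in> Arr C \<and> Cod C p = X \<and> q \<in> Arr C \<and> Cod C q = X \<and>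
               h \<in> Hom C (Dom C p) (Dom C q) \<and> q \<cdot>\<^bsub>C\<^esub> h = p)"
  by (auto simp: Hom_def slice_cat_def)

lemma product_hom:
  assumes "p \<in> Obj (product_cat I D)" "q \<in> Obj (product_cat I D)"
  shows "t \<in> Hom (product_cat I D) p q \<longleftrightarrow> t \<in> extensional I \<and> (\<forall>i\<in>I. t i \<in> Hom (D i) (p i) (q i))"
proof -
  have "(\<lambda>i\<in>I. Dom (D i) (t i)) = p \<longleftrightarrow> (\<forall>i\<in>I. Dom (D i) (t i) = p i)"
    "(\<lambda>i\<in>I. Cod (D i) (t i)) = q \<longleftrightarrow> (\<forall>i\<in>I. Cod (D i) (t i) = q i)"
    using assms by (auto simp: product_cat_def fun_eq_iff extensional_def)
  thus ?thesis unfolding Hom_def by (auto simp: product_cat_def PiE_def)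
qed

lemma slice_iso:
  assumes "is_iso (slice_cat C X) t" "t \<in> Hom (slice_cat C X) p q"
  shows "is_iso C (fst (snd t))"
proof -
  obtain h where h: "t = (p, h, q)" "h \<in> Hom C (Dom C p) (Dom C q)"
    using assms(2) unfolding slice_hom by auto
  obtain s where s: "s \<in> Hom (slice_cat C X) q p"
    "s \<cdot>\<^bsub>slice_cat C X\<^esub> t = Ide (slice_cat C X) p" "t \<cdot>\<^bsub>slice_cat C X\<^esub> s = Ide (slice_cat C X) q"
    using assms unfolding is_iso_def by (auto simp: Hom_def)
  then obtain k where k: "s = (q, k, p)" "k \<in> Hom C (Dom C q) (Dom C p)" unfolding slice_hom by auto
  have "k \<cdot>\<^bsub>C\<^esub> h = Ide C (Dom C h)" "h \<cdot>\<^bsub>C\<^esub> k = Ide C (Cod C h)"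
    using s(2,3) h k by (auto simp: slice_cat_def Hom_def)
  thus ?thesis using h k unfolding is_iso_def by (auto simp: Hom_def)
qed

locale extensive_cat = category V + small_sets U for U :: "'u set set" and V :: "('o, 'm) cat" (structure) +
  assumes extensive: "extensive U V"
begin

lemma small_coproduct:
  assumes "small U I" "\<And>i. i \<in> I \<Longrightarrow> X i \<in> Obj V"
  obtains c \<iota> where "is_coproduct V I X c \<iota>"
proof -
  obtain b J where J: "J \<in> U" "bij_betw b J I" using small_reindex[OF assms(1)] .
  have "\<forall>j\<in>J. X (b j) \<in> Obj V" using J assms(2) bij_betwE by blast
  moreover have "\<forall>I\<in>U. \<forall>X. (\<forall>i\<in>I. X i \<in> Obj V) \<longrightarrow> (\<exists>c \<iota>. is_coproduct V I X c \<iota>)"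
    using extensive unfolding extensive_def by (elim conjE)
  ultimately obtain c \<iota> where c: "is_coproduct V J (\<lambda>j. X (b j)) c \<iota>"
    using J(1) by meson
  have bi: "bij_betw (the_inv_into J b) I J" using J(2) by (rule bij_betw_the_inv_into)
  have "b (the_inv_into J b i) = i" if "i \<in> I" for i
    using that J(2) by (auto simp: bij_betw_def f_the_inv_into_f)
  hence "is_coproduct V I X c (\<lambda>i. \<iota> (the_inv_into J b i))"
    by (intro coproduct_cong[OF coproduct_reindex[OF bi c]]) auto
  thus thesis using that by blast
qed

lemma coprod:
  assumes "small U I" "\<And>i. i \<in> I \<Longrightarrow> X i \<in> Obj V"
  shows "is_coproduct V I X (coprod V I X) (coprod_inj V I X)"
proof -
  obtain c \<iota> where "is_coproduct V I X c \<iota>" using small_coproduct[OF assms(1), of X] assms(2) by blast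
  thus ?thesis by (rule chosen_coprod_is_coproduct)
qed

lemma coprod_map:
  assumes "small U I" "\<And>i. i \<in> I \<Longrightarrow> f i \<in> Hom V (X i) (Y i)"
  shows "coprod_map V I X Y f \<in> Hom V (coprod V I X) (coprod V I Y)"
    "i \<in> I \<Longrightarrow> coprod_map V I X Y f \<cdot> coprod_inj V I X i = coprod_inj V I Y i \<cdot> f i"
proof -
  have X: "is_coproduct V I X (coprod V I X) (coprod_inj V I X)"
    by (rule coprod[OF assms(1)]) (rule hom_obj(1)[OF assms(2)])
  have Y: "is_coproduct V I Y (coprod V I Y) (coprod_inj V I Y)"
    by (rule coprod[OF assms(1)]) (rule hom_obj(2)[OF assms(2)])
  have inj: "coprod_inj V I Y i \<cdot> f i \<in> Hom V (X i) (coprod V I Y)" if "i \<in> I" for i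
    by (rule comp_in[OF assms(2)[OF that] coproductD(3)[OF Y that]])
  show "coprod_map V I X Y f \<in> Hom V (coprod V I X) (coprod V I Y)"
    unfolding coprod_map_def by (rule cotuple(1)[OF X coproductD(2)[OF Y] inj])
  show "i \<in> I \<Longrightarrow> coprod_map V I X Y f \<cdot> coprod_inj V I X i = coprod_inj V I Y i \<cdot> f i"
    unfolding coprod_map_def by (rule cotuple(2)[OF X coproductD(2)[OF Y] inj])
qed

text \<open>The empty index set is given the type \<open>'u set\<close> only to pick one concrete
  coproduct. \<open>initial_coproduct\<close> then gives the universal property for every type of
  indices.\<close>

definition initial :: 'o where
  "initial = coprod V ({} :: 'u set) (\<lambda>_. undefined)"

definition from_initial :: "'o \<Rightarrow> 'm" where
  "from_initial X = (SOME f. f \<in> Hom V initial X)"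

lemma initial_coproduct: "is_coproduct V {} X initial \<iota>"
proof -
  have "is_coproduct V ({} :: 'u set) (\<lambda>_. undefined) initial (coprod_inj V ({} :: 'u set) (\<lambda>_. undefined))"
    unfolding initial_def by (rule coprod) (auto intro: small_finite)
  thus ?thesis unfolding is_coproduct_def by simp
qed

lemma initial_obj: "initial \<in> Obj V"
  using coproductD(2)[OF initial_coproduct] .

lemma from_initial:
  assumes "X \<in> Obj V"
  shows "from_initial X \<in> Hom V initial X"
proof -
  obtain h where "h \<in> Hom V initial X" by (rule coproduct_ex[OF initial_coproduct assms]) auto
  thus ?thesis unfolding from_initial_def by (rule someI)
qed

lemma from_initial_unique: "f \<in> Hom V initial X \<Longrightarrow> g \<in> Hom V initial X \<Longrightarrow> f = g"
  by (rule coproduct_eqI[OF initial_coproduct]) auto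

text \<open>A retraction is the cotuple of the identity on summand \<open>i\<close> and the unique
  maps out of the other summands. It is also a section: the composite with the injection agrees with
  the identity on every summand, by initiality except at \<open>i\<close>. The lemma serves both in
  the analysis of the slice equivalence and in the invertibility of \<open>eta\<close>.\<close>

lemma single_summand:
  assumes cop: "is_coproduct V I X c \<iota>" and i: "i \<in> I"
    and init: "\<And>j. j \<in> I \<Longrightarrow> j \<noteq> i \<Longrightarrow> is_coproduct V ({} :: 'u set) (\<lambda>_. undefined) (X j) (\<lambda>_. undefined)"
  shows "is_iso V (\<iota> i)"
proof -
  note D = coproductD[OF cop]
  define g where "g j = (if j = i then Ide V (X i) else SOME f. f \<in> Hom V (X j) (X i))" for j
  have g: "g j \<in> Hom V (X j) (X i)" if "j \<in> I" for j
  proof (cases "j = i")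
    case True thus ?thesis using ide_in D(1)[OF i] by (simp add: g_def)
  next
    case False
    have "\<exists>f. f \<in> Hom V (X j) (X i)" using coproduct_ex[OF init[OF that False] D(1)[OF i]] by blast
    thus ?thesis using False by (simp add: g_def) (rule someI_ex)
  qed
  obtain h where h: "h \<in> Hom V c (X i)" "\<And>j. j \<in> I \<Longrightarrow> h \<cdot> \<iota> j = g j"
    by (rule coproduct_ex[OF cop D(1)[OF i] g]) blast+
  have 1: "h \<cdot> \<iota> i = Ide V (X i)" using h(2)[OF i] by (simp add: g_def)
  have "\<iota> i \<cdot> h = Ide V c"
  proof (rule coproduct_eqI[OF cop comp_in[OF h(1) D(3)[OF i]] ide_in[OF D(2)]])
    fix j assume j: "j \<in> I"
    have t: "(\<iota> i \<cdot> h) \<cdot> \<iota> j \<in> Hom V (X j) c" "Ide V c \<cdot> \<iota> j \<in> Hom V (X j) c"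
      using comp_in[OF D(3)[OF j] comp_in[OF h(1) D(3)[OF i]]] comp_in[OF D(3)[OF j] ide_in[OF D(2)]] by auto
    show "(\<iota> i \<cdot> h) \<cdot> \<iota> j = Ide V c \<cdot> \<iota> j"
    proof (cases "j = i")
      case True
      thus ?thesis using comp_assoc_hom[OF D(3)[OF j] h(1) D(3)[OF i]] 1 D(3)[OF i]
        by (simp add: ide_left ide_right)
    next
      case False
      show ?thesis by (rule coproduct_eqI[OF init[OF j False] t]) auto
    qed
  qed
  thus ?thesis using is_isoI[OF D(3)[OF i] h(1) 1] by blast
qed

section \<open>Pullbacks of coproduct injections, read off the slice equivalence\<close>

lemma slice_equivalence:
  assumes "I \<in> U" "\<And>i. i \<in> I \<Longrightarrow> X i \<in> Obj V"
  shows "is_equivalence (product_cat I (\<lambda>i. slice_cat V (X i))) (slice_cat V (coprod V I X))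
    (coprod_functor V I X)"
  using extensive assms unfolding extensive_def by blast

text \<open>A cone consists of \<open>s\<close> into \<open>d\<close> and \<open>r\<close> into
  \<open>X i\<close>. Placing \<open>r\<close> at index \<open>i\<close> and initial objects
  elsewhere gives an object of the product of slices whose coproduct is again the apex, so that
  \<open>s\<close> becomes a map of slices. Fullness of the coproduct functor produces the
  factorization and faithfulness its uniqueness.\<close>

lemma equivalence_pullback:
  assumes I: "I \<in> U" and c: "is_coproduct V I X c \<iota>" and d: "is_coproduct V I Y d \<kappa>"
    and h: "\<And>i. i \<in> I \<Longrightarrow> h i \<in> Hom V (Y i) (X i)" and f: "f \<in> Hom V d c"
    and comm: "\<And>i. i \<in> I \<Longrightarrow> f \<cdot> \<kappa> i = \<iota> i \<cdot> h i" and i: "i \<in> I"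
  shows "is_pullback V (\<kappa> i) (h i) f (\<iota> i)"
proof -
  note c' = coproductD[OF c] and d' = coproductD[OF d]
  let ?P = "product_cat I (\<lambda>i. slice_cat V (X i))"
  let ?F = "coprod_functor V I X"
  have eqv: "is_equivalence ?P (slice_cat V (coprod V I X)) ?F"
    by (rule slice_equivalence[OF I c'(1)])
  note sI = small_mem[OF I]
  define p where "p = (\<lambda>i\<in>I. h i)"
  have p: "p \<in> Obj ?P" using h by (auto simp: product_slice_obj p_def Hom_def)
  \<comment> \<open>The family of domains that \<open>coprod_functor\<close> forms from
    \<open>p\<close>. It agrees with \<open>Y\<close> on \<open>I\<close>; \<phi> and \<psi> compare
    the given coproducts with the chosen ones.\<close>
  define Y' where "Y' = (\<lambda>i. Dom V (p i))"
  have Y': "Y' j = Y j" if "j \<in> I" for j using that h by (auto simp: Y'_def p_def Hom_def)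
  note X'c = coprod[OF sI c'(1)]
  have Y'c: "is_coproduct V I Y (coprod V I Y') (coprod_inj V I Y')"
    by (rule coproduct_cong[OF coprod[OF sI, of Y']]) (use Y' d'(1) in auto)
  note Xc' = coproductD[OF X'c] and Yc' = coproductD[OF Y'c]
  obtain \<phi> where \<phi>: "\<phi> \<in> Hom V d (coprod V I Y')" "\<And>j. j \<in> I \<Longrightarrow> \<phi> \<cdot> \<kappa> j = coprod_inj V I Y' j"
    by (rule coproduct_ex[OF d Yc'(2) Yc'(3)]) blast+
  obtain \<psi> where \<psi>: "\<psi> \<in> Hom V c (coprod V I X)" "\<And>j. j \<in> I \<Longrightarrow> \<psi> \<cdot> \<iota> j = coprod_inj V I X j"
    by (rule coproduct_ex[OF c Xc'(2) Xc'(3)]) blast+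
  have iso: "is_iso V \<phi>" "is_iso V \<psi>"
    using coproduct_iso[OF d Y'c \<phi>] coproduct_iso[OF c X'c \<psi>] by auto
  define Tp where "Tp = obj_map ?F p"
  have Tp_eq: "Tp = coprod_map V I Y' X p" unfolding Tp_def coprod_functor_obj[OF p] Y'_def ..
  have ph: "p j \<in> Hom V (Y' j) (X j)" if "j \<in> I" for j using h[OF that] that Y' by (simp add: p_def)
  have Tp: "Tp \<in> Hom V (coprod V I Y') (coprod V I X)"
    "\<And>j. j \<in> I \<Longrightarrow> Tp \<cdot> coprod_inj V I Y' j = coprod_inj V I X j \<cdot> p j"
    unfolding Tp_eq using coprod_map[of I p Y' X] sI ph by auto
  have T\<phi>: "Tp \<cdot> \<phi> = \<psi> \<cdot> f"
  proof (rule coproduct_eqI[OF d])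
    show "Tp \<cdot> \<phi> \<in> Hom V d (coprod V I X)" by (rule comp_in[OF \<phi>(1) Tp(1)])
    show "\<psi> \<cdot> f \<in> Hom V d (coprod V I X)" by (rule comp_in[OF f \<psi>(1)])
    fix j assume j: "j \<in> I"
    have "Tp \<cdot> \<phi> \<cdot> \<kappa> j = coprod_inj V I X j \<cdot> h j"
      using comp_assoc_hom[OF d'(3)[OF j] \<phi>(1) Tp(1)] \<phi>(2)[OF j] Tp(2)[OF j] j by (simp add: p_def)
    moreover have "\<psi> \<cdot> f \<cdot> \<kappa> j = coprod_inj V I X j \<cdot> h j"
      using comp_assoc_hom[OF d'(3)[OF j] f \<psi>(1)] comm[OF j] comp_assoc_hom[OF h[OF j] c'(3)[OF j] \<psi>(1)]
        \<psi>(2)[OF j] by simp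
    ultimately show "Tp \<cdot> \<phi> \<cdot> \<kappa> j = \<psi> \<cdot> f \<cdot> \<kappa> j" by simp
  qed
  show ?thesis
  proof (rule pullbackI[OF d'(3)[OF i] h[OF i] f c'(3)[OF i] comm[OF i]])
    fix w s r assume s: "s \<in> Hom V w d" and r: "r \<in> Hom V w (X i)" and e: "f \<cdot> s = \<iota> i \<cdot> r"
    have w: "w \<in> Obj V" using hom_obj r by auto
    \<comment> \<open>The object of the product of slices that represents the cone: everything away
      from \<open>i\<close> is initial.\<close>
    define q where "q = (\<lambda>j\<in>I. if j = i then r else from_initial (X j))"
    define W where "W = (\<lambda>j. Dom V (q j))"
    have q': "q j \<in> Hom V (W j) (X j)" if "j \<in> I" for j
      using that r from_initial[OF c'(1)[OF that]] by (auto simp: q_def W_def Hom_def)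
    have W: "W i = w" "\<And>j. j \<in> I \<Longrightarrow> j \<noteq> i \<Longrightarrow> W j = initial"
      using i r from_initial[OF c'(1)] by (auto simp: q_def W_def Hom_def)
    have q: "q \<in> Obj ?P" unfolding product_slice_obj using q' by (auto simp: q_def Hom_def)
    define Tq where "Tq = obj_map ?F q"
    have Tq_eq: "Tq = coprod_map V I W X q" unfolding Tq_def coprod_functor_obj[OF q] W_def ..
    have Tq: "Tq \<in> Hom V (coprod V I W) (coprod V I X)"
      "\<And>j. j \<in> I \<Longrightarrow> Tq \<cdot> coprod_inj V I W j = coprod_inj V I X j \<cdot> q j"
      unfolding Tq_eq using coprod_map[of I q W X] sI q' by auto
    have Wc: "is_coproduct V I W (coprod V I W) (coprod_inj V I W)"
      by (rule coprod[OF sI]) (use q' hom_obj in auto)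
    note Wc' = coproductD[OF Wc]
    \<comment> \<open>All summands of \<open>W\<close> other than \<open>W i\<close>, which is
      \<open>w\<close>, are initial, so the chosen coproduct of \<open>W\<close> is a copy of
      \<open>w\<close>.\<close>
    have "is_iso V (coprod_inj V I W i)"
      by (rule single_summand[OF Wc i]) (simp add: W(2) initial_coproduct)
    then obtain z where z: "z \<in> Hom V (coprod V I W) w" "z \<cdot> coprod_inj V I W i = Ide V w"
      "coprod_inj V I W i \<cdot> z = Ide V (coprod V I W)"
      using iso_inverse[OF _ Wc'(3)[OF i]] W(1) by metis
    \<comment> \<open>The map \<open>s\<close>, transported along the identifications of
      \<open>w\<close> and \<open>d\<close> with chosen coproducts, so that it can be read as a map
      between values of the coproduct functor.\<close>
    define k where "k = \<phi> \<cdot> (s \<cdot> z)"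
    have k: "k \<in> Hom V (coprod V I W) (coprod V I Y')"
      unfolding k_def by (rule comp_in[OF comp_in[OF z(1) s] \<phi>(1)])
    have "Tp \<cdot> k = (\<psi> \<cdot> (f \<cdot> s)) \<cdot> z"
    proof -
      have "Tp \<cdot> k = (\<psi> \<cdot> f) \<cdot> (s \<cdot> z)"
        unfolding k_def by (rule comp_ext[OF comp_in[OF z(1) s] \<phi>(1) Tp(1) T\<phi>])
      thus ?thesis using z(1) s f \<psi>(1) by (simp add: comp_assoc Hom_def)
    qed
    also have "\<dots> = (coprod_inj V I X i \<cdot> r) \<cdot> z"
      unfolding e using comp_ext[OF r c'(3)[OF i] \<psi>(1) \<psi>(2)[OF i]] by simp
    also have "\<dots> = (Tq \<cdot> coprod_inj V I W i) \<cdot> z" using Tq(2)[OF i] i by (simp add: q_def)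
    also have "\<dots> = Tq" using comp_assoc_hom[OF z(1) _ Tq(1)] Wc'(3)[OF i] W(1) z(3) Tq(1) ide_right by simp
    finally have Tk: "Tp \<cdot> k = Tq" .
    have "(Tq, k, Tp) \<in> Hom (slice_cat V (coprod V I X)) (obj_map ?F q) (obj_map ?F p)"
      unfolding slice_hom using Tk k Tp(1) by (auto simp: Hom_def Tp_def[symmetric] Tq_def[symmetric])
    then obtain t where t: "t \<in> Hom ?P q p" "arr_map ?F t = (Tq, k, Tp)"
      using equivalence_full[OF eqv q p] by blast
    have ti: "t j \<in> Hom (slice_cat V (X j)) (q j) (p j)" if "j \<in> I" for j
      using t(1) that product_hom[OF q p] by auto
    define u where "u = (\<lambda>j. fst (snd (t j)))"
    have u: "u j \<in> Hom V (W j) (Y' j)" "p j \<cdot> u j = q j" if "j \<in> I" for j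
      using ti[OF that] unfolding slice_hom u_def by (auto simp: W_def Y'_def)
    have "k = coprod_map V I W Y' u"
      using coprod_functor_arr[of t I V X] t by (simp add: Hom_def W_def Y'_def u_def)
    hence ku: "k \<cdot> coprod_inj V I W i = coprod_inj V I Y' i \<cdot> u i"
      using coprod_map(2)[OF sI u(1) i] by simp
    have ui: "u i \<in> Hom V w (Y i)" using u(1)[OF i] W Y' i by simp
    have "\<phi> \<cdot> s = k \<cdot> coprod_inj V I W i"
    proof -
      have "k \<cdot> coprod_inj V I W i = \<phi> \<cdot> (s \<cdot> (z \<cdot> coprod_inj V I W i))"
        unfolding k_def using Wc'(3)[OF i] z(1) s \<phi>(1) by (simp add: comp_assoc Hom_def)
      thus ?thesis using z(2) s by (simp add: ide_right)
    qed
    also have "\<dots> = \<phi> \<cdot> (\<kappa> i \<cdot> u i)"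
      unfolding ku using comp_ext[OF ui d'(3)[OF i] \<phi>(1) \<phi>(2)[OF i]] by simp
    finally have "s = \<kappa> i \<cdot> u i"
      by (rule iso_monic[OF iso(1) \<phi>(1) s comp_in[OF ui d'(3)[OF i]]])
    moreover have "h i \<cdot> u i = r" using u(2)[OF i] i by (simp add: p_def q_def)
    ultimately show "\<exists>g\<in>Hom V w (Y i). \<kappa> i \<cdot> g = s \<and> h i \<cdot> g = r" using ui by blast
  next
    fix w u u' assume u: "u \<in> Hom V w (Y i)" "u' \<in> Hom V w (Y i)"
      and e: "\<kappa> i \<cdot> u = \<kappa> i \<cdot> u'" "h i \<cdot> u = h i \<cdot> u'"
    define q where "q = (\<lambda>j\<in>I. if j = i then h i \<cdot> u else from_initial (X j))"
    have r: "h i \<cdot> u \<in> Hom V w (X i)" using comp_in[OF u(1) h[OF i]] .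
    have q: "q \<in> Obj ?P" unfolding product_slice_obj using r from_initial[OF c'(1)]
      by (auto simp: q_def Hom_def)
    \<comment> \<open>\<open>T v\<close> is the map of families that is \<open>v\<close> at
      \<open>i\<close> and the only possible map elsewhere. It determines \<open>v\<close>, so it
      suffices that the coproduct functor identifies \<open>T u\<close> and
      \<open>T u'\<close>.\<close>
    define T where "T v = (\<lambda>j\<in>I. (q j, if j = i then v else from_initial (Y j), p j))" for v
    have T: "T v \<in> Hom ?P q p" if v: "v \<in> Hom V w (Y i)" "h i \<cdot> v = h i \<cdot> u" for v
      unfolding product_hom[OF q p]
    proof (intro conjI ballI)
      fix j assume j: "j \<in> I"
      show "T v j \<in> Hom (slice_cat V (X j)) (q j) (p j)"
      proof (cases "j = i")
        case True
        show ?thesis using True i v r h[OF i] unfolding slice_hom by (auto simp: T_def q_def p_def Hom_def)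
      next
        case False
        have "h j \<cdot> from_initial (Y j) = from_initial (X j)"
          by (rule from_initial_unique[OF comp_in[OF from_initial[OF d'(1)[OF j]] h[OF j]] from_initial[OF c'(1)[OF j]]])
        thus ?thesis using j False h[OF j] from_initial[OF c'(1)[OF j]] from_initial[OF d'(1)[OF j]]
          unfolding slice_hom by (auto simp: T_def q_def p_def Hom_def)
      qed
    qed (simp add: T_def)
    define W where "W = (\<lambda>j. Dom V (q j))"
    have FT: "arr_map ?F (T v) = (obj_map ?F q, coprod_map V I W Y'
        (\<lambda>j. fst (snd (T v j))), obj_map ?F p)" if v: "v \<in> Hom V w (Y i)" "h i \<cdot> v = h i \<cdot> u" for v
      using T[OF that] q p by (simp add: coprod_functor_def Let_def Hom_def W_def Y'_def)
    \<comment> \<open>\<open>coprod_map\<close> is a definite description. Its value depends only on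
      the condition that describes it, and that condition sees \<open>u\<close> only through
      \<open>\<kappa> i \<cdot> u\<close>.\<close>
    have "(\<forall>j\<in>I. g \<cdot> coprod_inj V I W j = coprod_inj V I Y' j \<cdot> fst (snd (T u j))) \<longleftrightarrow>
      (\<forall>j\<in>I. g \<cdot> coprod_inj V I W j = coprod_inj V I Y' j \<cdot> fst (snd (T u' j)))" for g
    proof -
      have "coprod_inj V I Y' i \<cdot> u = \<phi> \<cdot> (\<kappa> i \<cdot> u)" "coprod_inj V I Y' i \<cdot> u' = \<phi> \<cdot> (\<kappa> i \<cdot> u')"
        using comp_ext[OF u(1) d'(3)[OF i] \<phi>(1) \<phi>(2)[OF i]] comp_ext[OF u(2) d'(3)[OF i] \<phi>(1) \<phi>(2)[OF i]] by auto
      thus ?thesis using e(1) by (simp add: T_def)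
    qed
    hence "coprod_map V I W Y' (\<lambda>j. fst (snd (T u j))) = coprod_map V I W Y' (\<lambda>j. fst (snd (T u' j)))"
      unfolding coprod_map_def cotuple_def by simp
    hence "arr_map ?F (T u) = arr_map ?F (T u')" using FT u e(2) by simp
    hence "T u = T u'" using equivalence_faithful[OF eqv T T] u e(2) by simp
    hence "T u i = T u' i" by simp
    thus "u = u'" using i by (simp add: T_def)
  qed
qed

text \<open>Essential surjectivity: an object over the chosen coproduct is isomorphic to a coproduct
  of objects over the summands.\<close>

lemma equivalence_decomp:
  assumes I: "I \<in> U" and c: "is_coproduct V I X c \<iota>" and f: "f \<in> Hom V d c"
  obtains Y h \<kappa> where "is_coproduct V I Y d \<kappa>" "\<And>i. i \<in> I \<Longrightarrow> h i \<in> Hom V (Y i) (X i)"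
    "\<And>i. i \<in> I \<Longrightarrow> f \<cdot> \<kappa> i = \<iota> i \<cdot> h i"
proof -
  note c' = coproductD[OF c]
  let ?P = "product_cat I (\<lambda>i. slice_cat V (X i))"
  let ?F = "coprod_functor V I X"
  have eqv: "is_equivalence ?P (slice_cat V (coprod V I X)) ?F"
    by (rule slice_equivalence[OF I c'(1)])
  note sI = small_mem[OF I]
  note X'c = coprod[OF sI c'(1)]
  note Xc' = coproductD[OF X'c]
  obtain \<psi> where \<psi>: "\<psi> \<in> Hom V c (coprod V I X)" "\<And>j. j \<in> I \<Longrightarrow> \<psi> \<cdot> \<iota> j = coprod_inj V I X j"
    by (rule coproduct_ex[OF c Xc'(2) Xc'(3)]) blast+
  have iso: "is_iso V \<psi>" using coproduct_iso[OF c X'c \<psi>] by auto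
  \<comment> \<open>The equivalence lives over the chosen coproduct, so \<open>f\<close> is first
    moved there along the comparison \<psi>, which is cancelled again at the end.\<close>
  have "\<psi> \<cdot> f \<in> Obj (slice_cat V (coprod V I X))"
    using comp_in[OF f \<psi>(1)] by (simp add: slice_cat_def Hom_def)
  then obtain p t where p: "p \<in> Obj ?P"
    and t: "t \<in> Hom (slice_cat V (coprod V I X)) (obj_map ?F p) (\<psi> \<cdot> f)" "is_iso (slice_cat V (coprod V I X)) t"
    using equivalence_ess_surj[OF eqv] by blast
  define \<theta> where "\<theta> = fst (snd t)"
  have iso\<theta>: "is_iso V \<theta>" using slice_iso[OF t(2,1)] by (simp add: \<theta>_def)
  define Y where "Y = (\<lambda>i. Dom V (p i))"
  have ph: "p i \<in> Hom V (Y i) (X i)" if "i \<in> I" for i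
    using p that by (auto simp: product_slice_obj Hom_def Y_def)
  have T_eq: "obj_map ?F p = coprod_map V I Y X p" unfolding coprod_functor_obj[OF p] Y_def ..
  have T: "obj_map ?F p \<in> Hom V (coprod V I Y) (coprod V I X)"
    "\<And>j. j \<in> I \<Longrightarrow> obj_map ?F p \<cdot> coprod_inj V I Y j = coprod_inj V I X j \<cdot> p j"
    unfolding T_eq using coprod_map[of I p Y X] sI ph by auto
  have Yc: "is_coproduct V I Y (coprod V I Y) (coprod_inj V I Y)"
    by (rule coprod[OF sI]) (use ph hom_obj in auto)
  note Yc' = coproductD[OF Yc]
  have \<theta>: "\<theta> \<in> Hom V (coprod V I Y) d" "(\<psi> \<cdot> f) \<cdot> \<theta> = obj_map ?F p"
    using t(1) T(1) comp_in[OF f \<psi>(1)] unfolding slice_hom by (auto simp: \<theta>_def Hom_def)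
  show thesis
  proof (rule that[OF coproduct_iso_target[OF Yc \<theta>(1) iso\<theta>] ph])
    fix i assume i: "i \<in> I"
    have "\<psi> \<cdot> (f \<cdot> (\<theta> \<cdot> coprod_inj V I Y i)) = ((\<psi> \<cdot> f) \<cdot> \<theta>) \<cdot> coprod_inj V I Y i"
      using Yc'(3)[OF i] \<theta>(1) f \<psi>(1) by (simp add: comp_assoc Hom_def)
    also have "\<dots> = coprod_inj V I X i \<cdot> p i" unfolding \<theta>(2) by (rule T(2)[OF i])
    also have "\<dots> = \<psi> \<cdot> (\<iota> i \<cdot> p i)" using comp_ext[OF ph[OF i] c'(3)[OF i] \<psi>(1) \<psi>(2)[OF i]] by simp
    finally show "f \<cdot> (\<theta> \<cdot> coprod_inj V I Y i) = \<iota> i \<cdot> p i"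
      by (rule iso_monic[OF iso \<psi>(1) comp_in[OF comp_in[OF Yc'(3)[OF i] \<theta>(1)] f] comp_in[OF ph[OF i] c'(3)[OF i]]])
  qed
qed

text \<open>A bijection from a member of \<open>U\<close> onto \<open>I\<close> reduces to the index
  sets for which extensivity is postulated.\<close>

lemma coproduct_pullback:
  assumes I: "small U I" and c: "is_coproduct V I X c \<iota>" and d: "is_coproduct V I Y d \<kappa>"
    and h: "\<And>i. i \<in> I \<Longrightarrow> h i \<in> Hom V (Y i) (X i)" and f: "f \<in> Hom V d c"
    and comm: "\<And>i. i \<in> I \<Longrightarrow> f \<cdot> \<kappa> i = \<iota> i \<cdot> h i" and i: "i \<in> I"
  shows "is_pullback V (\<kappa> i) (h i) f (\<iota> i)"
proof -
  obtain b J where J: "J \<in> U" "bij_betw b J I" using small_reindex[OF I] .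
  have b: "b j \<in> I" if "j \<in> J" for j using J(2) that bij_betwE by blast
  obtain j where j: "j \<in> J" "b j = i" using i J(2) by (auto simp: bij_betw_def)
  have "is_pullback V (\<kappa> (b j)) (h (b j)) f (\<iota> (b j))"
    by (rule equivalence_pullback[OF J(1) coproduct_reindex[OF J(2) c] coproduct_reindex[OF J(2) d] _ f])
      (use b h comm j in auto)
  thus ?thesis using j by simp
qed

lemma coproduct_decomp:
  assumes I: "small U I" and c: "is_coproduct V I X c \<iota>" and f: "f \<in> Hom V d c"
  obtains Y h \<kappa> where "is_coproduct V I Y d \<kappa>" "\<And>i. i \<in> I \<Longrightarrow> h i \<in> Hom V (Y i) (X i)"
    "\<And>i. i \<in> I \<Longrightarrow> f \<cdot> \<kappa> i = \<iota> i \<cdot> h i"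
proof -
  obtain b J where J: "J \<in> U" "bij_betw b J I" using small_reindex[OF I] .
  define b' where "b' = the_inv_into J b"
  have b': "bij_betw b' I J" unfolding b'_def by (rule bij_betw_the_inv_into[OF J(2)])
  have bb: "b' i \<in> J" "b (b' i) = i" if "i \<in> I" for i
    using that J(2) bij_betwE[OF b'] by (auto simp: bij_betw_def f_the_inv_into_f b'_def)
  obtain Y h \<kappa> where *: "is_coproduct V J Y d \<kappa>" "\<And>j. j \<in> J \<Longrightarrow> h j \<in> Hom V (Y j) (X (b j))"
    "\<And>j. j \<in> J \<Longrightarrow> f \<cdot> \<kappa> j = \<iota> (b j) \<cdot> h j"
    by (rule equivalence_decomp[OF J(1) coproduct_reindex[OF J(2) c] f]) blast+
  show thesis
    by (rule that[OF coproduct_reindex[OF b' *(1)], of "\<lambda>i. h (b' i)"]) (use *(2,3) bb in \<open>metis+\<close>)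
qed

text \<open>Coproducts are stable under pullback. The map \<open>f\<close> splits into a coproduct
  of maps, whose squares over the injections are pullbacks; the given pullbacks of the same cospans
  differ from these by isomorphisms, which may be absorbed into the injections.\<close>

lemma coproduct_universal:
  assumes I: "small U I" and c: "is_coproduct V I X c \<iota>" and f: "f \<in> Hom V d c"
    and pb: "\<And>i. i \<in> I \<Longrightarrow> is_pullback V (q i) (p i) f (\<iota> i)"
    and P: "\<And>i. i \<in> I \<Longrightarrow> Dom V (q i) = P i"
  shows "is_coproduct V I P d q"
proof -
  obtain Y h \<kappa> where *: "is_coproduct V I Y d \<kappa>" "\<And>i. i \<in> I \<Longrightarrow> h i \<in> Hom V (Y i) (X i)"
    "\<And>i. i \<in> I \<Longrightarrow> f \<cdot> \<kappa> i = \<iota> i \<cdot> h i"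
    by (rule coproduct_decomp[OF I c f]) blast+
  note D = coproductD[OF *(1)]
  have "\<exists>k. k \<in> Hom V (P i) (Y i) \<and> is_iso V k \<and> \<kappa> i \<cdot> k = q i" if i: "i \<in> I" for i
    using pullback_comparison[OF pb[OF i] coproduct_pullback[OF I c *(1) *(2) f *(3) i]]
      P[OF i] D(3)[OF i] by (metis HomD(2))
  then obtain k where k: "\<And>i. i \<in> I \<Longrightarrow> k i \<in> Hom V (P i) (Y i)" "\<And>i. i \<in> I \<Longrightarrow> is_iso V (k i)"
     "\<And>i. i \<in> I \<Longrightarrow> \<kappa> i \<cdot> k i = q i" by metis
  show ?thesis
    by (rule coproduct_cong[OF coproduct_iso_source[OF *(1) k(1,2)]]) (use k(3) in auto)
qed

end

section \<open>Natural transformations\<close>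

lemma nat_transI:
  assumes "cat_functor C D F" "cat_functor C D G" "\<tau> \<in> extensional (Obj C)"
    "\<And>a. a \<in> Obj C \<Longrightarrow> \<tau> a \<in> Hom D (obj_map F a) (obj_map G a)"
    "\<And>f a b. f \<in> Hom C a b \<Longrightarrow> arr_map G f \<cdot>\<^bsub>D\<^esub> \<tau> a = \<tau> b \<cdot>\<^bsub>D\<^esub> arr_map F f"
  shows "nat_trans C D F G \<tau>"
  using assms by (simp add: nat_trans_def nat_trans_axioms_def)

lemma vert_comp_apply: "a \<in> Obj C \<Longrightarrow> vert_comp C D \<beta> \<alpha> a = \<beta> a \<cdot>\<^bsub>D\<^esub> \<alpha> a"
  by (simp add: vert_comp_def)

lemma id_trans_apply: "a \<in> Obj C \<Longrightarrow> id_trans C D F a = Ide D (obj_map F a)"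
  by (simp add: id_trans_def)

lemma nat_trans_eqI:
  assumes "nat_trans C D F G \<tau>" "nat_trans C D F' G' \<tau>'" "\<And>a. a \<in> Obj C \<Longrightarrow> \<tau> a = \<tau>' a"
  shows "\<tau> = \<tau>'"
  using nat_trans.ext[OF assms(1)] nat_trans.ext[OF assms(2)] assms(3) by (rule extensionalityI)

lemma nat_trans_vert_comp:
  assumes "nat_trans C D F G \<alpha>" "nat_trans C D G H \<beta>"
  shows "nat_trans C D F H (vert_comp C D \<beta> \<alpha>)"
proof -
  interpret \<alpha>: nat_trans C D F G \<alpha> by fact
  interpret \<beta>: nat_trans C D G H \<beta> by fact
  show ?thesis
  proof (rule nat_transI)
    show "vert_comp C D \<beta> \<alpha> a \<in> Hom D (obj_map F a) (obj_map H a)" if "a \<in> Obj C" for a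
      using that \<alpha>.F.D.comp_in[OF \<alpha>.component[OF that] \<beta>.component[OF that]]
      by (simp add: vert_comp_apply)
    fix f a b assume f: "f \<in> Hom C a b"
    have ab: "a \<in> Obj C" "b \<in> Obj C" using f \<alpha>.F.C.hom_obj by auto
    have "arr_map H f \<cdot>\<^bsub>D\<^esub> (\<beta> a \<cdot>\<^bsub>D\<^esub> \<alpha> a) = (\<beta> b \<cdot>\<^bsub>D\<^esub> arr_map G f) \<cdot>\<^bsub>D\<^esub> \<alpha> a"
      by (rule \<alpha>.F.D.comp_ext[OF \<alpha>.component[OF ab(1)] \<beta>.component[OF ab(1)] \<beta>.G.arr_map[OF f] \<beta>.naturality[OF f]])
    also have "\<dots> = \<beta> b \<cdot>\<^bsub>D\<^esub> (\<alpha> b \<cdot>\<^bsub>D\<^esub> arr_map F f)"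
      using \<alpha>.F.D.comp_assoc_hom[OF \<alpha>.component[OF ab(1)] \<alpha>.G.arr_map[OF f] \<beta>.component[OF ab(2)]]
        \<alpha>.naturality[OF f] by simp
    also have "\<dots> = (\<beta> b \<cdot>\<^bsub>D\<^esub> \<alpha> b) \<cdot>\<^bsub>D\<^esub> arr_map F f"
      using \<alpha>.F.D.comp_assoc_hom[OF \<alpha>.F.arr_map[OF f] \<alpha>.component[OF ab(2)] \<beta>.component[OF ab(2)]] by simp
    finally show "arr_map H f \<cdot>\<^bsub>D\<^esub> vert_comp C D \<beta> \<alpha> a = vert_comp C D \<beta> \<alpha> b \<cdot>\<^bsub>D\<^esub> arr_map F f"
      using ab by (simp add: vert_comp_apply)
  qed (use \<alpha>.F.cat_functor_axioms \<beta>.G.cat_functor_axioms in \<open>auto simp: vert_comp_def\<close>)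
qed

lemma nat_trans_id:
  assumes "cat_functor C D F"
  shows "nat_trans C D F F (id_trans C D F)"
proof -
  interpret cat_functor C D F by fact
  show ?thesis
  proof (rule nat_transI[OF assms assms])
    fix f a b assume f: "f \<in> Hom C a b"
    thus "arr_map F f \<cdot>\<^bsub>D\<^esub> id_trans C D F a = id_trans C D F b \<cdot>\<^bsub>D\<^esub> arr_map F f"
      using arr_map[OF f] C.hom_obj[OF f] by (simp add: id_trans_apply D.ide_left D.ide_right)
  qed (auto simp: id_trans_def D.ide_in)
qed

lemma nat_iso_inverse:
  assumes "nat_trans C D F G \<tau>" "\<And>a. a \<in> Obj C \<Longrightarrow> is_iso D (\<tau> a)"
  obtains \<tau>' where "nat_trans C D G F \<tau>'" "\<And>a. a \<in> Obj C \<Longrightarrow> \<tau>' a \<cdot>\<^bsub>D\<^esub> \<tau> a = Ide D (obj_map F a)"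
    "\<And>a. a \<in> Obj C \<Longrightarrow> \<tau> a \<cdot>\<^bsub>D\<^esub> \<tau>' a = Ide D (obj_map G a)" "\<And>a. a \<in> Obj C \<Longrightarrow> is_iso D (\<tau>' a)"
proof -
  interpret nat_trans C D F G \<tau> by fact
  have "\<forall>a\<in>Obj C. \<exists>t. t \<in> Hom D (obj_map G a) (obj_map F a) \<and> t \<cdot>\<^bsub>D\<^esub> \<tau> a = Ide D (obj_map F a)
    \<and> \<tau> a \<cdot>\<^bsub>D\<^esub> t = Ide D (obj_map G a) \<and> is_iso D t"
    using F.D.iso_inverse[OF assms(2) component] by metis
  then obtain t where t: "\<And>a. a \<in> Obj C \<Longrightarrow> t a \<in> Hom D (obj_map G a) (obj_map F a)"
     "\<And>a. a \<in> Obj C \<Longrightarrow> t a \<cdot>\<^bsub>D\<^esub> \<tau> a = Ide D (obj_map F a)"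
     "\<And>a. a \<in> Obj C \<Longrightarrow> \<tau> a \<cdot>\<^bsub>D\<^esub> t a = Ide D (obj_map G a)" "\<And>a. a \<in> Obj C \<Longrightarrow> is_iso D (t a)" by metis
  have "nat_trans C D G F (restrict t (Obj C))"
  proof (rule nat_transI[OF G.cat_functor_axioms F.cat_functor_axioms])
    fix f a b assume f: "f \<in> Hom C a b"
    have ab: "a \<in> Obj C" "b \<in> Obj C" using f F.C.hom_obj by auto
    note ty = component[OF ab(1)] component[OF ab(2)] t(1)[OF ab(1)] t(1)[OF ab(2)] F.arr_map[OF f] G.arr_map[OF f]
    have 1: "\<tau> b \<cdot>\<^bsub>D\<^esub> (arr_map F f \<cdot>\<^bsub>D\<^esub> t a) = (arr_map G f \<cdot>\<^bsub>D\<^esub> \<tau> a) \<cdot>\<^bsub>D\<^esub> t a"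
      by (rule F.D.comp_ext[OF ty(3,5,2) naturality[OF f, symmetric]])
    have 2: "(arr_map G f \<cdot>\<^bsub>D\<^esub> \<tau> a) \<cdot>\<^bsub>D\<^esub> t a = arr_map G f \<cdot>\<^bsub>D\<^esub> Ide D (obj_map G a)"
      using F.D.comp_assoc_hom[OF ty(3,1,6)] t(3)[OF ab(1)] by simp
    have 3: "\<tau> b \<cdot>\<^bsub>D\<^esub> (t b \<cdot>\<^bsub>D\<^esub> arr_map G f) = Ide D (obj_map G b) \<cdot>\<^bsub>D\<^esub> arr_map G f"
      by (rule F.D.comp_ext[OF ty(6,4,2) t(3)[OF ab(2)]])
    have "\<tau> b \<cdot>\<^bsub>D\<^esub> (arr_map F f \<cdot>\<^bsub>D\<^esub> t a) = \<tau> b \<cdot>\<^bsub>D\<^esub> (t b \<cdot>\<^bsub>D\<^esub> arr_map G f)"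
      using 1 2 3 ty(6) F.D.ide_left F.D.ide_right by simp
    hence "arr_map F f \<cdot>\<^bsub>D\<^esub> t a = t b \<cdot>\<^bsub>D\<^esub> arr_map G f"
      by (rule F.D.iso_monic[OF assms(2)[OF ab(2)] ty(2) F.D.comp_in[OF ty(3,5)] F.D.comp_in[OF ty(6,4)]])
    thus "arr_map F f \<cdot>\<^bsub>D\<^esub> restrict t (Obj C) a = restrict t (Obj C) b \<cdot>\<^bsub>D\<^esub> arr_map G f" using ab by simp
  qed (use t in auto)
  thus thesis using that[of "restrict t (Obj C)"] t by simp
qed

lemma nat_trans_iso_cartesian:
  assumes "nat_trans C D F G \<tau>" "\<And>a. a \<in> Obj C \<Longrightarrow> is_iso D (\<tau> a)"
  shows "cartesian_trans C D F G \<tau>"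
proof -
  interpret nat_trans C D F G \<tau> by fact
  show ?thesis unfolding cartesian_trans_def
  proof (intro conjI ballI)
    fix f assume f: "f \<in> Arr C"
    note d = F.C.dom_in[OF f] F.C.cod_in[OF f] and fH = Hom_cong_arr[OF f]
    show "is_pullback D (arr_map F f) (\<tau> (Dom C f)) (\<tau> (Cod C f)) (arr_map G f)"
      using naturality[OF fH] assms(2) d
      by (intro F.D.pullback_iso[OF F.arr_map[OF fH] G.arr_map[OF fH] component[OF d(1)] component[OF d(2)]]) auto
  qed fact
qed

lemma cartesian_vert_comp:
  assumes \<alpha>: "cartesian_trans C D F G \<alpha>" and \<beta>: "cartesian_trans C D G H \<beta>"
  shows "cartesian_trans C D F H (vert_comp C D \<beta> \<alpha>)"
proof -
  interpret \<alpha>: nat_trans C D F G \<alpha> using \<alpha> by (simp add: cartesian_trans_def)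
  show ?thesis
    using nat_trans_vert_comp[of C D F G \<alpha> H \<beta>] \<alpha>.F.D.pullback_paste \<alpha> \<beta> \<alpha>.F.C.dom_in \<alpha>.F.C.cod_in
    by (auto simp: cartesian_trans_def vert_comp_apply)
qed

section \<open>Sequences\<close>

lemma seq_obj [simp]: "Obj (seq_cat C) = lists (Obj C)"
  by (simp add: seq_cat_def)

lemma seq_ide [simp]: "Ide (seq_cat C) = map (Ide C)"
  by (simp add: seq_cat_def)

lemma seq_comp [simp]: "Comp (seq_cat C) = map2 (Comp C)"
  by (simp add: seq_cat_def)

lemma seq_dom [simp]: "Dom (seq_cat C) = map (Dom C)" "Cod (seq_cat C) = map (Cod C)"
  by (simp_all add: seq_cat_def)

lemma seq_arr [simp]: "Arr (seq_cat C) = lists (Arr C)"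
  by (simp add: seq_cat_def)

lemma seq_hom_iff:
  "fs \<in> Hom (seq_cat C) Xs Ys \<longleftrightarrow> length Xs = length fs \<and> length Ys = length fs \<and>
    (\<forall>i<length fs. fs ! i \<in> Hom C (Xs ! i) (Ys ! i))"
  unfolding Hom_def by (auto simp: list_eq_iff_nth_eq all_set_conv_all_nth in_lists_conv_set)

lemma seq_hom_simps [simp]:
  "[] \<in> Hom (seq_cat C) Xs Ys \<longleftrightarrow> Xs = [] \<and> Ys = []"
  "fs \<in> Hom (seq_cat C) [] Ys \<longleftrightarrow> fs = [] \<and> Ys = []"
  "f # fs \<in> Hom (seq_cat C) (X # Xs) (Y # Ys) \<longleftrightarrow> f \<in> Hom C X Y \<and> fs \<in> Hom (seq_cat C) Xs Ys"
  by (auto simp: Hom_def)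

lemma seq_hom_append:
  "fs \<in> Hom (seq_cat C) Xs Ys \<Longrightarrow> gs \<in> Hom (seq_cat C) Xs' Ys'
    \<Longrightarrow> fs @ gs \<in> Hom (seq_cat C) (Xs @ Xs') (Ys @ Ys')"
  by (auto simp: Hom_def)

lemma seq_hom_map:
  "(\<And>x. x \<in> set xs \<Longrightarrow> f x \<in> Hom C (X x) (Y x))
    \<Longrightarrow> map f xs \<in> Hom (seq_cat C) (map X xs) (map Y xs)"
  by (auto simp: Hom_def)

lemma seq_hom_concat:
  "fss \<in> Hom (seq_cat (seq_cat C)) Xss Yss \<Longrightarrow> concat fss \<in> Hom (seq_cat C) (concat Xss) (concat Yss)"
  by (auto simp: Hom_def map_concat in_lists_conv_set)

lemma seq_hom_length: "fs \<in> Hom (seq_cat C) Xs Ys \<Longrightarrow> length fs = length Xs \<and> length fs = length Ys"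
  by (auto simp: Hom_def)

lemma category_seq_cat:
  assumes "category C"
  shows "category (seq_cat C)"
proof -
  interpret category C by fact
  show ?thesis
  proof
    fix f a b g c h d
    assume f: "f \<in> Hom (seq_cat C) a b"
    show "f \<cdot>\<^bsub>seq_cat C\<^esub> Ide (seq_cat C) a = f" "Ide (seq_cat C) b \<cdot>\<^bsub>seq_cat C\<^esub> f = f"
      using f by (auto simp: seq_hom_iff list_eq_iff_nth_eq ide_left ide_right)
    assume g: "g \<in> Hom (seq_cat C) b c"
    show "g \<cdot>\<^bsub>seq_cat C\<^esub> f \<in> Hom (seq_cat C) a c"
      using f g comp_in by (fastforce simp: seq_hom_iff)
    assume h: "h \<in> Hom (seq_cat C) c d"
    show "h \<cdot>\<^bsub>seq_cat C\<^esub> (g \<cdot>\<^bsub>seq_cat C\<^esub> f) = h \<cdot>\<^bsub>seq_cat C\<^esub> g \<cdot>\<^bsub>seq_cat C\<^esub> f"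
      using f g h assoc by (fastforce simp: seq_hom_iff list_eq_iff_nth_eq)
  next
    fix f assume "f \<in> Arr (seq_cat C)"
    thus "Dom (seq_cat C) f \<in> Obj (seq_cat C)" "Cod (seq_cat C) f \<in> Obj (seq_cat C)"
      using dom_in cod_in by auto
  next
    fix a assume "a \<in> Obj (seq_cat C)"
    thus "Ide (seq_cat C) a \<in> Hom (seq_cat C) a a" using ide_in by (auto simp: seq_hom_iff)
  qed
qed

lemma cat_functor_singleton:
  assumes "category C"
  shows "cat_functor C (seq_cat C) (singleton_functor C)"
proof -
  interpret category C by fact
  interpret S: category "seq_cat C" by (rule category_seq_cat) fact
  show ?thesis
    by unfold_locales (auto simp: singleton_functor_def Hom_def dom_in cod_in)
qed

lemma cat_functor_seq:
  assumes "cat_functor C D F"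
  shows "cat_functor (seq_cat C) (seq_cat D) (seq_functor C F)"
proof -
  interpret cat_functor C D F by fact
  interpret SC: category "seq_cat C" by (rule category_seq_cat) (rule C.category_axioms)
  interpret SD: category "seq_cat D" by (rule category_seq_cat) (rule D.category_axioms)
  show ?thesis
  proof
    show "obj_map (seq_functor C F) \<in> Obj (seq_cat C) \<rightarrow>\<^sub>E Obj (seq_cat D)"
      by (auto simp: seq_functor_def)
    show "arr_map (seq_functor C F) \<in> extensional (Arr (seq_cat C))"
      by (auto simp: seq_functor_def)
    show "arr_map (seq_functor C F) f \<in> Hom (seq_cat D) (obj_map (seq_functor C F) a) (obj_map (seq_functor C F) b)"
      if "f \<in> Hom (seq_cat C) a b" for f a b
      using that SC.hom_obj[OF that] by (auto simp: seq_functor_def Hom_def)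
    show "arr_map (seq_functor C F) (Ide (seq_cat C) a) = Ide (seq_cat D) (obj_map (seq_functor C F) a)"
      if "a \<in> Obj (seq_cat C)" for a
      using that by (auto simp: seq_functor_def map_ide)
    show "arr_map (seq_functor C F) (g \<cdot>\<^bsub>seq_cat C\<^esub> f) =
       arr_map (seq_functor C F) g \<cdot>\<^bsub>seq_cat D\<^esub> arr_map (seq_functor C F) f"
      if "f \<in> Hom (seq_cat C) a b" "g \<in> Hom (seq_cat C) b c" for f g a b c
    proof -
      have "map (arr_map F) (map2 (Comp C) g f) = map2 (Comp D) (map (arr_map F) g) (map (arr_map F) f)"
        using that map_comp by (fastforce simp: seq_hom_iff list_eq_iff_nth_eq)
      moreover have "map2 (Comp C) g f \<in> lists (Arr C)"
        using SC.comp_in[OF that] by (simp add: Hom_def)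
      ultimately show ?thesis using that by (simp add: seq_functor_def Hom_def)
    qed
  qed
qed

lemma cat_functor_concat:
  assumes "category C"
  shows "cat_functor (seq_cat (seq_cat C)) (seq_cat C) (concat_functor C)"
proof -
  interpret category C by fact
  interpret S: category "seq_cat C" by (rule category_seq_cat) fact
  interpret SS: category "seq_cat (seq_cat C)" by (rule category_seq_cat) (rule S.category_axioms)
  show ?thesis
  proof
    show "obj_map (concat_functor C) \<in> Obj (seq_cat (seq_cat C)) \<rightarrow>\<^sub>E Obj (seq_cat C)"
      by (auto simp: concat_functor_def in_lists_conv_set)
    show "arr_map (concat_functor C) \<in> extensional (Arr (seq_cat (seq_cat C)))"
      by (auto simp: concat_functor_def)
    show "arr_map (concat_functor C) f \<in> Hom (seq_cat C) (obj_map (concat_functor C) a) (obj_map (concat_functor C) b)"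
      if "f \<in> Hom (seq_cat (seq_cat C)) a b" for f a b
      using seq_hom_concat[OF that] SS.hom_obj[OF that] that
      by (simp add: concat_functor_def Hom_def)
    show "arr_map (concat_functor C) (Ide (seq_cat (seq_cat C)) a) = Ide (seq_cat C) (obj_map (concat_functor C) a)"
      if "a \<in> Obj (seq_cat (seq_cat C))" for a
      using that SS.ide_in[OF that] by (auto simp: concat_functor_def map_concat Hom_def)
    show "arr_map (concat_functor C) (g \<cdot>\<^bsub>seq_cat (seq_cat C)\<^esub> f) =
       arr_map (concat_functor C) g \<cdot>\<^bsub>seq_cat C\<^esub> arr_map (concat_functor C) f"
      if fg: "f \<in> Hom (seq_cat (seq_cat C)) a b" "g \<in> Hom (seq_cat (seq_cat C)) b c" for f g a b c
    proof -
      \<comment> \<open>Componentwise composition commutes with concatenation only when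
        corresponding blocks have equal lengths, since \<open>map2\<close> truncates.\<close>
      have "list_all2 (\<lambda>x y. length x = length y) g f"
        using fg by (auto simp: seq_hom_iff list_all2_conv_all_nth)
      hence "concat (map2 (map2 (Comp C)) g f) = map2 (Comp C) (concat g) (concat f)"
        by (induction rule: list_all2_induct) auto
      moreover have "map2 (map2 (Comp C)) g f \<in> lists (lists (Arr C))"
        using SS.comp_in[OF fg] by (simp add: Hom_def)
      ultimately show ?thesis using fg by (simp add: concat_functor_def Hom_def)
    qed
  qed
qed

section \<open>Multitensors\<close>

context multitensor
begin

sublocale V: category V using tensor_functor by (simp add: cat_functor_def)
sublocale T: cat_functor "seq_cat V" V "tensor E" by (rule tensor_functor)

lemma tens_obj: "Xs \<in> lists (Obj V) \<Longrightarrow> tens E Xs \<in> Obj V"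
  by simp

lemma tens_hom: "fs \<in> Hom (seq_cat V) Xs Ys \<Longrightarrow> tens_arr E fs \<in> Hom V (tens E Xs) (tens E Ys)"
  by (rule T.arr_map)

lemma tens_ide: "Xs \<in> lists (Obj V) \<Longrightarrow> tens_arr E (map (Ide V) Xs) = Ide V (tens E Xs)"
  using T.map_ide by simp

lemma tens_comp:
  "fs \<in> Hom (seq_cat V) Xs Ys \<Longrightarrow> gs \<in> Hom (seq_cat V) Ys Zs
    \<Longrightarrow> tens_arr E (map2 (Comp V) gs fs) = tens_arr E gs \<cdot>\<^bsub>V\<^esub> tens_arr E fs"
  using T.map_comp by simp

lemma tens_comp_map:
  assumes "\<And>x. x \<in> set xs \<Longrightarrow> f x \<in> Hom V (X x) (Y x)" "\<And>x. x \<in> set xs \<Longrightarrow> g x \<in> Hom V (Y x) (Z x)"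
  shows "tens_arr E (map g xs) \<cdot>\<^bsub>V\<^esub> tens_arr E (map f xs) = tens_arr E (map (\<lambda>x. g x \<cdot>\<^bsub>V\<^esub> f x) xs)"
proof -
  have "map2 (Comp V) (map g xs) (map f xs) = map (\<lambda>x. g x \<cdot>\<^bsub>V\<^esub> f x) xs"
    by (induction xs) auto
  thus ?thesis
    using tens_comp[OF seq_hom_map[of xs f V X Y] seq_hom_map[of xs g V Y Z]] assms by simp
qed

lemma unit_hom: "X \<in> Obj V \<Longrightarrow> tunit E X \<in> Hom V X (tens E [X])"
  using nat_trans.component[OF unit_natural]
  by (simp add: id_functor_def tensor_one_def comp_functor_def singleton_functor_def)

lemma unit_nat:
  assumes f: "f \<in> Hom V X Y"
  shows "tens_arr E [f] \<cdot>\<^bsub>V\<^esub> tunit E X = tunit E Y \<cdot>\<^bsub>V\<^esub> f"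
  using nat_trans.naturality[OF unit_natural f] f
  by (simp add: id_functor_def tensor_one_def comp_functor_def singleton_functor_def Hom_def)

lemma subst_hom: "Xss \<in> lists (lists (Obj V))
    \<Longrightarrow> tsubst E Xss \<in> Hom V (tens E (map (tens E) Xss)) (tens E (concat Xss))"
  using nat_trans.component[OF subst_natural]
  by (simp add: tensor_iter_def tensor_concat_def comp_functor_def seq_functor_def concat_functor_def)

lemma subst_nat:
  assumes f: "fss \<in> Hom (seq_cat (seq_cat V)) Xss Yss"
  shows "tens_arr E (concat fss) \<cdot>\<^bsub>V\<^esub> tsubst E Xss = tsubst E Yss \<cdot>\<^bsub>V\<^esub> tens_arr E (map (tens_arr E) fss)"
  using nat_trans.naturality[OF subst_natural f] f
  by (simp add: tensor_iter_def tensor_concat_def comp_functor_def seq_functor_def concat_functor_def Hom_def)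

end

text \<open>Bridges the definition, which speaks of the composite functors
  \<open>tensor_one\<close>, \<open>tensor_iter\<close> and \<open>tensor_concat\<close>, and the
  componentwise form in which the laws of \<open>psi\<close> are verified.\<close>

lemma multitensorI:
  assumes T: "cat_functor (seq_cat V) V (tensor E)"
    and ext: "tunit E \<in> extensional (Obj V)" "tsubst E \<in> extensional (lists (lists (Obj V)))"
    and unit_hom: "\<And>X. X \<in> Obj V \<Longrightarrow> tunit E X \<in> Hom V X (tens E [X])"
    and unit_nat: "\<And>f X Y. f \<in> Hom V X Y \<Longrightarrow> tens_arr E [f] \<cdot>\<^bsub>V\<^esub> tunit E X = tunit E Y \<cdot>\<^bsub>V\<^esub> f"
    and subst_hom: "\<And>Xss. Xss \<in> lists (lists (Obj V))
      \<Longrightarrow> tsubst E Xss \<in> Hom V (tens E (map (tens E) Xss)) (tens E (concat Xss))"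
    and subst_nat: "\<And>fss Xss Yss. fss \<in> Hom (seq_cat (seq_cat V)) Xss Yss
      \<Longrightarrow> tens_arr E (concat fss) \<cdot>\<^bsub>V\<^esub> tsubst E Xss = tsubst E Yss \<cdot>\<^bsub>V\<^esub> tens_arr E (map (tens_arr E) fss)"
    and laws: "\<And>Xs. Xs \<in> lists (Obj V)
      \<Longrightarrow> tsubst E [Xs] \<cdot>\<^bsub>V\<^esub> tunit E (tens E Xs) = Ide V (tens E Xs)"
      "\<And>Xs. Xs \<in> lists (Obj V)
      \<Longrightarrow> tsubst E (map (\<lambda>X. [X]) Xs) \<cdot>\<^bsub>V\<^esub> tens_arr E (map (tunit E) Xs) = Ide V (tens E Xs)"
      "\<And>Xsss. Xsss \<in> lists (lists (lists (Obj V)))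
      \<Longrightarrow> tsubst E (concat Xsss) \<cdot>\<^bsub>V\<^esub> tsubst E (map (map (tens E)) Xsss)
        = tsubst E (map concat Xsss) \<cdot>\<^bsub>V\<^esub> tens_arr E (map (tsubst E) Xsss)"
  shows "multitensor V E"
proof -
  interpret T: cat_functor "seq_cat V" V "tensor E" by fact
  interpret SS: category "seq_cat (seq_cat V)" by (rule category_seq_cat) (rule T.C.category_axioms)
  have one: "cat_functor V V (tensor_one V E)"
    unfolding tensor_one_def
    by (rule comp_functor_cat_functor[OF cat_functor_singleton[OF T.D.category_axioms] T])
  have iter: "cat_functor (seq_cat (seq_cat V)) V (tensor_iter V E)"
    unfolding tensor_iter_def by (rule comp_functor_cat_functor[OF cat_functor_seq[OF T] T])
  have conc: "cat_functor (seq_cat (seq_cat V)) V (tensor_concat V E)"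
    unfolding tensor_concat_def
    by (rule comp_functor_cat_functor[OF cat_functor_concat[OF T.D.category_axioms] T])
  have 1: "nat_trans V V (id_functor V) (tensor_one V E) (tunit E)"
      using unit_hom unit_nat
      by (intro nat_transI one id_functor_cat_functor T.D.category_axioms ext)
         (auto simp: id_functor_def tensor_one_def comp_functor_def singleton_functor_def Hom_def)
  have 2: "nat_trans (seq_cat (seq_cat V)) V (tensor_iter V E) (tensor_concat V E) (tsubst E)"
    proof (intro nat_transI iter conc)
      fix f a b assume f: "f \<in> Hom (seq_cat (seq_cat V)) a b"
      show "arr_map (tensor_concat V E) f \<cdot>\<^bsub>V\<^esub> tsubst E a = tsubst E b \<cdot>\<^bsub>V\<^esub> arr_map (tensor_iter V E) f"
        using subst_nat[OF f] f
        by (simp add: tensor_iter_def tensor_concat_def comp_functor_def seq_functor_def concat_functor_def Hom_def)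
    qed (use subst_hom ext in \<open>auto simp: tensor_iter_def tensor_concat_def comp_functor_def seq_functor_def concat_functor_def\<close>)
  show ?thesis using T 1 2 laws by (simp add: multitensor_def)
qed

section \<open>Maps of multitensors\<close>

context multitensor_map
begin

sublocale nat: nat_trans "seq_cat V" V "tensor A" "tensor E" \<theta> by (rule natural)

lemma comp_hom: "Xs \<in> lists (Obj V) \<Longrightarrow> \<theta> Xs \<in> Hom V (tens A Xs) (tens E Xs)"
  using nat.component by simp

lemma comp_map_hom:
  "Xss \<in> lists (lists (Obj V)) \<Longrightarrow> map \<theta> Xss \<in> Hom (seq_cat V) (map (tens A) Xss) (map (tens E) Xss)"
  by (rule seq_hom_map) (auto intro: comp_hom)

end

lemma multitensor_mapI:
  assumes "multitensor V A" "multitensor V E" "nat_trans (seq_cat V) V (tensor A) (tensor E) \<theta>"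
    and "\<And>X. X \<in> Obj V \<Longrightarrow> \<theta> [X] \<cdot>\<^bsub>V\<^esub> tunit A X = tunit E X"
    and "\<And>Xss. Xss \<in> lists (lists (Obj V))
      \<Longrightarrow> \<theta> (concat Xss) \<cdot>\<^bsub>V\<^esub> tsubst A Xss
        = tsubst E Xss \<cdot>\<^bsub>V\<^esub> (tens_arr E (map \<theta> Xss) \<cdot>\<^bsub>V\<^esub> \<theta> (map (tens A) Xss))"
  shows "multitensor_map V A E \<theta>"
  using assms by (simp add: multitensor_map_def multitensor_map_axioms_def)

lemma multitensor_map_id:
  assumes "multitensor V A"
  shows "multitensor_map V A A (id_trans (seq_cat V) V (tensor A))"
proof -
  interpret multitensor V A by fact
  show ?thesis
  proof (rule multitensor_mapI[OF assms assms nat_trans_id[OF tensor_functor]])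
    fix X assume X: "X \<in> Obj V"
    show "id_trans (seq_cat V) V (tensor A) [X] \<cdot>\<^bsub>V\<^esub> tunit A X = tunit A X"
      using X unit_hom[OF X] by (simp add: id_trans_apply V.ide_left)
  next
    fix Xss assume X: "Xss \<in> lists (lists (Obj V))"
    have e: "map (id_trans (seq_cat V) V (tensor A)) Xss = map (Ide V) (map (tens A) Xss)"
      using X by (auto simp: id_trans_apply)
    have "map (tens A) Xss \<in> lists (Obj V)" "concat Xss \<in> lists (Obj V)"
      using X by (auto simp: in_lists_conv_set)
    thus "id_trans (seq_cat V) V (tensor A) (concat Xss) \<cdot>\<^bsub>V\<^esub> tsubst A Xss =
      tsubst A Xss \<cdot>\<^bsub>V\<^esub> (tens_arr A (map (id_trans (seq_cat V) V (tensor A)) Xss) \<cdot>\<^bsub>V\<^esub>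
        id_trans (seq_cat V) V (tensor A) (map (tens A) Xss))"
      unfolding e using subst_hom[OF X] by (simp add: id_trans_apply tens_ide V.ide_left V.ide_right del: map_map)
  qed
qed

lemma multitensor_map_comp:
  assumes "multitensor_map V A B \<alpha>" "multitensor_map V B E \<beta>"
  shows "multitensor_map V A E (vert_comp (seq_cat V) V \<beta> \<alpha>)"
proof -
  interpret V: category V using assms(1) by (simp add: multitensor_map_def multitensor_def cat_functor_def)
  interpret \<alpha>: multitensor_map V A B \<alpha> by fact
  interpret \<beta>: multitensor_map V B E \<beta> by fact
  show ?thesis
  proof (rule multitensor_mapI[OF _ _ nat_trans_vert_comp[OF \<alpha>.natural \<beta>.natural]])
    fix X assume X: "X \<in> Obj V"
    have X': "[X] \<in> lists (Obj V)" using X by simp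
    show "vert_comp (seq_cat V) V \<beta> \<alpha> [X] \<cdot>\<^bsub>V\<^esub> tunit A X = tunit E X"
      using V.comp_assoc_hom[OF \<alpha>.A.unit_hom[OF X] \<alpha>.comp_hom[OF X'] \<beta>.comp_hom[OF X']]
        X' \<alpha>.map_unit[OF X] \<beta>.map_unit[OF X] by (simp add: vert_comp_apply)
  next
    fix Xss assume X: "Xss \<in> lists (lists (Obj V))"
    have X': "map (tens A) Xss \<in> lists (Obj V)" "concat Xss \<in> lists (Obj V)"
      "map (tens B) Xss \<in> lists (Obj V)"
      using X by (auto simp: in_lists_conv_set)
    let ?\<gamma> = "vert_comp (seq_cat V) V \<beta> \<alpha>"
    have m: "tens_arr E (map ?\<gamma> Xss) = tens_arr E (map \<beta> Xss) \<cdot>\<^bsub>V\<^esub> tens_arr E (map \<alpha> Xss)"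
    proof -
      have e: "map ?\<gamma> Xss = map (\<lambda>Xs. \<beta> Xs \<cdot>\<^bsub>V\<^esub> \<alpha> Xs) Xss"
        using X by (auto simp: vert_comp_apply)
      show ?thesis unfolding e
        using X by (intro \<beta>.E.tens_comp_map[symmetric]) (auto intro: \<alpha>.comp_hom \<beta>.comp_hom)
    qed
    note ty = \<alpha>.comp_hom[OF X'(2)] \<beta>.comp_hom[OF X'(2)] \<alpha>.comp_hom[OF X'(1)] \<beta>.comp_hom[OF X'(1)] \<beta>.comp_hom[OF X'(3)]
      \<alpha>.A.subst_hom[OF X] \<alpha>.E.subst_hom[OF X] \<beta>.E.subst_hom[OF X]
      \<alpha>.E.tens_hom[OF \<alpha>.comp_map_hom[OF X]] \<beta>.E.tens_hom[OF \<alpha>.comp_map_hom[OF X]] \<beta>.E.tens_hom[OF \<beta>.comp_map_hom[OF X]]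
    have "(\<beta> (concat Xss) \<cdot>\<^bsub>V\<^esub> \<alpha> (concat Xss)) \<cdot>\<^bsub>V\<^esub> tsubst A Xss
      = \<beta> (concat Xss) \<cdot>\<^bsub>V\<^esub> (tsubst B Xss \<cdot>\<^bsub>V\<^esub> (tens_arr B (map \<alpha> Xss) \<cdot>\<^bsub>V\<^esub> \<alpha> (map (tens A) Xss)))"
      using V.comp_assoc_hom[OF ty(6,1,2)] \<alpha>.map_subst[of Xss] X by simp
    also have "\<dots> = (tsubst E Xss \<cdot>\<^bsub>V\<^esub> (tens_arr E (map \<beta> Xss) \<cdot>\<^bsub>V\<^esub> \<beta> (map (tens B) Xss)))
       \<cdot>\<^bsub>V\<^esub> (tens_arr B (map \<alpha> Xss) \<cdot>\<^bsub>V\<^esub> \<alpha> (map (tens A) Xss))"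
      using \<beta>.map_subst[of Xss] X by (intro V.comp_ext[OF V.comp_in[OF ty(3,9)] ty(7,2)]) simp
    also have "\<dots> = tsubst E Xss \<cdot>\<^bsub>V\<^esub> (tens_arr E (map \<beta> Xss) \<cdot>\<^bsub>V\<^esub> ((\<beta> (map (tens B) Xss)
       \<cdot>\<^bsub>V\<^esub> tens_arr B (map \<alpha> Xss)) \<cdot>\<^bsub>V\<^esub> \<alpha> (map (tens A) Xss)))"
      using ty by (simp add: V.comp_assoc Hom_def)
    also have "\<beta> (map (tens B) Xss) \<cdot>\<^bsub>V\<^esub> tens_arr B (map \<alpha> Xss)
       = tens_arr E (map \<alpha> Xss) \<cdot>\<^bsub>V\<^esub> \<beta> (map (tens A) Xss)"
      using \<beta>.nat.naturality[OF \<alpha>.comp_map_hom[OF X]] by simp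
    also have "tsubst E Xss \<cdot>\<^bsub>V\<^esub> (tens_arr E (map \<beta> Xss) \<cdot>\<^bsub>V\<^esub> ((tens_arr E (map \<alpha> Xss) \<cdot>\<^bsub>V\<^esub> \<beta> (map (tens A) Xss)) \<cdot>\<^bsub>V\<^esub> \<alpha> (map (tens A) Xss)))
      = tsubst E Xss \<cdot>\<^bsub>V\<^esub> (tens_arr E (map ?\<gamma> Xss) \<cdot>\<^bsub>V\<^esub> ?\<gamma> (map (tens A) Xss))"
      unfolding m using X'(1) ty by (simp add: V.comp_assoc Hom_def vert_comp_apply)
    finally show "?\<gamma> (concat Xss) \<cdot>\<^bsub>V\<^esub> tsubst A Xss = tsubst E Xss \<cdot>\<^bsub>V\<^esub> (tens_arr E (map ?\<gamma> Xss) \<cdot>\<^bsub>V\<^esub> ?\<gamma> (map (tens A) Xss))"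
      using X' by (simp add: vert_comp_apply)
  qed (unfold_locales)
qed

lemma multitensor_map_inverse:
  assumes "multitensor_map V A B \<theta>" "\<And>Xs. Xs \<in> lists (Obj V) \<Longrightarrow> is_iso V (\<theta> Xs)"
  obtains \<theta>' where "multitensor_map V B A \<theta>'"
    "vert_comp (seq_cat V) V \<theta>' \<theta> = id_trans (seq_cat V) V (tensor A)"
    "vert_comp (seq_cat V) V \<theta> \<theta>' = id_trans (seq_cat V) V (tensor B)"
    "\<And>Xs. Xs \<in> lists (Obj V) \<Longrightarrow> is_iso V (\<theta>' Xs)"
proof -
  interpret V: category V using assms(1) by (simp add: multitensor_map_def multitensor_def cat_functor_def)
  interpret \<theta>: multitensor_map V A B \<theta> by fact
  obtain \<theta>' where n: "nat_trans (seq_cat V) V (tensor B) (tensor A) \<theta>'"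
    and inv: "\<And>Xs. Xs \<in> lists (Obj V) \<Longrightarrow> \<theta>' Xs \<cdot>\<^bsub>V\<^esub> \<theta> Xs = Ide V (tens A Xs)"
    "\<And>Xs. Xs \<in> lists (Obj V) \<Longrightarrow> \<theta> Xs \<cdot>\<^bsub>V\<^esub> \<theta>' Xs = Ide V (tens B Xs)" "\<And>Xs. Xs \<in> lists (Obj V) \<Longrightarrow> is_iso V (\<theta>' Xs)"
    using nat_iso_inverse[OF \<theta>.natural] assms(2) by (metis seq_obj)
  interpret n: nat_trans "seq_cat V" V "tensor B" "tensor A" \<theta>' by (rule n)
  have n_hom: "\<theta>' Xs \<in> Hom V (tens B Xs) (tens A Xs)" if "Xs \<in> lists (Obj V)" for Xs using n.component that by simp
  have "multitensor_map V B A \<theta>'"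
  proof (rule multitensor_mapI[OF _ _ n])
    fix X assume X: "X \<in> Obj V"
    have X': "[X] \<in> lists (Obj V)" using X by simp
    have "\<theta>' [X] \<cdot>\<^bsub>V\<^esub> (\<theta> [X] \<cdot>\<^bsub>V\<^esub> tunit A X) = Ide V (tens A [X]) \<cdot>\<^bsub>V\<^esub> tunit A X"
      by (rule V.comp_ext[OF \<theta>.A.unit_hom[OF X] \<theta>.comp_hom[OF X'] n_hom[OF X'] inv(1)[OF X']])
    thus "\<theta>' [X] \<cdot>\<^bsub>V\<^esub> tunit B X = tunit A X"
      using \<theta>.map_unit[OF X] V.ide_left[OF \<theta>.A.unit_hom[OF X]] by simp
  next
    fix Xss assume X: "Xss \<in> lists (lists (Obj V))"
    have X': "map (tens A) Xss \<in> lists (Obj V)" "concat Xss \<in> lists (Obj V)"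
      "map (tens B) Xss \<in> lists (Obj V)"
      using X by (auto simp: in_lists_conv_set)
    have mh: "map \<theta>' Xss \<in> Hom (seq_cat V) (map (tens B) Xss) (map (tens A) Xss)"
      using X by (intro seq_hom_map) (auto intro: n_hom)
    let ?r = "tens_arr B (map \<theta> Xss) \<cdot>\<^bsub>V\<^esub> \<theta> (map (tens A) Xss)"
    let ?s = "tens_arr A (map \<theta>' Xss) \<cdot>\<^bsub>V\<^esub> \<theta>' (map (tens B) Xss)"
    note ty = \<theta>.comp_hom[OF X'(2)] n_hom[OF X'(2)] \<theta>.comp_hom[OF X'(1)] n_hom[OF X'(3)] \<theta>.comp_hom[OF X'(3)]
      \<theta>.A.tens_hom[OF mh] \<theta>.E.tens_hom[OF mh] \<theta>.E.tens_hom[OF \<theta>.comp_map_hom[OF X]] \<theta>.A.subst_hom[OF X] \<theta>.E.subst_hom[OF X]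
    \<comment> \<open>\<open>?r\<close> is \<theta> applied at both levels and \<open>?s\<close> is
      the inverse applied at both levels. Naturality of \<theta> along
      \<open>map \<theta>' Xss\<close> exchanges the middle factors, after which everything
      cancels.\<close>
    have "?r \<cdot>\<^bsub>V\<^esub> ?s = tens_arr B (map \<theta> Xss) \<cdot>\<^bsub>V\<^esub> ((\<theta> (map (tens A) Xss) \<cdot>\<^bsub>V\<^esub> tens_arr A (map \<theta>' Xss)) \<cdot>\<^bsub>V\<^esub> \<theta>' (map (tens B) Xss))"
      using ty by (simp add: V.comp_assoc Hom_def)
    also have "\<theta> (map (tens A) Xss) \<cdot>\<^bsub>V\<^esub> tens_arr A (map \<theta>' Xss) = tens_arr B (map \<theta>' Xss) \<cdot>\<^bsub>V\<^esub> \<theta> (map (tens B) Xss)"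
      using \<theta>.nat.naturality[OF mh] by simp
    also have "tens_arr B (map \<theta> Xss) \<cdot>\<^bsub>V\<^esub> ((tens_arr B (map \<theta>' Xss) \<cdot>\<^bsub>V\<^esub> \<theta> (map (tens B) Xss)) \<cdot>\<^bsub>V\<^esub> \<theta>' (map (tens B) Xss))
      = (tens_arr B (map \<theta> Xss) \<cdot>\<^bsub>V\<^esub> tens_arr B (map \<theta>' Xss)) \<cdot>\<^bsub>V\<^esub> (\<theta> (map (tens B) Xss) \<cdot>\<^bsub>V\<^esub> \<theta>' (map (tens B) Xss))"
      using ty by (simp add: V.comp_assoc Hom_def)
    also have "tens_arr B (map \<theta> Xss) \<cdot>\<^bsub>V\<^esub> tens_arr B (map \<theta>' Xss) = tens_arr B (map (\<lambda>Xs. \<theta> Xs \<cdot>\<^bsub>V\<^esub> \<theta>' Xs) Xss)"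
      using X by (intro \<theta>.E.tens_comp_map) (auto intro: \<theta>.comp_hom n_hom)
    also have "map (\<lambda>Xs. \<theta> Xs \<cdot>\<^bsub>V\<^esub> \<theta>' Xs) Xss = map (Ide V) (map (tens B) Xss)"
      using X inv(2) by auto
    finally have rs: "?r \<cdot>\<^bsub>V\<^esub> ?s = Ide V (tens B (map (tens B) Xss))"
      using X' by (simp add: \<theta>.E.tens_ide inv(2) del: map_map)
    have "\<theta>' (concat Xss) \<cdot>\<^bsub>V\<^esub> tsubst B Xss = \<theta>' (concat Xss) \<cdot>\<^bsub>V\<^esub> (tsubst B Xss \<cdot>\<^bsub>V\<^esub> (?r \<cdot>\<^bsub>V\<^esub> ?s))"
      unfolding rs using ty(10) by (simp add: V.ide_right)
    also have "\<dots> = (\<theta>' (concat Xss) \<cdot>\<^bsub>V\<^esub> (tsubst B Xss \<cdot>\<^bsub>V\<^esub> ?r)) \<cdot>\<^bsub>V\<^esub> ?s"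
      using ty by (simp add: V.comp_assoc Hom_def)
    also have "tsubst B Xss \<cdot>\<^bsub>V\<^esub> ?r = \<theta> (concat Xss) \<cdot>\<^bsub>V\<^esub> tsubst A Xss" using \<theta>.map_subst[of Xss] X by simp
    also have "\<theta>' (concat Xss) \<cdot>\<^bsub>V\<^esub> (\<theta> (concat Xss) \<cdot>\<^bsub>V\<^esub> tsubst A Xss) = Ide V (tens A (concat Xss)) \<cdot>\<^bsub>V\<^esub> tsubst A Xss"
      by (rule V.comp_ext[OF ty(9,1,2) inv(1)[OF X'(2)]])
    finally show "\<theta>' (concat Xss) \<cdot>\<^bsub>V\<^esub> tsubst B Xss = tsubst A Xss \<cdot>\<^bsub>V\<^esub> ?s"
      using V.ide_left[OF ty(9)] by simp
  qed unfold_locales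
  moreover have "vert_comp (seq_cat V) V \<theta>' \<theta> = id_trans (seq_cat V) V (tensor A)"
    "vert_comp (seq_cat V) V \<theta> \<theta>' = id_trans (seq_cat V) V (tensor B)"
    using inv by (auto simp: vert_comp_def id_trans_def)
  ultimately show thesis using inv(3) that by blast
qed

text \<open>Distributivity in all variables at once, by induction on the list. \<open>Ps\<close>
  holds the variables whose summand has already been fixed: the first open variable is expanded by
  the one-variable hypothesis, the rest by induction, and \<open>coproduct_sigma\<close> combines
  the two. One family \<open>Y\<close> serves all positions; only the index sets vary.\<close>

lemma distributive_list:
  fixes Is :: "'i set list"
  assumes "multitensor V A"
    and dist: "\<And>Xs k I Y c \<iota>. Xs \<in> lists (Obj V) \<Longrightarrow> k < length Xs \<Longrightarrow> small U I
      \<Longrightarrow> is_coproduct V (I :: 'i set) Y c \<iota> \<Longrightarrow> is_coproduct V I (\<lambda>i. tens A (Xs[k := Y i])) (tens A (Xs[k := c]))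
          (\<lambda>i. tens_arr A ((map (Ide V) Xs)[k := \<iota> i]))"
    and "list_all2 (\<lambda>I c. small U I \<and> is_coproduct V I Y c \<iota>) Is cs" "Ps \<in> lists (Obj V)"
  shows "is_coproduct V (listset Is) (\<lambda>is. tens A (Ps @ map Y is)) (tens A (Ps @ cs))
    (\<lambda>is. tens_arr A (map (Ide V) Ps @ map \<iota> is))"
  using assms(3,4)
proof (induction arbitrary: Ps rule: list_all2_induct)
  case Nil
  interpret multitensor V A by fact
  show ?case
    using Nil tens_obj V.ide_in by (intro V.coproductI) (auto simp: tens_ide V.ide_right)
next
  case (Cons I Is c cs)
  interpret multitensor V A by fact
  note cop = conjunct2[OF Cons(1)] and sm = conjunct1[OF Cons(1)]
  note D = coproductD[OF cop]
  have cs: "cs \<in> lists (Obj V)"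
    using Cons(2) coproductD(2) by (force simp: list_all2_conv_all_nth in_set_conv_nth)
  have Ps: "Ps \<in> lists (Obj V)" by fact
  have Pcs: "Ps @ c # cs \<in> lists (Obj V)" "length Ps < length (Ps @ c # cs)" using Ps cs D(2) by auto
  have 1: "is_coproduct V I (\<lambda>i. tens A (Ps @ Y i # cs)) (tens A (Ps @ c # cs))
          (\<lambda>i. tens_arr A (map (Ide V) Ps @ \<iota> i # map (Ide V) cs))"
    using dist[OF Pcs sm cop] by (simp add: list_update_append)
  have 2: "is_coproduct V (listset Is) (\<lambda>is. tens A (Ps @ Y i # map Y is)) (tens A (Ps @ Y i # cs))
    (\<lambda>is. tens_arr A (map (Ide V) Ps @ Ide V (Y i) # map \<iota> is))" if "i \<in> I" for i
    using Cons.IH[of "Ps @ [Y i]"] D(1)[OF that] Ps by simp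
  have hom: "map \<iota> is \<in> Hom (seq_cat V) (map Y is) cs" if "is \<in> listset Is" for "is"
    using Cons(2) that
  proof (induction arbitrary: "is" rule: list_all2_induct)
    case (Cons J Js d ds)
    then obtain j js where "is = j # js" "j \<in> J" "js \<in> listset Js" by (auto simp: set_Cons_def)
    thus ?case using Cons coproductD(3) by auto
  qed simp
  have comp: "tens_arr A (map (Ide V) Ps @ \<iota> i # map (Ide V) cs) \<cdot>\<^bsub>V\<^esub> tens_arr A (map (Ide V) Ps @ Ide V (Y i) # map \<iota> is)
    = tens_arr A (map (Ide V) Ps @ \<iota> i # map \<iota> is)" if "i \<in> I" "is \<in> listset Is" for i "is"
  proof -
    have P: "map (Ide V) Ps \<in> Hom (seq_cat V) Ps Ps" "map (Ide V) cs \<in> Hom (seq_cat V) cs cs"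
      using Ps cs V.ide_in by (auto simp: seq_hom_iff)
    have f: "map (Ide V) Ps @ Ide V (Y i) # map \<iota> is \<in> Hom (seq_cat V) (Ps @ Y i # map Y is) (Ps @ Y i # cs)"
      using hom[OF that(2)] P D(1)[OF that(1)] V.ide_in by (intro seq_hom_append) auto
    have g: "map (Ide V) Ps @ \<iota> i # map (Ide V) cs \<in> Hom (seq_cat V) (Ps @ Y i # cs) (Ps @ c # cs)"
      using P D(3)[OF that(1)] by (intro seq_hom_append) auto
    have "map2 (Comp V) (map (Ide V) Ps) (map (Ide V) Ps) = map (Ide V) Ps"
      using Ps by (simp add: list_eq_iff_nth_eq in_lists_conv_set)
    moreover have "map2 (Comp V) (map (Ide V) cs) (map \<iota> is) = map \<iota> is"
      using hom[OF that(2)] by (auto simp: list_eq_iff_nth_eq seq_hom_iff V.ide_left)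
    ultimately show ?thesis
      using tens_comp[OF f g] V.ide_right[OF D(3)[OF that(1)]] by simp
  qed
  have b: "bij_betw (\<lambda>is. (hd is, tl is)) (listset (I # Is)) (I \<times> listset Is)"
    by (rule bij_betwI[where g = "\<lambda>(i, is). i # is"]) (auto simp: set_Cons_def)
  show ?case
  proof (rule coproduct_cong[OF V.coproduct_reindex[OF b V.coproduct_sigma[OF 1 2]]])
    fix js assume "js \<in> listset (I # Is)"
    then obtain i "is" where js: "js = i # is" "i \<in> I" "is \<in> listset Is" by (auto simp: set_Cons_def)
    show "(case (hd js, tl js) of (i, is) \<Rightarrow> tens A (Ps @ Y i # map Y is)) = tens A (Ps @ map Y js)"
      using js by simp
    show "(case (hd js, tl js) of
       (i, is) \<Rightarrow> tens_arr A (map (Ide V) Ps @ \<iota> i # map (Ide V) cs) \<cdot>\<^bsub>V\<^esub>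
          tens_arr A (map (Ide V) Ps @ Ide V (Y i) # map \<iota> is)) =
      tens_arr A (map (Ide V) Ps @ map \<iota> js)"
      using js comp by simp
  qed
qed

section \<open>Distributivity over small families\<close>

context extensive_cat
begin

definition dist_multitensor :: "('o, 'm) multitensor \<Rightarrow> bool" where
  "dist_multitensor A \<longleftrightarrow> multitensor V A \<and> distributive_multitensor U V A"

lemma dist_small:
  assumes A: "dist_multitensor A" and X: "Xs \<in> lists (Obj V)" "k < length Xs" "small U I"
     "is_coproduct V I Y c \<iota>"
  shows "is_coproduct V I (\<lambda>i. tens A (Xs[k := Y i])) (tens A (Xs[k := c]))
          (\<lambda>i. tens_arr A ((map (Ide V) Xs)[k := \<iota> i]))"
proof -
  obtain b J where J: "J \<in> U" "bij_betw b J I" using small_reindex[OF X(3)] .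
  define b' where "b' = the_inv_into J b"
  have b': "bij_betw b' I J" unfolding b'_def by (rule bij_betw_the_inv_into[OF J(2)])
  have bb: "b (b' i) = i" if "i \<in> I" for i
    using that J(2) by (auto simp: bij_betw_def f_the_inv_into_f b'_def)
  have "is_coproduct V J (\<lambda>i. tens A (Xs[k := Y (b i)])) (tens A (Xs[k := c]))
          (\<lambda>i. tens_arr A ((map (Ide V) Xs)[k := \<iota> (b i)]))"
    using A X J coproduct_reindex[OF J(2) X(4)] unfolding dist_multitensor_def distributive_multitensor_def by simp
  from coproduct_cong[OF coproduct_reindex[OF b' this]] show ?thesis using bb by simp
qed

lemma dist_list:
  assumes "dist_multitensor A"
    and "list_all2 (\<lambda>I c. small U I \<and> is_coproduct V I Y c \<iota>) Is cs"
  shows "is_coproduct V (listset Is) (\<lambda>is. tens A (map Y is)) (tens A cs) (\<lambda>is. tens_arr A (map \<iota> is))"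
proof -
  have A: "multitensor V A" using assms(1) by (simp add: dist_multitensor_def)
  have "is_coproduct V (listset Is) (\<lambda>is. tens A ([] @ map Y is)) (tens A ([] @ cs))
      (\<lambda>is. tens_arr A (map (Ide V) [] @ map \<iota> is))"
    by (rule distributive_list[OF A _ assms(2)]) (rule dist_small[OF assms(1)], auto)
  thus ?thesis by simp
qed

text \<open>The naturality square of \<alpha> at an injection in position \<open>k\<close> is a
  pullback over the corresponding injection for \<open>E\<close>. Universality of coproducts carries
  the decomposition from \<open>E\<close> to \<open>A\<close>.\<close>

lemma cartesian_over_distributive:
  assumes E: "dist_multitensor E" and \<alpha>: "cartesian_trans (seq_cat V) V (tensor A) (tensor E) \<alpha>"
  shows "distributive_multitensor U V A"
  unfolding distributive_multitensor_def
proof (intro ballI allI impI)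
  fix Xs k I Y c \<iota>
  assume X: "Xs \<in> Obj (seq_cat V)" "k < length Xs" and I: "I \<in> U" and cop: "is_coproduct V I Y c \<iota>"
  interpret nat: nat_trans "seq_cat V" V "tensor A" "tensor E" \<alpha> using \<alpha> by (simp add: cartesian_trans_def)
  note D = coproductD[OF cop]
  note e = dist_small[OF E _ X(2) small_mem[OF I] cop]
  have c: "Xs[k := c] \<in> Obj (seq_cat V)" using X D(2) set_update_subset_insert[of Xs k c] by auto
  show "is_coproduct V I (\<lambda>i. tens A (Xs[k := Y i])) (tens A (Xs[k := c])) (\<lambda>i. tens_arr A ((map (Ide V) Xs)[k := \<iota> i]))"
  proof (rule coproduct_universal[OF small_mem[OF I] e nat.component[OF c]])
    fix i assume i: "i \<in> I"
    let ?f = "(map (Ide V) Xs)[k := \<iota> i]"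
    have f: "?f \<in> Hom (seq_cat V) (Xs[k := Y i]) (Xs[k := c])"
      using X ide_in D(3)[OF i] by (auto simp: seq_hom_iff nth_list_update)
    show "is_pullback V (tens_arr A ?f) (\<alpha> (Xs[k := Y i])) (\<alpha> (Xs[k := c])) (tens_arr E ?f)"
      using \<alpha> f unfolding cartesian_trans_def by (metis HomD)
    show "Dom V (tens_arr A ?f) = tens A (Xs[k := Y i])" using nat.F.arr_map[OF f] by (simp add: Hom_def)
  qed (use X in simp)
qed

end

section \<open>Paths\<close>

lemma steps_simps [simp]:
  "steps [] = []" "steps [a] = []" "steps (a # b # xs) = (a, b) # steps (b # xs)"
  by (simp_all add: steps_def)

lemma steps_map: "steps (map v xs) = map (\<lambda>(a, b). (v a, v b)) (steps xs)"
  by (induction xs rule: induct_list012) auto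

lemma steps_length: "length (steps xs) = length xs - 1"
  by (simp add: steps_def)

lemma steps_set: "p \<in> set (steps xs) \<Longrightarrow> fst p \<in> set xs \<and> snd p \<in> set xs"
  by (induction xs rule: induct_list012) auto

lemma steps_set_in: "p \<in> set (steps xs) \<Longrightarrow> set xs \<subseteq> S \<Longrightarrow> fst p \<in> S \<and> snd p \<in> S"
  using steps_set by blast

lemma map_steps_cong:
  "set xs \<subseteq> S \<Longrightarrow> (\<And>a b. a \<in> S \<Longrightarrow> b \<in> S \<Longrightarrow> f (a, b) = g (a, b)) \<Longrightarrow> map f (steps xs) = map g (steps xs)"
  by (rule map_cong[OF refl]) (metis prod.collapse steps_set_in)

lemma steps_nth: "Suc i < length xs \<Longrightarrow> steps xs ! i = (xs ! i, xs ! Suc i)"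
  by (simp add: steps_def nth_tl)

lemma steps_append_tl:
  "xs \<noteq> [] \<Longrightarrow> ys \<noteq> [] \<Longrightarrow> last xs = hd ys \<Longrightarrow> steps (xs @ tl ys) = steps xs @ steps ys"
proof (induction xs rule: induct_list012)
  case (2 x) thus ?case by (cases ys) auto
qed auto

lemma path_homs_simps [simp]:
  "path_homs X [a] = []" "path_homs X (a # b # xs) = homs X (a, b) # path_homs X (b # xs)"
  by (simp_all add: path_homs_def)

lemma pathsD:
  assumes "xs \<in> paths S a b"
  shows "xs \<noteq> []" "set xs \<subseteq> S" "hd xs = a" "last xs = b" "a \<in> S" "b \<in> S"
  using assms by (auto simp: paths_def)

lemma path_map: "xs \<in> paths S a b \<Longrightarrow> (\<And>x. x \<in> S \<Longrightarrow> v x \<in> S') \<Longrightarrow> map v xs \<in> paths S' (v a) (v b)"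
  by (auto simp: paths_def hd_map last_map)

abbreviation step_paths :: "'u set \<Rightarrow> 'u list \<Rightarrow> 'u list list \<Rightarrow> bool" where
  "step_paths S ys xss \<equiv> list_all2 (\<lambda>(c, d) xs. xs \<in> paths S c d) (steps ys) xss"

lemma path_join_Cons:
  assumes "step_paths S (a # b # ys) (xs # xss)"
  shows "path_join (a # b # ys) (xs # xss) = xs @ tl (path_join (b # ys) xss)"
  using assms by (cases xs) (auto simp: path_join_def paths_def)

text \<open>Consecutive refining paths share a vertex, so dropping the head of each loses no step. A
  refining path with one vertex has no steps and contributes nothing to either side.\<close>

lemma path_join:
  assumes "ys \<in> paths S a b" "step_paths S ys xss"
  shows "path_join ys xss \<in> paths S a b \<and> steps (path_join ys xss) = concat (map steps xss)"
  using assms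
proof (induction ys arbitrary: a xss rule: induct_list012)
  case 1 thus ?case by (simp add: paths_def)
next
  case (2 x) thus ?case by (auto simp: path_join_def)
next
  case (3 x y ys)
  then obtain xs xss' where xss: "xss = xs # xss'" "xs \<in> paths S x y" "step_paths S (y # ys) xss'"
    by (auto simp: list_all2_Cons1)
  have "y # ys \<in> paths S y b" using 3(3) by (auto simp: paths_def)
  from 3(2)[OF this xss(3)]
  have IH: "path_join (y # ys) xss' \<in> paths S y b"
    "steps (path_join (y # ys) xss') = concat (map steps xss')" by auto
  have e: "path_join (x # y # ys) xss = xs @ tl (path_join (y # ys) xss')"
    unfolding xss(1) by (rule path_join_Cons) (use 3(4) xss(1) in simp)
  note D = pathsD[OF IH(1)] pathsD[OF xss(2)]
  have xa: "x = a" using 3(3) by (simp add: paths_def)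
  have "last (xs @ tl (path_join (y # ys) xss')) = b"
    using D by (cases "path_join (y # ys) xss'") (auto simp: last_append split: if_splits)
  moreover have "set (tl (path_join (y # ys) xss')) \<subseteq> S" using D by (auto dest: list.set_sel(2))
  ultimately have "path_join (x # y # ys) xss \<in> paths S a b"
    unfolding e using D xa by (auto simp: paths_def)
  moreover have "steps (path_join (x # y # ys) xss) = concat (map steps xss)"
    unfolding e using steps_append_tl[of xs "path_join (y # ys) xss'"] D IH(2) xss(1) by simp
  ultimately show ?case by blast
qed

lemma path_homs_join:
  assumes "ys \<in> paths S a b" "step_paths S ys xss"
  shows "path_homs X (path_join ys xss) = concat (map (path_homs X) xss)"
  using path_join[OF assms] by (simp add: path_homs_def[abs_def] map_concat comp_def)

lemma path_join_map:
  assumes "ys \<noteq> []" "step_paths S ys xss"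
  shows "map v (path_join ys xss) = path_join (map v ys) (map (map v) xss)"
  using assms by (simp add: path_join_def map_concat hd_map comp_def map_tl)

lemma step_paths_map:
  assumes "step_paths S ys xss" "\<And>x. x \<in> S \<Longrightarrow> v x \<in> S'"
  shows "step_paths S' (map v ys) (map (map v) xss)"
  unfolding steps_map list_all2_map1 list_all2_map2
  using assms(1) by (rule list_all2_mono) (auto intro: path_map assms(2))

text \<open>The trivial refinement, into single steps. It labels the summand that the inner unit
  reaches.\<close>

lemma path_join_pairs: "xs \<noteq> [] \<Longrightarrow> path_join xs (map (\<lambda>(a, b). [a, b]) (steps xs)) = xs"
  by (induction xs rule: induct_list012) (auto simp: path_join_def)

lemma list_all2_listset: "list_all2 (\<lambda>p x. x \<in> D p) ps xs \<longleftrightarrow> xs \<in> listset (map D ps)"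
  by (induction ps arbitrary: xs) (auto simp: list_all2_Cons1 set_Cons_def)

section \<open>The category of enriched graphs\<close>

text \<open>The restrictions make the record extensional. Every arrow of the graph category has this
  form (\<open>graph_mor_eq\<close>), so equality of arrows can be tested on vertices and
  homs.\<close>

definition graph_mor :: "('u, 'o) vgraph \<Rightarrow> ('u, 'o) vgraph \<Rightarrow> ('u \<Rightarrow> 'u) \<Rightarrow> ('u \<Rightarrow> 'u \<Rightarrow> 'm)
    \<Rightarrow> ('u, 'o, 'm) vgraph_mor" where
  "graph_mor X Y v h = \<lparr>source = X, target = Y, vmap = (\<lambda>a\<in>verts X. v a),
     hmap = (\<lambda>(a, b)\<in>verts X \<times> verts X. h a b)\<rparr>"

lemma graph_mor_simps [simp]:
  "source (graph_mor X Y v h) = X" "target (graph_mor X Y v h) = Y"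
  "a \<in> verts X \<Longrightarrow> vmap (graph_mor X Y v h) a = v a"
  "a \<in> verts X \<Longrightarrow> b \<in> verts X \<Longrightarrow> hmap (graph_mor X Y v h) (a, b) = h a b"
  by (simp_all add: graph_mor_def)

lemma graph_cat_simps [simp]:
  "Obj (graph_cat U V) = vgraphs U V" "Dom (graph_cat U V) = source" "Cod (graph_cat U V) = target"
  by (simp_all add: graph_cat_def)

lemma vgraph_homs: "X \<in> vgraphs U V \<Longrightarrow> a \<in> verts X \<Longrightarrow> b \<in> verts X \<Longrightarrow> homs X (a, b) \<in> Obj V"
  by (auto simp: vgraphs_def)

lemma path_homs_lists: "X \<in> vgraphs U V \<Longrightarrow> set xs \<subseteq> verts X \<Longrightarrow> path_homs X xs \<in> lists (Obj V)"
  using steps_set_in[of _ xs "verts X"] by (fastforce simp: path_homs_def intro!: vgraph_homs)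

lemma graph_homD:
  assumes "f \<in> Hom (graph_cat U V) X Y"
  shows "source f = X" "target f = Y" "X \<in> vgraphs U V" "Y \<in> vgraphs U V"
    "a \<in> verts X \<Longrightarrow> vmap f a \<in> verts Y"
    "a \<in> verts X \<Longrightarrow> b \<in> verts X \<Longrightarrow> hmap f (a, b) \<in> Hom V (homs X (a, b)) (homs Y (vmap f a, vmap f b))"
  using assms by (auto simp: Hom_def graph_cat_def)

lemma graph_mor_hom:
  assumes "X \<in> vgraphs U V" "Y \<in> vgraphs U V" "\<And>a. a \<in> verts X \<Longrightarrow> v a \<in> verts Y"
    "\<And>a b. a \<in> verts X \<Longrightarrow> b \<in> verts X \<Longrightarrow> h a b \<in> Hom V (homs X (a, b)) (homs Y (v a, v b))"
  shows "graph_mor X Y v h \<in> Hom (graph_cat U V) X Y"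
  using assms by (auto simp: Hom_def graph_cat_def graph_mor_def split: if_splits)

lemma graph_mor_eq:
  assumes "f \<in> Hom (graph_cat U V) X Y"
  shows "f = graph_mor X Y (vmap f) (\<lambda>a b. hmap f (a, b))"
  using assms by (cases f) (auto simp: Hom_def graph_cat_def graph_mor_def PiE_def extensional_def fun_eq_iff)

lemma graph_mor_cong:
  assumes "\<And>a. a \<in> verts X \<Longrightarrow> v a = v' a" "\<And>a b. a \<in> verts X \<Longrightarrow> b \<in> verts X \<Longrightarrow> h a b = h' a b"
  shows "graph_mor X Y v h = graph_mor X Y v' h'"
  using assms by (auto simp: graph_mor_def)

lemma graph_hom_eqI:
  assumes "f \<in> Hom (graph_cat U V) X Y" "g \<in> Hom (graph_cat U V) X Y"
    "\<And>a. a \<in> verts X \<Longrightarrow> vmap f a = vmap g a"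
    "\<And>a b. a \<in> verts X \<Longrightarrow> b \<in> verts X \<Longrightarrow> hmap f (a, b) = hmap g (a, b)"
  shows "f = g"
  by (subst graph_mor_eq[OF assms(1)], subst graph_mor_eq[OF assms(2)]) (rule graph_mor_cong[OF assms(3,4)])

lemma graph_comp:
  "g \<cdot>\<^bsub>graph_cat U V\<^esub> f = graph_mor (source f) (target g) (\<lambda>a. vmap g (vmap f a))
     (\<lambda>a b. hmap g (vmap f a, vmap f b) \<cdot>\<^bsub>V\<^esub> hmap f (a, b))"
  by (simp add: graph_cat_def graph_mor_def)

lemma graph_comp_simps [simp]:
  "a \<in> verts (source f) \<Longrightarrow> vmap (g \<cdot>\<^bsub>graph_cat U V\<^esub> f) a = vmap g (vmap f a)"
  "a \<in> verts (source f) \<Longrightarrow> b \<in> verts (source f) \<Longrightarrow>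
    hmap (g \<cdot>\<^bsub>graph_cat U V\<^esub> f) (a, b) = hmap g (vmap f a, vmap f b) \<cdot>\<^bsub>V\<^esub> hmap f (a, b)"
  by (simp_all add: graph_comp)

lemma graph_ide: "Ide (graph_cat U V) X = graph_mor X X (\<lambda>a. a) (\<lambda>a b. Ide V (homs X (a, b)))"
  by (simp add: graph_cat_def graph_mor_def)

context category
begin

lemma graph_comp_hom:
  assumes f: "f \<in> Hom (graph_cat U C) X Y" and g: "g \<in> Hom (graph_cat U C) Y Z"
  shows "g \<cdot>\<^bsub>graph_cat U C\<^esub> f \<in> Hom (graph_cat U C) X Z"
  unfolding graph_comp graph_homD(1)[OF f] graph_homD(2)[OF g]
  by (rule graph_mor_hom)
    (auto intro: graph_homD(3)[OF f] graph_homD(4)[OF g] graph_homD(5)[OF f] graph_homD(5)[OF g]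
      comp_in[OF graph_homD(6)[OF f] graph_homD(6)[OF g]])

lemma graph_ide_hom:
  assumes "X \<in> vgraphs U C"
  shows "Ide (graph_cat U C) X \<in> Hom (graph_cat U C) X X"
  unfolding graph_ide by (rule graph_mor_hom) (auto intro: assms vgraph_homs[OF assms] ide_in)

lemma category_graph_cat: "category (graph_cat U C)"
proof
  fix f X Y assume f: "f \<in> Hom (graph_cat U C) X Y"
  note F = graph_homD[OF f]
  show "f \<cdot>\<^bsub>graph_cat U C\<^esub> Ide (graph_cat U C) X = f"
    by (rule graph_hom_eqI[OF graph_comp_hom[OF graph_ide_hom f] f])
      (auto simp: graph_ide F(3) ide_right[OF F(6)])
  show "Ide (graph_cat U C) Y \<cdot>\<^bsub>graph_cat U C\<^esub> f = f"
    by (rule graph_hom_eqI[OF graph_comp_hom[OF f graph_ide_hom] f])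
      (auto simp: graph_ide F ide_left[OF F(6)])
  fix g Z assume g: "g \<in> Hom (graph_cat U C) Y Z"
  show "g \<cdot>\<^bsub>graph_cat U C\<^esub> f \<in> Hom (graph_cat U C) X Z" by (rule graph_comp_hom[OF f g])
  fix h W assume h: "h \<in> Hom (graph_cat U C) Z W"
  note G = graph_homD[OF g] and H = graph_homD[OF h]
  show "h \<cdot>\<^bsub>graph_cat U C\<^esub> (g \<cdot>\<^bsub>graph_cat U C\<^esub> f) = h \<cdot>\<^bsub>graph_cat U C\<^esub> g \<cdot>\<^bsub>graph_cat U C\<^esub> f"
  proof (rule graph_hom_eqI[OF graph_comp_hom[OF graph_comp_hom[OF f g] h] graph_comp_hom[OF f graph_comp_hom[OF g h]]])
    fix a b assume ab: "a \<in> verts X" "b \<in> verts X"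
    note ab' = F(5)[OF ab(1)] F(5)[OF ab(2)]
    show "vmap (h \<cdot>\<^bsub>graph_cat U C\<^esub> (g \<cdot>\<^bsub>graph_cat U C\<^esub> f)) a = vmap (h \<cdot>\<^bsub>graph_cat U C\<^esub> g \<cdot>\<^bsub>graph_cat U C\<^esub> f) a"
      using ab F G graph_homD(1)[OF graph_comp_hom[OF f g]] by simp
    show "hmap (h \<cdot>\<^bsub>graph_cat U C\<^esub> (g \<cdot>\<^bsub>graph_cat U C\<^esub> f)) (a, b) = hmap (h \<cdot>\<^bsub>graph_cat U C\<^esub> g \<cdot>\<^bsub>graph_cat U C\<^esub> f) (a, b)"
      using ab ab' F(1) G(1) graph_homD(1)[OF graph_comp_hom[OF f g]]
        comp_assoc_hom[OF F(6)[OF ab] G(6)[OF ab'] H(6)[OF G(5)[OF ab'(1)] G(5)[OF ab'(2)]]] by simp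
  qed
qed (auto intro: graph_ide_hom, auto simp: graph_cat_def)

end

section \<open>The monad of a distributive multitensor\<close>

lemma (in small_sets) small_paths: "S \<in> U \<Longrightarrow> small U (paths S a b)"
  by (rule small_subset[OF small_lists[OF small_mem]]) (auto simp: paths_def)

lemma vgraph_small: "X \<in> vgraphs U V \<Longrightarrow> verts X \<in> U"
  by (simp add: vgraphs_def)

abbreviation (in extensive_cat) graph_comp (infixl "\<odot>" 70) where
  "g \<odot> f \<equiv> g \<cdot>\<^bsub>graph_cat U V\<^esub> f"

locale dist_mult = extensive_cat U V + multitensor V A
  for U :: "'u set set" and V :: "('o, 'm) cat" (structure) and A :: "('o, 'm) multitensor" +
  assumes distributive: "distributive_multitensor U V A"
begin

lemma dist: "dist_multitensor A"
  using distributive multitensor_axioms by (simp add: dist_multitensor_def)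

abbreviation G where "G \<equiv> graph_cat U V"
abbreviation \<Gamma> :: "('u, 'o) vgraph \<Rightarrow> ('u, 'o) vgraph" where "\<Gamma> \<equiv> Gamma_graph V A"
abbreviation pinj :: "('u, 'o) vgraph \<Rightarrow> 'u list \<Rightarrow> 'm" where "pinj \<equiv> path_inj V A"
abbreviation "\<eta> \<equiv> Gamma_unit U V A"
abbreviation "\<mu> \<equiv> Gamma_mult U V A"
abbreviation "Gmor \<equiv> Gamma_mor V A"

sublocale G: category G by (rule category_graph_cat)

lemma verts_Gamma [simp]: "verts (\<Gamma> X) = verts X"
  by (simp add: Gamma_graph_def)

lemma path_tensor_obj: "X \<in> vgraphs U V \<Longrightarrow> set xs \<subseteq> verts X \<Longrightarrow> path_tensor A X xs \<in> Obj V"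
  unfolding path_tensor_def by (rule tens_obj[OF path_homs_lists])

lemma path_inj_eq: "xs \<in> paths (verts X) a b
  \<Longrightarrow> pinj X xs = coprod_inj V (paths (verts X) a b) (path_tensor A X) xs"
  using pathsD(3,4)[of xs "verts X" a b] by (simp add: path_inj_def)

text \<open>Restates the chosen coproduct with the injections \<open>pinj\<close>, which read the
  end vertices off the path and so need no index for the hom.\<close>

lemma Gamma_coproduct:
  assumes X: "X \<in> vgraphs U V" and ab: "a \<in> verts X" "b \<in> verts X"
  shows "is_coproduct V (paths (verts X) a b) (path_tensor A X) (homs (\<Gamma> X) (a, b)) (pinj X)"
proof -
  have "is_coproduct V (paths (verts X) a b) (path_tensor A X) (coprod V (paths (verts X) a b) (path_tensor A X))
     (coprod_inj V (paths (verts X) a b) (path_tensor A X))"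
    by (rule coprod[OF small_paths[OF vgraph_small[OF X]] path_tensor_obj[OF X pathsD(2)]])
  from coproduct_cong[OF this, of "path_tensor A X" "pinj X"] show ?thesis using ab
    by (simp add: Gamma_graph_def path_inj_eq[of _ X a b])
qed

lemma Gamma_graph_in:
  assumes "X \<in> vgraphs U V"
  shows "\<Gamma> X \<in> vgraphs U V"
proof -
  have "homs (\<Gamma> X) (a, b) \<in> Obj V" if "a \<in> verts X" "b \<in> verts X" for a b
    using coproductD(2)[OF Gamma_coproduct[OF assms that]] .
  thus ?thesis using assms by (auto simp: vgraphs_def Gamma_graph_def)
qed

lemma inj_hom:
  assumes "X \<in> vgraphs U V" "xs \<in> paths (verts X) a b"
  shows "pinj X xs \<in> Hom V (path_tensor A X xs) (homs (\<Gamma> X) (a, b))"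
  using coproductD(3)[OF Gamma_coproduct[OF assms(1)] assms(2)] pathsD[OF assms(2)] by blast

lemma hmap_steps_hom:
  assumes "f \<in> Hom G X Y" "set xs \<subseteq> verts X"
  shows "map (hmap f) (steps xs) \<in> Hom (seq_cat V) (path_homs X xs) (path_homs Y (map (vmap f) xs))"
proof -
  have "map (hmap f) (steps xs) \<in> Hom (seq_cat V) (map (homs X) (steps xs))
    (map (\<lambda>p. homs Y (vmap f (fst p), vmap f (snd p))) (steps xs))"
    by (rule seq_hom_map) (use graph_homD(6)[OF assms(1)] assms(2) steps_set in fastforce)
  thus ?thesis by (simp add: path_homs_def steps_map comp_def case_prod_beta)
qed

lemma Gamma_mor:
  assumes f: "f \<in> Hom G X Y"
  shows "Gmor f \<in> Hom G (\<Gamma> X) (\<Gamma> Y)" "vmap (Gmor f) = vmap f"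
    "xs \<in> paths (verts X) a b \<Longrightarrow> hmap (Gmor f) (a, b) \<cdot> pinj X xs
       = pinj Y (map (vmap f) xs) \<cdot> tens_arr A (map (hmap f) (steps xs))"
proof -
  note F = graph_homD[OF f]
  let ?c = "\<lambda>a b. cotuple V (paths (verts X) a b) (path_tensor A X) (homs (\<Gamma> Y) (vmap f a, vmap f b))
           (\<lambda>xs. pinj Y (map (vmap f) xs) \<cdot> tens_arr A (map (hmap f) (steps xs)))"
  have vm: "(\<lambda>a\<in>verts X. vmap f a) = vmap f"
    using arg_cong[OF graph_mor_eq[OF f], of vmap] by (simp add: graph_mor_def)
  have e: "Gmor f = graph_mor (\<Gamma> X) (\<Gamma> Y) (vmap f) ?c"
    using vm by (simp add: Gamma_mor_def graph_mor_def F)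
  have c: "?c a b \<in> Hom V (homs (\<Gamma> X) (a, b)) (homs (\<Gamma> Y) (vmap f a, vmap f b))"
    "\<And>xs. xs \<in> paths (verts X) a b \<Longrightarrow>
      ?c a b \<cdot> pinj X xs = pinj Y (map (vmap f) xs) \<cdot> tens_arr A (map (hmap f) (steps xs))"
    if ab: "a \<in> verts X" "b \<in> verts X" for a b
  proof -
    note cop = chosen_coprod_is_coproduct[OF Gamma_coproduct[OF F(3) ab]]
    have Y: "homs (\<Gamma> Y) (vmap f a, vmap f b) \<in> Obj V"
      using vgraph_homs[OF Gamma_graph_in[OF F(4)]] F(5) ab by simp
    have t: "pinj Y (map (vmap f) xs) \<cdot> tens_arr A (map (hmap f) (steps xs))
       \<in> Hom V (path_tensor A X xs) (homs (\<Gamma> Y) (vmap f a, vmap f b))" if xs: "xs \<in> paths (verts X) a b" for xs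
      using comp_in[OF tens_hom[OF hmap_steps_hom[OF f pathsD(2)[OF xs]]]]
        inj_hom[OF F(4) path_map[of xs _ a b "vmap f", OF xs F(5)]]
      by (simp add: path_tensor_def)
    from cotuple[OF cop Y t]
    show "?c a b \<in> Hom V (homs (\<Gamma> X) (a, b)) (homs (\<Gamma> Y) (vmap f a, vmap f b))"
      "\<And>xs. xs \<in> paths (verts X) a b \<Longrightarrow>
      ?c a b \<cdot> pinj X xs = pinj Y (map (vmap f) xs) \<cdot> tens_arr A (map (hmap f) (steps xs))"
      using ab by (simp_all add: Gamma_graph_def path_inj_eq[of _ X a b])
  qed
  show "Gmor f \<in> Hom G (\<Gamma> X) (\<Gamma> Y)" unfolding e
    by (rule graph_mor_hom) (use Gamma_graph_in F c in auto)
  show "vmap (Gmor f) = vmap f" by (simp add: Gamma_mor_def Let_def)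
  assume xs: "xs \<in> paths (verts X) a b"
  show "hmap (Gmor f) (a, b) \<cdot> pinj X xs = pinj Y (map (vmap f) xs) \<cdot> tens_arr A (map (hmap f) (steps xs))"
    unfolding e using c(2)[OF pathsD(5,6)[OF xs] xs] pathsD(5,6)[OF xs] by simp
qed

text \<open>The injections \<open>pinj\<close> of each hom are jointly epic, so two maps that agree
  on vertices need to be compared on single paths only.\<close>

lemma Gamma_hom_eqI:
  assumes X: "X \<in> vgraphs U V" and f: "f \<in> Hom G (\<Gamma> X) Y" and g: "g \<in> Hom G (\<Gamma> X) Y"
    and v: "\<And>a. a \<in> verts X \<Longrightarrow> vmap f a = vmap g a"
    and h: "\<And>a b xs. a \<in> verts X \<Longrightarrow> b \<in> verts X \<Longrightarrow> xs \<in> paths (verts X) a b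
      \<Longrightarrow> hmap f (a, b) \<cdot> pinj X xs = hmap g (a, b) \<cdot> pinj X xs"
  shows "f = g"
proof (rule graph_hom_eqI[OF f g])
  fix a b assume ab: "a \<in> verts (\<Gamma> X)" "b \<in> verts (\<Gamma> X)"
  hence ab': "a \<in> verts X" "b \<in> verts X" by auto
  show "hmap f (a, b) = hmap g (a, b)"
    using graph_homD(6)[OF f ab] graph_homD(6)[OF g ab] v ab'
    by (intro coproduct_eqI[OF Gamma_coproduct[OF X ab'] _ _ h]) auto
qed (use v in auto)

lemma Gamma_functor_simps [simp]:
  "X \<in> vgraphs U V \<Longrightarrow> obj_map (Gamma_functor U V A) X = \<Gamma> X"
  "f \<in> Hom G X Y \<Longrightarrow> arr_map (Gamma_functor U V A) f = Gmor f"
  by (simp_all add: Gamma_functor_def Hom_def)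

lemma cat_functor_Gamma: "cat_functor G G (Gamma_functor U V A)"
proof
  show "obj_map (Gamma_functor U V A) \<in> Obj G \<rightarrow>\<^sub>E Obj G"
    using Gamma_graph_in by (auto simp: Gamma_functor_def)
  show "arr_map (Gamma_functor U V A) \<in> extensional (Arr G)"
    by (simp add: Gamma_functor_def)
  show "arr_map (Gamma_functor U V A) f \<in> Hom G (obj_map (Gamma_functor U V A) X) (obj_map (Gamma_functor U V A) Y)"
    if f: "f \<in> Hom G X Y" for f X Y
    using Gamma_mor(1)[OF f] f graph_homD(3,4)[OF f] by simp
  show "arr_map (Gamma_functor U V A) (Ide G X) = Ide G (obj_map (Gamma_functor U V A) X)"
    if "X \<in> Obj G" for X
  proof -
    have X: "X \<in> vgraphs U V" using that by simp
    note i = graph_ide_hom[OF X] and i' = graph_ide_hom[OF Gamma_graph_in[OF X]]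
    have "Gmor (Ide G X) = Ide G (\<Gamma> X)"
    proof (rule Gamma_hom_eqI[OF X Gamma_mor(1)[OF i] i'])
      fix a b xs assume ab: "a \<in> verts X" "b \<in> verts X" and xs: "xs \<in> paths (verts X) a b"
      have 1: "map (vmap (Ide G X)) xs = xs"
        using pathsD[OF xs] by (auto simp: graph_ide intro!: map_idI)
      have 2: "map (hmap (Ide G X)) (steps xs) = map (Ide V) (path_homs X xs)"
        unfolding path_homs_def map_map by (rule map_steps_cong[OF pathsD(2)[OF xs]]) (simp add: graph_ide)
      show "hmap (Gmor (Ide G X)) (a, b) \<cdot> pinj X xs = hmap (Ide G (\<Gamma> X)) (a, b) \<cdot> pinj X xs"
        using Gamma_mor(3)[OF i xs] 1 2 tens_ide[OF path_homs_lists[OF X pathsD(2)[OF xs]]]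
          ide_right[OF inj_hom[OF X xs]] ide_left[OF inj_hom[OF X xs]] ab
        by (simp add: path_tensor_def) (simp add: graph_ide)
    qed (simp add: Gamma_mor(2)[OF i], simp add: graph_ide)
    thus ?thesis using X i by simp
  qed
  show "arr_map (Gamma_functor U V A) (g \<odot> f) = arr_map (Gamma_functor U V A) g \<odot> arr_map (Gamma_functor U V A) f"
    if f: "f \<in> Hom G X Y" and g: "g \<in> Hom G Y Z" for f g X Y Z
  proof -
    note F = graph_homD[OF f] and gf = graph_comp_hom[OF f g]
    note Gf = Gamma_mor(1)[OF f] and Gg = Gamma_mor(1)[OF g]
    have "Gmor (g \<odot> f) = Gmor g \<odot> Gmor f"
    proof (rule Gamma_hom_eqI[OF F(3) Gamma_mor(1)[OF gf] graph_comp_hom[OF Gf Gg]])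
      fix a assume "a \<in> verts X"
      thus "vmap (Gmor (g \<odot> f)) a = vmap (Gmor g \<odot> Gmor f) a"
        using graph_homD(1)[OF Gf] F(1) by (simp add: Gamma_mor(2)[OF gf] Gamma_mor(2)[OF f] Gamma_mor(2)[OF g])
    next
      fix a b xs assume ab: "a \<in> verts X" "b \<in> verts X" and xs: "xs \<in> paths (verts X) a b"
      note xsS = pathsD(2)[OF xs] and fxs = path_map[of xs _ a b "vmap f", OF xs F(5)]
      note fs = hmap_steps_hom[OF f xsS] and gs = hmap_steps_hom[OF g pathsD(2)[OF fxs]]
      have m: "map (vmap (g \<odot> f)) xs = map (vmap g) (map (vmap f) xs)"
        using xsS F(1) by auto
      have ms: "map (hmap (g \<odot> f)) (steps xs) = map2 (Comp V) (map (hmap g) (steps (map (vmap f) xs))) (map (hmap f) (steps xs))"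
        unfolding steps_map map_map map2_map_map by (rule map_steps_cong[OF xsS]) (simp add: F(1))
      have a1: "hmap (Gmor f) (a, b) \<in> Hom V (homs (\<Gamma> X) (a, b)) (homs (\<Gamma> Y) (vmap f a, vmap f b))"
        using graph_homD(6)[OF Gf] ab Gamma_mor(2)[OF f] by simp
      have a2: "hmap (Gmor g) (vmap f a, vmap f b) \<in> Hom V (homs (\<Gamma> Y) (vmap f a, vmap f b)) (homs (\<Gamma> Z) (vmap g (vmap f a), vmap g (vmap f b)))"
        using graph_homD(6)[OF Gg] ab F(5) Gamma_mor(2)[OF g] by simp
      have t: "tens_arr A (map (hmap f) (steps xs)) \<in> Hom V (path_tensor A X xs) (path_tensor A Y (map (vmap f) xs))"
        "tens_arr A (map (hmap g) (steps (map (vmap f) xs))) \<in> Hom V (path_tensor A Y (map (vmap f) xs)) (path_tensor A Z (map (vmap g) (map (vmap f) xs)))"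
        using tens_hom[OF fs] tens_hom[OF gs] by (auto simp: path_tensor_def)
      note i1 = inj_hom[OF F(3) xs] and i2 = inj_hom[OF F(4) fxs] and i3 = inj_hom[OF graph_homD(4)[OF g] path_map[of _ _ _ _ "vmap g", OF fxs graph_homD(5)[OF g]]]
      have "hmap (Gmor g \<odot> Gmor f) (a, b) \<cdot> pinj X xs
         = (hmap (Gmor g) (vmap f a, vmap f b) \<cdot> hmap (Gmor f) (a, b)) \<cdot> pinj X xs"
        using graph_homD(1)[OF Gf] ab by (simp add: Gamma_mor(2)[OF f])
      also have "\<dots> = hmap (Gmor g) (vmap f a, vmap f b) \<cdot> (pinj Y (map (vmap f) xs) \<cdot> tens_arr A (map (hmap f) (steps xs)))"
        using comp_assoc_hom[OF i1 a1 a2] Gamma_mor(3)[OF f xs] by simp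
      also have "\<dots> = (pinj Z (map (vmap g) (map (vmap f) xs)) \<cdot> tens_arr A (map (hmap g) (steps (map (vmap f) xs)))) \<cdot> tens_arr A (map (hmap f) (steps xs))"
        by (rule comp_ext[OF t(1) i2 a2 Gamma_mor(3)[OF g fxs]])
      also have "\<dots> = pinj Z (map (vmap (g \<odot> f)) xs) \<cdot> tens_arr A (map (hmap (g \<odot> f)) (steps xs))"
        using comp_assoc_hom[OF t i3] tens_comp[OF fs gs] by (simp add: m ms del: map_map)
      finally show "hmap (Gmor (g \<odot> f)) (a, b) \<cdot> pinj X xs
          = hmap (Gmor g \<odot> Gmor f) (a, b) \<cdot> pinj X xs"
        using Gamma_mor(3)[OF gf xs] by simp
    qed
    thus ?thesis using f g gf by simp
  qed
qed

end

section \<open>Summands of iterated applications of \<Gamma>\<close>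

lemma list_all2_concat_intro:
  "list_all2 (list_all2 P) xss yss \<Longrightarrow> list_all2 P (concat xss) (concat yss)"
  by (induction rule: list_all2_induct) (auto intro: list_all2_appendI)

lemma map2_list_all2:
  "list_all2 P ps is \<Longrightarrow> (\<And>p i. P p i \<Longrightarrow> h (f p) (g i) = k i) \<Longrightarrow> map2 h (map f ps) (map g is) = map k is"
  by (induction rule: list_all2_induct) auto

lemma step_paths_mem:
  assumes "step_paths S ys xss" "xs \<in> set xss"
  obtains c d where "xs \<in> paths S c d"
proof -
  obtain i where "i < length xss" "xs = xss ! i" using assms(2) by (auto simp: in_set_conv_nth)
  hence "(case steps ys ! i of (c, d) \<Rightarrow> \<lambda>xs. xs \<in> paths S c d) xs"
    using assms(1) by (simp add: list_all2_conv_all_nth)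
  thus thesis using that by (cases "steps ys ! i") auto
qed

lemma list_all2_steps_mono:
  assumes "list_all2 P (steps ys) is" "set ys \<subseteq> S"
    "\<And>c d i. c \<in> S \<Longrightarrow> d \<in> S \<Longrightarrow> P (c, d) i \<Longrightarrow> Q (c, d) i"
  shows "list_all2 Q (steps ys) is"
  using assms(1)
proof (rule list.rel_mono_strong)
  fix p i assume "p \<in> set (steps ys)" "P p i"
  thus "Q p i" using steps_set_in[OF _ assms(2), of p] assms(3)[of "fst p" "snd p" i] by simp
qed

lemma list_all2_seq_hom:
  "list_all2 P ps is \<Longrightarrow> (\<And>p i. P p i \<Longrightarrow> f i \<in> Hom C (X i) (Y p))
    \<Longrightarrow> map f is \<in> Hom (seq_cat C) (map X is) (map Y ps)"
  by (induction rule: list_all2_induct) auto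

context dist_mult
begin

text \<open>\<open>is\<close> selects an index for every step of \<open>ys\<close>. The families
  \<open>T\<close> and \<iota> do not mention the step: the indices used later, paths and refined
  paths, carry their end vertices with them.\<close>

lemma layer_hom:
  assumes "ys \<in> paths (verts Y) a b" "list_all2 (\<lambda>(c, d) i. i \<in> D c d) (steps ys) is"
    and \<iota>: "\<And>c d i. c \<in> verts Y \<Longrightarrow> d \<in> verts Y \<Longrightarrow> i \<in> D c d \<Longrightarrow> \<iota> i \<in> Hom V (T i) (homs Y (c, d))"
  shows "map \<iota> is \<in> Hom (seq_cat V) (map T is) (path_homs Y ys)"
proof -
  have "list_all2 (\<lambda>p i. \<iota> i \<in> Hom V (T i) (homs Y p)) (steps ys) is"
    by (rule list_all2_steps_mono[OF assms(2) pathsD(2)[OF assms(1)]]) (use \<iota> in auto)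
  thus ?thesis unfolding path_homs_def by (rule list_all2_seq_hom) auto
qed

text \<open>Arrows out of \<open>\<Gamma> Y\<close> are tested on the summands of a decomposition of the homs of \<open>Y\<close>.\<close>

lemma Gamma_mor_layer:
  assumes k: "k \<in> Hom G Y Z" and ys: "ys \<in> paths (verts Y) a b"
    and "is": "list_all2 (\<lambda>(c, d) i. i \<in> D c d) (steps ys) is"
    and \<iota>: "\<And>c d i. c \<in> verts Y \<Longrightarrow> d \<in> verts Y \<Longrightarrow> i \<in> D c d \<Longrightarrow> \<iota> i \<in> Hom V (T i) (homs Y (c, d))"
    and H: "\<And>c d i. c \<in> verts Y \<Longrightarrow> d \<in> verts Y \<Longrightarrow> i \<in> D c d \<Longrightarrow> hmap k (c, d) \<cdot> \<iota> i = H i"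
  shows "hmap (Gmor k) (a, b) \<cdot> (pinj Y ys \<cdot> tens_arr A (map \<iota> is))
    = pinj Z (map (vmap k) ys) \<cdot> tens_arr A (map H is)"
proof -
  note K = graph_homD[OF k] and GK = Gamma_mor[OF k]
  note ab = pathsD(5,6)[OF ys]
  note i = layer_hom[of ys Y a b D "is" \<iota> T, OF ys "is" \<iota>]
  note kh = hmap_steps_hom[OF k pathsD(2)[OF ys]]
  note kys = path_map[of ys _ a b "vmap k", OF ys K(5)]
  have t: "tens_arr A (map \<iota> is) \<in> Hom V (tens A (map T is)) (path_tensor A Y ys)"
    "tens_arr A (map (hmap k) (steps ys)) \<in> Hom V (path_tensor A Y ys) (path_tensor A Z (map (vmap k) ys))"
    using tens_hom[OF i] tens_hom[OF kh] by (auto simp: path_tensor_def)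
  have g: "hmap (Gmor k) (a, b) \<in> Hom V (homs (\<Gamma> Y) (a, b)) (homs (\<Gamma> Z) (vmap k a, vmap k b))"
    using graph_homD(6)[OF GK(1)] ab GK(2) by simp
  have "list_all2 (\<lambda>p i. hmap k p \<cdot> \<iota> i = H i) (steps ys) is"
    by (rule list_all2_steps_mono[OF "is" pathsD(2)[OF ys]]) (use H in auto)
  hence m: "map2 (Comp V) (map (hmap k) (steps ys)) (map \<iota> is) = map H is"
    by (rule map2_list_all2)
  have "hmap (Gmor k) (a, b) \<cdot> (pinj Y ys \<cdot> tens_arr A (map \<iota> is))
    = (pinj Z (map (vmap k) ys) \<cdot> tens_arr A (map (hmap k) (steps ys))) \<cdot> tens_arr A (map \<iota> is)"
    by (rule comp_ext[OF t(1) inj_hom[OF K(3) ys] g GK(3)[OF ys]])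
  also have "\<dots> = pinj Z (map (vmap k) ys) \<cdot> tens_arr A (map H is)"
    using comp_assoc_hom[OF t inj_hom[OF K(4) kys]] tens_comp[OF i kh] m by simp
  finally show ?thesis .
qed

text \<open>A hom of \<open>\<Gamma> Y\<close> is a coproduct over paths of tensors of homs of
  \<open>Y\<close>; distributivity expands each tensor, and \<open>coproduct_sigma\<close> merges
  the two levels. \<open>D0\<close> is one small bound for all the index sets. Applied to
  \<open>\<Gamma> X\<close> this describes the twofold application, and applied once more the
  threefold one.\<close>

lemma layer_coproduct:
  assumes Y: "Y \<in> vgraphs U V" and ab: "a \<in> verts Y" "b \<in> verts Y" and D0: "small U D0"
    and D: "\<And>c d. c \<in> verts Y \<Longrightarrow> d \<in> verts Y \<Longrightarrow> D c d \<subseteq> D0 \<and> is_coproduct V (D c d) T (homs Y (c, d)) \<iota>"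
  shows "is_coproduct V {(ys, is). ys \<in> paths (verts Y) a b \<and> list_all2 (\<lambda>(c, d) i. i \<in> D c d) (steps ys) is}
    (\<lambda>(ys, is). tens A (map T is)) (homs (\<Gamma> Y) (a, b)) (\<lambda>(ys, is). pinj Y ys \<cdot> tens_arr A (map \<iota> is))"
proof -
  let ?J = "\<lambda>ys. listset (map (\<lambda>(c, d). D c d) (steps ys))"
  have "is_coproduct V (?J ys) (\<lambda>is. tens A (map T is)) (path_tensor A Y ys) (\<lambda>is. tens_arr A (map \<iota> is))"
    if ys: "ys \<in> paths (verts Y) a b" for ys
    unfolding path_tensor_def
  proof (rule dist_list[OF dist])
    have "small U (D c d) \<and> is_coproduct V (D c d) T (homs Y (c, d)) \<iota>" if "c \<in> verts Y" "d \<in> verts Y" for c d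
      using D[OF that] small_subset[OF D0] by blast
    hence "\<forall>p\<in>set (steps ys). small U (case p of (c, d) \<Rightarrow> D c d) \<and> is_coproduct V (case p of (c, d) \<Rightarrow> D c d) T (homs Y p) \<iota>"
      using steps_set_in[OF _ pathsD(2)[OF ys]] by (metis case_prod_conv prod.collapse)
    thus "list_all2 (\<lambda>I c. small U I \<and> is_coproduct V I T c \<iota>) (map (\<lambda>(c, d). D c d) (steps ys)) (path_homs Y ys)"
      unfolding path_homs_def list_all2_map1 list_all2_map2 by (simp add: list_all2_same)
  qed
  from coproduct_sigma[OF Gamma_coproduct[OF Y ab] this]
  have "is_coproduct V (Sigma (paths (verts Y) a b) ?J) (\<lambda>(ys, is). tens A (map T is)) (homs (\<Gamma> Y) (a, b))
    (\<lambda>(ys, is). pinj Y ys \<cdot> tens_arr A (map \<iota> is))" .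
  moreover have "Sigma (paths (verts Y) a b) ?J
     = {(ys, is). ys \<in> paths (verts Y) a b \<and> list_all2 (\<lambda>(c, d) i. i \<in> D c d) (steps ys) is}"
    by (auto simp: list_all2_listset[symmetric] case_prod_unfold)
  ultimately show ?thesis by simp
qed

definition double_paths :: "'u set \<Rightarrow> 'u \<Rightarrow> 'u \<Rightarrow> ('u list \<times> 'u list list) set" where
  "double_paths S a b = {(ys, xss). ys \<in> paths S a b \<and> step_paths S ys xss}"

definition double_inj :: "('u, 'o) vgraph \<Rightarrow> 'u list \<times> 'u list list \<Rightarrow> 'm" where
  "double_inj X = (\<lambda>(ys, xss). pinj (\<Gamma> X) ys \<cdot> tens_arr A (map (pinj X) xss))"

definition double_tensor :: "('u, 'o) vgraph \<Rightarrow> 'u list \<times> 'u list list \<Rightarrow> 'o" where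
  "double_tensor X = (\<lambda>(ys, xss). tens A (map (path_tensor A X) xss))"

lemma double_coproduct:
  assumes X: "X \<in> vgraphs U V" and ab: "a \<in> verts X" "b \<in> verts X"
  shows "is_coproduct V (double_paths (verts X) a b) (double_tensor X) (homs (\<Gamma> (\<Gamma> X)) (a, b)) (double_inj X)"
proof -
  have "is_coproduct V {(ys, is). ys \<in> paths (verts (\<Gamma> X)) a b \<and> list_all2 (\<lambda>(c, d) i. i \<in> paths (verts X) c d) (steps ys) is}
    (\<lambda>(ys, is). tens A (map (path_tensor A X) is)) (homs (\<Gamma> (\<Gamma> X)) (a, b)) (\<lambda>(ys, is). pinj (\<Gamma> X) ys \<cdot> tens_arr A (map (pinj X) is))"
  proof (rule layer_coproduct[OF Gamma_graph_in[OF X]])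
    show "small U (lists (verts X))" by (rule small_lists[OF small_mem[OF vgraph_small[OF X]]])
    show "paths (verts X) c d \<subseteq> lists (verts X) \<and> is_coproduct V (paths (verts X) c d) (path_tensor A X) (homs (\<Gamma> X) (c, d)) (pinj X)"
      if "c \<in> verts (\<Gamma> X)" "d \<in> verts (\<Gamma> X)" for c d
      using Gamma_coproduct[OF X] that by (auto simp: paths_def)
  qed (use ab in auto)
  thus ?thesis by (simp add: double_paths_def double_tensor_def[abs_def] double_inj_def[abs_def])
qed

lemma triple_coproduct:
  assumes X: "X \<in> vgraphs U V" and ab: "a \<in> verts X" "b \<in> verts X"
  shows "is_coproduct V {(zs, ps). zs \<in> paths (verts X) a b \<and> list_all2 (\<lambda>(c, d) p. p \<in> double_paths (verts X) c d) (steps zs) ps}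
    (\<lambda>(zs, ps). tens A (map (double_tensor X) ps)) (homs (\<Gamma> (\<Gamma> (\<Gamma> X))) (a, b))
    (\<lambda>(zs, ps). pinj (\<Gamma> (\<Gamma> X)) zs \<cdot> tens_arr A (map (double_inj X) ps))"
proof -
  let ?L = "lists (verts X)"
  have sm: "small U ?L" by (rule small_lists[OF small_mem[OF vgraph_small[OF X]]])
  have "is_coproduct V {(zs, ps). zs \<in> paths (verts (\<Gamma> (\<Gamma> X))) a b \<and> list_all2 (\<lambda>(c, d) p. p \<in> double_paths (verts X) c d) (steps zs) ps}
    (\<lambda>(zs, ps). tens A (map (double_tensor X) ps)) (homs (\<Gamma> (\<Gamma> (\<Gamma> X))) (a, b))
    (\<lambda>(zs, ps). pinj (\<Gamma> (\<Gamma> X)) zs \<cdot> tens_arr A (map (double_inj X) ps))"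
  proof (rule layer_coproduct[OF Gamma_graph_in[OF Gamma_graph_in[OF X]]])
    \<comment> \<open>A refined path is a list of vertices together with a list of such lists, which
      bounds all index sets at once.\<close>
    show "small U (?L \<times> lists ?L)" by (intro small_times small_lists sm)
    have "p \<in> ?L \<times> lists ?L" if p: "p \<in> double_paths (verts X) c d" for p c d
    proof -
      obtain ys xss where ys: "p = (ys, xss)" "ys \<in> paths (verts X) c d" "step_paths (verts X) ys xss"
        using p by (cases p) (auto simp: double_paths_def)
      have "xs \<in> ?L" if "xs \<in> set xss" for xs
        using step_paths_mem[OF ys(3) that] by (metis in_listsI pathsD(2) subsetD)
      thus ?thesis using ys pathsD(2)[OF ys(2)] by auto
    qed
    hence "double_paths (verts X) c d \<subseteq> ?L \<times> lists ?L" for c d by (rule subsetI)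
    thus "double_paths (verts X) c d \<subseteq> ?L \<times> lists ?L \<and>
      is_coproduct V (double_paths (verts X) c d) (double_tensor X) (homs (\<Gamma> (\<Gamma> X)) (c, d)) (double_inj X)"
      if "c \<in> verts (\<Gamma> (\<Gamma> X))" "d \<in> verts (\<Gamma> (\<Gamma> X))" for c d
      using double_coproduct[OF X, of c d] that by simp
  qed (use ab in auto)
  thus ?thesis by simp
qed

section \<open>Unit and multiplication\<close>

lemma unit_hom_graph:
  assumes X: "X \<in> vgraphs U V"
  shows "\<eta> X \<in> Hom G X (\<Gamma> X)" "vmap (\<eta> X) = (\<lambda>a\<in>verts X. a)"
    "a \<in> verts X \<Longrightarrow> b \<in> verts X \<Longrightarrow> hmap (\<eta> X) (a, b) = pinj X [a, b] \<cdot> tunit A (homs X (a, b))"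
proof -
  have e: "\<eta> X = graph_mor X (\<Gamma> X) (\<lambda>a. a) (\<lambda>a b. pinj X [a, b] \<cdot> tunit A (homs X (a, b)))"
    using X by (simp add: Gamma_unit_def graph_mor_def)
  have "pinj X [a, b] \<cdot> tunit A (homs X (a, b)) \<in> Hom V (homs X (a, b)) (homs (\<Gamma> X) (a, b))"
    if "a \<in> verts X" "b \<in> verts X" for a b
    using comp_in[OF unit_hom[OF vgraph_homs[OF X that]]] inj_hom[OF X, of "[a, b]" a b] that
    by (simp add: path_tensor_def paths_def)
  thus "\<eta> X \<in> Hom G X (\<Gamma> X)" unfolding e
    by (intro graph_mor_hom) (auto intro: X Gamma_graph_in)
  show "vmap (\<eta> X) = (\<lambda>a\<in>verts X. a)" unfolding e by (simp add: graph_mor_def)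
  show "a \<in> verts X \<Longrightarrow> b \<in> verts X \<Longrightarrow> hmap (\<eta> X) (a, b) = pinj X [a, b] \<cdot> tunit A (homs X (a, b))"
    unfolding e by simp
qed

lemma path_homs_map_in:
  assumes "X \<in> vgraphs U V" "step_paths (verts X) ys xss"
  shows "map (path_homs X) xss \<in> lists (lists (Obj V))"
proof -
  have "set xs \<subseteq> verts X" if "xs \<in> set xss" for xs
    using step_paths_mem[OF assms(2) that] pathsD(2) by metis
  hence "path_homs X xs \<in> lists (Obj V)" if "xs \<in> set xss" for xs
    using path_homs_lists[OF assms(1)] that by blast
  thus ?thesis by (intro in_listsI) simp
qed

text \<open>\<open>Gamma_mult\<close> is given by a definite description. The universal property of
  \<open>double_coproduct\<close> shows that it denotes, and the characterization on summands is
  then the only fact used about it.\<close>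

lemma mult_hom_graph:
  assumes X: "X \<in> vgraphs U V"
  shows "\<mu> X \<in> Hom G (\<Gamma> (\<Gamma> X)) (\<Gamma> X)" "vmap (\<mu> X) = (\<lambda>a\<in>verts X. a)"
    "ys \<in> paths (verts X) a b \<Longrightarrow> step_paths (verts X) ys xss \<Longrightarrow>
      hmap (\<mu> X) (a, b) \<cdot> (pinj (\<Gamma> X) ys \<cdot> tens_arr A (map (pinj X) xss))
      = pinj X (path_join ys xss) \<cdot> tsubst A (map (path_homs X) xss)"
proof -
  let ?P = "\<lambda>a b m. m \<in> Hom V (homs (\<Gamma> (\<Gamma> X)) (a, b)) (homs (\<Gamma> X) (a, b)) \<and>
           (\<forall>ys\<in>paths (verts X) a b. \<forall>xss. step_paths (verts X) ys xss \<longrightarrow>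
              m \<cdot> (pinj (\<Gamma> X) ys \<cdot> tens_arr A (map (pinj X) xss))
                = pinj X (path_join ys xss) \<cdot> tsubst A (map (path_homs X) xss))"
  have e: "\<mu> X = graph_mor (\<Gamma> (\<Gamma> X)) (\<Gamma> X) (\<lambda>a. a) (\<lambda>a b. THE m. ?P a b m)"
    using X by (simp add: Gamma_mult_def graph_mor_def Let_def)
  have P: "?P a b (THE m. ?P a b m)" if ab: "a \<in> verts X" "b \<in> verts X" for a b
  proof (rule theI')
    note cop = double_coproduct[OF X ab]
    let ?f = "\<lambda>(ys, xss). pinj X (path_join ys xss) \<cdot> tsubst A (map (path_homs X) xss)"
    have f: "?f p \<in> Hom V (double_tensor X p) (homs (\<Gamma> X) (a, b))" if p': "p \<in> double_paths (verts X) a b" for p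
    proof -
      obtain ys xss where p: "p = (ys, xss)" "ys \<in> paths (verts X) a b" "step_paths (verts X) ys xss"
        using p' by (cases p) (auto simp: double_paths_def)
      have 1: "tsubst A (map (path_homs X) xss) \<in> Hom V (double_tensor X p) (path_tensor A X (path_join ys xss))"
        using subst_hom[OF path_homs_map_in[OF X p(3)]] path_homs_join[OF p(2,3), of X]
        by (simp add: path_tensor_def[abs_def] double_tensor_def p(1) comp_def)
      show ?thesis using comp_in[OF 1 inj_hom[OF X conjunct1[OF path_join[OF p(2,3)]]]] p(1) by simp
    qed
    obtain h where h: "h \<in> Hom V (homs (\<Gamma> (\<Gamma> X)) (a, b)) (homs (\<Gamma> X) (a, b))"
      "\<And>p. p \<in> double_paths (verts X) a b \<Longrightarrow> h \<cdot> double_inj X p = ?f p"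
      using coproduct_ex[OF cop coproductD(2)[OF Gamma_coproduct[OF X ab]] f] by blast
    show "\<exists>!m. ?P a b m"
    proof (rule ex1I[of _ h])
      show "?P a b h" using h(1) h(2)[of "(_, _)"] by (simp add: double_paths_def double_inj_def)
      fix m assume m: "?P a b m"
      have "m \<cdot> double_inj X p = ?f p" if "p \<in> double_paths (verts X) a b" for p
        using m that by (auto simp: double_paths_def double_inj_def)
      thus "m = h" using h m by (intro coproduct_eqI[OF cop, of m _ h]) auto
    qed
  qed
  show "\<mu> X \<in> Hom G (\<Gamma> (\<Gamma> X)) (\<Gamma> X)" unfolding e
    by (rule graph_mor_hom) (use X Gamma_graph_in P in auto)
  show "vmap (\<mu> X) = (\<lambda>a\<in>verts X. a)" unfolding e by (simp add: graph_mor_def)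
  assume *: "ys \<in> paths (verts X) a b" "step_paths (verts X) ys xss"
  show "hmap (\<mu> X) (a, b) \<cdot> (pinj (\<Gamma> X) ys \<cdot> tens_arr A (map (pinj X) xss))
      = pinj X (path_join ys xss) \<cdot> tsubst A (map (path_homs X) xss)"
    unfolding e using P[OF pathsD(5,6)[OF *(1)]] * pathsD(5,6)[OF *(1)] by simp
qed

lemma Gamma_unit_natural: "nat_trans G G (id_functor G) (Gamma_functor U V A) (\<eta>)"
proof (rule nat_transI[OF id_functor_cat_functor[OF G.category_axioms] cat_functor_Gamma])
  show "\<eta> \<in> extensional (Obj G)" by (simp add: Gamma_unit_def)
  show "\<eta> X \<in> Hom G (obj_map (id_functor G) X) (obj_map (Gamma_functor U V A) X)" if "X \<in> Obj G" for X
    using unit_hom_graph(1)[of X] that by (simp add: id_functor_def)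
  fix f X Y assume f: "f \<in> Hom G X Y"
  note F = graph_homD[OF f] and Gf = Gamma_mor[OF f]
  note uX = unit_hom_graph[OF F(3)] and uY = unit_hom_graph[OF F(4)]
  have "Gmor f \<odot> \<eta> X = \<eta> Y \<odot> f"
  proof (rule graph_hom_eqI[OF G.comp_in[OF uX(1) Gf(1)] G.comp_in[OF f uY(1)]])
    fix a b assume ab: "a \<in> verts X" "b \<in> verts X"
    note s = graph_homD(1)[OF uX(1)] F(1)
    note ab' = F(5)[OF ab(1)] F(5)[OF ab(2)]
    show "vmap (Gmor f \<odot> \<eta> X) a = vmap (\<eta> Y \<odot> f) a"
      using ab s by (simp add: uX uY Gf F)
    have xs: "[a, b] \<in> paths (verts X) a b" "[vmap f a, vmap f b] \<in> paths (verts Y) (vmap f a) (vmap f b)"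
      using ab ab' by (auto simp: paths_def)
    note h = F(6)[OF ab]
    note g = graph_homD(6)[OF Gf(1)]
    have gh: "hmap (Gmor f) (a, b) \<in> Hom V (homs (\<Gamma> X) (a, b)) (homs (\<Gamma> Y) (vmap f a, vmap f b))"
      using g ab Gf(2) by simp
    have i: "pinj X [a, b] \<in> Hom V (tens A [homs X (a, b)]) (homs (\<Gamma> X) (a, b))"
      "pinj Y [vmap f a, vmap f b] \<in> Hom V (tens A [homs Y (vmap f a, vmap f b)]) (homs (\<Gamma> Y) (vmap f a, vmap f b))"
      using inj_hom[OF F(3) xs(1)] inj_hom[OF F(4) xs(2)] by (simp_all add: path_tensor_def)
    note u = unit_hom[OF vgraph_homs[OF F(3) ab]] unit_hom[OF vgraph_homs[OF F(4) ab']]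
    have t: "tens_arr A [hmap f (a, b)] \<in> Hom V (tens A [homs X (a, b)]) (tens A [homs Y (vmap f a, vmap f b)])"
      using h by (intro tens_hom) simp
    have "hmap (Gmor f) (a, b) \<cdot> (pinj X [a, b] \<cdot> tunit A (homs X (a, b)))
      = (pinj Y [vmap f a, vmap f b] \<cdot> tens_arr A [hmap f (a, b)]) \<cdot> tunit A (homs X (a, b))"
      by (rule comp_ext[OF u(1) i(1) gh]) (use Gf(3)[OF xs(1)] in simp)
    also have "\<dots> = pinj Y [vmap f a, vmap f b] \<cdot> (tunit A (homs Y (vmap f a, vmap f b)) \<cdot> hmap f (a, b))"
      using comp_assoc_hom[OF u(1) t i(2)] unit_nat[OF h] by simp
    also have "\<dots> = (pinj Y [vmap f a, vmap f b] \<cdot> tunit A (homs Y (vmap f a, vmap f b))) \<cdot> hmap f (a, b)"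
      using comp_assoc_hom[OF h u(2) i(2)] by simp
    finally show "hmap (Gmor f \<odot> \<eta> X) (a, b) = hmap (\<eta> Y \<odot> f) (a, b)"
      using ab ab' s by (simp add: uX(2,3) uY(2,3))
  qed
  thus "arr_map (Gamma_functor U V A) f \<odot> \<eta> X = \<eta> Y \<odot> arr_map (id_functor G) f"
    using f by (simp add: id_functor_def Hom_def)
qed

lemma double_hom_eqI:
  assumes X: "X \<in> vgraphs U V" and f: "f \<in> Hom G (\<Gamma> (\<Gamma> X)) Y" and g: "g \<in> Hom G (\<Gamma> (\<Gamma> X)) Y"
    and v: "\<And>a. a \<in> verts X \<Longrightarrow> vmap f a = vmap g a"
    and h: "\<And>a b ys xss. a \<in> verts X \<Longrightarrow> b \<in> verts X \<Longrightarrow> ys \<in> paths (verts X) a b \<Longrightarrow> step_paths (verts X) ys xss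
      \<Longrightarrow> hmap f (a, b) \<cdot> (pinj (\<Gamma> X) ys \<cdot> tens_arr A (map (pinj X) xss))
        = hmap g (a, b) \<cdot> (pinj (\<Gamma> X) ys \<cdot> tens_arr A (map (pinj X) xss))"
  shows "f = g"
proof (rule graph_hom_eqI[OF f g])
  fix a b assume ab: "a \<in> verts (\<Gamma> (\<Gamma> X))" "b \<in> verts (\<Gamma> (\<Gamma> X))"
  hence ab': "a \<in> verts X" "b \<in> verts X" by auto
  have "hmap f (a, b) \<cdot> double_inj X p = hmap g (a, b) \<cdot> double_inj X p"
    if "p \<in> double_paths (verts X) a b" for p
    using h[OF ab'] that by (auto simp: double_paths_def double_inj_def)
  moreover have "hmap g (a, b) \<in> Hom V (homs (\<Gamma> (\<Gamma> X)) (a, b)) (homs Y (vmap f a, vmap f b))"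
    using graph_homD(6)[OF g ab] v[OF ab'(1)] v[OF ab'(2)] by simp
  ultimately show "hmap f (a, b) = hmap g (a, b)"
    by (intro coproduct_eqI[OF double_coproduct[OF X ab'] graph_homD(6)[OF f ab]])
qed (use v in auto)

lemma map_pinj_hom:
  assumes X: "X \<in> vgraphs U V" and ys: "ys \<in> paths (verts X) a b" "step_paths (verts X) ys xss"
  shows "map (pinj X) xss \<in> Hom (seq_cat V) (map (path_tensor A X) xss) (path_homs (\<Gamma> X) ys)"
  by (rule layer_hom[of ys "\<Gamma> X" a b "\<lambda>c d. paths (verts X) c d"]) (use ys inj_hom[OF X] in auto)

text \<open>On the summand of a refined path both composites end in the injection of the image of
  the joined path: joining commutes with mapping vertices, and naturality of \<open>tsubst\<close>
  along the homs of \<open>f\<close> supplies the remaining equation.\<close>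

lemma Gamma_mult_natural:
  "nat_trans G G (comp_functor G (Gamma_functor U V A) (Gamma_functor U V A)) (Gamma_functor U V A) (\<mu>)"
proof (rule nat_transI[OF comp_functor_cat_functor[OF cat_functor_Gamma cat_functor_Gamma] cat_functor_Gamma])
  show "\<mu> \<in> extensional (Obj G)" by (simp add: Gamma_mult_def)
  show "\<mu> X \<in> Hom G (obj_map (comp_functor G (Gamma_functor U V A) (Gamma_functor U V A)) X) (obj_map (Gamma_functor U V A) X)" if "X \<in> Obj G" for X
    using mult_hom_graph(1)[of X] that Gamma_graph_in by (simp add: comp_functor_def)
  fix f X Y assume f: "f \<in> Hom G X Y"
  note F = graph_homD[OF f] and Gf = Gamma_mor[OF f]
  note GGf = Gamma_mor[OF Gf(1)]
  note mX = mult_hom_graph[OF F(3)] and mY = mult_hom_graph[OF F(4)]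
  have "Gmor f \<odot> \<mu> X = \<mu> Y \<odot> Gmor (Gmor f)"
  proof (rule double_hom_eqI[OF F(3) G.comp_in[OF mX(1) Gf(1)] G.comp_in[OF GGf(1) mY(1)]])
    note s = graph_homD(1)[OF mX(1)] graph_homD(1)[OF GGf(1)]
    show "vmap (Gmor f \<odot> \<mu> X) a = vmap (\<mu> Y \<odot> Gmor (Gmor f)) a" if "a \<in> verts X" for a
      using that s by (simp add: mX(2) mY(2) Gf(2) GGf(2) F(5))
    fix a b ys xss assume ab: "a \<in> verts X" "b \<in> verts X" and ys: "ys \<in> paths (verts X) a b" "step_paths (verts X) ys xss"
    let ?J = "pinj (\<Gamma> X) ys \<cdot> tens_arr A (map (pinj X) xss)"
    let ?j = "path_join ys xss"
    let ?fs = "\<lambda>xs. map (hmap f) (steps xs)"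
    have J: "?J \<in> Hom V (double_tensor X (ys, xss)) (homs (\<Gamma> (\<Gamma> X)) (a, b))"
      using coproductD(3)[OF double_coproduct[OF F(3) ab], of "(ys, xss)"] ys by (simp add: double_paths_def double_inj_def)
    have dt: "double_tensor X (ys, xss) = tens A (map (tens A) (map (path_homs X) xss))"
      by (simp add: double_tensor_def path_tensor_def[abs_def] comp_def)
    have m1: "hmap (\<mu> X) (a, b) \<in> Hom V (homs (\<Gamma> (\<Gamma> X)) (a, b)) (homs (\<Gamma> X) (a, b))"
      using graph_homD(6)[OF mX(1)] ab mX(2) by simp
    have m2: "hmap (\<mu> Y) (vmap f a, vmap f b) \<in> Hom V (homs (\<Gamma> (\<Gamma> Y)) (vmap f a, vmap f b)) (homs (\<Gamma> Y) (vmap f a, vmap f b))"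
      using graph_homD(6)[OF mY(1)] F(5)[OF ab(1)] F(5)[OF ab(2)] mY(2) by simp
    have g1: "hmap (Gmor f) (a, b) \<in> Hom V (homs (\<Gamma> X) (a, b)) (homs (\<Gamma> Y) (vmap f a, vmap f b))"
      using graph_homD(6)[OF Gf(1)] ab Gf(2) by simp
    have g2: "hmap (Gmor (Gmor f)) (a, b) \<in> Hom V (homs (\<Gamma> (\<Gamma> X)) (a, b)) (homs (\<Gamma> (\<Gamma> Y)) (vmap f a, vmap f b))"
      using graph_homD(6)[OF GGf(1)] ab GGf(2) Gf(2) by simp
    have xs: "xs \<in> set xss \<Longrightarrow> \<exists>c d. xs \<in> paths (verts X) c d" for xs
      using step_paths_mem[OF ys(2)] by metis
    have pl: "set xs \<subseteq> verts X" if "xs \<in> set xss" for xs using xs[OF that] pathsD(2) by metis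
    note j = conjunct1[OF path_join[OF ys]]
    note hX = path_homs_map_in[OF F(3) ys(2)]
    have ys': "map (vmap f) ys \<in> paths (verts Y) (vmap f a) (vmap f b)" "step_paths (verts Y) (map (vmap f) ys) (map (map (vmap f)) xss)"
      using path_map[of ys _ a b "vmap f", OF ys(1) F(5)] step_paths_map[OF ys(2), of "vmap f"] F(5) by auto
    note hY = path_homs_map_in[OF F(4) ys'(2)]
    have sX: "tsubst A (map (path_homs X) xss) \<in> Hom V (double_tensor X (ys, xss)) (path_tensor A X ?j)"
      using subst_hom[OF hX] dt path_homs_join[OF ys, of X] by (simp add: path_tensor_def)
    have fss: "map ?fs xss \<in> Hom (seq_cat (seq_cat V)) (map (path_homs X) xss) (map (path_homs Y) (map (map (vmap f)) xss))"
      unfolding map_map comp_def by (rule seq_hom_map) (rule hmap_steps_hom[OF f pl])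
    have cf: "concat (map ?fs xss) = map (hmap f) (steps ?j)"
      using path_join[OF ys] by (simp add: map_concat comp_def)
    have tj: "tens_arr A (map (hmap f) (steps ?j)) \<in> Hom V (path_tensor A X ?j) (path_tensor A Y (map (vmap f) ?j))"
      using tens_hom[OF hmap_steps_hom[OF f pathsD(2)[OF j]]] by (simp add: path_tensor_def)
    note ij = inj_hom[OF F(3) j] and ij' = inj_hom[OF F(4) path_map[of ?j _ a b "vmap f", OF j F(5)]]
    have L: "hmap (Gmor f) (a, b) \<cdot> (pinj X ?j \<cdot> tsubst A (map (path_homs X) xss))
      = pinj Y (map (vmap f) ?j) \<cdot> (tens_arr A (map (hmap f) (steps ?j)) \<cdot> tsubst A (map (path_homs X) xss))"
      using comp_ext[OF sX ij g1 Gf(3)[OF j]] comp_assoc_hom[OF sX tj ij'] by simp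
    let ?H = "\<lambda>xs. pinj Y (map (vmap f) xs) \<cdot> tens_arr A (?fs xs)"
    have R1: "hmap (Gmor (Gmor f)) (a, b) \<cdot> ?J = pinj (\<Gamma> Y) (map (vmap f) ys) \<cdot> tens_arr A (map ?H xss)"
      using Gamma_mor_layer[OF Gf(1), of ys a b "\<lambda>c d. paths (verts X) c d" xss "pinj X" "path_tensor A X" ?H]
        ys inj_hom[OF F(3)] Gf(3) Gf(2) by simp
    let ?P = "map (pinj Y) (map (map (vmap f)) xss)"
    have R2: "tens_arr A (map ?H xss) = tens_arr A ?P \<cdot> tens_arr A (map (tens_arr A) (map ?fs xss))"
    proof -
      have "tens_arr A (map ?H xss) = tens_arr A (map (\<lambda>xs. pinj Y (map (vmap f) xs)) xss) \<cdot> tens_arr A (map (\<lambda>xs. tens_arr A (?fs xs)) xss)"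
      proof (rule tens_comp_map[symmetric])
        fix xs assume "xs \<in> set xss"
        then obtain c d where c: "xs \<in> paths (verts X) c d" using xs by blast
        show "tens_arr A (?fs xs) \<in> Hom V (path_tensor A X xs) (path_tensor A Y (map (vmap f) xs))"
          using tens_hom[OF hmap_steps_hom[OF f pathsD(2)[OF c]]] by (simp add: path_tensor_def)
        show "pinj Y (map (vmap f) xs) \<in> Hom V (path_tensor A Y (map (vmap f) xs)) (homs (\<Gamma> Y) (vmap f (hd xs), vmap f (last xs)))"
          using inj_hom[OF F(4) path_map[of xs _ c d "vmap f", OF c F(5)]] pathsD(3,4)[OF c] by simp
      qed
      thus ?thesis by (simp add: comp_def)
    qed
    have tP: "tens_arr A ?P \<in> Hom V (tens A (map (path_tensor A Y) (map (map (vmap f)) xss))) (path_tensor A (\<Gamma> Y) (map (vmap f) ys))"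
      using tens_hom[OF map_pinj_hom[OF F(4) ys']] by (simp add: path_tensor_def)
    have tt: "tens_arr A (map (tens_arr A) (map ?fs xss)) \<in> Hom V (double_tensor X (ys, xss)) (tens A (map (path_tensor A Y) (map (map (vmap f)) xss)))"
    proof -
      have "map (tens_arr A) (map ?fs xss) \<in> Hom (seq_cat V) (map (path_tensor A X) xss) (map (path_tensor A Y) (map (map (vmap f)) xss))"
        unfolding map_map comp_def path_tensor_def by (rule seq_hom_map) (rule tens_hom[OF hmap_steps_hom[OF f pl]])
      from tens_hom[OF this] show ?thesis by (simp add: double_tensor_def)
    qed
    have sY: "tsubst A (map (path_homs Y) (map (map (vmap f)) xss)) \<in> Hom V (tens A (map (path_tensor A Y) (map (map (vmap f)) xss))) (path_tensor A Y (map (vmap f) ?j))"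
      using subst_hom[OF hY] path_homs_join[OF ys', of Y] path_join_map[OF pathsD(1)[OF ys(1)] ys(2), of "vmap f"]
      by (simp add: path_tensor_def[abs_def] comp_def)
    have "hmap (\<mu> Y) (vmap f a, vmap f b) \<cdot> (pinj (\<Gamma> Y) (map (vmap f) ys) \<cdot> (tens_arr A ?P \<cdot> tens_arr A (map (tens_arr A) (map ?fs xss))))
      = (pinj Y (map (vmap f) ?j) \<cdot> tsubst A (map (path_homs Y) (map (map (vmap f)) xss))) \<cdot> tens_arr A (map (tens_arr A) (map ?fs xss))"
    proof -
      have iG: "pinj (\<Gamma> Y) (map (vmap f) ys) \<in> Hom V (path_tensor A (\<Gamma> Y) (map (vmap f) ys)) (homs (\<Gamma> (\<Gamma> Y)) (vmap f a, vmap f b))"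
        using inj_hom[OF Gamma_graph_in[OF F(4)]] ys'(1) by simp
      show ?thesis unfolding comp_assoc_hom[OF tt tP iG, symmetric] path_join_map[OF pathsD(1)[OF ys(1)] ys(2), of "vmap f"]
        by (rule comp_ext[OF tt comp_in[OF tP iG] m2 mY(3)[OF ys']])
    qed
    also have "\<dots> = pinj Y (map (vmap f) ?j) \<cdot> (tens_arr A (map (hmap f) (steps ?j)) \<cdot> tsubst A (map (path_homs X) xss))"
      using comp_assoc_hom[OF tt sY ij'] subst_nat[OF fss] cf by simp
    finally have R: "hmap (\<mu> Y) (vmap f a, vmap f b) \<cdot> (hmap (Gmor (Gmor f)) (a, b) \<cdot> ?J)
      = pinj Y (map (vmap f) ?j) \<cdot> (tens_arr A (map (hmap f) (steps ?j)) \<cdot> tsubst A (map (path_homs X) xss))"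
      unfolding R1 R2 .
    show "hmap (Gmor f \<odot> \<mu> X) (a, b) \<cdot> ?J = hmap (\<mu> Y \<odot> Gmor (Gmor f)) (a, b) \<cdot> ?J"
      using ab s L R mX(3)[OF ys] comp_assoc_hom[OF J m1 g1] comp_assoc_hom[OF J g2 m2]
      by (simp add: mX(2) GGf(2) Gf(2))
  qed
  thus "arr_map (Gamma_functor U V A) f \<odot> \<mu> X = \<mu> Y \<odot> arr_map (comp_functor G (Gamma_functor U V A) (Gamma_functor U V A)) f"
    using f Gf(1) by (simp add: comp_functor_def Hom_def)
qed

end

section \<open>The monad laws\<close>

context dist_mult
begin

lemma mult_hmap:
  assumes "X \<in> vgraphs U V" "a \<in> verts X" "b \<in> verts X"
  shows "hmap (\<mu> X) (a, b) \<in> Hom V (homs (\<Gamma> (\<Gamma> X)) (a, b)) (homs (\<Gamma> X) (a, b))"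
  using graph_homD(6)[OF mult_hom_graph(1)[OF assms(1)]] assms mult_hom_graph(2)[OF assms(1)] by simp

lemma unit_hmap:
  assumes "X \<in> vgraphs U V" "a \<in> verts X" "b \<in> verts X"
  shows "hmap (\<eta> X) (a, b) \<in> Hom V (homs X (a, b)) (homs (\<Gamma> X) (a, b))"
  using graph_homD(6)[OF unit_hom_graph(1)[OF assms(1)]] assms unit_hom_graph(2)[OF assms(1)] by simp

lemma mult_single:
  assumes X: "X \<in> vgraphs U V" and xs: "xs \<in> paths (verts X) a b"
  shows "hmap (\<mu> X) (a, b) \<cdot> (pinj (\<Gamma> X) [a, b] \<cdot> tens_arr A [pinj X xs])
    = pinj X xs \<cdot> tsubst A [path_homs X xs]"
proof -
  have "path_join [a, b] [xs] = xs" using pathsD[OF xs] by (cases xs) (auto simp: path_join_def)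
  moreover have "[a, b] \<in> paths (verts X) a b" using pathsD[OF xs] by (simp add: paths_def)
  ultimately show ?thesis using mult_hom_graph(3)[OF X, of "[a, b]" a b "[xs]"] xs by simp
qed

text \<open>The unit at \<open>\<Gamma> X\<close> sends the summand of \<open>xs\<close> to the
  one-step path \<open>[a, b]\<close> refined by \<open>xs\<close>, and joining this gives
  \<open>xs\<close> back. What remains is \<open>unit_outer\<close> of the multitensor.\<close>

lemma Gamma_unit_outer:
  assumes X: "X \<in> vgraphs U V"
  shows "\<mu> X \<odot> \<eta> (\<Gamma> X) = Ide G (\<Gamma> X)"
proof -
  note GX = Gamma_graph_in[OF X]
  note m = mult_hom_graph[OF X] and u = unit_hom_graph[OF GX]
  show ?thesis
  proof (rule Gamma_hom_eqI[OF X G.comp_in[OF u(1) m(1)] graph_ide_hom[OF GX]])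
    fix a assume "a \<in> verts X"
    thus "vmap (\<mu> X \<odot> \<eta> (\<Gamma> X)) a = vmap (Ide G (\<Gamma> X)) a"
      using graph_homD(1)[OF u(1)] by (simp add: m(2) u(2)) (simp add: graph_ide)
  next
    fix a b xs assume ab: "a \<in> verts X" "b \<in> verts X" and xs: "xs \<in> paths (verts X) a b"
    note xl = path_homs_lists[OF X pathsD(2)[OF xs]]
    note i = inj_hom[OF X xs]
    have ab': "a \<in> verts (\<Gamma> X)" "b \<in> verts (\<Gamma> X)" using ab by auto
    have iG: "pinj (\<Gamma> X) [a, b] \<in> Hom V (tens A [homs (\<Gamma> X) (a, b)]) (homs (\<Gamma> (\<Gamma> X)) (a, b))"
      using inj_hom[OF GX, of "[a, b]" a b] ab by (simp add: path_tensor_def paths_def)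
    have t: "tens_arr A [pinj X xs] \<in> Hom V (tens A [path_tensor A X xs]) (tens A [homs (\<Gamma> X) (a, b)])"
      using i by (intro tens_hom) simp
    note uo = unit_hom[OF path_tensor_obj[OF X pathsD(2)[OF xs]]]
    note ui = unit_hom[OF vgraph_homs[OF GX ab']]
    have s: "tsubst A [path_homs X xs] \<in> Hom V (tens A [path_tensor A X xs]) (path_tensor A X xs)"
      using subst_hom[of "[path_homs X xs]"] xl by (simp add: path_tensor_def)
    have "hmap (\<eta> (\<Gamma> X)) (a, b) \<cdot> pinj X xs
      = pinj (\<Gamma> X) [a, b] \<cdot> (tens_arr A [pinj X xs] \<cdot> tunit A (path_tensor A X xs))"
      using u(3)[OF ab'] comp_assoc_hom[OF i ui iG] unit_nat[OF i] by simp
    also have "\<dots> = (pinj (\<Gamma> X) [a, b] \<cdot> tens_arr A [pinj X xs]) \<cdot> tunit A (path_tensor A X xs)"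
      using comp_assoc_hom[OF uo t iG] by simp
    finally have 1: "hmap (\<eta> (\<Gamma> X)) (a, b) \<cdot> pinj X xs
      = (pinj (\<Gamma> X) [a, b] \<cdot> tens_arr A [pinj X xs]) \<cdot> tunit A (path_tensor A X xs)" .
    have "hmap (\<mu> X) (a, b) \<cdot> (hmap (\<eta> (\<Gamma> X)) (a, b) \<cdot> pinj X xs)
      = (pinj X xs \<cdot> tsubst A [path_homs X xs]) \<cdot> tunit A (path_tensor A X xs)"
      unfolding 1 by (rule comp_ext[OF uo comp_in[OF t iG] mult_hmap[OF X ab] mult_single[OF X xs]])
    also have "\<dots> = pinj X xs"
      using comp_assoc_hom[OF uo s i] unit_outer[of "path_homs X xs"] xl ide_right[OF i] by (simp add: path_tensor_def)
    finally have "hmap (\<mu> X) (a, b) \<cdot> (hmap (\<eta> (\<Gamma> X)) (a, b) \<cdot> pinj X xs) = pinj X xs" .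
    thus "hmap (\<mu> X \<odot> \<eta> (\<Gamma> X)) (a, b) \<cdot> pinj X xs = hmap (Ide G (\<Gamma> X)) (a, b) \<cdot> pinj X xs"
      using ab comp_assoc_hom[OF i unit_hmap[OF GX ab'] mult_hmap[OF X ab]] graph_homD(1)[OF u(1)]
      by (simp add: u(2)) (simp add: graph_ide ide_left[OF i])
  qed
qed

text \<open>Applying \<Gamma> to the unit sends the summand of \<open>xs\<close> to
  \<open>xs\<close> refined into its single steps, which joins to \<open>xs\<close>. What remains is
  \<open>unit_inner\<close> of the multitensor.\<close>

lemma Gamma_unit_inner:
  assumes X: "X \<in> vgraphs U V"
  shows "\<mu> X \<odot> Gmor (\<eta> X) = Ide G (\<Gamma> X)"
proof -
  note GX = Gamma_graph_in[OF X]
  note m = mult_hom_graph[OF X] and u = unit_hom_graph[OF X]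
  note Gu = Gamma_mor[OF u(1)]
  show ?thesis
  proof (rule Gamma_hom_eqI[OF X G.comp_in[OF Gu(1) m(1)] graph_ide_hom[OF GX]])
    fix a assume "a \<in> verts X"
    thus "vmap (\<mu> X \<odot> Gmor (\<eta> X)) a = vmap (Ide G (\<Gamma> X)) a"
      using graph_homD(1)[OF Gu(1)] by (simp add: m(2) u(2) Gu(2)) (simp add: graph_ide)
  next
    fix a b xs assume ab: "a \<in> verts X" "b \<in> verts X" and xs: "xs \<in> paths (verts X) a b"
    note xS = pathsD(2)[OF xs]
    note xl = path_homs_lists[OF X xS]
    note i = inj_hom[OF X xs]
    have xsG: "xs \<in> paths (verts (\<Gamma> X)) a b" using xs by simp
    note iG = inj_hom[OF GX xsG]
    let ?pair = "\<lambda>(a, b). [a, b]"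
    let ?xss = "map ?pair (steps xs)"
    have sp: "step_paths (verts X) xs ?xss"
      unfolding list_all2_map2 list_all2_same using steps_set_in[OF _ xS] by (auto simp: paths_def)
    have vm: "map (vmap (\<eta> X)) xs = xs" using xS by (auto simp: u(2) intro!: map_idI)
    have ph: "map (path_homs X) ?xss = map (\<lambda>X. [X]) (path_homs X xs)"
      by (auto simp: path_homs_def[of X xs])
    have pt: "map (path_tensor A X) ?xss = map (\<lambda>X. tens A [X]) (path_homs X xs)"
      by (auto simp: path_homs_def[of X xs] path_tensor_def)
    have hm: "tens_arr A (map (hmap (\<eta> X)) (steps xs))
      = tens_arr A (map (pinj X) ?xss) \<cdot> tens_arr A (map (tunit A) (path_homs X xs))"
    proof -
      have "map (hmap (\<eta> X)) (steps xs) = map (\<lambda>p. pinj X (?pair p) \<cdot> tunit A (homs X p)) (steps xs)"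
        by (rule map_steps_cong[OF xS]) (simp add: u(3))
      also have "tens_arr A \<dots> = tens_arr A (map (\<lambda>p. pinj X (?pair p)) (steps xs)) \<cdot> tens_arr A (map (\<lambda>p. tunit A (homs X p)) (steps xs))"
      proof (rule tens_comp_map[symmetric])
        fix p assume "p \<in> set (steps xs)"
        then obtain c d where p: "p = (c, d)" "c \<in> verts X" "d \<in> verts X"
          using steps_set_in[OF _ xS] by (metis prod.collapse)
        show "tunit A (homs X p) \<in> Hom V (homs X p) (tens A [homs X p])"
          using unit_hom[OF vgraph_homs[OF X p(2,3)]] p by simp
        show "pinj X (?pair p) \<in> Hom V (tens A [homs X p]) (homs (\<Gamma> X) p)"
          using inj_hom[OF X, of "[c, d]" c d] p by (simp add: path_tensor_def paths_def)
      qed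
      finally show ?thesis by (simp add: path_homs_def comp_def)
    qed
    have t1: "tens_arr A (map (pinj X) ?xss) \<in> Hom V (tens A (map (\<lambda>X. tens A [X]) (path_homs X xs))) (path_tensor A (\<Gamma> X) xs)"
      using tens_hom[OF map_pinj_hom[OF X xs sp]] unfolding pt by (simp add: path_tensor_def)
    have t2: "tens_arr A (map (tunit A) (path_homs X xs)) \<in> Hom V (path_tensor A X xs) (tens A (map (\<lambda>X. tens A [X]) (path_homs X xs)))"
    proof -
      have "map (tunit A) (path_homs X xs) \<in> Hom (seq_cat V) (map (\<lambda>X. X) (path_homs X xs)) (map (\<lambda>X. tens A [X]) (path_homs X xs))"
        using xl by (intro seq_hom_map unit_hom) auto
      from tens_hom[OF this] show ?thesis by (simp add: path_tensor_def)
    qed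
    have s: "tsubst A (map (\<lambda>X. [X]) (path_homs X xs)) \<in> Hom V (tens A (map (\<lambda>X. tens A [X]) (path_homs X xs))) (path_tensor A X xs)"
      using subst_hom[of "map (\<lambda>X. [X]) (path_homs X xs)"] xl by (simp add: path_tensor_def comp_def in_lists_conv_set)
    have gu: "hmap (Gmor (\<eta> X)) (a, b) \<in> Hom V (homs (\<Gamma> X) (a, b)) (homs (\<Gamma> (\<Gamma> X)) (a, b))"
      using graph_homD(6)[OF Gu(1)] ab by (simp add: Gu(2) u(2))
    have m1: "hmap (\<mu> X) (a, b) \<cdot> (pinj (\<Gamma> X) xs \<cdot> tens_arr A (map (pinj X) ?xss))
      = pinj X xs \<cdot> tsubst A (map (\<lambda>X. [X]) (path_homs X xs))"
      using m(3)[OF xs sp] path_join_pairs[OF pathsD(1)[OF xs]] unfolding ph by simp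
    have "hmap (\<mu> X) (a, b) \<cdot> (hmap (Gmor (\<eta> X)) (a, b) \<cdot> pinj X xs)
      = hmap (\<mu> X) (a, b) \<cdot> ((pinj (\<Gamma> X) xs \<cdot> tens_arr A (map (pinj X) ?xss)) \<cdot> tens_arr A (map (tunit A) (path_homs X xs)))"
      using Gu(3)[OF xs] vm hm comp_assoc_hom[OF t2 t1 iG] by simp
    also have "\<dots> = (pinj X xs \<cdot> tsubst A (map (\<lambda>X. [X]) (path_homs X xs))) \<cdot> tens_arr A (map (tunit A) (path_homs X xs))"
      by (rule comp_ext[OF t2 comp_in[OF t1 iG] mult_hmap[OF X ab] m1])
    also have "\<dots> = pinj X xs"
      using comp_assoc_hom[OF t2 s i] unit_inner[of "path_homs X xs"] xl ide_right[OF i] by (simp add: path_tensor_def)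
    finally have "hmap (\<mu> X) (a, b) \<cdot> (hmap (Gmor (\<eta> X)) (a, b) \<cdot> pinj X xs) = pinj X xs" .
    thus "hmap (\<mu> X \<odot> Gmor (\<eta> X)) (a, b) \<cdot> pinj X xs = hmap (Ide G (\<Gamma> X)) (a, b) \<cdot> pinj X xs"
      using ab comp_assoc_hom[OF i gu mult_hmap[OF X ab]] graph_homD(1)[OF Gu(1)]
      by (simp add: Gu(2) u(2)) (simp add: graph_ide ide_left[OF i])
  qed
qed

lemma triple_hom_eqI:
  assumes X: "X \<in> vgraphs U V" and f: "f \<in> Hom G (\<Gamma> (\<Gamma> (\<Gamma> X))) Y" and g: "g \<in> Hom G (\<Gamma> (\<Gamma> (\<Gamma> X))) Y"
    and v: "\<And>a. a \<in> verts X \<Longrightarrow> vmap f a = vmap g a"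
    and h: "\<And>a b zs ps. a \<in> verts X \<Longrightarrow> b \<in> verts X \<Longrightarrow> zs \<in> paths (verts X) a b
      \<Longrightarrow> list_all2 (\<lambda>(c, d) p. p \<in> double_paths (verts X) c d) (steps zs) ps
      \<Longrightarrow> hmap f (a, b) \<cdot> (pinj (\<Gamma> (\<Gamma> X)) zs \<cdot> tens_arr A (map (double_inj X) ps))
        = hmap g (a, b) \<cdot> (pinj (\<Gamma> (\<Gamma> X)) zs \<cdot> tens_arr A (map (double_inj X) ps))"
  shows "f = g"
proof (rule graph_hom_eqI[OF f g])
  fix a b assume ab: "a \<in> verts (\<Gamma> (\<Gamma> (\<Gamma> X)))" "b \<in> verts (\<Gamma> (\<Gamma> (\<Gamma> X)))"
  hence ab': "a \<in> verts X" "b \<in> verts X" by auto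
  have g': "hmap g (a, b) \<in> Hom V (homs (\<Gamma> (\<Gamma> (\<Gamma> X))) (a, b)) (homs Y (vmap f a, vmap f b))"
    using graph_homD(6)[OF g ab] v[OF ab'(1)] v[OF ab'(2)] by simp
  show "hmap f (a, b) = hmap g (a, b)"
    by (rule coproduct_eqI[OF triple_coproduct[OF X ab'] graph_homD(6)[OF f ab] g']) (use h[OF ab'] in auto)
qed (use v in auto)

text \<open>A summand of the threefold application is a path with a refined path over each step.
  Joining the two outer levels first leaves \<open>j\<close> refined by all the innermost paths;
  joining the two inner levels first leaves \<open>zs\<close> refined by \<open>js\<close>. The
  final paths coincide, and \<open>subst_assoc\<close> identifies the maps.\<close>

lemma Gamma_mult_assoc:
  assumes X: "X \<in> vgraphs U V"
  shows "\<mu> X \<odot> \<mu> (\<Gamma> X) = \<mu> X \<odot> Gmor (\<mu> X)"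
proof -
  note GX = Gamma_graph_in[OF X]
  note m = mult_hom_graph[OF X] and mG = mult_hom_graph[OF GX]
  note Gm = Gamma_mor[OF m(1)]
  show ?thesis
  proof (rule triple_hom_eqI[OF X G.comp_in[OF mG(1) m(1)] G.comp_in[OF Gm(1) m(1)]])
    fix a assume "a \<in> verts X"
    thus "vmap (\<mu> X \<odot> \<mu> (\<Gamma> X)) a = vmap (\<mu> X \<odot> Gmor (\<mu> X)) a"
      using graph_homD(1)[OF Gm(1)] graph_homD(1)[OF mG(1)] by (simp add: m(2) mG(2) Gm(2))
  next
    fix a b zs ps assume ab: "a \<in> verts X" "b \<in> verts X" and zs: "zs \<in> paths (verts X) a b"
      and ps: "list_all2 (\<lambda>(c, d) p. p \<in> double_paths (verts X) c d) (steps zs) ps"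
    have ab': "a \<in> verts (\<Gamma> X)" "b \<in> verts (\<Gamma> X)" using ab by auto
    have zsG: "zs \<in> paths (verts (\<Gamma> X)) a b" and zsGG: "zs \<in> paths (verts (\<Gamma> (\<Gamma> X))) a b" using zs by auto
    \<comment> \<open>\<open>ps\<close> contains one refined path for each step of
      \<open>zs\<close>: \<open>yss\<close> are the middle paths, \<open>xsss\<close> their
      refinements, and \<open>js\<close> the joins of the two.\<close>
    define yss where "yss = map fst ps"
    define xsss where "xsss = map snd ps"
    define js where "js = map (\<lambda>(ys, xss). path_join ys xss) ps"
    have yss: "step_paths (verts X) zs yss" unfolding yss_def list_all2_map2
      by (rule list_all2_mono[OF ps]) (auto simp: double_paths_def)
    have js: "step_paths (verts X) zs js" unfolding js_def list_all2_map2
      by (rule list_all2_mono[OF ps]) (auto simp: double_paths_def path_join)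
    have pD: "\<exists>c d. fst p \<in> paths (verts X) c d \<and> step_paths (verts X) (fst p) (snd p)" if p: "p \<in> set ps" for p
    proof -
      obtain i where i: "i < length ps" "p = ps ! i" using p by (auto simp: in_set_conv_nth)
      have "(case steps zs ! i of (c, d) \<Rightarrow> \<lambda>p. p \<in> double_paths (verts X) c d) p"
        using ps i by (simp add: list_all2_conv_all_nth)
      then obtain c d where "p \<in> double_paths (verts X) c d" by (cases "steps zs ! i") auto
      thus ?thesis unfolding double_paths_def by fastforce
    qed
    have yssG: "step_paths (verts (\<Gamma> X)) zs yss" using yss by simp
    define j where "j = path_join zs yss"
    have j: "j \<in> paths (verts X) a b" "steps j = concat (map steps yss)"
      using path_join[OF zs yss] by (auto simp: j_def)
    have jx: "step_paths (verts X) j (concat xsss)"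
      unfolding j(2)
    proof (rule list_all2_concat_intro)
      show "list_all2 (list_all2 (\<lambda>(c, d) xs. xs \<in> paths (verts X) c d)) (map steps yss) xsss"
        unfolding yss_def xsss_def list_all2_map1 list_all2_map2 list_all2_same using pD by auto
    qed
    \<comment> \<open>Either way the joined path is the first vertex of \<open>zs\<close> followed
      by the tails of all innermost paths in order.\<close>
    have jj: "path_join j (concat xsss) = path_join zs js"
    proof -
      have "concat (map tl (concat xsss)) = concat (map (\<lambda>p. concat (map tl (snd p))) ps)"
        unfolding xsss_def by (induction ps) auto
      moreover have "map tl js = map (\<lambda>p. concat (map tl (snd p))) ps"
        by (auto simp: js_def path_join_def)
      ultimately show ?thesis by (simp add: path_join_def j_def)
    qed
    let ?J = "pinj (\<Gamma> (\<Gamma> X)) zs \<cdot> tens_arr A (map (double_inj X) ps)"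
    let ?T = "tens A (map (double_tensor X) ps)"
    have J: "?J \<in> Hom V ?T (homs (\<Gamma> (\<Gamma> (\<Gamma> X))) (a, b))"
      using coproductD(3)[OF triple_coproduct[OF X ab], of "(zs, ps)"] zs ps by simp
    let ?Xsss = "map (map (path_homs X)) xsss"
    have Xsss: "?Xsss \<in> lists (lists (lists (Obj V)))"
    proof (rule in_listsI, rule ballI)
      fix Xss assume "Xss \<in> set ?Xsss"
      then obtain p where "p \<in> set ps" "Xss = map (path_homs X) (snd p)" by (auto simp: xsss_def)
      thus "Xss \<in> lists (lists (Obj V))" using pD path_homs_map_in[OF X] by metis
    qed
    have Tq: "?T = tens A (map (tens A) (map (map (tens A)) ?Xsss))"
      by (simp add: double_tensor_def path_tensor_def[abs_def] xsss_def comp_def case_prod_unfold)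
    let ?fss = "map (map (pinj X)) xsss"
    have fss: "?fss \<in> Hom (seq_cat (seq_cat V)) (map (map (path_tensor A X)) xsss) (map (path_homs (\<Gamma> X)) yss)"
      unfolding xsss_def yss_def map_map comp_def by (rule seq_hom_map) (use pD map_pinj_hom[OF X] in metis)
    have l1: "tens_arr A (map (double_inj X) ps) = tens_arr A (map (pinj (\<Gamma> X)) yss) \<cdot> tens_arr A (map (tens_arr A) ?fss)"
    proof -
      have "tens_arr A (map (pinj (\<Gamma> X)) yss) \<cdot> tens_arr A (map (tens_arr A) ?fss)
        = tens_arr A (map (\<lambda>p. pinj (\<Gamma> X) (fst p)) ps) \<cdot> tens_arr A (map (\<lambda>p. tens_arr A (map (pinj X) (snd p))) ps)"
        by (simp add: yss_def xsss_def comp_def)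
      also have "\<dots> = tens_arr A (map (\<lambda>p. pinj (\<Gamma> X) (fst p) \<cdot> tens_arr A (map (pinj X) (snd p))) ps)"
      proof (rule tens_comp_map)
        fix p assume "p \<in> set ps"
        then obtain c d where p: "fst p \<in> paths (verts X) c d" "step_paths (verts X) (fst p) (snd p)" using pD by blast
        show "tens_arr A (map (pinj X) (snd p)) \<in> Hom V (tens A (map (path_tensor A X) (snd p))) (path_tensor A (\<Gamma> X) (fst p))"
          using tens_hom[OF map_pinj_hom[OF X p]] by (simp add: path_tensor_def)
        show "pinj (\<Gamma> X) (fst p) \<in> Hom V (path_tensor A (\<Gamma> X) (fst p)) (homs (\<Gamma> (\<Gamma> X)) (hd (fst p), last (fst p)))"
          using inj_hom[OF GX, of "fst p" c d] p(1) pathsD(3,4)[OF p(1)] by simp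
      qed
      finally show ?thesis by (simp add: double_inj_def case_prod_unfold)
    qed
    have tf: "tens_arr A (map (tens_arr A) ?fss) \<in> Hom V ?T (tens A (map (path_tensor A (\<Gamma> X)) yss))"
    proof -
      have "map (\<lambda>p. tens_arr A (map (pinj X) (snd p))) ps
        \<in> Hom (seq_cat V) (map (double_tensor X) ps) (map (\<lambda>p. path_tensor A (\<Gamma> X) (fst p)) ps)"
      proof (rule seq_hom_map)
        fix p assume "p \<in> set ps"
        then obtain c d where p: "fst p \<in> paths (verts X) c d" "step_paths (verts X) (fst p) (snd p)" using pD by blast
        show "tens_arr A (map (pinj X) (snd p)) \<in> Hom V (double_tensor X p) (path_tensor A (\<Gamma> X) (fst p))"
          using tens_hom[OF map_pinj_hom[OF X p]] by (simp add: path_tensor_def double_tensor_def case_prod_unfold)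
      qed
      from tens_hom[OF this] show ?thesis by (simp add: xsss_def yss_def comp_def)
    qed
    have ty: "tens_arr A (map (pinj (\<Gamma> X)) yss) \<in> Hom V (tens A (map (path_tensor A (\<Gamma> X)) yss)) (path_tensor A (\<Gamma> (\<Gamma> X)) zs)"
      using tens_hom[OF map_pinj_hom[OF GX zsG yssG]] by (simp add: path_tensor_def)
    note iz = inj_hom[OF Gamma_graph_in[OF GX] zsGG]
    have jG: "j \<in> paths (verts (\<Gamma> X)) a b" using j by simp
    note ij = inj_hom[OF GX jG]
    have sG: "tsubst A (map (path_homs (\<Gamma> X)) yss) \<in> Hom V (tens A (map (path_tensor A (\<Gamma> X)) yss)) (path_tensor A (\<Gamma> X) j)"
      using subst_hom[OF path_homs_map_in[OF GX yssG]] path_homs_join[OF zsG yssG, of "\<Gamma> X"]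
      by (simp add: path_tensor_def[abs_def] comp_def j_def)
    have mGh: "hmap (\<mu> (\<Gamma> X)) (a, b) \<in> Hom V (homs (\<Gamma> (\<Gamma> (\<Gamma> X))) (a, b)) (homs (\<Gamma> (\<Gamma> X)) (a, b))"
      using mult_hmap[OF GX ab'] .
    have "hmap (\<mu> (\<Gamma> X)) (a, b) \<cdot> ?J
      = (pinj (\<Gamma> X) j \<cdot> tsubst A (map (path_homs (\<Gamma> X)) yss)) \<cdot> tens_arr A (map (tens_arr A) ?fss)"
      unfolding l1 comp_assoc_hom[OF tf ty iz, symmetric] j_def
      by (rule comp_ext[OF tf comp_in[OF ty iz] mGh mG(3)[OF zsG yssG]])
    also have "\<dots> = pinj (\<Gamma> X) j \<cdot> (tens_arr A (concat ?fss) \<cdot> tsubst A (map (map (path_tensor A X)) xsss))"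
      using comp_assoc_hom[OF tf sG ij] subst_nat[OF fss] by simp
    finally have L1: "hmap (\<mu> (\<Gamma> X)) (a, b) \<cdot> ?J
      = pinj (\<Gamma> X) j \<cdot> (tens_arr A (map (pinj X) (concat xsss)) \<cdot> tsubst A (map (map (path_tensor A X)) xsss))"
      by (simp add: map_concat)
    have tx: "tens_arr A (map (pinj X) (concat xsss)) \<in> Hom V (tens A (map (path_tensor A X) (concat xsss))) (path_tensor A (\<Gamma> X) j)"
      using tens_hom[OF map_pinj_hom[OF X j(1) jx]] by (simp add: path_tensor_def)
    have sx: "tsubst A (map (map (path_tensor A X)) xsss) \<in> Hom V ?T (tens A (map (path_tensor A X) (concat xsss)))"
    proof -
      have e: "map (map (path_tensor A X)) xsss = map (map (tens A)) ?Xsss"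
        by (simp add: path_tensor_def[abs_def])
      have "map (map (tens A)) ?Xsss \<in> lists (lists (Obj V))"
        using Xsss by (auto simp: in_lists_conv_set)
      from subst_hom[OF this] show ?thesis unfolding Tq e[symmetric] by (simp add: map_concat)
    qed
    have sc: "tsubst A (map (path_homs X) (concat xsss)) \<in> Hom V (tens A (map (path_tensor A X) (concat xsss))) (path_tensor A X (path_join j (concat xsss)))"
      using subst_hom[OF path_homs_map_in[OF X jx]] path_homs_join[OF j(1) jx, of X]
      by (simp add: path_tensor_def[abs_def] comp_def)
    note jxp = conjunct1[OF path_join[OF j(1) jx]]
    have "hmap (\<mu> X) (a, b) \<cdot> (hmap (\<mu> (\<Gamma> X)) (a, b) \<cdot> ?J)
      = (pinj X (path_join j (concat xsss)) \<cdot> tsubst A (map (path_homs X) (concat xsss))) \<cdot> tsubst A (map (map (path_tensor A X)) xsss)"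
      unfolding L1 comp_assoc_hom[OF sx tx ij, symmetric]
      by (rule comp_ext[OF sx comp_in[OF tx ij] mult_hmap[OF X ab] m(3)[OF j(1) jx]])
    also have "\<dots> = pinj X (path_join j (concat xsss)) \<cdot> (tsubst A (concat ?Xsss) \<cdot> tsubst A (map (map (tens A)) ?Xsss))"
      using comp_assoc_hom[OF sx sc inj_hom[OF X jxp]] by (simp add: map_concat path_tensor_def[abs_def] comp_def)
    finally have L: "hmap (\<mu> X) (a, b) \<cdot> (hmap (\<mu> (\<Gamma> X)) (a, b) \<cdot> ?J)
      = pinj X (path_join j (concat xsss)) \<cdot> (tsubst A (concat ?Xsss) \<cdot> tsubst A (map (map (tens A)) ?Xsss))" .
    let ?H = "\<lambda>p. pinj X (path_join (fst p) (snd p)) \<cdot> tsubst A (map (path_homs X) (snd p))"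
    have gm: "hmap (Gmor (\<mu> X)) (a, b) \<in> Hom V (homs (\<Gamma> (\<Gamma> (\<Gamma> X))) (a, b)) (homs (\<Gamma> (\<Gamma> X)) (a, b))"
      using graph_homD(6)[OF Gm(1)] ab by (simp add: Gm(2) m(2))
    have vm: "map (vmap (\<mu> X)) zs = zs" using pathsD(2)[OF zs] by (auto simp: m(2) intro!: map_idI)
    have R1: "hmap (Gmor (\<mu> X)) (a, b) \<cdot> ?J = pinj (\<Gamma> X) zs \<cdot> tens_arr A (map ?H ps)"
    proof -
      have "hmap (Gmor (\<mu> X)) (a, b) \<cdot> ?J
        = pinj (\<Gamma> X) (map (vmap (\<mu> X)) zs) \<cdot> tens_arr A (map ?H ps)"
      proof (rule Gamma_mor_layer[OF m(1) zsGG ps])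
        fix c d p assume "c \<in> verts (\<Gamma> (\<Gamma> X))" "d \<in> verts (\<Gamma> (\<Gamma> X))" and p: "p \<in> double_paths (verts X) c d"
        hence cd: "c \<in> verts X" "d \<in> verts X" by auto
        show "double_inj X p \<in> Hom V (double_tensor X p) (homs (\<Gamma> (\<Gamma> X)) (c, d))"
          by (rule coproductD(3)[OF double_coproduct[OF X cd] p])
        show "hmap (\<mu> X) (c, d) \<cdot> double_inj X p = ?H p"
          using m(3) p by (auto simp: double_inj_def double_paths_def)
      qed
      thus ?thesis using vm by simp
    qed
    let ?St = "map (tsubst A) ?Xsss"
    have R2: "tens_arr A (map ?H ps) = tens_arr A (map (pinj X) js) \<cdot> tens_arr A ?St"
    proof -
      have "tens_arr A (map (pinj X) js) \<cdot> tens_arr A ?St =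
        tens_arr A (map (\<lambda>p. pinj X (path_join (fst p) (snd p))) ps) \<cdot> tens_arr A (map (\<lambda>p. tsubst A (map (path_homs X) (snd p))) ps)"
        by (simp add: js_def xsss_def comp_def case_prod_unfold)
      also have "\<dots> = tens_arr A (map ?H ps)"
      proof (rule tens_comp_map)
        fix p assume "p \<in> set ps"
        then obtain c d where p: "fst p \<in> paths (verts X) c d" "step_paths (verts X) (fst p) (snd p)" using pD by blast
        show "tsubst A (map (path_homs X) (snd p)) \<in> Hom V (tens A (map (path_tensor A X) (snd p))) (path_tensor A X (path_join (fst p) (snd p)))"
          using subst_hom[OF path_homs_map_in[OF X p(2)]] path_homs_join[OF p, of X] by (simp add: path_tensor_def[abs_def] comp_def)
        note q = conjunct1[OF path_join[OF p]]
        show "pinj X (path_join (fst p) (snd p)) \<in> Hom V (path_tensor A X (path_join (fst p) (snd p)))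
          (homs (\<Gamma> X) (hd (path_join (fst p) (snd p)), last (path_join (fst p) (snd p))))"
          using inj_hom[OF X q] pathsD(3,4)[OF q] by simp
      qed
      finally show ?thesis by simp
    qed
    have phj: "map (path_homs X) js = map concat ?Xsss"
      unfolding js_def xsss_def map_map comp_def by (rule map_cong[OF refl]) (use pD path_homs_join in \<open>fastforce simp: case_prod_unfold\<close>)
    have ts: "tens_arr A ?St \<in> Hom V ?T (tens A (map (path_tensor A X) js))"
    proof -
      have "?St \<in> Hom (seq_cat V) (map (\<lambda>Xss. tens A (map (tens A) Xss)) ?Xsss) (map (\<lambda>Xss. tens A (concat Xss)) ?Xsss)"
        by (rule seq_hom_map, rule subst_hom) (use Xsss in blast)
      moreover have "map (\<lambda>Xss. tens A (concat Xss)) ?Xsss = map (path_tensor A X) js"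
        using arg_cong[OF phj, of "map (tens A)"] by (simp add: path_tensor_def[abs_def] comp_def)
      ultimately show ?thesis using tens_hom Tq by (fastforce simp: comp_def)
    qed
    have tj: "tens_arr A (map (pinj X) js) \<in> Hom V (tens A (map (path_tensor A X) js)) (path_tensor A (\<Gamma> X) zs)"
      using tens_hom[OF map_pinj_hom[OF X zs js]] by (simp add: path_tensor_def)
    note jsp = conjunct1[OF path_join[OF zs js]]
    have sj: "tsubst A (map (path_homs X) js) \<in> Hom V (tens A (map (path_tensor A X) js)) (path_tensor A X (path_join zs js))"
      using subst_hom[OF path_homs_map_in[OF X js]] path_homs_join[OF zs js, of X]
      by (simp add: path_tensor_def[abs_def] comp_def)
    note izG = inj_hom[OF GX zsG]
    have "hmap (\<mu> X) (a, b) \<cdot> (hmap (Gmor (\<mu> X)) (a, b) \<cdot> ?J)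
      = (pinj X (path_join zs js) \<cdot> tsubst A (map (path_homs X) js)) \<cdot> tens_arr A ?St"
      unfolding R1 R2 comp_assoc_hom[OF ts tj izG, symmetric]
      by (rule comp_ext[OF ts comp_in[OF tj izG] mult_hmap[OF X ab] m(3)[OF zs js]])
    also have "\<dots> = pinj X (path_join zs js) \<cdot> (tsubst A (map concat ?Xsss) \<cdot> tens_arr A ?St)"
      using comp_assoc_hom[OF ts sj inj_hom[OF X jsp]] unfolding phj by simp
    also have "\<dots> = hmap (\<mu> X) (a, b) \<cdot> (hmap (\<mu> (\<Gamma> X)) (a, b) \<cdot> ?J)"
      unfolding L jj using subst_assoc[of ?Xsss] Xsss by simp
    finally show "hmap (\<mu> X \<odot> \<mu> (\<Gamma> X)) (a, b) \<cdot> ?J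
       = hmap (\<mu> X \<odot> Gmor (\<mu> X)) (a, b) \<cdot> ?J"
      using comp_assoc_hom[OF J mGh mult_hmap[OF X ab]] comp_assoc_hom[OF J gm mult_hmap[OF X ab]] ab
        graph_homD(1)[OF Gm(1)] graph_homD(1)[OF mG(1)] by (simp add: mG(2) Gm(2) m(2))
  qed
qed

lemma monad_Gamma: "monad G (Gamma U V A)"
proof (rule monad.intro)
  show "cat_functor G G (endo (Gamma U V A))" using cat_functor_Gamma by (simp add: Gamma_def)
  show "nat_trans G G (id_functor G) (endo (Gamma U V A)) (munit (Gamma U V A))"
    using Gamma_unit_natural by (simp add: Gamma_def)
  show "nat_trans G G (comp_functor G (endo (Gamma U V A)) (endo (Gamma U V A))) (endo (Gamma U V A)) (mmult (Gamma U V A))"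
    using Gamma_mult_natural by (simp add: Gamma_def)
  fix X assume "X \<in> Obj G"
  hence X: "X \<in> vgraphs U V" by simp
  show "mmult (Gamma U V A) X \<odot> munit (Gamma U V A) (obj_map (endo (Gamma U V A)) X) = Ide G (obj_map (endo (Gamma U V A)) X)"
    using Gamma_unit_outer[OF X] X by (simp add: Gamma_def)
  show "mmult (Gamma U V A) X \<odot> arr_map (endo (Gamma U V A)) (munit (Gamma U V A) X) = Ide G (obj_map (endo (Gamma U V A)) X)"
    using Gamma_unit_inner[OF X] X by (simp add: Gamma_def Gamma_functor_simps(2)[OF unit_hom_graph(1)[OF X]])
  show "mmult (Gamma U V A) X \<odot> mmult (Gamma U V A) (obj_map (endo (Gamma U V A)) X)
     = mmult (Gamma U V A) X \<odot> arr_map (endo (Gamma U V A)) (mmult (Gamma U V A) X)"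
    using Gamma_mult_assoc[OF X] X by (simp add: Gamma_def Gamma_functor_simps(2)[OF mult_hom_graph(1)[OF X]])
qed

lemma monad_over_Set_Gamma: "monad_over_Set U V (Gamma U V A)"
  unfolding monad_over_Set_def identity_on_objects_def
  using monad_Gamma unit_hom_graph(2) mult_hom_graph(2) Gamma_mor(2)[OF Hom_cong_arr]
  by (auto simp: Gamma_def Gamma_functor_def)

end

section \<open>Pullbacks of coproducts and of graphs\<close>

lemma cartesian_transD:
  assumes "cartesian_trans C D F G \<tau>" "f \<in> Hom C a b"
  shows "is_pullback D (arr_map F f) (\<tau> a) (\<tau> b) (arr_map G f)"
  using assms by (auto simp: cartesian_trans_def Hom_def)

context extensive_cat
begin

text \<open>The maps \<open>p\<close> and \<open>p'\<close> need not respect a common index set: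
  summand \<open>i\<close> goes into summand \<open>\<phi> i\<close>, and several summands may share
  a target. Extensivity cuts the apex of a cone into pieces along the map to \<open>c'\<close>. On
  each piece the map to \<open>d\<close> factors through one summand, because its square over
  \<open>f\<close> is a pullback, and then the given pullback of summands applies.\<close>

lemma coproduct_map_pullback:
  assumes I: "small U I" and J: "small U J" and \<phi>: "\<And>i. i \<in> I \<Longrightarrow> \<phi> i \<in> J"
    and c: "is_coproduct V I A c \<iota>" and c': "is_coproduct V I A' c' \<iota>'"
    and d: "is_coproduct V J B d \<kappa>" and d': "is_coproduct V J B' d' \<kappa>'"
    and s: "\<And>i. i \<in> I \<Longrightarrow> s i \<in> Hom V (A i) (B (\<phi> i))" and s': "\<And>i. i \<in> I \<Longrightarrow> s' i \<in> Hom V (A' i) (B' (\<phi> i))"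
    and t: "\<And>i. i \<in> I \<Longrightarrow> t i \<in> Hom V (A i) (A' i)" and r: "\<And>j. j \<in> J \<Longrightarrow> r j \<in> Hom V (B j) (B' j)"
    and pb: "\<And>i. i \<in> I \<Longrightarrow> is_pullback V (s i) (t i) (r (\<phi> i)) (s' i)"
    and p: "p \<in> Hom V c d" "\<And>i. i \<in> I \<Longrightarrow> p \<cdot> \<iota> i = \<kappa> (\<phi> i) \<cdot> s i"
    and p': "p' \<in> Hom V c' d'" "\<And>i. i \<in> I \<Longrightarrow> p' \<cdot> \<iota>' i = \<kappa>' (\<phi> i) \<cdot> s' i"
    and q: "q \<in> Hom V c c'" "\<And>i. i \<in> I \<Longrightarrow> q \<cdot> \<iota> i = \<iota>' i \<cdot> t i"
    and f: "f \<in> Hom V d d'" "\<And>j. j \<in> J \<Longrightarrow> f \<cdot> \<kappa> j = \<kappa>' j \<cdot> r j"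
  shows "is_pullback V p q f p'"
proof -
  note C = coproductD(3)[OF c] and C' = coproductD(3)[OF c'] and D = coproductD(3)[OF d] and D' = coproductD(3)[OF d']
  have pbd: "is_pullback V (\<kappa> j) (r j) f (\<kappa>' j)" if "j \<in> J" for j
    by (rule coproduct_pullback[OF J d' d r f(1) f(2) that])
  have pbc: "is_pullback V (\<iota> i) (t i) q (\<iota>' i)" if "i \<in> I" for i
    by (rule coproduct_pullback[OF I c' c t q(1) q(2) that])
  show ?thesis
  proof (rule pullbackI[OF p(1) q(1) f(1) p'(1)])
    show "f \<cdot> p = p' \<cdot> q"
    proof (rule coproduct_eqI[OF c comp_in[OF p(1) f(1)] comp_in[OF q(1) p'(1)]])
      fix i assume i: "i \<in> I"
      have "(f \<cdot> p) \<cdot> \<iota> i = f \<cdot> (\<kappa> (\<phi> i) \<cdot> s i)"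
        using comp_assoc_hom[OF C[OF i] p(1) f(1)] p(2)[OF i] by simp
      also have "\<dots> = (\<kappa>' (\<phi> i) \<cdot> r (\<phi> i)) \<cdot> s i"
        by (rule comp_ext[OF s[OF i] D[OF \<phi>[OF i]] f(1) f(2)[OF \<phi>[OF i]]])
      also have "\<dots> = \<kappa>' (\<phi> i) \<cdot> (s' i \<cdot> t i)"
        using comp_assoc_hom[OF s[OF i] r[OF \<phi>[OF i]] D'[OF \<phi>[OF i]]] pullbackD(9)[OF pb[OF i]] by simp
      also have "\<dots> = p' \<cdot> (\<iota>' i \<cdot> t i)"
        using comp_ext[OF t[OF i] C'[OF i] p'(1) p'(2)[OF i]] comp_assoc_hom[OF t[OF i] s'[OF i] D'[OF \<phi>[OF i]]] by simp
      also have "\<dots> = (p' \<cdot> q) \<cdot> \<iota> i"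
        using comp_assoc_hom[OF C[OF i] q(1) p'(1)] q(2)[OF i] by simp
      finally show "(f \<cdot> p) \<cdot> \<iota> i = (p' \<cdot> q) \<cdot> \<iota> i" .
    qed
  next
    fix w x y assume x: "x \<in> Hom V w d" and y: "y \<in> Hom V w c'" and e: "f \<cdot> x = p' \<cdot> y"
    \<comment> \<open>The pieces of \<open>w\<close> on which \<open>y\<close> lands in a single
      summand of \<open>c'\<close>.\<close>
    obtain W h l where W: "is_coproduct V I W w l" and h: "\<And>i. i \<in> I \<Longrightarrow> h i \<in> Hom V (W i) (A' i)"
      "\<And>i. i \<in> I \<Longrightarrow> y \<cdot> l i = \<iota>' i \<cdot> h i"
      by (rule coproduct_decomp[OF I c' y]) blast
    note WD = coproductD[OF W]
    \<comment> \<open>Two factorizations in turn: \<open>m\<close> lifts the restriction of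
      \<open>x\<close> to the summand \<open>\<phi> i\<close> of \<open>d\<close>, and
      \<open>n\<close> is then induced by the pullback of summands.\<close>
    have "\<exists>n. n \<in> Hom V (W i) (A i) \<and> \<kappa> (\<phi> i) \<cdot> (s i \<cdot> n) = x \<cdot> l i \<and> t i \<cdot> n = h i" if i: "i \<in> I" for i
    proof -
      note \<phi>i = \<phi>[OF i]
      have "f \<cdot> (x \<cdot> l i) = (p' \<cdot> y) \<cdot> l i" by (rule comp_ext[OF WD(3)[OF i] x f(1) e])
      also have "\<dots> = p' \<cdot> (\<iota>' i \<cdot> h i)" using comp_assoc_hom[OF WD(3)[OF i] y p'(1)] h(2)[OF i] by simp
      also have "\<dots> = \<kappa>' (\<phi> i) \<cdot> (s' i \<cdot> h i)"
        using comp_ext[OF h(1)[OF i] C'[OF i] p'(1) p'(2)[OF i]] comp_assoc_hom[OF h(1)[OF i] s'[OF i] D'[OF \<phi>i]] by simp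
      finally obtain m where m: "m \<in> Hom V (W i) (B (\<phi> i))" "\<kappa> (\<phi> i) \<cdot> m = x \<cdot> l i" "r (\<phi> i) \<cdot> m = s' i \<cdot> h i"
        using pullback_ex[OF pbd[OF \<phi>i], of "x \<cdot> l i" "W i" "s' i \<cdot> h i"] WD(1)[OF i]
          comp_in[OF WD(3)[OF i] x] comp_in[OF h(1)[OF i] s'[OF i]] f(1) D'[OF \<phi>i] D[OF \<phi>i] by (auto simp: Hom_def)
      obtain n where "n \<in> Hom V (W i) (A i)" "s i \<cdot> n = m" "t i \<cdot> n = h i"
        using pullback_ex[OF pb[OF i], of m "W i" "h i"] m(1,3) h(1)[OF i] WD(1)[OF i] r[OF \<phi>i] s'[OF i] s[OF i]
        by (auto simp: Hom_def)
      thus ?thesis using m(2) by blast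
    qed
    then obtain n where n: "\<And>i. i \<in> I \<Longrightarrow> n i \<in> Hom V (W i) (A i)"
      "\<And>i. i \<in> I \<Longrightarrow> \<kappa> (\<phi> i) \<cdot> (s i \<cdot> n i) = x \<cdot> l i" "\<And>i. i \<in> I \<Longrightarrow> t i \<cdot> n i = h i" by metis
    have cn: "\<iota> i \<cdot> n i \<in> Hom V (W i) c" if "i \<in> I" for i by (rule comp_in[OF n(1)[OF that] C[OF that]])
    obtain k where k: "k \<in> Hom V w c" "\<And>i. i \<in> I \<Longrightarrow> k \<cdot> l i = \<iota> i \<cdot> n i"
      by (rule coproduct_ex[OF W coproductD(2)[OF c] cn]) blast+
    have "p \<cdot> k = x"
    proof (rule coproduct_eqI[OF W comp_in[OF k(1) p(1)] x])
      fix i assume i: "i \<in> I"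
      show "(p \<cdot> k) \<cdot> l i = x \<cdot> l i"
        using comp_assoc_hom[OF WD(3)[OF i] k(1) p(1)] k(2)[OF i] comp_ext[OF n(1)[OF i] C[OF i] p(1) p(2)[OF i]]
          comp_assoc_hom[OF n(1)[OF i] s[OF i] D[OF \<phi>[OF i]]] n(2)[OF i] by simp
    qed
    moreover have "q \<cdot> k = y"
    proof (rule coproduct_eqI[OF W comp_in[OF k(1) q(1)] y])
      fix i assume i: "i \<in> I"
      show "(q \<cdot> k) \<cdot> l i = y \<cdot> l i"
        using comp_assoc_hom[OF WD(3)[OF i] k(1) q(1)] k(2)[OF i] comp_ext[OF n(1)[OF i] C[OF i] q(1) q(2)[OF i]]
          comp_assoc_hom[OF n(1)[OF i] t[OF i] C'[OF i]] n(3)[OF i] h(2)[OF i] by simp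
    qed
    ultimately show "\<exists>h\<in>Hom V w c. p \<cdot> h = x \<and> q \<cdot> h = y" using k(1) by blast
  next
    fix w h h' assume h: "h \<in> Hom V w c" "h' \<in> Hom V w c" and e: "p \<cdot> h = p \<cdot> h'" "q \<cdot> h = q \<cdot> h'"
    obtain W g l where W: "is_coproduct V I W w l" and g: "\<And>i. i \<in> I \<Longrightarrow> g i \<in> Hom V (W i) (A' i)"
      "\<And>i. i \<in> I \<Longrightarrow> (q \<cdot> h) \<cdot> l i = \<iota>' i \<cdot> g i"
      by (rule coproduct_decomp[OF I c' comp_in[OF h(1) q(1)]]) blast
    note WD = coproductD[OF W]
    show "h = h'"
    proof (rule coproduct_eqI[OF W h])
      fix i assume i: "i \<in> I"
      note \<phi>i = \<phi>[OF i] and li = WD(3)[OF i]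
      \<comment> \<open>Applied to both \<open>h\<close> and \<open>h'\<close>. They agree after
        \<open>q\<close>, so one decomposition of \<open>w\<close> lifts both of them to the same
        summand of \<open>c\<close>.\<close>
      have lift: "\<exists>k. k \<in> Hom V (W i) (A i) \<and> \<iota> i \<cdot> k = x \<cdot> l i \<and> t i \<cdot> k = g i"
        if x: "x \<in> Hom V w c" "q \<cdot> x = q \<cdot> h" for x
      proof -
        have "q \<cdot> (x \<cdot> l i) = \<iota>' i \<cdot> g i" using comp_assoc_hom[OF li x(1) q(1)] x(2) g(2)[OF i] by simp
        thus ?thesis
          using pullback_ex[OF pbc[OF i], of "x \<cdot> l i" "W i" "g i"] comp_in[OF li x(1)] g(1)[OF i] WD(1)[OF i]
            q(1) C[OF i] C'[OF i] by (auto simp: Hom_def)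
      qed
      obtain k where k: "k \<in> Hom V (W i) (A i)" "\<iota> i \<cdot> k = h \<cdot> l i" "t i \<cdot> k = g i" using lift[OF h(1) refl] by blast
      obtain k' where k': "k' \<in> Hom V (W i) (A i)" "\<iota> i \<cdot> k' = h' \<cdot> l i" "t i \<cdot> k' = g i"
        using lift[OF h(2) e(2)[symmetric]] by blast
      have sk: "\<kappa> (\<phi> i) \<cdot> (s i \<cdot> u) = (p \<cdot> x) \<cdot> l i" if u: "u \<in> Hom V (W i) (A i)" "\<iota> i \<cdot> u = x \<cdot> l i" "x \<in> Hom V w c" for u x
        using comp_assoc_hom[OF li u(3) p(1)] u(2) comp_ext[OF u(1) C[OF i] p(1) p(2)[OF i]]
          comp_assoc_hom[OF u(1) s[OF i] D[OF \<phi>i]] by simp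
      have rk: "r (\<phi> i) \<cdot> (s i \<cdot> u) = s' i \<cdot> g i" if u: "u \<in> Hom V (W i) (A i)" "t i \<cdot> u = g i" for u
        using comp_ext[OF u(1) s[OF i] r[OF \<phi>i] pullbackD(9)[OF pb[OF i]]] comp_assoc_hom[OF u(1) t[OF i] s'[OF i]] u(2) by simp
      have "s i \<cdot> k = s i \<cdot> k'"
      proof (rule pullback_unique[OF pbd[OF \<phi>i]])
        show "s i \<cdot> k \<in> Hom V (W i) (Dom V (\<kappa> (\<phi> i)))" "s i \<cdot> k' \<in> Hom V (W i) (Dom V (\<kappa> (\<phi> i)))"
          using comp_in[OF k(1) s[OF i]] comp_in[OF k'(1) s[OF i]] HomD(2)[OF D[OF \<phi>i]] by auto
      qed (simp_all add: sk[OF k(1,2) h(1)] sk[OF k'(1,2) h(2)] e(1) rk[OF k(1,3)] rk[OF k'(1,3)])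
      hence "k = k'"
        using pullback_unique[OF pb[OF i], of k "W i" k'] k k' HomD(2)[OF s[OF i]] by simp
      thus "h \<cdot> l i = h' \<cdot> l i" using k(2) k'(2) by simp
    qed
  qed
qed

text \<open>Since \<open>q\<close> and \<open>f\<close> fix vertices, the vertex part of a mediating
  map can only be that of the component into \<open>B\<close>. The lifting problem is thereby
  reduced to the homs, where it is solved separately for each pair of vertices.\<close>

lemma graph_pullbackI:
  assumes p: "p \<in> Hom (graph_cat U V) P A" and q: "q \<in> Hom (graph_cat U V) P B"
    and f: "f \<in> Hom (graph_cat U V) A D" and g: "g \<in> Hom (graph_cat U V) B D"
    and vB: "verts B = verts P" "\<And>a. a \<in> verts P \<Longrightarrow> vmap q a = a"
    and vD: "\<And>a. a \<in> verts A \<Longrightarrow> vmap f a = a"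
    and v: "\<And>a. a \<in> verts P \<Longrightarrow> vmap p a = vmap g a"
    and pb: "\<And>a b. a \<in> verts P \<Longrightarrow> b \<in> verts P \<Longrightarrow>
      is_pullback V (hmap p (a, b)) (hmap q (a, b)) (hmap f (vmap p a, vmap p b)) (hmap g (a, b))"
  shows "is_pullback (graph_cat U V) p q f g"
proof -
  interpret G: category "graph_cat U V" by (rule category_graph_cat)
  note pD = graph_homD[OF p] and qD = graph_homD[OF q] and fD = graph_homD[OF f] and gD = graph_homD[OF g]
  show ?thesis
  proof (rule G.pullbackI[OF p q f g])
    show "f \<cdot>\<^bsub>graph_cat U V\<^esub> p = g \<cdot>\<^bsub>graph_cat U V\<^esub> q"
      by (rule graph_hom_eqI[OF G.comp_in[OF p f] G.comp_in[OF q g]])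
        (use pD(1,5) qD(1) vD v vB pullbackD(9)[OF pb] in auto)
  next
    fix W r s assume r: "r \<in> Hom (graph_cat U V) W A" and s: "s \<in> Hom (graph_cat U V) W B"
      and e: "f \<cdot>\<^bsub>graph_cat U V\<^esub> r = g \<cdot>\<^bsub>graph_cat U V\<^esub> s"
    note rD = graph_homD[OF r] and sD = graph_homD[OF s]
    have vs: "vmap s a \<in> verts P" if "a \<in> verts W" for a using sD(5)[OF that] vB by simp
    have vr: "vmap r a = vmap g (vmap s a)" if "a \<in> verts W" for a
      using arg_cong[OF e, of "\<lambda>k. vmap k a"] that rD(1,5) sD(1) vD by simp
    have er: "hmap f (vmap r a, vmap r b) \<cdot> hmap r (a, b) = hmap g (vmap s a, vmap s b) \<cdot> hmap s (a, b)"
      if "a \<in> verts W" "b \<in> verts W" for a b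
      using arg_cong[OF e, of "\<lambda>k. hmap k (a, b)"] that rD(1) sD(1) by simp
    have "\<exists>h. h \<in> Hom V (homs W (a, b)) (homs P (vmap s a, vmap s b)) \<and>
        hmap p (vmap s a, vmap s b) \<cdot> h = hmap r (a, b) \<and> hmap q (vmap s a, vmap s b) \<cdot> h = hmap s (a, b)"
      if ab: "a \<in> verts W" "b \<in> verts W" for a b
    proof -
      note pb' = pb[OF vs[OF ab(1)] vs[OF ab(2)]]
      have vv: "vmap p (vmap s a) = vmap r a" "vmap p (vmap s b) = vmap r b" using ab v vr vs by auto
      have 1: "hmap r (a, b) \<in> Hom V (homs W (a, b)) (Dom V (hmap f (vmap p (vmap s a), vmap p (vmap s b))))"
        unfolding vv using rD(6)[OF ab] HomD(2)[OF fD(6)[OF rD(5)[OF ab(1)] rD(5)[OF ab(2)]]] by simp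
      have 2: "hmap s (a, b) \<in> Hom V (homs W (a, b)) (Dom V (hmap g (vmap s a, vmap s b)))"
        using sD(6)[OF ab] HomD(2)[OF gD(6)[OF sD(5)[OF ab(1)] sD(5)[OF ab(2)]]] by simp
      have 3: "hmap f (vmap p (vmap s a), vmap p (vmap s b)) \<cdot> hmap r (a, b) = hmap g (vmap s a, vmap s b) \<cdot> hmap s (a, b)"
        unfolding vv by (rule er[OF ab])
      have 4: "Dom V (hmap p (vmap s a, vmap s b)) = homs P (vmap s a, vmap s b)"
        by (rule HomD(2)[OF pD(6)[OF vs[OF ab(1)] vs[OF ab(2)]]])
      show ?thesis using pullback_ex[OF pb' 1 2 hom_obj(1)[OF 1] 3] unfolding 4 by blast
    qed
    then obtain h where h: "\<And>a b. a \<in> verts W \<Longrightarrow> b \<in> verts W \<Longrightarrow> h a b \<in> Hom V (homs W (a, b)) (homs P (vmap s a, vmap s b))"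
      "\<And>a b. a \<in> verts W \<Longrightarrow> b \<in> verts W \<Longrightarrow> hmap p (vmap s a, vmap s b) \<cdot> h a b = hmap r (a, b)"
      "\<And>a b. a \<in> verts W \<Longrightarrow> b \<in> verts W \<Longrightarrow> hmap q (vmap s a, vmap s b) \<cdot> h a b = hmap s (a, b)" by metis
    let ?h = "graph_mor W P (vmap s) h"
    have hh: "?h \<in> Hom (graph_cat U V) W P" by (rule graph_mor_hom[OF rD(3) pD(3) vs h(1)])
    have "p \<cdot>\<^bsub>graph_cat U V\<^esub> ?h = r"
      by (rule graph_hom_eqI[OF G.comp_in[OF hh p] r]) (auto simp: h vs vr v)
    moreover have "q \<cdot>\<^bsub>graph_cat U V\<^esub> ?h = s"
      by (rule graph_hom_eqI[OF G.comp_in[OF hh q] s]) (auto simp: h vs vB)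
    ultimately show "\<exists>h\<in>Hom (graph_cat U V) W P. p \<cdot>\<^bsub>graph_cat U V\<^esub> h = r \<and> q \<cdot>\<^bsub>graph_cat U V\<^esub> h = s" using hh by blast
  next
    fix W h h' assume h: "h \<in> Hom (graph_cat U V) W P" and h': "h' \<in> Hom (graph_cat U V) W P"
      and e: "p \<cdot>\<^bsub>graph_cat U V\<^esub> h = p \<cdot>\<^bsub>graph_cat U V\<^esub> h'" "q \<cdot>\<^bsub>graph_cat U V\<^esub> h = q \<cdot>\<^bsub>graph_cat U V\<^esub> h'"
    note hD = graph_homD[OF h] and hD' = graph_homD[OF h']
    have vh: "vmap h a = vmap h' a" if "a \<in> verts W" for a
      using arg_cong[OF e(2), of "\<lambda>k. vmap k a"] that hD(1,5) hD'(1,5) vB by simp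
    show "h = h'"
    proof (rule graph_hom_eqI[OF h h' vh])
      fix a b assume ab: "a \<in> verts W" "b \<in> verts W"
      note ab' = hD(5)[OF ab(1)] hD(5)[OF ab(2)]
      have eq: "hmap p (vmap h a, vmap h b) \<cdot> hmap h (a, b) = hmap p (vmap h a, vmap h b) \<cdot> hmap h' (a, b)"
        "hmap q (vmap h a, vmap h b) \<cdot> hmap h (a, b) = hmap q (vmap h a, vmap h b) \<cdot> hmap h' (a, b)"
        using arg_cong[OF e(1), of "\<lambda>k. hmap k (a, b)"] arg_cong[OF e(2), of "\<lambda>k. hmap k (a, b)"]
          ab hD(1) hD'(1) vh by auto
      show "hmap h (a, b) = hmap h' (a, b)"
      proof (rule pullback_unique[OF pb[OF ab'] _ _ eq])
        show "hmap h (a, b) \<in> Hom V (homs W (a, b)) (Dom V (hmap p (vmap h a, vmap h b)))"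
          using hD(6)[OF ab] HomD(2)[OF pD(6)[OF ab']] by simp
        show "hmap h' (a, b) \<in> Hom V (homs W (a, b)) (Dom V (hmap p (vmap h a, vmap h b)))"
          using hD'(6)[OF ab] HomD(2)[OF pD(6)[OF ab']] vh ab by simp
      qed
    qed
  qed
qed

end

section \<open>Monad morphisms induced by maps of multitensors\<close>

locale dist_map = A: dist_mult U V A + B: dist_mult U V B + multitensor_map V A B \<theta>
  for U :: "'u set set" and V :: "('o, 'm) cat" (structure) and A B :: "('o, 'm) multitensor"
    and \<theta> :: "'o list \<Rightarrow> 'm"
begin

abbreviation G where "G \<equiv> graph_cat U V"
abbreviation \<tau> :: "('u, 'o) vgraph \<Rightarrow> ('u, 'o, 'm) vgraph_mor" where "\<tau> \<equiv> Gamma_trans U V A B \<theta>"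

lemma theta_hom:
  "X \<in> vgraphs U V \<Longrightarrow> set xs \<subseteq> verts X \<Longrightarrow> \<theta> (path_homs X xs) \<in> Hom V (path_tensor A X xs) (path_tensor B X xs)"
  unfolding path_tensor_def by (rule comp_hom[OF path_homs_lists])

lemma trans_hom:
  assumes X: "X \<in> vgraphs U V"
  shows "\<tau> X \<in> Hom G (Gamma_graph V A X) (Gamma_graph V B X)" "vmap (\<tau> X) = (\<lambda>a\<in>verts X. a)"
    "xs \<in> paths (verts X) a b \<Longrightarrow> hmap (\<tau> X) (a, b) \<cdot> path_inj V A X xs = path_inj V B X xs \<cdot> \<theta> (path_homs X xs)"
proof -
  let ?c = "\<lambda>a b. coprod_map V (paths (verts X) a b) (path_tensor A X) (path_tensor B X) (\<lambda>xs. \<theta> (path_homs X xs))"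
  have e: "\<tau> X = graph_mor (Gamma_graph V A X) (Gamma_graph V B X) (\<lambda>a. a) ?c"
    using X by (simp add: Gamma_trans_def graph_mor_def)
  have c: "?c a b \<in> Hom V (homs (Gamma_graph V A X) (a, b)) (homs (Gamma_graph V B X) (a, b))"
    "\<And>xs. xs \<in> paths (verts X) a b \<Longrightarrow> ?c a b \<cdot> path_inj V A X xs = path_inj V B X xs \<cdot> \<theta> (path_homs X xs)"
    if ab: "a \<in> verts X" "b \<in> verts X" for a b
  proof -
    have "small U (paths (verts X) a b)" by (rule A.small_paths[OF vgraph_small[OF X]])
    note cm = A.coprod_map[OF this, of "\<lambda>xs. \<theta> (path_homs X xs)" "path_tensor A X" "path_tensor B X", OF theta_hom[OF X pathsD(2)]]
    show "?c a b \<in> Hom V (homs (Gamma_graph V A X) (a, b)) (homs (Gamma_graph V B X) (a, b))"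
      using cm(1) ab by (simp add: Gamma_graph_def)
    show "\<And>xs. xs \<in> paths (verts X) a b \<Longrightarrow> ?c a b \<cdot> path_inj V A X xs = path_inj V B X xs \<cdot> \<theta> (path_homs X xs)"
      using cm(2) by (simp add: A.path_inj_eq[of _ X a b] B.path_inj_eq[of _ X a b])
  qed
  show "\<tau> X \<in> Hom G (Gamma_graph V A X) (Gamma_graph V B X)" unfolding e
    by (rule graph_mor_hom) (use A.Gamma_graph_in[OF X] B.Gamma_graph_in[OF X] c in auto)
  show "vmap (\<tau> X) = (\<lambda>a\<in>verts X. a)" unfolding e by (simp add: graph_mor_def)
  assume xs: "xs \<in> paths (verts X) a b"
  show "hmap (\<tau> X) (a, b) \<cdot> path_inj V A X xs = path_inj V B X xs \<cdot> \<theta> (path_homs X xs)"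
    unfolding e using c(2)[OF pathsD(5,6)[OF xs] xs] pathsD(5,6)[OF xs] by simp
qed

lemma trans_hmap:
  assumes "X \<in> vgraphs U V" "a \<in> verts X" "b \<in> verts X"
  shows "hmap (\<tau> X) (a, b) \<in> Hom V (homs (Gamma_graph V A X) (a, b)) (homs (Gamma_graph V B X) (a, b))"
  using graph_homD(6)[OF trans_hom(1)[OF assms(1)]] assms trans_hom(2)[OF assms(1)] by simp

lemma trans_naturality:
  assumes f: "f \<in> Hom G X Y"
  shows "Gamma_mor V B f \<odot> \<tau> X = \<tau> Y \<odot> Gamma_mor V A f"
proof -
  note F = graph_homD[OF f] and Af = A.Gamma_mor[OF f] and Bf = B.Gamma_mor[OF f]
  note tX = trans_hom[OF F(3)] and tY = trans_hom[OF F(4)]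
  show ?thesis
  proof (rule A.Gamma_hom_eqI[OF F(3) A.G.comp_in[OF tX(1) Bf(1)] A.G.comp_in[OF Af(1) tY(1)]])
    note s = graph_homD(1)[OF tX(1)] graph_homD(1)[OF Af(1)]
    show "vmap (Gamma_mor V B f \<odot> \<tau> X) a = vmap (\<tau> Y \<odot> Gamma_mor V A f) a" if "a \<in> verts X" for a
      using that s by (simp add: tX(2) tY(2) Af(2) Bf(2) F(5))
    fix a b xs assume ab: "a \<in> verts X" "b \<in> verts X" and xs: "xs \<in> paths (verts X) a b"
    note i = A.inj_hom[OF F(3) xs] and iB = B.inj_hom[OF F(3) xs]
    note fxs = path_map[of xs _ a b "vmap f", OF xs F(5)]
    note j = A.inj_hom[OF F(4) fxs] and jB = B.inj_hom[OF F(4) fxs]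
    note th = theta_hom[OF F(3) pathsD(2)[OF xs]] and thf = theta_hom[OF F(4) pathsD(2)[OF fxs]]
    note fs = A.hmap_steps_hom[OF f pathsD(2)[OF xs]]
    have tf: "tens_arr A (map (hmap f) (steps xs)) \<in> Hom V (path_tensor A X xs) (path_tensor A Y (map (vmap f) xs))"
      "tens_arr B (map (hmap f) (steps xs)) \<in> Hom V (path_tensor B X xs) (path_tensor B Y (map (vmap f) xs))"
      using A.tens_hom[OF fs] B.tens_hom[OF fs] by (auto simp: path_tensor_def)
    have bf: "hmap (Gamma_mor V B f) (a, b) \<in> Hom V (homs (Gamma_graph V B X) (a, b)) (homs (Gamma_graph V B Y) (vmap f a, vmap f b))"
      using graph_homD(6)[OF Bf(1)] ab Bf(2) by simp
    have af: "hmap (Gamma_mor V A f) (a, b) \<in> Hom V (homs (Gamma_graph V A X) (a, b)) (homs (Gamma_graph V A Y) (vmap f a, vmap f b))"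
      using graph_homD(6)[OF Af(1)] ab Af(2) by simp
    have ty: "hmap (\<tau> Y) (vmap f a, vmap f b) \<in> Hom V (homs (Gamma_graph V A Y) (vmap f a, vmap f b)) (homs (Gamma_graph V B Y) (vmap f a, vmap f b))"
      by (rule trans_hmap[OF F(4) F(5)[OF ab(1)] F(5)[OF ab(2)]])
    have "hmap (Gamma_mor V B f) (a, b) \<cdot> (hmap (\<tau> X) (a, b) \<cdot> path_inj V A X xs)
      = (path_inj V B Y (map (vmap f) xs) \<cdot> tens_arr B (map (hmap f) (steps xs))) \<cdot> \<theta> (path_homs X xs)"
      unfolding tX(3)[OF xs] by (rule A.comp_ext[OF th iB bf Bf(3)[OF xs]])
    also have "\<dots> = path_inj V B Y (map (vmap f) xs) \<cdot> (\<theta> (path_homs Y (map (vmap f) xs)) \<cdot> tens_arr A (map (hmap f) (steps xs)))"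
      using A.comp_assoc_hom[OF th tf(2) jB] nat.naturality[OF fs] by simp
    also have "\<dots> = hmap (\<tau> Y) (vmap f a, vmap f b) \<cdot> (hmap (Gamma_mor V A f) (a, b) \<cdot> path_inj V A X xs)"
      using Af(3)[OF xs] A.comp_ext[OF tf(1) j ty tY(3)[OF fxs]] A.comp_assoc_hom[OF tf(1) thf jB] by simp
    finally show "hmap (Gamma_mor V B f \<odot> \<tau> X) (a, b) \<cdot> path_inj V A X xs = hmap (\<tau> Y \<odot> Gamma_mor V A f) (a, b) \<cdot> path_inj V A X xs"
      using ab s A.comp_assoc_hom[OF i trans_hmap[OF F(3) ab] bf] A.comp_assoc_hom[OF i af ty]
      by (simp add: tX(2) Af(2))
  qed
qed

lemma trans_natural: "nat_trans G G (Gamma_functor U V A) (Gamma_functor U V B) \<tau>"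
proof (rule nat_transI[OF A.cat_functor_Gamma B.cat_functor_Gamma])
  show "\<tau> \<in> extensional (Obj G)" by (simp add: Gamma_trans_def)
  show "\<tau> X \<in> Hom G (obj_map (Gamma_functor U V A) X) (obj_map (Gamma_functor U V B) X)" if "X \<in> Obj G" for X
    using trans_hom(1)[of X] that by simp
  show "arr_map (Gamma_functor U V B) f \<odot> \<tau> X = \<tau> Y \<odot> arr_map (Gamma_functor U V A) f" if f: "f \<in> Hom G X Y" for f X Y
    using trans_naturality[OF f] f by simp
qed

lemma trans_unit:
  assumes X: "X \<in> vgraphs U V"
  shows "\<tau> X \<odot> Gamma_unit U V A X = Gamma_unit U V B X"
proof -
  note t = trans_hom[OF X] and uA = A.unit_hom_graph[OF X] and uB = B.unit_hom_graph[OF X]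
  show ?thesis
  proof (rule graph_hom_eqI[OF A.G.comp_in[OF uA(1) t(1)] uB(1)])
    note s = graph_homD(1)[OF uA(1)]
    fix a b assume ab: "a \<in> verts X" "b \<in> verts X"
    show "vmap (\<tau> X \<odot> Gamma_unit U V A X) a = vmap (Gamma_unit U V B X) a"
      using ab s by (simp add: t uA uB)
    have xs: "[a, b] \<in> paths (verts X) a b" using ab by (simp add: paths_def)
    note h = vgraph_homs[OF X ab]
    note u = A.unit_hom[OF h]
    have i: "path_inj V A X [a, b] \<in> Hom V (tens A [homs X (a, b)]) (homs (Gamma_graph V A X) (a, b))"
      "path_inj V B X [a, b] \<in> Hom V (tens B [homs X (a, b)]) (homs (Gamma_graph V B X) (a, b))"
      using A.inj_hom[OF X xs] B.inj_hom[OF X xs] by (auto simp: path_tensor_def)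
    have th: "\<theta> [homs X (a, b)] \<in> Hom V (tens A [homs X (a, b)]) (tens B [homs X (a, b)])"
      using comp_hom h by simp
    have "hmap (\<tau> X) (a, b) \<cdot> (path_inj V A X [a, b] \<cdot> tunit A (homs X (a, b)))
      = (path_inj V B X [a, b] \<cdot> \<theta> [homs X (a, b)]) \<cdot> tunit A (homs X (a, b))"
      by (rule A.comp_ext[OF u i(1) trans_hmap[OF X ab]]) (use t(3)[OF xs] in simp)
    also have "\<dots> = path_inj V B X [a, b] \<cdot> tunit B (homs X (a, b))"
      using A.comp_assoc_hom[OF u th i(2)] map_unit[OF h] by simp
    finally show "hmap (\<tau> X \<odot> Gamma_unit U V A X) (a, b) = hmap (Gamma_unit U V B X) (a, b)"
      using ab s by (simp add: uA(2,3) uB(3))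
  qed
qed

text \<open>On the summand of a refined path both sides reduce to the injection of the joined path
  for \<open>B\<close>, preceded by the two sides of \<open>map_subst\<close> at the homs of the
  refining paths. Naturality of \<theta> at the injections moves \<theta> past the first application
  of \<Gamma>.\<close>

lemma trans_mult:
  assumes X: "X \<in> vgraphs U V"
  shows "\<tau> X \<odot> Gamma_mult U V A X
    = Gamma_mult U V B X \<odot> (Gamma_mor V B (\<tau> X) \<odot> \<tau> (Gamma_graph V A X))"
proof -
  note XA = A.Gamma_graph_in[OF X] and XB = B.Gamma_graph_in[OF X]
  note t = trans_hom[OF X] and tA = trans_hom[OF XA]
  note Bt = B.Gamma_mor[OF t(1)]
  note mA = A.mult_hom_graph[OF X] and mB = B.mult_hom_graph[OF X]
  note r = A.G.comp_in[OF tA(1) Bt(1)]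
  show ?thesis
  proof (rule A.double_hom_eqI[OF X A.G.comp_in[OF mA(1) t(1)] A.G.comp_in[OF r mB(1)]])
    note s = graph_homD(1)[OF mA(1)] graph_homD(1)[OF r] graph_homD(1)[OF tA(1)]
    show "vmap (\<tau> X \<odot> Gamma_mult U V A X) a = vmap (Gamma_mult U V B X \<odot> (Gamma_mor V B (\<tau> X) \<odot> \<tau> (Gamma_graph V A X))) a"
      if "a \<in> verts X" for a
      using that s by (simp add: mA(2) mB(2) t(2) tA(2) Bt(2))
    fix a b ys xss assume ab: "a \<in> verts X" "b \<in> verts X" and ys: "ys \<in> paths (verts X) a b" "step_paths (verts X) ys xss"
    let ?pA = "path_inj V A" and ?pB = "path_inj V B" and ?XA = "Gamma_graph V A X" and ?XB = "Gamma_graph V B X"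
    let ?J = "?pA ?XA ys \<cdot> tens_arr A (map (?pA X) xss)"
    let ?Xss = "map (path_homs X) xss" and ?j = "path_join ys xss"
    note Xss = A.path_homs_map_in[OF X ys(2)]
    have Xss': "map (tens A) ?Xss \<in> lists (Obj V)" using Xss by auto
    have abA: "a \<in> verts ?XA" "b \<in> verts ?XA" using ab by auto
    have ysA: "ys \<in> paths (verts ?XA) a b" and ysB: "ys \<in> paths (verts ?XB) a b" using ys by auto
    note j = conjunct1[OF path_join[OF ys]]
    note ph = path_homs_join[OF ys, of X]
    have pt: "map (path_tensor A X) xss = map (tens A) ?Xss" "map (path_tensor B X) xss = map (tens B) ?Xss"
      by (simp_all add: path_tensor_def)
    have J: "?J \<in> Hom V (tens A (map (tens A) ?Xss)) (homs (Gamma_graph V A ?XA) (a, b))"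
      using coproductD(3)[OF A.double_coproduct[OF X ab], of "(ys, xss)"] ys
      unfolding A.double_paths_def A.double_inj_def A.double_tensor_def pt[symmetric] by simp
    have sA: "tsubst A ?Xss \<in> Hom V (tens A (map (tens A) ?Xss)) (path_tensor A X ?j)"
      using A.subst_hom[OF Xss] ph by (simp add: path_tensor_def)
    have sB: "tsubst B ?Xss \<in> Hom V (tens B (map (tens B) ?Xss)) (path_tensor B X ?j)"
      using B.subst_hom[OF Xss] ph by (simp add: path_tensor_def)
    note th = theta_hom[OF X pathsD(2)[OF j]]
    note iA = A.inj_hom[OF X j] and iB = B.inj_hom[OF X j]
    have L: "hmap (\<tau> X) (a, b) \<cdot> (hmap (Gamma_mult U V A X) (a, b) \<cdot> ?J) = ?pB X ?j \<cdot> (\<theta> (concat ?Xss) \<cdot> tsubst A ?Xss)"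
      using mA(3)[OF ys] A.comp_ext[OF sA iA trans_hmap[OF X ab] t(3)[OF j]] A.comp_assoc_hom[OF sA th iB] ph by simp
    have pA: "map (?pA X) xss \<in> Hom (seq_cat V) (map (tens A) ?Xss) (path_homs ?XA ys)"
      using A.map_pinj_hom[OF X ys] unfolding pt .
    have pB: "map (?pB X) xss \<in> Hom (seq_cat V) (map (tens B) ?Xss) (path_homs ?XB ys)"
      using B.map_pinj_hom[OF X ys] unfolding pt .
    have tpA: "tens_arr A (map (?pA X) xss) \<in> Hom V (tens A (map (tens A) ?Xss)) (path_tensor A ?XA ys)"
       "tens_arr B (map (?pA X) xss) \<in> Hom V (tens B (map (tens A) ?Xss)) (path_tensor B ?XA ys)"
      using A.tens_hom[OF pA] B.tens_hom[OF pA] by (simp_all add: path_tensor_def)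
    have tpB: "tens_arr B (map (?pB X) xss) \<in> Hom V (tens B (map (tens B) ?Xss)) (path_tensor B ?XB ys)"
      using B.tens_hom[OF pB] by (simp add: path_tensor_def)
    note iAA = A.inj_hom[OF XA ysA] and iBA = B.inj_hom[OF XA ysA] and iBB = B.inj_hom[OF XB ysB]
    note thA = theta_hom[OF XA pathsD(2)[OF ysA]]
    note thX = comp_hom[OF Xss']
    have R1: "hmap (\<tau> ?XA) (a, b) \<cdot> ?J = (?pB ?XA ys \<cdot> tens_arr B (map (?pA X) xss)) \<cdot> \<theta> (map (tens A) ?Xss)"
    proof -
      have "hmap (\<tau> ?XA) (a, b) \<cdot> ?J = (?pB ?XA ys \<cdot> \<theta> (path_homs ?XA ys)) \<cdot> tens_arr A (map (?pA X) xss)"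
        by (rule A.comp_ext[OF tpA(1) iAA trans_hmap[OF XA abA] tA(3)[OF ysA]])
      also have "\<dots> = ?pB ?XA ys \<cdot> (tens_arr B (map (?pA X) xss) \<cdot> \<theta> (map (tens A) ?Xss))"
        using A.comp_assoc_hom[OF tpA(1) thA iBA] nat.naturality[OF pA] by simp
      finally show ?thesis using A.comp_assoc_hom[OF thX tpA(2) iBA] by simp
    qed
    let ?H = "\<lambda>xs. ?pB X xs \<cdot> \<theta> (path_homs X xs)"
    have R2: "hmap (Gamma_mor V B (\<tau> X)) (a, b) \<cdot> (?pB ?XA ys \<cdot> tens_arr B (map (?pA X) xss)) = ?pB ?XB ys \<cdot> tens_arr B (map ?H xss)"
    proof -
      have "hmap (Gamma_mor V B (\<tau> X)) (a, b) \<cdot> (?pB ?XA ys \<cdot> tens_arr B (map (?pA X) xss))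
        = ?pB ?XB (map (vmap (\<tau> X)) ys) \<cdot> tens_arr B (map ?H xss)"
        by (rule B.Gamma_mor_layer[OF t(1) ysA, of "\<lambda>c d. paths (verts X) c d" xss "?pA X" "path_tensor A X"])
          (use ys A.inj_hom[OF X] t(3) in auto)
      moreover have "map (vmap (\<tau> X)) ys = ys" using pathsD(2)[OF ys(1)] by (auto simp: t(2) intro!: map_idI)
      ultimately show ?thesis by simp
    qed
    have th2: "map \<theta> ?Xss \<in> Hom (seq_cat V) (map (tens A) ?Xss) (map (tens B) ?Xss)" by (rule comp_map_hom[OF Xss])
    note tth = B.tens_hom[OF th2]
    have R3: "tens_arr B (map ?H xss) = tens_arr B (map (?pB X) xss) \<cdot> tens_arr B (map \<theta> ?Xss)"
    proof -
      have "map ?H xss = map2 (Comp V) (map (?pB X) xss) (map \<theta> ?Xss)" unfolding map_map map2_map_map by simp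
      thus ?thesis using B.tens_comp[OF th2 pB] by simp
    qed
    have R4: "hmap (Gamma_mult U V B X) (a, b) \<cdot> (?pB ?XB ys \<cdot> tens_arr B (map ?H xss)) = (?pB X ?j \<cdot> tsubst B ?Xss) \<cdot> tens_arr B (map \<theta> ?Xss)"
      unfolding R3 A.comp_assoc_hom[OF tth tpB iBB, symmetric]
      by (rule A.comp_ext[OF tth A.comp_in[OF tpB iBB] B.mult_hmap[OF X ab] mB(3)[OF ys]])
    have hBt: "hmap (Gamma_mor V B (\<tau> X)) (a, b) \<in> Hom V (homs (Gamma_graph V B ?XA) (a, b)) (homs (Gamma_graph V B ?XB) (a, b))"
      using graph_homD(6)[OF Bt(1)] ab by (simp add: Bt(2) t(2))
    have H: "?pB ?XB ys \<cdot> tens_arr B (map ?H xss) \<in> Hom V (tens B (map (tens A) ?Xss)) (homs (Gamma_graph V B ?XB) (a, b))"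
      unfolding R3 by (rule A.comp_in[OF A.comp_in[OF tth tpB] iBB])
    have "hmap (Gamma_mult U V B X) (a, b) \<cdot> (hmap (Gamma_mor V B (\<tau> X)) (a, b) \<cdot> (hmap (\<tau> ?XA) (a, b) \<cdot> ?J))
      = hmap (Gamma_mult U V B X) (a, b) \<cdot> ((?pB ?XB ys \<cdot> tens_arr B (map ?H xss)) \<cdot> \<theta> (map (tens A) ?Xss))"
      unfolding R1 A.comp_ext[OF thX A.comp_in[OF tpA(2) iBA] hBt R2] ..
    also have "\<dots> = ((?pB X ?j \<cdot> tsubst B ?Xss) \<cdot> tens_arr B (map \<theta> ?Xss)) \<cdot> \<theta> (map (tens A) ?Xss)"
      by (rule A.comp_ext[OF thX H B.mult_hmap[OF X ab] R4])
    also have "\<dots> = ?pB X ?j \<cdot> (tsubst B ?Xss \<cdot> (tens_arr B (map \<theta> ?Xss) \<cdot> \<theta> (map (tens A) ?Xss)))"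
      using A.comp_assoc_hom[OF thX tth A.comp_in[OF sB iB]] A.comp_assoc_hom[OF A.comp_in[OF thX tth] sB iB] by simp
    also have "\<dots> = ?pB X ?j \<cdot> (\<theta> (concat ?Xss) \<cdot> tsubst A ?Xss)"
      using map_subst[of ?Xss] Xss by simp
    finally have R: "hmap (Gamma_mult U V B X) (a, b) \<cdot> (hmap (Gamma_mor V B (\<tau> X)) (a, b) \<cdot> (hmap (\<tau> ?XA) (a, b) \<cdot> ?J))
      = ?pB X ?j \<cdot> (\<theta> (concat ?Xss) \<cdot> tsubst A ?Xss)" .
    have hr: "hmap (Gamma_mor V B (\<tau> X)) (a, b) \<cdot> hmap (\<tau> ?XA) (a, b) \<in> Hom V (homs (Gamma_graph V A ?XA) (a, b)) (homs (Gamma_graph V B ?XB) (a, b))"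
      by (rule A.comp_in[OF trans_hmap[OF XA abA] hBt])
    show "hmap (\<tau> X \<odot> Gamma_mult U V A X) (a, b) \<cdot> ?J
      = hmap (Gamma_mult U V B X \<odot> (Gamma_mor V B (\<tau> X) \<odot> \<tau> ?XA)) (a, b) \<cdot> ?J"
      using ab s L R A.comp_assoc_hom[OF J A.mult_hmap[OF X ab] trans_hmap[OF X ab]]
        A.comp_assoc_hom[OF J trans_hmap[OF XA abA] hBt] A.comp_assoc_hom[OF J hr B.mult_hmap[OF X ab]]
      by (simp add: mA(2) tA(2) t(2) Bt(2))
  qed
qed

lemma trans_monad_morphism: "monad_morphism G (Gamma U V A) (Gamma U V B) \<tau>"
proof (rule monad_morphism.intro[OF A.monad_Gamma B.monad_Gamma], rule monad_morphism_axioms.intro)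
  show "nat_trans G G (endo (Gamma U V A)) (endo (Gamma U V B)) \<tau>" using trans_natural by (simp add: Gamma_def)
  fix X assume "X \<in> Obj G"
  hence X: "X \<in> vgraphs U V" by simp
  show "\<tau> X \<odot> munit (Gamma U V A) X = munit (Gamma U V B) X" using trans_unit[OF X] by (simp add: Gamma_def)
  show "\<tau> X \<odot> mmult (Gamma U V A) X = mmult (Gamma U V B) X \<odot>
      (arr_map (endo (Gamma U V B)) (\<tau> X) \<odot> \<tau> (obj_map (endo (Gamma U V A)) X))"
    using trans_mult[OF X] X by (simp add: Gamma_def B.Gamma_functor_simps(2)[OF trans_hom(1)[OF X]])
qed

lemma trans_identity_on_objects: "identity_on_objects U V \<tau>"
  using trans_hom(2) by (simp add: identity_on_objects_def)

text \<open>The squares are computed on homs, where they are squares of coproducts. The index map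
  \<open>\<phi>\<close> of \<open>coproduct_map_pullback\<close> sends a path to its image under the
  vertex map of \<open>f\<close>, and the summand squares are naturality squares of
  \<theta>.\<close>

lemma trans_cartesian:
  assumes "cartesian_trans (seq_cat V) V (tensor A) (tensor B) \<theta>"
  shows "cartesian_trans G G (Gamma_functor U V A) (Gamma_functor U V B) \<tau>"
  unfolding cartesian_trans_def
proof (intro conjI ballI trans_natural)
  fix f assume "f \<in> Arr G"
  from Hom_cong_arr[OF this] obtain X Y where f: "f \<in> Hom G X Y" ..
  note F = graph_homD[OF f] and Af = A.Gamma_mor[OF f] and Bf = B.Gamma_mor[OF f]
  note tX = trans_hom[OF F(3)] and tY = trans_hom[OF F(4)]
  have "is_pullback G (Gamma_mor V A f) (\<tau> X) (\<tau> Y) (Gamma_mor V B f)"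
  proof (rule A.graph_pullbackI[OF Af(1) tX(1) tY(1) Bf(1)])
    fix a b assume "a \<in> verts (Gamma_graph V A X)" "b \<in> verts (Gamma_graph V A X)"
    hence ab: "a \<in> verts X" "b \<in> verts X" by auto
    note fab = F(5)[OF ab(1)] F(5)[OF ab(2)]
    note sm = A.small_paths[OF vgraph_small[OF F(3)], of a b] A.small_paths[OF vgraph_small[OF F(4)], of "vmap f a" "vmap f b"]
    have fp: "map (vmap f) xs \<in> paths (verts Y) (vmap f a) (vmap f b)" if "xs \<in> paths (verts X) a b" for xs
      using path_map[of xs _ a b "vmap f", OF that F(5)] .
    have fs: "map (hmap f) (steps xs) \<in> Hom (seq_cat V) (path_homs X xs) (path_homs Y (map (vmap f) xs))"
      if "xs \<in> paths (verts X) a b" for xs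
      using A.hmap_steps_hom[OF f pathsD(2)[OF that]] .
    have "is_pullback V (hmap (Gamma_mor V A f) (a, b)) (hmap (\<tau> X) (a, b)) (hmap (\<tau> Y) (vmap f a, vmap f b)) (hmap (Gamma_mor V B f) (a, b))"
    proof (rule A.coproduct_map_pullback[OF sm fp A.Gamma_coproduct[OF F(3) ab] B.Gamma_coproduct[OF F(3) ab]
          A.Gamma_coproduct[OF F(4) fab] B.Gamma_coproduct[OF F(4) fab]])
      show "hmap (Gamma_mor V A f) (a, b) \<in> Hom V (homs (Gamma_graph V A X) (a, b)) (homs (Gamma_graph V A Y) (vmap f a, vmap f b))"
        using graph_homD(6)[OF Af(1)] ab Af(2) by simp
      show "hmap (Gamma_mor V B f) (a, b) \<in> Hom V (homs (Gamma_graph V B X) (a, b)) (homs (Gamma_graph V B Y) (vmap f a, vmap f b))"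
        using graph_homD(6)[OF Bf(1)] ab Bf(2) by simp
      show "hmap (\<tau> X) (a, b) \<in> Hom V (homs (Gamma_graph V A X) (a, b)) (homs (Gamma_graph V B X) (a, b))"
        by (rule trans_hmap[OF F(3) ab])
      show "hmap (\<tau> Y) (vmap f a, vmap f b) \<in> Hom V (homs (Gamma_graph V A Y) (vmap f a, vmap f b)) (homs (Gamma_graph V B Y) (vmap f a, vmap f b))"
        by (rule trans_hmap[OF F(4) fab])
      fix xs assume xs: "xs \<in> paths (verts X) a b"
      show "hmap (Gamma_mor V A f) (a, b) \<cdot> path_inj V A X xs = path_inj V A Y (map (vmap f) xs) \<cdot> tens_arr A (map (hmap f) (steps xs))"
        by (rule Af(3)[OF xs])
      show "hmap (Gamma_mor V B f) (a, b) \<cdot> path_inj V B X xs = path_inj V B Y (map (vmap f) xs) \<cdot> tens_arr B (map (hmap f) (steps xs))"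
        by (rule Bf(3)[OF xs])
      show "tens_arr A (map (hmap f) (steps xs)) \<in> Hom V (path_tensor A X xs) (path_tensor A Y (map (vmap f) xs))"
        using A.tens_hom[OF fs[OF xs]] by (simp add: path_tensor_def)
      show "tens_arr B (map (hmap f) (steps xs)) \<in> Hom V (path_tensor B X xs) (path_tensor B Y (map (vmap f) xs))"
        using B.tens_hom[OF fs[OF xs]] by (simp add: path_tensor_def)
      show "hmap (\<tau> X) (a, b) \<cdot> path_inj V A X xs = path_inj V B X xs \<cdot> \<theta> (path_homs X xs)" by (rule tX(3)[OF xs])
      show "\<theta> (path_homs X xs) \<in> Hom V (path_tensor A X xs) (path_tensor B X xs)" by (rule theta_hom[OF F(3) pathsD(2)[OF xs]])
      show "is_pullback V (tens_arr A (map (hmap f) (steps xs))) (\<theta> (path_homs X xs)) (\<theta> (path_homs Y (map (vmap f) xs))) (tens_arr B (map (hmap f) (steps xs)))"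
        by (rule cartesian_transD[OF assms fs[OF xs]])
    next
      fix ys assume ys: "ys \<in> paths (verts Y) (vmap f a) (vmap f b)"
      show "hmap (\<tau> Y) (vmap f a, vmap f b) \<cdot> path_inj V A Y ys = path_inj V B Y ys \<cdot> \<theta> (path_homs Y ys)" by (rule tY(3)[OF ys])
      show "\<theta> (path_homs Y ys) \<in> Hom V (path_tensor A Y ys) (path_tensor B Y ys)" by (rule theta_hom[OF F(4) pathsD(2)[OF ys]])
    qed
    thus "is_pullback V (hmap (Gamma_mor V A f) (a, b)) (hmap (\<tau> X) (a, b))
      (hmap (\<tau> Y) (vmap (Gamma_mor V A f) a, vmap (Gamma_mor V A f) b)) (hmap (Gamma_mor V B f) (a, b))"
      by (simp add: Af(2))
  qed (simp_all add: Af(2) Bf(2) tX(2) tY(2))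
  thus "is_pullback G (arr_map (Gamma_functor U V A) f) (\<tau> (Dom G f)) (\<tau> (Cod G f)) (arr_map (Gamma_functor U V B) f)"
    using f F(1,2) by simp
qed

end

section \<open>Functoriality of \<Gamma> in the multitensor\<close>

lemma (in dist_mult) trans_id:
  "Gamma_trans U V A A (id_trans (seq_cat V) V (tensor A)) = id_trans G G (Gamma_functor U V A)"
proof -
  interpret I: dist_map U V A A "id_trans (seq_cat V) V (tensor A)"
    by (intro dist_map.intro dist_mult_axioms multitensor_map_id multitensor_axioms)
  show ?thesis
  proof (rule nat_trans_eqI[OF I.trans_natural nat_trans_id[OF cat_functor_Gamma]])
    fix X assume "X \<in> Obj G"
    hence X: "X \<in> vgraphs U V" by simp
    note t = I.trans_hom[OF X] and i = graph_ide_hom[OF Gamma_graph_in[OF X]]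
    have "Gamma_trans U V A A (id_trans (seq_cat V) V (tensor A)) X = Ide G (\<Gamma> X)"
    proof (rule Gamma_hom_eqI[OF X t(1) i])
      fix a b xs assume ab: "a \<in> verts X" "b \<in> verts X" and xs: "xs \<in> paths (verts X) a b"
      note ii = inj_hom[OF X xs]
      have "id_trans (seq_cat V) V (tensor A) (path_homs X xs) = Ide V (path_tensor A X xs)"
        using path_homs_lists[OF X pathsD(2)[OF xs]] by (simp add: id_trans_apply path_tensor_def)
      thus "hmap (Gamma_trans U V A A (id_trans (seq_cat V) V (tensor A)) X) (a, b) \<cdot> pinj X xs = hmap (Ide G (\<Gamma> X)) (a, b) \<cdot> pinj X xs"
        using t(3)[OF xs] ide_right[OF ii] ab by (simp add: graph_ide ide_left[OF ii])
    qed (simp add: t(2) graph_ide)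
    thus "Gamma_trans U V A A (id_trans (seq_cat V) V (tensor A)) X = id_trans G G (Gamma_functor U V A) X"
      using X by (simp add: id_trans_apply)
  qed
qed

lemma (in extensive_cat) trans_vert_comp:
  assumes AB: "dist_map U V A B \<alpha>" and BC: "dist_map U V B C \<beta>"
  shows "Gamma_trans U V A C (vert_comp (seq_cat V) V \<beta> \<alpha>)
    = vert_comp (graph_cat U V) (graph_cat U V) (Gamma_trans U V B C \<beta>) (Gamma_trans U V A B \<alpha>)"
proof -
  interpret AB: dist_map U V A B \<alpha> by fact
  interpret BC: dist_map U V B C \<beta> by fact
  interpret AC: dist_map U V A C "vert_comp (seq_cat V) V \<beta> \<alpha>"
    by (intro dist_map.intro AB.A.dist_mult_axioms BC.B.dist_mult_axioms
        multitensor_map_comp[OF AB.multitensor_map_axioms BC.multitensor_map_axioms])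
  let ?G = "graph_cat U V"
  show ?thesis
  proof (rule nat_trans_eqI[OF AC.trans_natural nat_trans_vert_comp[OF AB.trans_natural BC.trans_natural]])
    fix X assume "X \<in> Obj ?G"
    hence X: "X \<in> vgraphs U V" by simp
    note a = AB.trans_hom[OF X] and b = BC.trans_hom[OF X] and c = AC.trans_hom[OF X]
    have "Gamma_trans U V A C (vert_comp (seq_cat V) V \<beta> \<alpha>) X = Gamma_trans U V B C \<beta> X \<cdot>\<^bsub>?G\<^esub> Gamma_trans U V A B \<alpha> X"
    proof (rule AB.A.Gamma_hom_eqI[OF X c(1) graph_comp_hom[OF a(1) b(1)]])
      note s = graph_homD(1)[OF a(1)]
      show "vmap (Gamma_trans U V A C (vert_comp (seq_cat V) V \<beta> \<alpha>) X) x = vmap (Gamma_trans U V B C \<beta> X \<cdot>\<^bsub>?G\<^esub> Gamma_trans U V A B \<alpha> X) x"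
        if "x \<in> verts X" for x using that s by (simp add: a(2) b(2) c(2))
      fix x y xs assume xy: "x \<in> verts X" "y \<in> verts X" and xs: "xs \<in> paths (verts X) x y"
      note xS = pathsD(2)[OF xs]
      note ta = AB.theta_hom[OF X xS] and tb = BC.theta_hom[OF X xS]
      note iA = AB.A.inj_hom[OF X xs] and iB = AB.B.inj_hom[OF X xs] and iC = BC.B.inj_hom[OF X xs]
      note ha = AB.trans_hmap[OF X xy] and hb = BC.trans_hmap[OF X xy]
      show "hmap (Gamma_trans U V A C (vert_comp (seq_cat V) V \<beta> \<alpha>) X) (x, y) \<cdot> path_inj V A X xs
        = hmap (Gamma_trans U V B C \<beta> X \<cdot>\<^bsub>?G\<^esub> Gamma_trans U V A B \<alpha> X) (x, y) \<cdot> path_inj V A X xs"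
        using c(3)[OF xs] path_homs_lists[OF X xS] comp_assoc_hom[OF iA ha hb] a(3)[OF xs]
          comp_ext[OF ta iB hb b(3)[OF xs]] comp_assoc_hom[OF ta tb iC] xy s
        by (simp add: vert_comp_apply a(2))
    qed
    thus "Gamma_trans U V A C (vert_comp (seq_cat V) V \<beta> \<alpha>) X = vert_comp ?G ?G (Gamma_trans U V B C \<beta>) (Gamma_trans U V A B \<alpha>) X"
      using X by (simp add: vert_comp_apply)
  qed
qed

section \<open>Linear graphs\<close>

text \<open>On lines this is the vertex at which block \<open>i\<close> starts in the line of the
  concatenation. For \<open>i\<close> equal to the number of blocks it is the last vertex.\<close>

definition off :: "'a list list \<Rightarrow> nat \<Rightarrow> nat" where
  "off xss i = length (concat (take i xss))"

lemma off_0 [simp]: "off xss 0 = 0"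
  by (simp add: off_def)

lemma off_length: "off xss (length xss) = length (concat xss)"
  by (simp add: off_def)

lemma off_Suc: "i < length xss \<Longrightarrow> off xss (Suc i) = off xss i + length (xss ! i)"
  by (simp add: off_def take_Suc_conv_app_nth)

lemma take_off:
  assumes "i < length xss" "j \<le> length (xss ! i)"
  shows "take (off xss i + j) (concat xss) = concat (take i xss) @ take j (xss ! i)"
proof -
  have "concat xss = concat (take i xss) @ xss ! i @ concat (drop (Suc i) xss)"
    using assms(1) by (metis concat.simps(2) concat_append id_take_nth_drop)
  hence "take (off xss i + j) (concat xss) = take (off xss i + j) (concat (take i xss) @ xss ! i @ concat (drop (Suc i) xss))"
    by simp
  thus ?thesis using assms(2) by (simp add: off_def)
qed

lemma off_le:
  assumes "i < length xss" "j \<le> length (xss ! i)"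
  shows "off xss i + j \<le> length (concat xss)"
proof -
  have "concat xss = concat (take i xss) @ xss ! i @ concat (drop (Suc i) xss)"
    using assms(1) by (metis concat.simps(2) concat_append id_take_nth_drop)
  from arg_cong[OF this, of length] show ?thesis using assms(2) by (simp add: off_def)
qed

lemma off_le_length: "i \<le> length xss \<Longrightarrow> off xss i \<le> length (concat xss)"
  using off_le[of i xss 0] off_length[of xss] by (cases "i = length xss") auto

lemma concat_nth_off:
  assumes "i < length xss" "j < length (xss ! i)"
  shows "concat xss ! (off xss i + j) = xss ! i ! j"
proof -
  have "concat xss = concat (take i xss) @ xss ! i @ concat (drop (Suc i) xss)"
    using assms(1) by (metis concat.simps(2) concat_append id_take_nth_drop)
  from arg_cong[OF this, of "\<lambda>zs. zs ! (off xss i + j)"] show ?thesis using assms(2)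
    by (simp add: off_def nth_append)
qed

lemma off_map_length: "(\<And>x. x \<in> set xss \<Longrightarrow> length (f x) = length x) \<Longrightarrow> off (map f xss) i = off xss i"
  by (induction xss arbitrary: i) (auto simp: off_def take_Cons' split: if_splits)

lemma off_cong:
  assumes "map length xss = map length yss"
  shows "off xss i = off yss i"
  unfolding off_def length_concat take_map[symmetric] assms ..

text \<open>Positions in a twofold concatenation can be counted over all inner blocks or first over
  outer blocks and then inside one. The bound on \<open>j\<close> is not strict, so the end of an
  outer block is included.\<close>

lemma off_concat:
  assumes "i < length xsss" "j \<le> length (xsss ! i)"
  shows "off (concat xsss) (off xsss i + j) = off (map concat xsss) i + off (xsss ! i) j"
proof -
  have "length (concat (concat zsss)) = length (concat (map concat zsss))" for zsss :: "'a list list list"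
    by (induction zsss) auto
  thus ?thesis using take_off[OF assms] by (simp add: off_def take_map)
qed

text \<open>Vertices of graphs are elements of the type \<open>'u\<close>; \<open>e\<close> places
  the natural numbers there, to serve as the vertices of lines.\<close>

locale line_cat = extensive_cat U V for U :: "'u set set" and V :: "('o, 'm) cat" (structure) +
  fixes e :: "nat \<Rightarrow> 'u"
  assumes inj_e: "inj e"
begin

abbreviation G where "G \<equiv> graph_cat U V"
sublocale G: category G by (rule category_graph_cat)

abbreviation ix :: "'u \<Rightarrow> nat" where "ix \<equiv> inv e"

lemma ix [simp]: "ix (e i) = i"
  using inj_e by simp

lemma e_eq [simp]: "e i = e j \<longleftrightarrow> i = j"
  using inj_e by (auto dest: injD)

text \<open>All homs between vertices that are not consecutive are initial. A map out of a line is
  therefore the same as a choice of vertices and of maps on the consecutive homs, which is what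
  \<open>line_mor\<close> builds and \<open>line_hom_eqI\<close> uses.\<close>

definition line :: "'o list \<Rightarrow> ('u, 'o) vgraph" where
  "line Xs = \<lparr>verts = e ` {..length Xs},
     homs = (\<lambda>(a, b)\<in>e ` {..length Xs} \<times> e ` {..length Xs}. if ix b = Suc (ix a) then Xs ! ix a else initial)\<rparr>"

definition line_mor :: "'o list \<Rightarrow> ('u, 'o) vgraph \<Rightarrow> (nat \<Rightarrow> 'u) \<Rightarrow> (nat \<Rightarrow> 'm) \<Rightarrow> ('u, 'o, 'm) vgraph_mor" where
  "line_mor Xs Y v f = graph_mor (line Xs) Y (\<lambda>a. v (ix a))
     (\<lambda>a b. if ix b = Suc (ix a) then f (ix a) else from_initial (homs Y (v (ix a), v (ix b))))"

lemma verts_line: "verts (line Xs) = e ` {..length Xs}"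
  by (simp add: line_def)

lemma e_in_line [simp]: "e i \<in> verts (line Xs) \<longleftrightarrow> i \<le> length Xs"
  by (auto simp: verts_line)

lemma homs_line:
  "i < length Xs \<Longrightarrow> homs (line Xs) (e i, e (Suc i)) = Xs ! i"
  "i \<le> length Xs \<Longrightarrow> j \<le> length Xs \<Longrightarrow> j \<noteq> Suc i \<Longrightarrow> homs (line Xs) (e i, e j) = initial"
  by (auto simp: line_def)

lemma line_in:
  assumes "Xs \<in> lists (Obj V)"
  shows "line Xs \<in> vgraphs U V"
proof -
  have "verts (line Xs) \<in> U" unfolding verts_line by (rule finite_in) simp
  thus ?thesis using assms initial_obj by (auto simp: vgraphs_def line_def split: if_splits)
qed

lemma line_mor_hom:
  assumes "Xs \<in> lists (Obj V)" "Y \<in> vgraphs U V" "\<And>i. i \<le> length Xs \<Longrightarrow> v i \<in> verts Y"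
    "\<And>i. i < length Xs \<Longrightarrow> f i \<in> Hom V (Xs ! i) (homs Y (v i, v (Suc i)))"
  shows "line_mor Xs Y v f \<in> Hom G (line Xs) Y"
  unfolding line_mor_def
proof (rule graph_mor_hom[OF line_in[OF assms(1)] assms(2)])
  fix a assume "a \<in> verts (line Xs)"
  then obtain i where i: "a = e i" "i \<le> length Xs" by (auto simp: verts_line)
  thus "v (ix a) \<in> verts Y" using assms(3) by simp
  fix b assume "b \<in> verts (line Xs)"
  then obtain j where j: "b = e j" "j \<le> length Xs" by (auto simp: verts_line)
  show "(if ix b = Suc (ix a) then f (ix a) else from_initial (homs Y (v (ix a), v (ix b))))
    \<in> Hom V (homs (line Xs) (a, b)) (homs Y (v (ix a), v (ix b)))"
    using i j assms(3,4) homs_line from_initial[OF vgraph_homs[OF assms(2)]] by auto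
qed

lemma line_mor_simps [simp]:
  "i \<le> length Xs \<Longrightarrow> vmap (line_mor Xs Y v f) (e i) = v i"
  "i < length Xs \<Longrightarrow> hmap (line_mor Xs Y v f) (e i, e (Suc i)) = f i"
  "source (line_mor Xs Y v f) = line Xs" "target (line_mor Xs Y v f) = Y"
  by (simp_all add: line_mor_def)

lemma line_hom_eqI:
  assumes f: "f \<in> Hom G (line Xs) Y" and g: "g \<in> Hom G (line Xs) Y"
    and v: "\<And>i. i \<le> length Xs \<Longrightarrow> vmap f (e i) = vmap g (e i)"
    and h: "\<And>i. i < length Xs \<Longrightarrow> hmap f (e i, e (Suc i)) = hmap g (e i, e (Suc i))"
  shows "f = g"
proof (rule graph_hom_eqI[OF f g])
  fix a assume a: "a \<in> verts (line Xs)"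
  then obtain i where i: "a = e i" "i \<le> length Xs" by (auto simp: verts_line)
  thus va: "vmap f a = vmap g a" using v by simp
  fix b assume b: "b \<in> verts (line Xs)"
  then obtain j where j: "b = e j" "j \<le> length Xs" by (auto simp: verts_line)
  hence vb: "vmap f b = vmap g b" using v by simp
  show "hmap f (a, b) = hmap g (a, b)"
  proof (cases "j = Suc i")
    case True thus ?thesis using i j h by simp
  next
    case False
    hence "homs (line Xs) (a, b) = initial" using i j homs_line(2) by simp
    thus ?thesis using graph_homD(6)[OF f a b] graph_homD(6)[OF g a b] va vb from_initial_unique by simp
  qed
qed

section \<open>Maps between lines\<close>

definition line_map :: "'m list \<Rightarrow> ('u, 'o, 'm) vgraph_mor" where
  "line_map fs = line_mor (map (Dom V) fs) (line (map (Cod V) fs)) e (\<lambda>i. fs ! i)"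

lemma seq_hom_lists:
  assumes "fs \<in> Hom (seq_cat V) Xs Ys"
  shows "Xs \<in> lists (Obj V)" "Ys \<in> lists (Obj V)" "length fs = length Xs" "length Ys = length Xs"
    "i < length Xs \<Longrightarrow> fs ! i \<in> Hom V (Xs ! i) (Ys ! i)"
  using assms category.hom_obj[OF category_seq_cat[OF category_axioms] assms] by (auto simp: seq_hom_iff)

lemma line_map_eq: "fs \<in> Hom (seq_cat V) Xs Ys \<Longrightarrow> line_map fs = line_mor Xs (line Ys) e (\<lambda>i. fs ! i)"
  by (auto simp: line_map_def Hom_def)

lemma line_map_hom:
  assumes "fs \<in> Hom (seq_cat V) Xs Ys"
  shows "line_map fs \<in> Hom G (line Xs) (line Ys)"
  unfolding line_map_eq[OF assms] using seq_hom_lists[OF assms]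
  by (intro line_mor_hom line_in) (auto simp: homs_line)

lemma line_map_simps:
  assumes "fs \<in> Hom (seq_cat V) Xs Ys"
  shows "i \<le> length Xs \<Longrightarrow> vmap (line_map fs) (e i) = e i"
    "i < length Xs \<Longrightarrow> hmap (line_map fs) (e i, e (Suc i)) = fs ! i"
    "source (line_map fs) = line Xs"
  unfolding line_map_eq[OF assms] by auto

lemma line_map_ide:
  assumes "Xs \<in> lists (Obj V)"
  shows "line_map (map (Ide V) Xs) = Ide G (line Xs)"
proof -
  have i: "map (Ide V) Xs \<in> Hom (seq_cat V) Xs Xs"
    using category.ide_in[OF category_seq_cat[OF category_axioms], of Xs] assms by simp
  show ?thesis
    by (rule line_hom_eqI[OF line_map_hom[OF i] graph_ide_hom[OF line_in[OF assms]]])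
      (auto simp: line_map_simps[OF i] graph_ide homs_line)
qed

lemma line_map_comp:
  assumes f: "fs \<in> Hom (seq_cat V) Xs Ys" and g: "gs \<in> Hom (seq_cat V) Ys Zs"
  shows "line_map (map2 (Comp V) gs fs) = line_map gs \<odot> line_map fs"
proof -
  have h: "map2 (Comp V) gs fs \<in> Hom (seq_cat V) Xs Zs"
    using category.comp_in[OF category_seq_cat[OF category_axioms] f g] by simp
  show ?thesis
    by (rule line_hom_eqI[OF line_map_hom[OF h] G.comp_in[OF line_map_hom[OF f] line_map_hom[OF g]]])
      (auto simp: line_map_simps[OF f] line_map_simps[OF g] line_map_simps[OF h] seq_hom_lists[OF f] seq_hom_lists[OF g])
qed

text \<open>The inclusion of the line on block \<open>i\<close> into the line on the concatenation,
  as the stretch beginning at vertex \<open>off Xss i\<close>.\<close>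

definition segment :: "'o list list \<Rightarrow> nat \<Rightarrow> ('u, 'o, 'm) vgraph_mor" where
  "segment Xss i = line_mor (Xss ! i) (line (concat Xss)) (\<lambda>j. e (off Xss i + j)) (\<lambda>j. Ide V (Xss ! i ! j))"

lemma lists_nth: "Xss \<in> lists A \<Longrightarrow> i < length Xss \<Longrightarrow> Xss ! i \<in> A"
  by auto

lemma lists_concat: "Xss \<in> lists (lists A) \<Longrightarrow> concat Xss \<in> lists A"
  by (auto simp: in_lists_conv_set)

lemma segment_hom:
  assumes X: "Xss \<in> lists (lists (Obj V))" "i < length Xss"
  shows "segment Xss i \<in> Hom G (line (Xss ! i)) (line (concat Xss))"
  unfolding segment_def
proof (rule line_mor_hom[OF lists_nth[OF X] line_in[OF lists_concat[OF X(1)]]])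
  show "e (off Xss i + j) \<in> verts (line (concat Xss))" if "j \<le> length (Xss ! i)" for j
    using off_le[OF X(2) that] by simp
  show "Ide V (Xss ! i ! j) \<in> Hom V (Xss ! i ! j) (homs (line (concat Xss)) (e (off Xss i + j), e (off Xss i + Suc j)))"
    if "j < length (Xss ! i)" for j
    using off_le[OF X(2), of "Suc j"] that concat_nth_off[OF X(2) that] ide_in lists_nth[OF lists_nth[OF X] that]
    by (simp add: homs_line)
qed

lemma segment_simps:
  "j \<le> length (Xss ! i) \<Longrightarrow> vmap (segment Xss i) (e j) = e (off Xss i + j)"
  "j < length (Xss ! i) \<Longrightarrow> hmap (segment Xss i) (e j, e (Suc j)) = Ide V (Xss ! i ! j)"
  "source (segment Xss i) = line (Xss ! i)"
  by (simp_all add: segment_def)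

end

section \<open>The multitensor of a monad over Set\<close>

locale set_monad = line_cat U V e for U :: "'u set set" and V :: "('o, 'm) cat" (structure) and e :: "nat \<Rightarrow> 'u" +
  fixes T :: "('u, 'o, 'm) graph_monad"
  assumes over_Set: "monad_over_Set U V T"
begin

sublocale T: monad G T
  using over_Set by (simp add: monad_over_Set_def)
sublocale F: cat_functor G G "endo T"
  by (rule T.endofunctor)

abbreviation To where "To \<equiv> obj_map (endo T)"
abbreviation Ta where "Ta \<equiv> arr_map (endo T)"

lemma To_in: "X \<in> vgraphs U V \<Longrightarrow> To X \<in> vgraphs U V"
  using F.obj_in[of X] by simp

lemma verts_To: "X \<in> vgraphs U V \<Longrightarrow> verts (To X) = verts X"
  using over_Set by (simp add: monad_over_Set_def)

lemma Ta_hom: "f \<in> Hom G X Y \<Longrightarrow> Ta f \<in> Hom G (To X) (To Y)"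
  by (rule F.arr_map)

lemma vmap_Ta: "f \<in> Hom G X Y \<Longrightarrow> vmap (Ta f) = vmap f"
  using over_Set by (simp add: monad_over_Set_def Hom_def)

lemma Ta_comp: "f \<in> Hom G X Y \<Longrightarrow> g \<in> Hom G Y Z \<Longrightarrow> Ta (g \<odot> f) = Ta g \<odot> Ta f"
  by (rule F.map_comp)

lemma Ta_ide: "X \<in> vgraphs U V \<Longrightarrow> Ta (Ide G X) = Ide G (To X)"
  using F.map_ide by simp

lemma munit_hom: "X \<in> vgraphs U V \<Longrightarrow> munit T X \<in> Hom G X (To X)"
  using nat_trans.component[OF T.unit_natural, of X] by (simp add: id_functor_def)

lemma munit_nat:
  assumes "f \<in> Hom G X Y"
  shows "Ta f \<odot> munit T X = munit T Y \<odot> f"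
  using nat_trans.naturality[OF T.unit_natural assms] assms by (simp add: id_functor_def Hom_def)

lemma mmult_hom: "X \<in> vgraphs U V \<Longrightarrow> mmult T X \<in> Hom G (To (To X)) (To X)"
  using nat_trans.component[OF T.mult_natural, of X] by (simp add: comp_functor_def)

lemma mmult_nat:
  assumes "f \<in> Hom G X Y"
  shows "Ta f \<odot> mmult T X = mmult T Y \<odot> Ta (Ta f)"
  using nat_trans.naturality[OF T.mult_natural assms] assms by (simp add: comp_functor_def Hom_def)

lemma vmap_munit: "X \<in> vgraphs U V \<Longrightarrow> a \<in> verts X \<Longrightarrow> vmap (munit T X) a = a"
  and vmap_mmult: "X \<in> vgraphs U V \<Longrightarrow> a \<in> verts X \<Longrightarrow> vmap (mmult T X) a = a"
  using over_Set by (simp_all add: monad_over_Set_def identity_on_objects_def)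

text \<open>The Kleisli extension of \<open>k\<close>. The monad laws take the form of
  \<open>lift_lift\<close>, \<open>lift_munit\<close> and \<open>lift_unit\<close>, which match the
  associativity, outer unit and inner unit laws of \<open>psi\<close>.\<close>

definition lift :: "('u, 'o) vgraph \<Rightarrow> ('u, 'o, 'm) vgraph_mor \<Rightarrow> ('u, 'o, 'm) vgraph_mor" where
  "lift Y k = mmult T Y \<odot> Ta k"

lemma lift_hom:
  assumes "k \<in> Hom G X (To Y)" "Y \<in> vgraphs U V"
  shows "lift Y k \<in> Hom G (To X) (To Y)"
  unfolding lift_def by (rule G.comp_in[OF Ta_hom[OF assms(1)] mmult_hom[OF assms(2)]])

lemma vmap_lift:
  assumes k: "k \<in> Hom G X (To Y)" and Y: "Y \<in> vgraphs U V" and a: "a \<in> verts X"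
  shows "vmap (lift Y k) a = vmap k a"
proof -
  have "a \<in> verts (source (Ta k))" using a graph_homD(1)[OF Ta_hom[OF k]] verts_To[OF graph_homD(3)[OF k]] by simp
  thus ?thesis unfolding lift_def
    using vmap_Ta[OF k] vmap_mmult[OF Y] graph_homD(5)[OF k a] verts_To[OF Y] by simp
qed

lemma Ta_lift:
  assumes k: "k \<in> Hom G X (To Y)" and f: "f \<in> Hom G Y Z"
  shows "Ta f \<odot> lift Y k = lift Z (Ta f \<odot> k)"
proof -
  note Y = graph_homD(3)[OF f] and Z = graph_homD(4)[OF f]
  note Tf = Ta_hom[OF f] and Tk = Ta_hom[OF k]
  have "Ta f \<odot> lift Y k = (mmult T Z \<odot> Ta (Ta f)) \<odot> Ta k"
    unfolding lift_def by (rule G.comp_ext[OF Tk mmult_hom[OF Y] Tf mmult_nat[OF f]])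
  thus ?thesis unfolding lift_def Ta_comp[OF k Tf]
    using G.comp_assoc_hom[OF Tk Ta_hom[OF Tf] mmult_hom[OF Z]] by simp
qed

lemma lift_lift:
  assumes k: "k \<in> Hom G X (To Y)" and l: "l \<in> Hom G Y (To Z)" and Z: "Z \<in> vgraphs U V"
  shows "lift Z l \<odot> lift Y k = lift Z (lift Z l \<odot> k)"
proof -
  note Y = graph_homD(3)[OF l]
  note TZ = To_in[OF Z]
  note Tl = Ta_hom[OF l] and TTl = Ta_hom[OF Ta_hom[OF l]] and Tk = Ta_hom[OF k]
  note m = mmult_hom[OF Z] and mT = mmult_hom[OF TZ] and Tm = Ta_hom[OF mmult_hom[OF Z]]
  have "lift Z l \<odot> lift Y k = mmult T Z \<odot> (Ta l \<odot> lift Y k)"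
    unfolding lift_def[of Z l] by (rule G.comp_assoc_hom[OF lift_hom[OF k Y] Tl m])
  also have "\<dots> = mmult T Z \<odot> (mmult T (To Z) \<odot> (Ta (Ta l) \<odot> Ta k))"
    unfolding Ta_lift[OF k l] unfolding lift_def Ta_comp[OF k Tl] ..
  also have "\<dots> = (mmult T Z \<odot> Ta (mmult T Z)) \<odot> (Ta (Ta l) \<odot> Ta k)"
    by (rule G.comp_ext[OF G.comp_in[OF Tk TTl] mT m]) (use T.mult_assoc Z in simp)
  also have "\<dots> = mmult T Z \<odot> ((Ta (mmult T Z) \<odot> Ta (Ta l)) \<odot> Ta k)"
    using G.comp_assoc_hom[OF G.comp_in[OF Tk TTl] Tm m] G.comp_assoc_hom[OF Tk TTl Tm] by simp
  also have "\<dots> = lift Z (lift Z l \<odot> k)"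
    unfolding lift_def Ta_comp[OF k G.comp_in[OF Tl m]] Ta_comp[OF Tl m] ..
  finally show ?thesis .
qed

lemma lift_Ta:
  assumes k: "k \<in> Hom G X (To Y)" and h: "h \<in> Hom G W X" and Y: "Y \<in> vgraphs U V"
  shows "lift Y k \<odot> Ta h = lift Y (k \<odot> h)"
  unfolding lift_def Ta_comp[OF h k] by (rule G.comp_assoc_hom[OF Ta_hom[OF h] Ta_hom[OF k] mmult_hom[OF Y]])

lemma lift_munit:
  assumes k: "k \<in> Hom G X (To Y)" and Y: "Y \<in> vgraphs U V"
  shows "lift Y k \<odot> munit T X = k"
proof -
  note X = graph_homD(3)[OF k]
  have "lift Y k \<odot> munit T X = mmult T Y \<odot> (munit T (To Y) \<odot> k)"
    unfolding lift_def munit_nat[OF k, symmetric]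
    by (rule G.comp_assoc_hom[OF munit_hom[OF X] Ta_hom[OF k] mmult_hom[OF Y]])
  also have "\<dots> = Ide G (To Y) \<odot> k"
    by (rule G.comp_ext[OF k munit_hom[OF To_in[OF Y]] mmult_hom[OF Y]]) (use T.unit_outer Y in simp)
  finally show ?thesis using G.ide_left[OF k] by simp
qed

lemma lift_unit: "X \<in> vgraphs U V \<Longrightarrow> lift X (munit T X) = Ide G (To X)"
  unfolding lift_def using T.unit_inner by simp

definition point :: "'o list \<Rightarrow> 'o" where
  "point Xs = homs (To (line Xs)) (e 0, e (length Xs))"

definition kappa :: "'o list list \<Rightarrow> ('u, 'o, 'm) vgraph_mor" where
  "kappa Xss = line_mor (map point Xss) (To (line (concat Xss))) (\<lambda>i. e (off Xss i))
     (\<lambda>i. hmap (Ta (segment Xss i)) (e 0, e (length (Xss ! i))))"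

text \<open>The restrictions meet the extensionality required of functors and natural
  transformations. Functor, unit and substitution are each the value of a graph map at the two end
  vertices of a line.\<close>

definition psi :: "('o, 'm) multitensor" where
  "psi = \<lparr>tensor = \<lparr>obj_map = (\<lambda>Xs\<in>lists (Obj V). point Xs),
                    arr_map = (\<lambda>fs\<in>lists (Arr V). hmap (Ta (line_map fs)) (e 0, e (length fs)))\<rparr>,
     tunit = (\<lambda>X\<in>Obj V. hmap (munit T (line [X])) (e 0, e 1)),
     tsubst = (\<lambda>Xss\<in>lists (lists (Obj V)). hmap (lift (line (concat Xss)) (kappa Xss)) (e 0, e (length Xss)))\<rparr>"

lemma psi_simps:
  "Xs \<in> lists (Obj V) \<Longrightarrow> tens psi Xs = point Xs"
  "fs \<in> Hom (seq_cat V) Xs Ys \<Longrightarrow> tens_arr psi fs = hmap (Ta (line_map fs)) (e 0, e (length Xs))"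
  "X \<in> Obj V \<Longrightarrow> tunit psi X = hmap (munit T (line [X])) (e 0, e 1)"
  "Xss \<in> lists (lists (Obj V)) \<Longrightarrow> tsubst psi Xss = hmap (lift (line (concat Xss)) (kappa Xss)) (e 0, e (length Xss))"
  by (auto simp: psi_def Hom_def)

lemma point_obj: "Xs \<in> lists (Obj V) \<Longrightarrow> point Xs \<in> Obj V"
  unfolding point_def by (rule vgraph_homs[OF To_in[OF line_in]]) (simp_all add: verts_To line_in)

lemma map_point: "Xss \<in> lists (lists (Obj V)) \<Longrightarrow> map point Xss \<in> lists (Obj V)"
  using point_obj by auto

lemma point_hom:
  assumes "k \<in> Hom G (line Xs) Y"
  shows "hmap (Ta k) (e 0, e (length Xs)) \<in> Hom V (point Xs) (homs (To Y) (vmap k (e 0), vmap k (e (length Xs))))"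
proof -
  have "e 0 \<in> verts (To (line Xs))" "e (length Xs) \<in> verts (To (line Xs))"
    using verts_To[OF graph_homD(3)[OF assms]] by auto
  from graph_homD(6)[OF Ta_hom[OF assms] this] show ?thesis by (simp add: point_def vmap_Ta[OF assms])
qed

lemma point_lift_hom:
  assumes k: "k \<in> Hom G (line Xs) (To Y)" and Y: "Y \<in> vgraphs U V"
  shows "hmap (lift Y k) (e 0, e (length Xs)) \<in> Hom V (point Xs) (homs (To Y) (vmap k (e 0), vmap k (e (length Xs))))"
proof -
  have "e 0 \<in> verts (To (line Xs))" "e (length Xs) \<in> verts (To (line Xs))"
    using verts_To[OF graph_homD(3)[OF k]] by auto
  from graph_homD(6)[OF lift_hom[OF k Y] this] show ?thesis
    using vmap_lift[OF k Y] by (simp add: point_def)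
qed

lemma segment_point_hom:
  assumes X: "Xss \<in> lists (lists (Obj V))" "i < length Xss"
  shows "hmap (Ta (segment Xss i)) (e 0, e (length (Xss ! i)))
    \<in> Hom V (point (Xss ! i)) (homs (To (line (concat Xss))) (e (off Xss i), e (off Xss (Suc i))))"
  using point_hom[OF segment_hom[OF X]] by (simp add: segment_simps off_Suc X(2))

lemma kappa_hom:
  assumes X: "Xss \<in> lists (lists (Obj V))"
  shows "kappa Xss \<in> Hom G (line (map point Xss)) (To (line (concat Xss)))"
  unfolding kappa_def
proof (rule line_mor_hom[OF map_point[OF X] To_in[OF line_in[OF lists_concat[OF X]]]])
  show "e (off Xss i) \<in> verts (To (line (concat Xss)))" if "i \<le> length (map point Xss)" for i
    using that off_le_length[of i Xss] verts_To[OF line_in[OF lists_concat[OF X]]] by simp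
  show "hmap (Ta (segment Xss i)) (e 0, e (length (Xss ! i)))
         \<in> Hom V (map point Xss ! i) (homs (To (line (concat Xss))) (e (off Xss i), e (off Xss (Suc i))))"
    if "i < length (map point Xss)" for i
    using segment_point_hom[OF X] that by simp
qed

lemma kappa_simps:
  "i \<le> length Xss \<Longrightarrow> vmap (kappa Xss) (e i) = e (off Xss i)"
  "i < length Xss \<Longrightarrow> hmap (kappa Xss) (e i, e (Suc i)) = hmap (Ta (segment Xss i)) (e 0, e (length (Xss ! i)))"
  "source (kappa Xss) = line (map point Xss)"
  by (simp_all add: kappa_def)

lemma ends_To: "Xs \<in> lists (Obj V) \<Longrightarrow> i \<le> length Xs \<Longrightarrow> e i \<in> verts (To (line Xs))"
  by (simp add: verts_To line_in)

text \<open>Turns an identity of graph maps out of \<open>To (line Xs)\<close> into an identity of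
  composites in \<open>V\<close>. Each law of \<open>psi\<close> is obtained by such an evaluation
  at the end vertices.\<close>

lemma hmap_comp_To:
  assumes "f \<in> Hom G (To (line Xs)) Y" "Xs \<in> lists (Obj V)"
  shows "hmap (g \<odot> f) (e 0, e (length Xs))
    = hmap g (vmap f (e 0), vmap f (e (length Xs))) \<cdot> hmap f (e 0, e (length Xs))"
  using ends_To[OF assms(2)] graph_homD(1)[OF assms(1)] by simp

section \<open>The multitensor laws for \<open>psi\<close>\<close>

lemma psi_functor: "cat_functor (seq_cat V) V (tensor psi)"
proof (rule cat_functor.intro[OF category_seq_cat[OF category_axioms] category_axioms], rule cat_functor_axioms.intro)
  show "tens psi \<in> Obj (seq_cat V) \<rightarrow>\<^sub>E Obj V"
    using point_obj by (auto simp: psi_def)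
  show "tens_arr psi \<in> extensional (Arr (seq_cat V))" by (simp add: psi_def)
  show "tens_arr psi fs \<in> Hom V (tens psi Xs) (tens psi Ys)" if f: "fs \<in> Hom (seq_cat V) Xs Ys" for fs Xs Ys
    using point_hom[OF line_map_hom[OF f]] seq_hom_lists[OF f]
    by (simp add: psi_simps(1) psi_simps(2)[OF f] line_map_simps[OF f]) (simp add: point_def)
  show "tens_arr psi (Ide (seq_cat V) Xs) = Ide V (tens psi Xs)" if "Xs \<in> Obj (seq_cat V)" for Xs
  proof -
    have X: "Xs \<in> lists (Obj V)" using that by simp
    have i: "map (Ide V) Xs \<in> Hom (seq_cat V) Xs Xs"
      using category.ide_in[OF category_seq_cat[OF category_axioms] that] by simp
    have "tens_arr psi (Ide (seq_cat V) Xs) = hmap (Ide G (To (line Xs))) (e 0, e (length Xs))"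
      using X by (simp add: psi_simps(2)[OF i] line_map_ide Ta_ide line_in)
    thus ?thesis using X ends_To[OF X] by (simp add: psi_simps(1) graph_ide point_def)
  qed
  show "tens_arr psi (gs \<cdot>\<^bsub>seq_cat V\<^esub> fs) = tens_arr psi gs \<cdot> tens_arr psi fs"
    if f: "fs \<in> Hom (seq_cat V) Xs Ys" and g: "gs \<in> Hom (seq_cat V) Ys Zs" for fs gs Xs Ys Zs
  proof -
    have h: "map2 (Comp V) gs fs \<in> Hom (seq_cat V) Xs Zs"
      using category.comp_in[OF category_seq_cat[OF category_axioms] f g] by simp
    note lf = line_map_hom[OF f] and lg = line_map_hom[OF g]
    show ?thesis using seq_hom_lists[OF f]
      by (simp add: psi_simps(2)[OF f] psi_simps(2)[OF g] psi_simps(2)[OF h] line_map_comp[OF f g] Ta_comp[OF lf lg]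
          hmap_comp_To[OF Ta_hom[OF lf]] vmap_Ta[OF lf] line_map_simps[OF f])
  qed
qed

lemma psi_unit_hom:
  assumes X: "X \<in> Obj V"
  shows "hmap (munit T (line [X])) (e 0, e 1) \<in> Hom V X (point [X])"
proof -
  have l: "line [X] \<in> vgraphs U V" using X by (intro line_in) simp
  have v: "e 0 \<in> verts (line [X])" "e 1 \<in> verts (line [X])" by simp_all
  show ?thesis using graph_homD(6)[OF munit_hom[OF l] v] vmap_munit[OF l v(1)] vmap_munit[OF l v(2)] homs_line(1)[of 0 "[X]"]
    by (simp add: point_def)
qed

lemma psi_subst_hom:
  assumes X: "Xss \<in> lists (lists (Obj V))"
  shows "hmap (lift (line (concat Xss)) (kappa Xss)) (e 0, e (length Xss))
    \<in> Hom V (point (map point Xss)) (point (concat Xss))"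
  using point_lift_hom[OF kappa_hom[OF X] line_in[OF lists_concat[OF X]]]
  by (simp add: kappa_simps off_length) (simp add: point_def)

lemma map_psi_subst_hom:
  assumes X: "Xsss \<in> lists (lists (lists (Obj V)))"
  shows "map (tsubst psi) Xsss \<in> Hom (seq_cat V) (map point (map (map point) Xsss)) (map point (map concat Xsss))"
proof -
  have "tsubst psi Xss \<in> Hom V (point (map point Xss)) (point (concat Xss))" if "Xss \<in> set Xsss" for Xss
    using psi_subst_hom[of Xss] X that by (simp add: psi_simps(4) in_lists_conv_set)
  from seq_hom_map[of Xsss, OF this] show ?thesis by (simp add: comp_def)
qed

text \<open>Maps out of a line are compared one step at a time. On step \<open>i\<close> the claim
  is the image under \<open>T\<close> of the compatibility of line maps with the inclusion of block
  \<open>i\<close>, evaluated at the ends of the block.\<close>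

lemma kappa_nat:
  assumes f: "fss \<in> Hom (seq_cat (seq_cat V)) Xss Yss"
  shows "Ta (line_map (concat fss)) \<odot> kappa Xss = kappa Yss \<odot> line_map (map (tens_arr psi) fss)"
proof -
  interpret S: category "seq_cat V" by (rule category_seq_cat[OF category_axioms])
  interpret SS: category "seq_cat (seq_cat V)" by (rule category_seq_cat[OF S.category_axioms])
  have X: "Xss \<in> lists (lists (Obj V))" and Y: "Yss \<in> lists (lists (Obj V))" using SS.hom_obj[OF f] by auto
  have len: "length fss = length Xss" "length Yss = length Xss" using seq_hom_length[OF f] by auto
  have fi: "fss ! i \<in> Hom (seq_cat V) (Xss ! i) (Yss ! i)" if "i < length Xss" for i
    using f that by (simp add: seq_hom_iff)
  have leni: "length (fss ! i) = length (Xss ! i)" "length (Yss ! i) = length (Xss ! i)" if "i < length Xss" for i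
    using seq_hom_length[OF fi[OF that]] by auto
  note cf = seq_hom_concat[OF f]
  note lc = line_map_hom[OF cf]
  have mf: "map (tens_arr psi) fss \<in> Hom (seq_cat V) (map point Xss) (map point Yss)"
    using fi len point_hom[OF line_map_hom[OF fi]]
    by (auto simp: seq_hom_iff psi_simps(2)[OF fi] line_map_simps[OF fi] leni) (metis fi leni(2) line_map_simps(1) order_refl point_def)
  note lm = line_map_hom[OF mf]
  have off: "off Yss i = off Xss i" "off fss i = off Xss i" for i
    by (rule off_cong, use len leni in \<open>auto simp: list_eq_iff_nth_eq\<close>)+
  show ?thesis
  proof (rule line_hom_eqI[OF G.comp_in[OF kappa_hom[OF X] Ta_hom[OF lc]] G.comp_in[OF lm kappa_hom[OF Y]]])
    fix i assume "i \<le> length (map point Xss)"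
    hence i: "i \<le> length Xss" by simp
    show "vmap (Ta (line_map (concat fss)) \<odot> kappa Xss) (e i) = vmap (kappa Yss \<odot> line_map (map (tens_arr psi) fss)) (e i)"
      using i off_le_length[OF i] len
      by (simp add: kappa_simps line_map_simps[OF mf] vmap_Ta[OF lc] line_map_simps[OF cf] off)
  next
    fix i assume "i < length (map point Xss)"
    hence i: "i < length Xss" by simp
    note sX = segment_hom[OF X i]
    have iY: "i < length Yss" using i len by simp
    note sY = segment_hom[OF Y iY]
    note li = line_map_hom[OF fi[OF i]]
    have eq: "line_map (concat fss) \<odot> segment Xss i = segment Yss i \<odot> line_map (fss ! i)"
    proof (rule line_hom_eqI[OF G.comp_in[OF sX lc] G.comp_in[OF li sY]])
      show "vmap (line_map (concat fss) \<odot> segment Xss i) (e j) = vmap (segment Yss i \<odot> line_map (fss ! i)) (e j)" if "j \<le> length (Xss ! i)" for j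
        using that off_le[OF i that] leni[OF i] by (simp add: segment_simps line_map_simps[OF cf] line_map_simps[OF fi[OF i]] off)
      fix j assume j: "j < length (Xss ! i)"
      have b: "off Xss i + j < length (concat Xss)" using off_le[OF i, of "Suc j"] j by simp
      have fij: "fss ! i ! j \<in> Hom V (Xss ! i ! j) (Yss ! i ! j)" using fi[OF i] j by (simp add: seq_hom_iff)
      have n: "concat fss ! (off Xss i + j) = fss ! i ! j"
        using concat_nth_off[of i fss j] i j len leni[OF i] off(2)[of i] by simp
      show "hmap (line_map (concat fss) \<odot> segment Xss i) (e j, e (Suc j)) = hmap (segment Yss i \<odot> line_map (fss ! i)) (e j, e (Suc j))"
        using j leni[OF i] line_map_simps(2)[OF cf b] ide_left[OF fij] ide_right[OF fij] n
        by (simp add: segment_simps line_map_simps[OF fi[OF i]])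
    qed
    have "Ta (line_map (concat fss)) \<odot> Ta (segment Xss i) = Ta (segment Yss i) \<odot> Ta (line_map (fss ! i))"
      using arg_cong[OF eq, of Ta] Ta_comp[OF sX lc] Ta_comp[OF li sY] by simp
    from arg_cong[OF this, of "\<lambda>k. hmap k (e 0, e (length (Xss ! i)))"]
    have "hmap (Ta (line_map (concat fss))) (e (off Xss i), e (off Xss i + length (Xss ! i))) \<cdot> hmap (Ta (segment Xss i)) (e 0, e (length (Xss ! i)))
      = hmap (Ta (segment Yss i)) (e 0, e (length (Xss ! i))) \<cdot> hmap (Ta (line_map (fss ! i))) (e 0, e (length (Xss ! i)))"
      using lists_nth[OF X i]
      by (simp add: hmap_comp_To[OF Ta_hom[OF sX]] hmap_comp_To[OF Ta_hom[OF li]] vmap_Ta[OF sX] vmap_Ta[OF li] segment_simps line_map_simps[OF fi[OF i]])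
    thus "hmap (Ta (line_map (concat fss)) \<odot> kappa Xss) (e i, e (Suc i)) = hmap (kappa Yss \<odot> line_map (map (tens_arr psi) fss)) (e i, e (Suc i))"
      using i len leni[OF i] psi_simps(2)[OF fi[OF i]] by (simp add: kappa_simps line_map_simps[OF mf] off_Suc)
  qed
qed

text \<open>With a single block the inclusion \<open>segment\<close> is the identity of the
  line.\<close>

lemma kappa_single:
  assumes X: "Xs \<in> lists (Obj V)"
  shows "hmap (kappa [Xs]) (e 0, e 1) = Ide V (point Xs)"
proof -
  have "segment [Xs] 0 = Ide G (line Xs)"
    by (rule line_hom_eqI[of _ Xs "line Xs"])
      (use segment_hom[of "[Xs]" 0] X graph_ide_hom[OF line_in[OF X]] segment_simps(1,2)[of _ "[Xs]" 0] in \<open>auto simp: graph_ide homs_line\<close>)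
  hence "hmap (kappa [Xs]) (e 0, e 1) = hmap (Ide G (To (line Xs))) (e 0, e (length Xs))"
    using kappa_simps(2)[of 0 "[Xs]"] by (simp add: Ta_ide line_in[OF X])
  thus ?thesis using ends_To[OF X] by (simp add: graph_ide point_def)
qed

text \<open>With blocks of length one, step \<open>i\<close> of the composite is the unit of
  \<open>T\<close> on a one-step line followed by the inclusion of that line. Naturality of the unit
  at the inclusion identifies this with the unit on the whole line.\<close>

lemma kappa_units:
  assumes X: "Xs \<in> lists (Obj V)"
  shows "kappa (map (\<lambda>X. [X]) Xs) \<odot> line_map (map (tunit psi) Xs) = munit T (line Xs)"
proof -
  let ?Xss = "map (\<lambda>X. [X]) Xs"
  have Xss: "?Xss \<in> lists (lists (Obj V))" using X by auto
  \<comment> \<open>All blocks have length one, so block \<open>i\<close> starts at vertex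
    \<open>i\<close>.\<close>
  have off: "off ?Xss i = i" if "i \<le> length Xs" for i using that by (simp add: off_def take_map)
  have u: "map (tunit psi) Xs \<in> Hom (seq_cat V) Xs (map point ?Xss)"
    using X psi_unit_hom by (auto simp: seq_hom_iff psi_simps(3))
  note lX = line_in[OF X]
  show ?thesis
  proof (rule line_hom_eqI[OF _ munit_hom[OF lX]])
    show "kappa ?Xss \<odot> line_map (map (tunit psi) Xs) \<in> Hom G (line Xs) (To (line Xs))"
      using G.comp_in[OF line_map_hom[OF u] kappa_hom[OF Xss]] by simp
    fix i assume i: "i \<le> length Xs"
    show "vmap (kappa ?Xss \<odot> line_map (map (tunit psi) Xs)) (e i) = vmap (munit T (line Xs)) (e i)"
      using i off[OF i] by (simp add: line_map_simps[OF u] kappa_simps vmap_munit[OF lX])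
  next
    fix i assume i: "i < length Xs"
    have Xi: "Xs ! i \<in> Obj V" using lists_nth[OF X i] .
    have iX: "i < length ?Xss" using i by simp
    have s: "segment ?Xss i \<in> Hom G (line [Xs ! i]) (line Xs)" using segment_hom[OF Xss iX] i by simp
    have si: "vmap (segment ?Xss i) (e 0) = e i" "vmap (segment ?Xss i) (e 1) = e (Suc i)"
      "hmap (segment ?Xss i) (e 0, e 1) = Ide V (Xs ! i)"
      using segment_simps(1,2)[of _ ?Xss i] i off[of i] by auto
    have l1: "line [Xs ! i] \<in> vgraphs U V" using Xi by (intro line_in) simp
    note m1 = munit_hom[OF l1]
    have mi: "hmap (munit T (line Xs)) (e i, e (Suc i)) \<in> Hom V (Xs ! i) (homs (To (line Xs)) (e i, e (Suc i)))"
      using graph_homD(6)[OF munit_hom[OF lX], of "e i" "e (Suc i)"] i vmap_munit[OF lX] by (simp add: homs_line)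
    have "hmap (Ta (segment ?Xss i) \<odot> munit T (line [Xs ! i])) (e 0, e 1) = hmap (munit T (line Xs) \<odot> segment ?Xss i) (e 0, e 1)"
      unfolding munit_nat[OF s] ..
    hence "hmap (Ta (segment ?Xss i)) (e 0, e 1) \<cdot> hmap (munit T (line [Xs ! i])) (e 0, e 1) = hmap (munit T (line Xs)) (e i, e (Suc i))"
      using graph_homD(1)[OF m1] graph_homD(1)[OF s] vmap_munit[OF l1] si ide_right[OF mi] by simp
    thus "hmap (kappa ?Xss \<odot> line_map (map (tunit psi) Xs)) (e i, e (Suc i)) = hmap (munit T (line Xs)) (e i, e (Suc i))"
      using i Xi by (simp add: line_map_simps[OF u] kappa_simps psi_simps(3))
  qed
qed

text \<open>An inner block can be included directly or through the outer block that contains it.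
  Vertices agree by \<open>off_concat\<close>, and on homs both inclusions are identities.\<close>

lemma segment_segment:
  assumes X: "Xsss \<in> lists (lists (lists (Obj V)))" and i: "i < length Xsss" and j: "j < length (Xsss ! i)"
  shows "segment (concat Xsss) (off Xsss i + j) = segment (map concat Xsss) i \<odot> segment (Xsss ! i) j"
proof -
  have C: "concat Xsss \<in> lists (lists (Obj V))" "map concat Xsss \<in> lists (lists (Obj V))"
    using X by (auto simp: in_lists_conv_set)
  have Xi: "Xsss ! i \<in> lists (lists (Obj V))" using lists_nth[OF X i] .
  have cc: "concat (map concat Xsss) = concat (concat Xsss)" by (induction Xsss) auto
  have nth: "concat Xsss ! (off Xsss i + j) = Xsss ! i ! j" by (rule concat_nth_off[OF i j])
  have ij: "off Xsss i + j < length (concat Xsss)" using off_le[OF i, of "Suc j"] j by simp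
  have i': "i < length (map concat Xsss)" using i by simp
  have s: "segment (concat Xsss) (off Xsss i + j) \<in> Hom G (line (Xsss ! i ! j)) (line (concat (concat Xsss)))"
    using segment_hom[OF C(1) ij] nth by simp
  have s1: "segment (map concat Xsss) i \<in> Hom G (line (concat (Xsss ! i))) (line (concat (concat Xsss)))"
    using segment_hom[OF C(2) i'] cc i by simp
  note s2 = segment_hom[OF Xi j]
  show ?thesis
  proof (rule line_hom_eqI[OF s G.comp_in[OF s2 s1]])
    note o = off_concat[OF i, of j]
    fix l assume l: "l \<le> length (Xsss ! i ! j)"
    show "vmap (segment (concat Xsss) (off Xsss i + j)) (e l) = vmap (segment (map concat Xsss) i \<odot> segment (Xsss ! i) j) (e l)"
      using l off_le[OF j l] o j i by (simp add: segment_simps nth)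
  next
    fix l assume l: "l < length (Xsss ! i ! j)"
    have b: "off (Xsss ! i) j + l < length (concat (Xsss ! i))" using off_le[OF j, of "Suc l"] l by simp
    have Xl: "Xsss ! i ! j ! l \<in> Obj V" using lists_nth[OF lists_nth[OF Xi j] l] .
    show "hmap (segment (concat Xsss) (off Xsss i + j)) (e l, e (Suc l)) = hmap (segment (map concat Xsss) i \<odot> segment (Xsss ! i) j) (e l, e (Suc l))"
      using l b i concat_nth_off[OF j l] ide_left[OF ide_in[OF Xl]] by (simp add: segment_simps nth)
  qed
qed

text \<open>The part of associativity that concerns blocks. Both maps out of the outer line are
  compared on step \<open>i\<close>, where they become the extension of
  \<open>kappa (Xsss ! i)\<close> followed by the inclusion of block \<open>i\<close>;
  \<open>lift_lift\<close> then yields the law itself.\<close>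

lemma kappa_assoc:
  assumes X: "Xsss \<in> lists (lists (lists (Obj V)))"
  shows "lift (line (concat (concat Xsss))) (kappa (concat Xsss)) \<odot> kappa (map (map point) Xsss)
    = kappa (map concat Xsss) \<odot> line_map (map (tsubst psi) Xsss)"
proof -
  have C: "concat Xsss \<in> lists (lists (Obj V))" "map concat Xsss \<in> lists (lists (Obj V))"
    using X by (auto simp: in_lists_conv_set)
  have M: "map (map point) Xsss \<in> lists (lists (Obj V))" using X map_point by (auto simp: in_lists_conv_set)
  have cm: "concat (map (map point) Xsss) = map point (concat Xsss)" by (simp add: map_concat)
  have cc: "concat (map concat Xsss) = concat (concat Xsss)" by (induction Xsss) auto
  have lY: "line (concat (concat Xsss)) \<in> vgraphs U V" by (rule line_in[OF lists_concat[OF C(1)]])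
  note k = kappa_hom[OF C(1)]
  have k2: "kappa (map (map point) Xsss) \<in> Hom G (line (map point (map (map point) Xsss))) (To (line (map point (concat Xsss))))"
    using kappa_hom[OF M] cm by simp
  have k3: "kappa (map concat Xsss) \<in> Hom G (line (map point (map concat Xsss))) (To (line (concat (concat Xsss))))"
    using kappa_hom[OF C(2)] cc by simp
  note s = map_psi_subst_hom[OF X]
  have offm: "off (map (map point) Xsss) i = off Xsss i" for i by (rule off_map_length) simp
  note L = G.comp_in[OF k2 lift_hom[OF k lY]] and R = G.comp_in[OF line_map_hom[OF s] k3]
  show ?thesis
  proof (rule line_hom_eqI[OF L R])
    fix i assume "i \<le> length (map point (map (map point) Xsss))"
    hence i: "i \<le> length Xsss" by simp
    \<comment> \<open>\<open>off_concat\<close> covers only positions inside an outer block, so the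
      last vertex is treated apart by comparing total lengths.\<close>
    have o: "off (concat Xsss) (off Xsss i) = off (map concat Xsss) i"
      using i off_concat[of i Xsss 0] off_length[of Xsss] off_length[of "concat Xsss"] off_length[of "map concat Xsss"] cc
      by (cases "i = length Xsss") auto
    have v: "vmap (kappa (map (map point) Xsss)) (e i) = e (off Xsss i)" using i by (simp add: kappa_simps offm)
    show "vmap (lift (line (concat (concat Xsss))) (kappa (concat Xsss)) \<odot> kappa (map (map point) Xsss)) (e i) =
      vmap (kappa (map concat Xsss) \<odot> line_map (map (tsubst psi) Xsss)) (e i)"
      using i off_le_length[OF i] o by (simp add: v line_map_simps[OF s] kappa_simps vmap_lift[OF k lY])
  next
    fix i assume "i < length (map point (map (map point) Xsss))"
    hence i: "i < length Xsss" by simp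
    have Xi: "Xsss ! i \<in> lists (lists (Obj V))" using lists_nth[OF X i] .
    have iM: "i < length (map (map point) Xsss)" and iC: "i < length (map concat Xsss)" using i by auto
    have sM: "segment (map (map point) Xsss) i \<in> Hom G (line (map point (Xsss ! i))) (line (map point (concat Xsss)))"
      using segment_hom[OF M iM] i cm by simp
    have sC: "segment (map concat Xsss) i \<in> Hom G (line (concat (Xsss ! i))) (line (concat (concat Xsss)))"
      using segment_hom[OF C(2) iC] i cc by simp
    note ki = kappa_hom[OF Xi]
    have lYi: "line (concat (Xsss ! i)) \<in> vgraphs U V" by (rule line_in[OF lists_concat[OF Xi]])
    \<comment> \<open>Restricting the global \<open>kappa\<close> to outer block \<open>i\<close>
      gives the \<open>kappa\<close> of that block followed by its inclusion; step by step this is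
      the image of \<open>segment_segment\<close> under \<open>T\<close>.\<close>
    have eq: "kappa (concat Xsss) \<odot> segment (map (map point) Xsss) i = Ta (segment (map concat Xsss) i) \<odot> kappa (Xsss ! i)"
    proof (rule line_hom_eqI[OF G.comp_in[OF sM k] G.comp_in[OF ki Ta_hom[OF sC]]])
      fix j assume "j \<le> length (map point (Xsss ! i))"
      hence j: "j \<le> length (Xsss ! i)" by simp
      have "off Xsss i + j \<le> length (concat Xsss)" by (rule off_le[OF i j])
      thus "vmap (kappa (concat Xsss) \<odot> segment (map (map point) Xsss) i) (e j) = vmap (Ta (segment (map concat Xsss) i) \<odot> kappa (Xsss ! i)) (e j)"
        using i j segment_simps(1)[of j "map (map point) Xsss" i] segment_simps(1)[of "off (Xsss ! i) j" "map concat Xsss" i] off_concat[OF i j]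
          off_le_length[OF j] graph_homD(1)[OF sM]
        by (simp add: kappa_simps offm vmap_Ta[OF sC])
    next
      fix j assume "j < length (map point (Xsss ! i))"
      hence j: "j < length (Xsss ! i)" by simp
      have ij: "off Xsss i + j < length (concat Xsss)" using off_le[OF i, of "Suc j"] j by simp
      have nth: "concat Xsss ! (off Xsss i + j) = Xsss ! i ! j" by (rule concat_nth_off[OF i j])
      note sj = segment_hom[OF Xi j]
      have hs: "hmap (segment (map (map point) Xsss) i) (e j, e (Suc j)) = Ide V (point (Xsss ! i ! j))"
        using segment_simps(2)[of j "map (map point) Xsss" i] i j by simp
      have hk: "hmap (kappa (concat Xsss)) (e (off Xsss i + j), e (Suc (off Xsss i + j)))
        = hmap (Ta (segment (concat Xsss) (off Xsss i + j))) (e 0, e (length (Xsss ! i ! j)))"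
        using kappa_simps(2)[OF ij] nth by simp
      have "segment (concat Xsss) (off Xsss i + j) \<in> Hom G (line (Xsss ! i ! j)) (line (concat (concat Xsss)))"
        using segment_hom[OF C(1) ij] nth by simp
      note hkt = point_hom[OF this]
      have "hmap (Ta (segment (concat Xsss) (off Xsss i + j))) (e 0, e (length (Xsss ! i ! j)))
        = hmap (Ta (segment (map concat Xsss) i)) (e (off (Xsss ! i) j), e (off (Xsss ! i) (Suc j))) \<cdot> hmap (Ta (segment (Xsss ! i) j)) (e 0, e (length (Xsss ! i ! j)))"
        unfolding segment_segment[OF X i j] Ta_comp[OF sj sC] hmap_comp_To[OF Ta_hom[OF sj] lists_nth[OF Xi j]] vmap_Ta[OF sj]
        using j by (simp add: segment_simps off_Suc)
      thus "hmap (kappa (concat Xsss) \<odot> segment (map (map point) Xsss) i) (e j, e (Suc j))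
         = hmap (Ta (segment (map concat Xsss) i) \<odot> kappa (Xsss ! i)) (e j, e (Suc j))"
        using i j segment_simps(1)[of j "map (map point) Xsss" i] segment_simps(1)[of "Suc j" "map (map point) Xsss" i]
          graph_homD(1)[OF sM] ide_right[OF hkt]
        by (simp add: kappa_simps(1,2,3) hs hk offm)
    qed
    \<comment> \<open>Extending both sides of \<open>eq\<close> along the monad; the evaluation at
      the ends of the block follows.\<close>
    have "Ta (segment (map concat Xsss) i) \<odot> lift (line (concat (Xsss ! i))) (kappa (Xsss ! i))
      = lift (line (concat (concat Xsss))) (kappa (concat Xsss)) \<odot> Ta (segment (map (map point) Xsss) i)"
      unfolding Ta_lift[OF ki sC] lift_Ta[OF k sM lY] eq ..
    from arg_cong[OF this, of "\<lambda>k. hmap k (e 0, e (length (map point (Xsss ! i))))"]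
    have "hmap (Ta (segment (map concat Xsss) i)) (e 0, e (length (concat (Xsss ! i)))) \<cdot> hmap (lift (line (concat (Xsss ! i))) (kappa (Xsss ! i))) (e 0, e (length (Xsss ! i)))
      = hmap (lift (line (concat (concat Xsss))) (kappa (concat Xsss))) (e (off Xsss i), e (off Xsss (Suc i))) \<cdot> hmap (Ta (segment (map (map point) Xsss) i)) (e 0, e (length (Xsss ! i)))"
      unfolding hmap_comp_To[OF lift_hom[OF ki lYi] map_point[OF Xi]] hmap_comp_To[OF Ta_hom[OF sM] map_point[OF Xi]]
      using i segment_simps(1)[of _ "map (map point) Xsss" i]
      by (simp add: vmap_lift[OF ki lYi] kappa_simps off_length vmap_Ta[OF sM] offm off_Suc)
    thus "hmap (lift (line (concat (concat Xsss))) (kappa (concat Xsss)) \<odot> kappa (map (map point) Xsss)) (e i, e (Suc i))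
      = hmap (kappa (map concat Xsss) \<odot> line_map (map (tsubst psi) Xsss)) (e i, e (Suc i))"
      using i Xi by (simp add: kappa_simps offm line_map_simps[OF s] psi_simps(4))
  qed
qed

text \<open>Each law joins a general fact about Kleisli extension with a fact about
  \<open>kappa\<close>: naturality of substitution uses \<open>kappa_nat\<close>, the outer unit
  \<open>lift_munit\<close> and \<open>kappa_single\<close>, the inner unit \<open>lift_unit\<close>
  and \<open>kappa_units\<close>, associativity \<open>lift_lift\<close> and
  \<open>kappa_assoc\<close>.\<close>

lemma multitensor_psi: "multitensor V psi"
proof (rule multitensorI[OF psi_functor])
  show "tunit psi \<in> extensional (Obj V)" "tsubst psi \<in> extensional (lists (lists (Obj V)))" by (auto simp: psi_def)
  show "tunit psi X \<in> Hom V X (tens psi [X])" if "X \<in> Obj V" for X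
    using psi_unit_hom[OF that] that by (simp add: psi_simps)
  show "tsubst psi Xss \<in> Hom V (tens psi (map (tens psi) Xss)) (tens psi (concat Xss))" if X: "Xss \<in> lists (lists (Obj V))" for Xss
  proof -
    have e: "map (tens psi) Xss = map point Xss" using X by (auto simp: psi_simps(1))
    show ?thesis unfolding e using psi_subst_hom[OF X] X map_point[OF X] lists_concat[OF X] by (simp add: psi_simps)
  qed
  show "tens_arr psi [f] \<cdot> tunit psi X = tunit psi Y \<cdot> f" if f: "f \<in> Hom V X Y" for f X Y
  proof -
    have s: "[f] \<in> Hom (seq_cat V) [X] [Y]" using f by simp
    have XY: "X \<in> Obj V" "Y \<in> Obj V" using hom_obj[OF f] by auto
    have l: "line [X] \<in> vgraphs U V" using XY by (intro line_in) simp
    note lm = line_map_hom[OF s]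
    from arg_cong[OF munit_nat[OF lm], of "\<lambda>k. hmap k (e 0, e 1)"] show ?thesis
      using XY graph_homD(1)[OF munit_hom[OF l]]
      by (simp add: psi_simps(3) psi_simps(2)[OF s] vmap_munit[OF l] line_map_simps[OF s])
  qed
  show "tens_arr psi (concat fss) \<cdot> tsubst psi Xss = tsubst psi Yss \<cdot> tens_arr psi (map (tens_arr psi) fss)"
    if f: "fss \<in> Hom (seq_cat (seq_cat V)) Xss Yss" for fss Xss Yss
  proof -
    interpret S: category "seq_cat V" by (rule category_seq_cat[OF category_axioms])
    interpret SS: category "seq_cat (seq_cat V)" by (rule category_seq_cat[OF S.category_axioms])
    interpret P: cat_functor "seq_cat V" V "tensor psi" by (rule psi_functor)
    have X: "Xss \<in> lists (lists (Obj V))" and Y: "Yss \<in> lists (lists (Obj V))" using SS.hom_obj[OF f] by auto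
    have len: "length fss = length Xss" "length Yss = length Xss" using seq_hom_length[OF f] by auto
    note cf = seq_hom_concat[OF f]
    have mf: "map (tens_arr psi) fss \<in> Hom (seq_cat V) (map point Xss) (map point Yss)"
    proof -
      have "fss ! i \<in> Hom (seq_cat V) (Xss ! i) (Yss ! i)" if "i < length Xss" for i
        using f that by (simp add: seq_hom_iff)
      from P.arr_map[OF this] show ?thesis using len lists_nth[OF X] lists_nth[OF Y] by (simp add: seq_hom_iff psi_simps(1))
    qed
    note lc = line_map_hom[OF cf] and lm = line_map_hom[OF mf]
    have lX: "line (concat Xss) \<in> vgraphs U V" and lY: "line (concat Yss) \<in> vgraphs U V"
      using line_in lists_concat X Y by auto
    have "Ta (line_map (concat fss)) \<odot> lift (line (concat Xss)) (kappa Xss) = lift (line (concat Yss)) (kappa Yss) \<odot> Ta (line_map (map (tens_arr psi) fss))"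
      unfolding Ta_lift[OF kappa_hom[OF X] lc] lift_Ta[OF kappa_hom[OF Y] lm lY] kappa_nat[OF f] ..
    from arg_cong[OF this, of "\<lambda>k. hmap k (e 0, e (length (map point Xss)))"]
    show ?thesis
      unfolding hmap_comp_To[OF lift_hom[OF kappa_hom[OF X] lX] map_point[OF X]] hmap_comp_To[OF Ta_hom[OF lm] map_point[OF X]]
      using X Y len by (simp add: vmap_lift[OF kappa_hom[OF X] lX] kappa_simps off_length vmap_Ta[OF lm] line_map_simps[OF mf]
          psi_simps(4) psi_simps(2)[OF cf] psi_simps(2)[OF mf])
  qed
  show "tsubst psi [Xs] \<cdot> tunit psi (tens psi Xs) = Ide V (tens psi Xs)" if X: "Xs \<in> lists (Obj V)" for Xs
  proof -
    have X1: "[Xs] \<in> lists (lists (Obj V))" using X by simp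
    have k: "kappa [Xs] \<in> Hom G (line [point Xs]) (To (line Xs))" using kappa_hom[OF X1] by simp
    have l: "line [point Xs] \<in> vgraphs U V" using point_obj[OF X] by (intro line_in) simp
    from arg_cong[OF lift_munit[OF k line_in[OF X]], of "\<lambda>k. hmap k (e 0, e 1)"] show ?thesis
      using X point_obj[OF X] graph_homD(1)[OF munit_hom[OF l]] kappa_single[OF X] by (simp add: psi_simps vmap_munit[OF l])
  qed
  show "tsubst psi (map (\<lambda>X. [X]) Xs) \<cdot> tens_arr psi (map (tunit psi) Xs) = Ide V (tens psi Xs)" if X: "Xs \<in> lists (Obj V)" for Xs
  proof -
    let ?Xss = "map (\<lambda>X. [X]) Xs"
    have Xss: "?Xss \<in> lists (lists (Obj V))" using X by auto
    have u: "map (tunit psi) Xs \<in> Hom (seq_cat V) Xs (map point ?Xss)"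
      using X psi_unit_hom by (auto simp: seq_hom_iff psi_simps(3))
    note lu = line_map_hom[OF u]
    have k: "kappa ?Xss \<in> Hom G (line (map point ?Xss)) (To (line Xs))" using kappa_hom[OF Xss] by simp
    have "lift (line Xs) (kappa ?Xss) \<odot> Ta (line_map (map (tunit psi) Xs)) = Ide G (To (line Xs))"
      unfolding lift_Ta[OF k lu line_in[OF X]] kappa_units[OF X] by (rule lift_unit[OF line_in[OF X]])
    from arg_cong[OF this, of "\<lambda>k. hmap k (e 0, e (length Xs))"] show ?thesis
      unfolding hmap_comp_To[OF Ta_hom[OF lu] X]
      using X Xss ends_To[OF X] by (simp add: psi_simps(1,4) psi_simps(2)[OF u] vmap_Ta[OF lu] line_map_simps[OF u] graph_ide)
        (simp add: point_def)
  qed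
  show "tsubst psi (concat Xsss) \<cdot> tsubst psi (map (map (tens psi)) Xsss) = tsubst psi (map concat Xsss) \<cdot> tens_arr psi (map (tsubst psi) Xsss)"
    if X: "Xsss \<in> lists (lists (lists (Obj V)))" for Xsss
  proof -
    have C: "concat Xsss \<in> lists (lists (Obj V))" "map concat Xsss \<in> lists (lists (Obj V))"
      using X by (auto simp: in_lists_conv_set)
    have M: "map (map point) Xsss \<in> lists (lists (Obj V))" using X map_point by (auto simp: in_lists_conv_set)
    have mm: "map (map (tens psi)) Xsss = map (map point) Xsss" using X by (auto simp: psi_simps(1))
    have cm: "concat (map (map point) Xsss) = map point (concat Xsss)" by (simp add: map_concat)
    have cc: "concat (map concat Xsss) = concat (concat Xsss)" by (induction Xsss) auto
    have lY: "line (concat (concat Xsss)) \<in> vgraphs U V" by (rule line_in[OF lists_concat[OF C(1)]])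
    have lM: "line (map point (concat Xsss)) \<in> vgraphs U V" by (rule line_in[OF map_point[OF C(1)]])
    note k = kappa_hom[OF C(1)]
    have k2: "kappa (map (map point) Xsss) \<in> Hom G (line (map point (map (map point) Xsss))) (To (line (map point (concat Xsss))))"
      using kappa_hom[OF M] cm by simp
    have k3: "kappa (map concat Xsss) \<in> Hom G (line (map point (map concat Xsss))) (To (line (concat (concat Xsss))))"
      using kappa_hom[OF C(2)] cc by simp
    note s = map_psi_subst_hom[OF X]
    note ls = line_map_hom[OF s]
    have offm: "off (map (map point) Xsss) i = off Xsss i" for i by (rule off_map_length) simp
    have "lift (line (concat (concat Xsss))) (kappa (concat Xsss)) \<odot> lift (line (map point (concat Xsss))) (kappa (map (map point) Xsss))
      = lift (line (concat (concat Xsss))) (kappa (map concat Xsss)) \<odot> Ta (line_map (map (tsubst psi) Xsss))"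
      unfolding lift_lift[OF k2 k lY] lift_Ta[OF k3 ls lY] kappa_assoc[OF X] ..
    from arg_cong[OF this, of "\<lambda>k. hmap k (e 0, e (length (map point (map (map point) Xsss))))"] show ?thesis
      unfolding hmap_comp_To[OF lift_hom[OF k2 lM] map_point[OF M]] hmap_comp_To[OF Ta_hom[OF ls] map_point[OF M]] mm
      using C M cm cc by (simp add: vmap_lift[OF k2 lM] kappa_simps offm off_length psi_simps(4) psi_simps(2)[OF s] vmap_Ta[OF ls] line_map_simps[OF s])
  qed
qed

end

section \<open>Maps of multitensors from morphisms of monads\<close>

locale set_monad_map = S: set_monad U V e S + T: set_monad U V e T + monad_morphism "graph_cat U V" S T \<gamma>
  for U :: "'u set set" and V :: "('o, 'm) cat" (structure) and e :: "nat \<Rightarrow> 'u"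
    and S T :: "('u, 'o, 'm) graph_monad" and \<gamma> :: "('u, 'o) vgraph \<Rightarrow> ('u, 'o, 'm) vgraph_mor" +
  assumes id_obj: "identity_on_objects U V \<gamma>"
begin

abbreviation G where "G \<equiv> graph_cat U V"

lemma gamma_hom: "X \<in> vgraphs U V \<Longrightarrow> \<gamma> X \<in> Hom G (S.To X) (T.To X)"
  using nat_trans.component[OF natural] by simp

lemma vmap_gamma: "X \<in> vgraphs U V \<Longrightarrow> a \<in> verts X \<Longrightarrow> vmap (\<gamma> X) a = a"
  using id_obj by (simp add: identity_on_objects_def)

lemma gamma_nat: "f \<in> Hom G X Y \<Longrightarrow> T.Ta f \<odot> \<gamma> X = \<gamma> Y \<odot> S.Ta f"
  using nat_trans.naturality[OF natural] by blast

text \<open>Compatibility with multiplication, restated for Kleisli extensions; this is the form in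
  which it meets the substitution of \<open>psi\<close>.\<close>

lemma gamma_lift:
  assumes k: "k \<in> Hom G X (S.To Y)" and Y: "Y \<in> vgraphs U V"
  shows "\<gamma> Y \<odot> S.lift Y k = T.lift Y (\<gamma> Y \<odot> k) \<odot> \<gamma> X"
proof -
  note X = graph_homD(3)[OF k]
  note gY = gamma_hom[OF Y] and gX = gamma_hom[OF X] and gSY = gamma_hom[OF S.To_in[OF Y]]
  note mS = S.mmult_hom[OF Y] and mT = T.mmult_hom[OF Y]
  note Sk = S.Ta_hom[OF k] and Tk = T.Ta_hom[OF k] and Tg = T.Ta_hom[OF gY]
  have "\<gamma> Y \<odot> S.lift Y k = (mmult T Y \<odot> (T.Ta (\<gamma> Y) \<odot> \<gamma> (S.To Y))) \<odot> S.Ta k"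
    unfolding S.lift_def by (rule S.G.comp_ext[OF Sk mS gY]) (use map_mult Y in simp)
  also have "\<dots> = mmult T Y \<odot> (T.Ta (\<gamma> Y) \<odot> (T.Ta k \<odot> \<gamma> X))"
    using S.G.comp_assoc_hom[OF Sk S.G.comp_in[OF gSY Tg] mT] S.G.comp_assoc_hom[OF Sk gSY Tg] gamma_nat[OF k] by simp
  also have "\<dots> = T.lift Y (\<gamma> Y \<odot> k) \<odot> \<gamma> X"
    unfolding T.lift_def T.Ta_comp[OF k gY]
    using S.G.comp_assoc_hom[OF gX S.G.comp_in[OF Tk Tg] mT] S.G.comp_assoc_hom[OF gX Tk Tg] by simp
  finally show ?thesis .
qed

definition psi_map :: "'o list \<Rightarrow> 'm" where
  "psi_map = (\<lambda>Xs\<in>lists (Obj V). hmap (\<gamma> (S.line Xs)) (e 0, e (length Xs)))"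

lemma psi_map_apply: "Xs \<in> lists (Obj V) \<Longrightarrow> psi_map Xs = hmap (\<gamma> (S.line Xs)) (e 0, e (length Xs))"
  by (simp add: psi_map_def)

lemma psi_map_hom: "Xs \<in> lists (Obj V) \<Longrightarrow> psi_map Xs \<in> Hom V (S.point Xs) (T.point Xs)"
  using graph_homD(6)[OF gamma_hom[OF S.line_in], of Xs "e 0" "e (length Xs)"] S.line_in[of Xs]
  by (simp add: psi_map_def S.point_def T.point_def S.verts_To vmap_gamma)

lemma point_psi:
  assumes "Xss \<in> lists (lists (Obj V))"
  shows "map (tens S.psi) Xss = map S.point Xss" "map (tens T.psi) Xss = map T.point Xss"
  using assms by (auto simp: S.psi_simps(1) T.psi_simps(1))

lemma hmap_gamma_comp:
  assumes "Xs \<in> lists (Obj V)" "f \<in> Hom G (S.line Xs) Y"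
  shows "hmap (T.Ta f) (e 0, e (length Xs)) \<cdot> psi_map Xs
    = hmap (\<gamma> Y) (vmap f (e 0), vmap f (e (length Xs))) \<cdot> hmap (S.Ta f) (e 0, e (length Xs))"
proof -
  note l = S.line_in[OF assms(1)]
  from arg_cong[OF gamma_nat[OF assms(2)], of "\<lambda>k. hmap k (e 0, e (length Xs))"]
  show ?thesis
    unfolding S.hmap_comp_To[OF S.Ta_hom[OF assms(2)] assms(1)] S.hmap_comp_To[OF gamma_hom[OF l] assms(1)]
    using assms(1) by (simp add: vmap_gamma[OF l] S.vmap_Ta[OF assms(2)] psi_map_def)
qed

lemma psi_map_natural: "nat_trans (seq_cat V) V (tensor S.psi) (tensor T.psi) psi_map"
proof (rule nat_transI[OF S.psi_functor T.psi_functor])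
  show "psi_map \<in> extensional (Obj (seq_cat V))" by (simp add: psi_map_def)
  show "psi_map Xs \<in> Hom V (tens S.psi Xs) (tens T.psi Xs)" if "Xs \<in> Obj (seq_cat V)" for Xs
    using psi_map_hom[of Xs] that by (simp add: S.psi_simps(1) T.psi_simps(1))
  fix fs Xs Ys assume f: "fs \<in> Hom (seq_cat V) Xs Ys"
  note X = S.seq_hom_lists[OF f]
  show "tens_arr T.psi fs \<cdot> psi_map Xs = psi_map Ys \<cdot> tens_arr S.psi fs"
    using hmap_gamma_comp[OF X(1) S.line_map_hom[OF f]] X
    by (simp add: S.psi_simps(2)[OF f] T.psi_simps(2)[OF f] S.line_map_simps[OF f] psi_map_def)
qed

text \<open>On step \<open>i\<close> this is naturality of \<gamma> at the inclusion of block
  \<open>i\<close>, evaluated at the ends of the block.\<close>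

lemma gamma_kappa:
  assumes X: "Xss \<in> lists (lists (Obj V))"
  shows "\<gamma> (S.line (concat Xss)) \<odot> S.kappa Xss = T.kappa Xss \<odot> S.line_map (map psi_map Xss)"
proof -
  have p: "map psi_map Xss \<in> Hom (seq_cat V) (map S.point Xss) (map T.point Xss)"
    by (rule seq_hom_map) (use X psi_map_hom in auto)
  note l = S.line_in[OF S.lists_concat[OF X]]
  show ?thesis
  proof (rule S.line_hom_eqI[OF S.G.comp_in[OF S.kappa_hom[OF X] gamma_hom[OF l]] S.G.comp_in[OF S.line_map_hom[OF p] T.kappa_hom[OF X]]])
    fix i assume "i \<le> length (map S.point Xss)"
    thus "vmap (\<gamma> (S.line (concat Xss)) \<odot> S.kappa Xss) (e i) = vmap (T.kappa Xss \<odot> S.line_map (map psi_map Xss)) (e i)"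
      using off_le_length[of i Xss] by (simp add: S.kappa_simps T.kappa_simps S.line_map_simps[OF p] vmap_gamma[OF l])
  next
    fix i assume "i < length (map S.point Xss)"
    hence i: "i < length Xss" by simp
    show "hmap (\<gamma> (S.line (concat Xss)) \<odot> S.kappa Xss) (e i, e (Suc i)) = hmap (T.kappa Xss \<odot> S.line_map (map psi_map Xss)) (e i, e (Suc i))"
      using i hmap_gamma_comp[OF S.lists_nth[OF X i] S.segment_hom[OF X i]]
      by (simp add: S.kappa_simps T.kappa_simps S.line_map_simps[OF p] S.segment_simps off_Suc)
  qed
qed

lemma psi_map_multitensor_map: "multitensor_map V S.psi T.psi psi_map"
proof (rule multitensor_mapI[OF S.multitensor_psi T.multitensor_psi psi_map_natural])
  fix X assume X: "X \<in> Obj V"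
  have l: "S.line [X] \<in> vgraphs U V" using X by (intro S.line_in) simp
  have "\<gamma> (S.line [X]) \<odot> munit S (S.line [X]) = munit T (S.line [X])" using map_unit l by simp
  from arg_cong[OF this, of "\<lambda>k. hmap k (e 0, e 1)"] show "psi_map [X] \<cdot> tunit S.psi X = tunit T.psi X"
    using X graph_homD(1)[OF S.munit_hom[OF l]] by (simp add: psi_map_def S.psi_simps(3) T.psi_simps(3) S.vmap_munit[OF l])
next
  fix Xss assume X: "Xss \<in> lists (lists (Obj V))"
  have p: "map psi_map Xss \<in> Hom (seq_cat V) (map S.point Xss) (map T.point Xss)"
    by (rule seq_hom_map) (use X psi_map_hom in auto)
  let ?L = "S.line (concat Xss)" and ?K = "S.line (map S.point Xss)"
  note c = S.lists_concat[OF X] and m = S.map_point[OF X]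
  note l = S.line_in[OF c] and lK = S.line_in[OF m]
  note kS = S.kappa_hom[OF X] and kT = T.kappa_hom[OF X] and lp = S.line_map_hom[OF p]
  have "\<gamma> ?L \<odot> S.lift ?L (S.kappa Xss) = (T.lift ?L (T.kappa Xss) \<odot> T.Ta (S.line_map (map psi_map Xss))) \<odot> \<gamma> ?K"
    unfolding gamma_lift[OF kS l] gamma_kappa[OF X] T.lift_Ta[OF kT lp l] ..
  also have "\<dots> = T.lift ?L (T.kappa Xss) \<odot> (T.Ta (S.line_map (map psi_map Xss)) \<odot> \<gamma> ?K)"
    by (rule S.G.comp_assoc_hom[OF gamma_hom[OF lK] T.Ta_hom[OF lp] T.lift_hom[OF kT l]])
  finally have "hmap (\<gamma> ?L \<odot> S.lift ?L (S.kappa Xss)) (e 0, e (length (map S.point Xss)))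
    = hmap (T.lift ?L (T.kappa Xss) \<odot> (T.Ta (S.line_map (map psi_map Xss)) \<odot> \<gamma> ?K)) (e 0, e (length (map S.point Xss)))"
    by simp
  thus "psi_map (concat Xss) \<cdot> tsubst S.psi Xss = tsubst T.psi Xss \<cdot> (tens_arr T.psi (map psi_map Xss) \<cdot> psi_map (map (tens S.psi) Xss))"
    unfolding S.hmap_comp_To[OF S.lift_hom[OF kS l] m] S.hmap_comp_To[OF S.G.comp_in[OF gamma_hom[OF lK] T.Ta_hom[OF lp]] m]
      S.hmap_comp_To[OF gamma_hom[OF lK] m] point_psi(1)[OF X] using X c S.ends_To[OF m, of 0] S.ends_To[OF m, of "length
      Xss"] graph_homD(1)[OF gamma_hom[OF lK]]
    by (simp add: psi_map_apply[OF c] psi_map_apply[OF m] S.psi_simps(4) T.psi_simps(4) T.psi_simps(2)[OF p] S.vmap_lift[OF kS l] S.kappa_simps off_length vmap_gamma[OF lK] T.vmap_Ta[OF lp] S.line_map_simps[OF p])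
qed

end

text \<open>A pullback of graphs along maps that are the identity on objects is a pullback on homs:
  test it against graphs with a single nontrivial hom.\<close>

lemma (in line_cat) graph_pullback_hom:
  assumes pb: "is_pullback G p q f g" and p: "p \<in> Hom G P A" and q: "q \<in> Hom G P B"
    and f: "f \<in> Hom G A D" and g: "g \<in> Hom G B D"
    and vB: "verts B = verts P" "\<And>a. a \<in> verts P \<Longrightarrow> vmap q a = a"
    and ab: "a \<in> verts P" "b \<in> verts P"
  shows "is_pullback V (hmap p (a, b)) (hmap q (a, b)) (hmap f (vmap p a, vmap p b)) (hmap g (a, b))"
proof -
  note pD = graph_homD[OF p] and qD = graph_homD[OF q] and fD = graph_homD[OF f] and gD = graph_homD[OF g]
  have comm: "f \<odot> p = g \<odot> q" using pullbackD(9)[OF pb] .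
  have vc: "vmap f (vmap p c) = vmap g c" if "c \<in> verts P" for c
    using arg_cong[OF comm, of "\<lambda>k. vmap k c"] that pD(1) qD(1) vB by simp
  have abB: "a \<in> verts B" "b \<in> verts B" using ab vB by auto
  have pq: "hmap q (a, b) \<in> Hom V (homs P (a, b)) (homs B (a, b))" using qD(6)[OF ab] vB ab by simp
  have gg: "hmap g (a, b) \<in> Hom V (homs B (a, b)) (homs D (vmap f (vmap p a), vmap f (vmap p b)))"
    using gD(6)[OF abB] vc ab by simp
  have ff: "hmap f (vmap p a, vmap p b) \<in> Hom V (homs A (vmap p a, vmap p b)) (homs D (vmap f (vmap p a), vmap f (vmap p b)))"
    using fD(6) pD(5) ab by simp
  \<comment> \<open>A one-step line has two distinct vertices, sent here to \<open>x\<close> and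
    \<open>y\<close>, so the case \<open>x = y\<close> needs no separate treatment. Every index
    other than 0 is sent to \<open>y\<close>.\<close>
  define v where "v = (\<lambda>(x :: 'u) (y :: 'u) i. if i = (0::nat) then x else y)"
  have v: "v x y 0 = x" "v x y (Suc i) = y" for x y i by (auto simp: v_def)
  have vmem: "x \<in> verts X \<Longrightarrow> y \<in> verts X \<Longrightarrow> v x y i \<in> verts X" for x y i and X :: "('u, 'o) vgraph" by (simp add: v_def)
  have L: "line_mor [w] X (v x y) (\<lambda>_. k) \<in> Hom G (line [w]) X"
    if "X \<in> vgraphs U V" "x \<in> verts X" "y \<in> verts X" "k \<in> Hom V w (homs X (x, y))" for w X x y k
    using that hom_obj[OF that(4)] by (intro line_mor_hom vmem) (simp_all add: v)
  show ?thesis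
  proof (rule pullbackI[OF pD(6)[OF ab] pq ff gg])
    show "hmap f (vmap p a, vmap p b) \<cdot> hmap p (a, b) = hmap g (a, b) \<cdot> hmap q (a, b)"
      using arg_cong[OF comm, of "\<lambda>k. hmap k (a, b)"] ab pD(1) qD(1) vB by simp
  next
    fix w r s assume r: "r \<in> Hom V w (homs A (vmap p a, vmap p b))" and s: "s \<in> Hom V w (homs B (a, b))"
      and e: "hmap f (vmap p a, vmap p b) \<cdot> r = hmap g (a, b) \<cdot> s"
    have w: "w \<in> Obj V" using hom_obj[OF r] by simp
    \<comment> \<open>The cone in \<open>V\<close> becomes a cone of graphs on
      \<open>line [w]\<close>, where all homs except the one from \<open>e 0\<close> to
      \<open>e 1\<close> are initial. The mediating graph map is then read at that hom.\<close>
    let ?R = "line_mor [w] A (v (vmap p a) (vmap p b)) (\<lambda>_. r)" and ?S = "line_mor [w] B (v a b) (\<lambda>_. s)"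
    have R: "?R \<in> Hom G (line [w]) A" by (rule L[OF pD(4) pD(5)[OF ab(1)] pD(5)[OF ab(2)] r])
    have S: "?S \<in> Hom G (line [w]) B" by (rule L[OF qD(4) abB s])
    have "f \<odot> ?R = g \<odot> ?S"
    proof (rule line_hom_eqI[OF G.comp_in[OF R f] G.comp_in[OF S g]])
      show "vmap (f \<odot> ?R) (e i) = vmap (g \<odot> ?S) (e i)" if "i \<le> length [w]" for i
        using that vc ab by (cases i) (auto simp: v)
      show "hmap (f \<odot> ?R) (e i, e (Suc i)) = hmap (g \<odot> ?S) (e i, e (Suc i))" if "i < length [w]" for i
        using that e by (simp add: v)
    qed
    moreover have "?R \<in> Hom G (line [w]) (Dom G f)" "?S \<in> Hom G (line [w]) (Dom G g)" "line [w] \<in> Obj G"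
      using R S HomD(2)[OF f] HomD(2)[OF g] line_in[of "[w]"] w by auto
    ultimately obtain h where "h \<in> Hom G (line [w]) (Dom G p)" "p \<odot> h = ?R" "q \<odot> h = ?S"
      using pullback_ex[OF pb] by metis
    hence h: "h \<in> Hom G (line [w]) P" "p \<odot> h = ?R" "q \<odot> h = ?S" using HomD(2)[OF p] by auto
    note hD = graph_homD[OF h(1)]
    have vh: "vmap h (e 0) = a" "vmap h (e 1) = b"
      using arg_cong[OF h(3), of "\<lambda>k. vmap k (e 0)"] arg_cong[OF h(3), of "\<lambda>k. vmap k (e 1)"] hD(1,5) vB(2) by (auto simp: v)
    have "hmap p (a, b) \<cdot> hmap h (e 0, e 1) = r"
      using arg_cong[OF h(2), of "\<lambda>k. hmap k (e 0, e 1)"] hD(1) vh by simp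
    moreover have "hmap q (a, b) \<cdot> hmap h (e 0, e 1) = s"
      using arg_cong[OF h(3), of "\<lambda>k. hmap k (e 0, e 1)"] hD(1) vh by simp
    moreover have "hmap h (e 0, e 1) \<in> Hom V w (homs P (a, b))"
      using hD(6)[of "e 0" "e 1"] vh homs_line(1)[of 0 "[w]"] by simp
    ultimately show "\<exists>h\<in>Hom V w (homs P (a, b)). hmap p (a, b) \<cdot> h = r \<and> hmap q (a, b) \<cdot> h = s" by blast
  next
    fix w h h' assume h: "h \<in> Hom V w (homs P (a, b))" "h' \<in> Hom V w (homs P (a, b))"
      and e: "hmap p (a, b) \<cdot> h = hmap p (a, b) \<cdot> h'" "hmap q (a, b) \<cdot> h = hmap q (a, b) \<cdot> h'"
    let ?H = "\<lambda>h. line_mor [w] P (v a b) (\<lambda>_. h)"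
    note H = L[OF pD(3) ab h(1)] L[OF pD(3) ab h(2)]
    have *: "k \<odot> ?H h = k \<odot> ?H h'" if k: "k \<in> Hom G P X" "hmap k (a, b) \<cdot> h = hmap k (a, b) \<cdot> h'" for k X
    proof (rule line_hom_eqI[OF G.comp_in[OF H(1) k(1)] G.comp_in[OF H(2) k(1)]])
      show "hmap (k \<odot> ?H h) (e i, e (Suc i)) = hmap (k \<odot> ?H h') (e i, e (Suc i))" if "i < length [w]" for i
        using that k(2) by (simp add: v)
    qed simp
    have "?H h = ?H h'"
      using G.pullback_unique[OF pb, of "?H h" "line [w]" "?H h'"] H *[OF p e(1)] *[OF q e(2)] HomD(2)[OF p] by simp
    from arg_cong[OF this, of "\<lambda>k. hmap k (e 0, e 1)"] show "h = h'"
      by simp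
  qed
qed

lemma (in set_monad_map) gamma_pullback_hom:
  assumes cart: "cartesian_trans G G (endo S) (endo T) \<gamma>" and f: "f \<in> Hom G X Y" and ab: "a \<in> verts X" "b \<in> verts X"
  shows "is_pullback V (hmap (S.Ta f) (a, b)) (hmap (\<gamma> X) (a, b)) (hmap (\<gamma> Y) (vmap f a, vmap f b)) (hmap (T.Ta f) (a, b))"
proof -
  note F = graph_homD[OF f]
  show ?thesis
    using S.graph_pullback_hom[OF cartesian_transD[OF cart f] S.Ta_hom[OF f] gamma_hom[OF F(3)] gamma_hom[OF F(4)] T.Ta_hom[OF f]]
      S.verts_To[OF F(3)] T.verts_To[OF F(3)] vmap_gamma[OF F(3)] ab S.vmap_Ta[OF f] by simp
qed

text \<open>The naturality square at \<open>fs\<close> is the pullback square of \<gamma> at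
  \<open>line_map fs\<close>, evaluated at the end vertices.\<close>

lemma (in set_monad_map) psi_map_cartesian:
  assumes cart: "cartesian_trans G G (endo S) (endo T) \<gamma>"
  shows "cartesian_trans (seq_cat V) V (tensor S.psi) (tensor T.psi) psi_map"
  unfolding cartesian_trans_def
proof (intro conjI ballI psi_map_natural)
  fix fs assume "fs \<in> Arr (seq_cat V)"
  from Hom_cong_arr[OF this] obtain Xs Ys where f: "fs \<in> Hom (seq_cat V) Xs Ys" ..
  note X = S.seq_hom_lists[OF f]
  have "e 0 \<in> verts (S.line Xs)" "e (length Xs) \<in> verts (S.line Xs)" by auto
  from gamma_pullback_hom[OF cart S.line_map_hom[OF f] this]
  show "is_pullback V (tens_arr S.psi fs) (psi_map (Dom (seq_cat V) fs)) (psi_map (Cod (seq_cat V) fs)) (tens_arr T.psi fs)"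
    using X HomD(2,3)[OF f] by (simp add: S.psi_simps(2)[OF f] T.psi_simps(2)[OF f] psi_map_def S.line_map_simps[OF f])
qed

section \<open>The unit of the equivalence\<close>

locale dist_line = line_cat U V e + A: dist_mult U V A
  for U :: "'u set set" and V :: "('o, 'm) cat" (structure) and e :: "nat \<Rightarrow> 'u" and A :: "('o, 'm) multitensor"
begin

sublocale P: set_monad U V e "Gamma U V A"
  by unfold_locales (rule A.monad_over_Set_Gamma)

abbreviation \<Gamma> :: "('u, 'o) vgraph \<Rightarrow> ('u, 'o) vgraph" where "\<Gamma> \<equiv> Gamma_graph V A"
abbreviation pinj :: "('u, 'o) vgraph \<Rightarrow> 'u list \<Rightarrow> 'm" where "pinj \<equiv> path_inj V A"

lemma Gamma_simps [simp]:
  "munit (Gamma U V A) = Gamma_unit U V A" "mmult (Gamma U V A) = Gamma_mult U V A"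
  "X \<in> vgraphs U V \<Longrightarrow> P.To X = \<Gamma> X" "f \<in> Hom G X Y \<Longrightarrow> P.Ta f = Gamma_mor V A f"
  by (simp_all add: Gamma_def)

text \<open>The second argument counts steps, so the list has one vertex more. With no steps it is a
  single vertex, the path that belongs to the empty tensor.\<close>

definition interval :: "nat \<Rightarrow> nat \<Rightarrow> 'u list" where
  "interval m n = map e [m..<Suc (m + n)]"

lemma interval_simps:
  "interval m n \<noteq> []" "length (interval m n) = Suc n" "hd (interval m n) = e m" "last (interval m n) = e (m + n)"
  "i \<le> n \<Longrightarrow> interval m n ! i = e (m + i)" "tl (interval m n) = map e [Suc m..<Suc (m + n)]"
proof -
  have "[m..<Suc (m + n)] = m # [Suc m..<Suc (m + n)]" by (simp add: upt_conv_Cons del: upt_Suc)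
  thus "interval m n \<noteq> []" "hd (interval m n) = e m" "tl (interval m n) = map e [Suc m..<Suc (m + n)]"
    by (simp_all add: interval_def del: upt_Suc)
  show "length (interval m n) = Suc n" "last (interval m n) = e (m + n)" by (simp_all add: interval_def)
  show "i \<le> n \<Longrightarrow> interval m n ! i = e (m + i)" by (simp add: interval_def del: upt_Suc)
qed

lemma interval_Suc: "interval m (Suc n) = e m # interval (Suc m) n"
  by (simp add: interval_def upt_conv_Cons del: upt_Suc)

lemma steps_interval: "steps (interval m n) = map (\<lambda>i. (e i, e (Suc i))) [m..<m + n]"
  by (rule nth_equalityI) (simp_all add: steps_length interval_simps steps_nth)

lemma interval_path:
  assumes "m + n \<le> length Xs"
  shows "interval m n \<in> paths (verts (line Xs)) (e m) (e (m + n))"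
  using assms interval_simps[of m n] by (auto simp: paths_def) (auto simp: interval_def)

lemma path_homs_interval:
  "m + n \<le> length Xs \<Longrightarrow> path_homs (line Xs) (interval m n) = take n (drop m Xs)"
  by (rule nth_equalityI) (simp_all add: path_homs_def steps_interval homs_line)

definition eta :: "'o list \<Rightarrow> 'm" where
  "eta = (\<lambda>Xs\<in>lists (Obj V). pinj (line Xs) (interval 0 (length Xs)))"

lemma full_path: "interval 0 (length Xs) \<in> paths (verts (line Xs)) (e 0) (e (length Xs))"
  using interval_path[of 0 "length Xs" Xs] by simp

lemma full_homs: "path_homs (line Xs) (interval 0 (length Xs)) = Xs"
  using path_homs_interval[of 0 "length Xs" Xs] by simp

lemma point_Gamma: "Xs \<in> lists (Obj V) \<Longrightarrow> P.point Xs = homs (\<Gamma> (line Xs)) (e 0, e (length Xs))"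
  by (simp add: P.point_def line_in)

lemma eta_hom:
  assumes "Xs \<in> lists (Obj V)"
  shows "eta Xs \<in> Hom V (tens A Xs) (P.point Xs)"
  using A.inj_hom[OF line_in[OF assms] full_path] assms full_homs[of Xs]
  by (simp add: eta_def point_Gamma path_tensor_def)

lemma map_hmap_full:
  assumes "f \<in> Hom G (line Xs) Y"
  shows "map (hmap f) (steps (interval 0 (length Xs))) = map (\<lambda>i. hmap f (e i, e (Suc i))) [0..<length Xs]"
  by (simp add: steps_interval)

lemma eta_natural: "nat_trans (seq_cat V) V (tensor A) (tensor P.psi) eta"
proof (rule nat_transI[OF A.tensor_functor P.psi_functor])
  show "eta \<in> extensional (Obj (seq_cat V))" by (simp add: eta_def)
  show "eta Xs \<in> Hom V (tens A Xs) (tens P.psi Xs)" if "Xs \<in> Obj (seq_cat V)" for Xs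
    using eta_hom[of Xs] that by (simp add: P.psi_simps(1))
  fix fs Xs Ys assume f: "fs \<in> Hom (seq_cat V) Xs Ys"
  note X = seq_hom_lists[OF f] and l = line_map_hom[OF f]
  have 1: "map (vmap (line_map fs)) (interval 0 (length Xs)) = interval 0 (length Ys)"
    using X(3,4) by (auto simp: interval_def line_map_simps[OF f])
  have 2: "map (hmap (line_map fs)) (steps (interval 0 (length Xs))) = fs"
    unfolding map_hmap_full[OF l] by (rule nth_equalityI) (simp_all add: X(3) line_map_simps[OF f])
  show "tens_arr P.psi fs \<cdot> eta Xs = eta Ys \<cdot> tens_arr A fs"
    using A.Gamma_mor(3)[OF l full_path] X(1,2) l by (simp add: P.psi_simps(2)[OF f] eta_def 1 2)
qed

text \<open>Distributivity over the empty family: a tensor with an initial factor is an empty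
  coproduct.\<close>

lemma initial_factor:
  assumes X: "Xs \<in> lists (Obj V)" and k: "k < length Xs" "Xs ! k = initial"
  shows "is_coproduct V ({} :: 'u set) (\<lambda>_. undefined) (tens A Xs) (\<lambda>_. undefined)"
proof -
  \<comment> \<open>No index is available, so \<open>undefined\<close> only fills the place of the
    injections.\<close>
  have "is_coproduct V ({} :: 'u set) (\<lambda>i. tens A (Xs[k := (\<lambda>_. initial) i])) (tens A (Xs[k := initial]))
          (\<lambda>i. tens_arr A ((map (Ide V) Xs)[k := (\<lambda>_. undefined) i]))"
    by (rule dist_small[OF A.dist X k(1) small_finite initial_coproduct]) simp
  hence "is_coproduct V ({} :: 'u set) (\<lambda>i. tens A (Xs[k := initial])) (tens A Xs)
          (\<lambda>i. tens_arr A ((map (Ide V) Xs)[k := undefined]))" using list_update_id[of Xs k] k(2) by simp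
  from coproduct_cong[OF this, of "\<lambda>_. undefined" "\<lambda>_. undefined"] show ?thesis by simp
qed

text \<open>A path in which every step raises the index by one is determined by its start and its
  number of steps.\<close>

lemma path_is_interval:
  assumes "xs \<in> paths (range e) (e m) b" "\<And>c d. (c, d) \<in> set (steps xs) \<Longrightarrow> ix d = Suc (ix c)"
  shows "xs = interval m (length xs - 1)"
  using assms
proof (induction xs arbitrary: m rule: induct_list012)
  case (3 x y zs)
  have x: "x = e m" using 3(3) by (simp add: paths_def)
  have "ix y = Suc m" using 3(4)[of x y] x by simp
  moreover have "y \<in> range e" using 3(3) by (auto simp: paths_def)
  ultimately have y: "y = e (Suc m)" by auto
  have "y # zs \<in> paths (range e) (e (Suc m)) b" using 3(3) y by (auto simp: paths_def)
  from 3(2)[OF this] 3(4) have "y # zs = interval (Suc m) (length zs)" by simp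
  thus ?case using x interval_Suc[of m "length zs"] interval_simps(2)[of "Suc m" "length zs"] by simp
qed (auto simp: paths_def interval_def)

text \<open>A path between the two ends other than the full one has a step between vertices that are
  not consecutive, hence an initial factor. \<open>single_summand\<close> then applies to the full
  path.\<close>

lemma eta_iso:
  assumes X: "Xs \<in> lists (Obj V)"
  shows "is_iso V (eta Xs)"
proof -
  let ?L = "line Xs"
  note lX = line_in[OF X]
  have ends: "e 0 \<in> verts ?L" "e (length Xs) \<in> verts ?L" by auto
  have "is_iso V (pinj ?L (interval 0 (length Xs)))"
  proof (rule single_summand[OF A.Gamma_coproduct[OF lX ends] full_path])
    fix xs assume xs: "xs \<in> paths (verts ?L) (e 0) (e (length Xs))" and ne: "xs \<noteq> interval 0 (length Xs)"
    have xs': "xs \<in> paths (range e) (e 0) (e (length Xs))" using xs by (auto simp: paths_def verts_line)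
    obtain c d where cd: "(c, d) \<in> set (steps xs)" "ix d \<noteq> Suc (ix c)"
    \<comment> \<open>Without such a step \<open>xs\<close> is an interval that starts at
      \<open>e 0\<close>. Its last vertex fixes the length, so it would be the full path.\<close>
    proof (rule ccontr)
      assume "\<not> thesis"
      hence "xs = interval 0 (length xs - 1)" using path_is_interval[OF xs'] that by blast
      moreover from this have "length xs - 1 = length Xs"
        using pathsD(4)[OF xs] interval_simps(4)[of 0 "length xs - 1"] by simp
      ultimately show False using ne by simp
    qed
    have "c \<in> verts ?L" "d \<in> verts ?L" using steps_set_in[OF cd(1) pathsD(2)[OF xs]] by auto
    then obtain i j where "c = e i" "d = e j" "i \<le> length Xs" "j \<le> length Xs" by (auto simp: verts_line)
    hence "homs ?L (c, d) = initial" using cd(2) homs_line(2) by simp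
    moreover obtain k where "k < length (steps xs)" "steps xs ! k = (c, d)" using cd(1) by (auto simp: in_set_conv_nth)
    ultimately have "k < length (path_homs ?L xs)" "path_homs ?L xs ! k = initial" by (auto simp: path_homs_def)
    thus "is_coproduct V ({} :: 'u set) (\<lambda>_. undefined) (path_tensor A ?L xs) (\<lambda>_. undefined)"
      unfolding path_tensor_def by (rule initial_factor[OF path_homs_lists[OF lX pathsD(2)[OF xs]]])
  qed
  thus ?thesis using X by (simp add: eta_def)
qed

text \<open>The refined path that \<open>eta_subst\<close> meets: the outer path visits the starts
  of the blocks and the final vertex, and the refinements run through the blocks.\<close>

lemma interval_join:
  assumes "Xss \<in> lists (lists (Obj V))"
  shows "path_join (map (\<lambda>i. e (off Xss i)) [0..<Suc (length Xss)]) (map (\<lambda>i. interval (off Xss i) (length (Xss ! i))) [0..<length Xss])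
    = interval 0 (length (concat Xss))"
proof -
  have "concat (map (\<lambda>i. map e [Suc (off Xss i)..<Suc (off Xss i + length (Xss ! i))]) [0..<k]) = map e [Suc 0..<Suc (off Xss k)]"
    if "k \<le> length Xss" for k
    using that
  proof (induction k)
    case (Suc k)
    have "[Suc 0..<Suc (off Xss (Suc k))] = [Suc 0..<Suc (off Xss k)] @ [Suc (off Xss k)..<Suc (off Xss k + length (Xss ! k))]"
      using upt_add_eq_append[of "Suc 0" "Suc (off Xss k)" "length (Xss ! k)"] Suc.prems by (simp add: off_Suc del: upt_Suc)
    moreover have "[0..<Suc k] = [0..<k] @ [k]" by simp
    ultimately show ?case using Suc by (simp del: upt_Suc)
  qed simp
  from this[of "length Xss"] show ?thesis
    by (simp add: path_join_def interval_simps(6) comp_def off_length hd_map del: upt_Suc) (simp add: interval_def upt_conv_Cons del: upt_Suc)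
qed

text \<open>Substitution in \<open>psi\<close> after \<open>eta\<close> on the blocks is the
  extension of one graph map \<open>k\<close> from the line on the block values into \<Gamma> of the
  concatenated line. Restricted along \<open>eta\<close>, the image of \<open>k\<close> is the
  summand given by the outer path \<open>?ys\<close> and its refinement \<open>?xss\<close>. There
  the multiplication of \<Gamma> is described by \<open>tsubst A\<close>, and the joined path is the
  full path.\<close>

lemma eta_subst:
  assumes X: "Xss \<in> lists (lists (Obj V))"
  shows "eta (concat Xss) \<cdot> tsubst A Xss = tsubst P.psi Xss \<cdot> (tens_arr P.psi (map eta Xss) \<cdot> eta (map (tens A) Xss))"
proof -
  let ?L = "line (concat Xss)" and ?k = "length Xss" and ?Ys = "map (tens A) Xss"
  note c = lists_concat[OF X]
  note l = line_in[OF c]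
  have Ys: "?Ys \<in> lists (Obj V)" using X by auto
  note lY = line_in[OF Ys] and m = P.map_point[OF X]
  have et: "map eta Xss \<in> Hom (seq_cat V) ?Ys (map P.point Xss)"
    by (rule seq_hom_map) (use X eta_hom in auto)
  note le = line_map_hom[OF et] and kX = P.kappa_hom[OF X]
  define k where "k = P.kappa Xss \<odot> line_map (map eta Xss)"
  have k: "k \<in> Hom G (line ?Ys) (\<Gamma> ?L)" unfolding k_def using G.comp_in[OF le kX] l by simp
  have vk: "vmap k (e i) = e (off Xss i)" if "i \<le> ?k" for i
    using that by (simp add: k_def line_map_simps[OF et] P.kappa_simps)
  \<comment> \<open>On step \<open>i\<close> the inclusion of block \<open>i\<close> carries the
    full path of its own line to an interval of the large line, with identities on the homs.\<close>
  have hk: "hmap k (e i, e (Suc i)) = pinj ?L (interval (off Xss i) (length (Xss ! i)))" if i: "i < ?k" for i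
  proof -
    note s = segment_hom[OF X i] and Xi = lists_nth[OF X i]
    let ?n = "length (Xss ! i)"
    have b: "off Xss i + ?n \<le> length (concat Xss)" by (rule off_le[OF i order_refl])
    note ip = interval_path[OF b]
    have sv: "map (vmap (segment Xss i)) (interval 0 ?n) = interval (off Xss i) ?n"
      by (rule nth_equalityI) (simp_all add: interval_simps segment_simps)
    have sh: "map (hmap (segment Xss i)) (steps (interval 0 ?n)) = map (Ide V) (Xss ! i)"
      unfolding map_hmap_full[OF s] by (rule nth_equalityI) (simp_all add: segment_simps)
    have ph: "path_homs ?L (interval (off Xss i) ?n) = Xss ! i"
      unfolding path_homs_interval[OF b] by (rule nth_equalityI) (use b concat_nth_off[OF i] in auto)
    have "hmap k (e i, e (Suc i)) = hmap (Gamma_mor V A (segment Xss i)) (e 0, e ?n) \<cdot> eta (Xss ! i)"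
      using i s by (simp add: k_def line_map_simps[OF et] P.kappa_simps)
    also have "\<dots> = pinj ?L (interval (off Xss i) ?n) \<cdot> tens_arr A (map (Ide V) (Xss ! i))"
      using A.Gamma_mor(3)[OF s full_path] sv sh Xi by (simp add: eta_def)
    also have "\<dots> = pinj ?L (interval (off Xss i) ?n)"
      using ide_right[OF A.inj_hom[OF l ip]] ph A.tens_ide[OF Xi] by (simp add: path_tensor_def)
    finally show ?thesis .
  qed
  let ?ys = "map (\<lambda>i. e (off Xss i)) [0..<Suc ?k]" and ?xss = "map (\<lambda>i. interval (off Xss i) (length (Xss ! i))) [0..<?k]"
  have vk': "map (vmap k) (interval 0 ?k) = ?ys"
    by (rule nth_equalityI) (simp_all add: interval_simps vk del: upt_Suc)
  have hk': "map (hmap k) (steps (interval 0 ?k)) = map (pinj ?L) ?xss"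
    by (rule nth_equalityI) (simp_all add: steps_interval hk)
  have ys: "?ys \<in> paths (verts ?L) (e 0) (e (length (concat Xss)))"
    using off_le_length[of _ Xss] by (auto simp: paths_def hd_map last_map off_length simp del: upt_Suc)
  have xss: "step_paths (verts ?L) ?ys ?xss"
  proof -
    have "steps ?ys = map (\<lambda>i. (e (off Xss i), e (off Xss (Suc i)))) [0..<?k]"
      by (rule nth_equalityI) (simp_all add: steps_length steps_nth del: upt_Suc)
    thus ?thesis using interval_path[OF off_le[OF _ order_refl], of _ Xss] by (simp add: list_all2_map1 list_all2_map2 list_all2_same off_Suc)
  qed
  have phx: "map (path_homs ?L) ?xss = Xss"
  proof (rule nth_equalityI)
    fix i assume "i < length (map (path_homs ?L) ?xss)"
    hence i: "i < length Xss" by simp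
    have b: "off Xss i + length (Xss ! i) \<le> length (concat Xss)" by (rule off_le[OF i order_refl])
    have "path_homs ?L (interval (off Xss i) (length (Xss ! i))) = Xss ! i"
      unfolding path_homs_interval[OF b] by (rule nth_equalityI) (use b concat_nth_off[OF i] in auto)
    thus "map (path_homs ?L) ?xss ! i = Xss ! i" using i by simp
  qed simp
  note j = A.mult_hom_graph(3)[OF l ys xss, unfolded interval_join[OF X] phx]
  have pk: "hmap (Gamma_mor V A k) (e 0, e ?k) \<cdot> eta ?Ys = pinj (\<Gamma> ?L) ?ys \<cdot> tens_arr A (map (pinj ?L) ?xss)"
    using A.Gamma_mor(3)[OF k full_path] Ys by (simp add: eta_def vk' hk' del: upt_Suc map_map)
  have lift: "P.lift ?L k = Gamma_mult U V A ?L \<odot> Gamma_mor V A k"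
    unfolding P.lift_def using k by simp
  have eqn: "P.lift ?L (P.kappa Xss) \<odot> P.Ta (line_map (map eta Xss)) = P.lift ?L k"
    unfolding k_def by (rule P.lift_Ta[OF kX le l])
  have gk: "hmap (Gamma_mor V A k) (e 0, e ?k) \<in> Hom V (P.point ?Ys) (homs (\<Gamma> (\<Gamma> ?L)) (e 0, e (length (concat Xss))))"
    using P.point_hom[OF k] k A.Gamma_graph_in[OF l] vk[of 0] vk[of ?k] by (simp add: off_length)
  have mh: "hmap (Gamma_mult U V A ?L) (e 0, e (length (concat Xss))) \<in> Hom V (homs (\<Gamma> (\<Gamma> ?L)) (e 0, e (length (concat Xss)))) (homs (\<Gamma> ?L) (e 0, e (length (concat Xss))))"
    by (rule A.mult_hmap[OF l]) simp_all
  have "tsubst P.psi Xss \<cdot> tens_arr P.psi (map eta Xss) = hmap (P.lift ?L k) (e 0, e ?k)"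
    using arg_cong[OF eqn, of "\<lambda>h. hmap h (e 0, e (length ?Ys))"]
    unfolding P.hmap_comp_To[OF P.Ta_hom[OF le] Ys]
    using X by (simp add: P.psi_simps(4) P.psi_simps(2)[OF et] P.vmap_Ta[OF le] line_map_simps[OF et] del: Gamma_simps)
  also have "\<dots> = hmap (Gamma_mult U V A ?L) (e 0, e (length (concat Xss))) \<cdot> hmap (Gamma_mor V A k) (e 0, e ?k)"
  proof -
    have "Gamma_mor V A k \<in> Hom G (P.To (line ?Ys)) (\<Gamma> (\<Gamma> ?L))" using A.Gamma_mor(1)[OF k] lY by simp
    from P.hmap_comp_To[OF this Ys, of "Gamma_mult U V A ?L"] show ?thesis unfolding lift
      using vk[of 0] vk[of ?k] by (simp add: A.Gamma_mor(2)[OF k] off_length)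
  qed
  finally have 1: "tsubst P.psi Xss \<cdot> tens_arr P.psi (map eta Xss) = hmap (Gamma_mult U V A ?L) (e 0, e (length (concat Xss))) \<cdot> hmap (Gamma_mor V A k) (e 0, e ?k)" .
  interpret Q: multitensor V P.psi by (rule P.multitensor_psi)
  have pp: "map (tens P.psi) Xss = map P.point Xss" using X by (auto simp: P.psi_simps(1))
  have ty: "eta ?Ys \<in> Hom V (tens A ?Ys) (P.point ?Ys)" by (rule eta_hom[OF Ys])
  have tx: "tens_arr P.psi (map eta Xss) \<in> Hom V (P.point ?Ys) (P.point (map P.point Xss))"
    using Q.tens_hom[OF et] Ys m by (simp add: P.psi_simps(1))
  have ts: "tsubst P.psi Xss \<in> Hom V (P.point (map P.point Xss)) (P.point (concat Xss))"
    using Q.subst_hom[OF X] unfolding pp using m c by (simp add: P.psi_simps(1))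
  have "tsubst P.psi Xss \<cdot> (tens_arr P.psi (map eta Xss) \<cdot> eta ?Ys) = (tsubst P.psi Xss \<cdot> tens_arr P.psi (map eta Xss)) \<cdot> eta ?Ys"
    using comp_assoc_hom[OF ty tx ts] by simp
  also have "\<dots> = hmap (Gamma_mult U V A ?L) (e 0, e (length (concat Xss))) \<cdot> (pinj (\<Gamma> ?L) ?ys \<cdot> tens_arr A (map (pinj ?L) ?xss))"
    unfolding 1 comp_assoc_hom[OF ty gk mh] pk ..
  also have "\<dots> = eta (concat Xss) \<cdot> tsubst A Xss" unfolding j using c by (simp add: eta_def)
  finally show ?thesis ..
qed

lemma eta_multitensor_map: "multitensor_map V A P.psi eta"
proof (rule multitensor_mapI[OF A.multitensor_axioms P.multitensor_psi eta_natural])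
  fix X assume X: "X \<in> Obj V"
  have X1: "[X] \<in> lists (Obj V)" using X by simp
  note l = line_in[OF X1]
  have "interval 0 1 = [e 0, e 1]" by (simp add: interval_def)
  thus "eta [X] \<cdot> tunit A X = tunit P.psi X"
    using X A.unit_hom_graph(3)[OF l, of "e 0" "e 1"] homs_line(1)[of 0 "[X]"] by (simp add: eta_def P.psi_simps(3))
qed (rule eta_subst)

end

section \<open>The counit of the equivalence\<close>

lemma path_homs_length: "length (path_homs X xs) = length xs - 1"
  by (simp add: path_homs_def steps_length)

lemma path_homs_nth: "Suc i < length xs \<Longrightarrow> path_homs X xs ! i = homs X (xs ! i, xs ! Suc i)"
  by (simp add: path_homs_def steps_length steps_nth)

lemma step_paths_nth:
  assumes "step_paths S ys xss" "i < length xss"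
  shows "xss ! i \<in> paths S (ys ! i) (ys ! Suc i)"
proof -
  have "Suc i < length ys" using assms by (auto simp: list_all2_conv_all_nth steps_length)
  thus ?thesis using assms by (auto simp: list_all2_conv_all_nth steps_nth)
qed

lemma step_paths_length: "step_paths S ys xss \<Longrightarrow> length xss = length ys - 1"
  by (simp add: list_all2_lengthD[symmetric] steps_length)

text \<open>A path has one hom fewer than vertices, hence as many as its tail has vertices. Block
  positions computed from homs therefore agree with those computed from tails, which is how
  \<open>path_join\<close> is stored.\<close>

lemma off_path_homs: "off (map (path_homs X) xss) i = off (map tl xss) i"
  by (rule off_cong) (simp add: path_homs_length)

text \<open>The last vertex of one refining path and the first of the next occupy the same position
  of the joined path. Positions inside a block come from the concatenation of tails; a first vertex
  was written by an earlier block or is the head.\<close>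

lemma path_join_nth:
  assumes ys: "ys \<noteq> []" "step_paths S ys xss" and i: "i < length xss" and j: "j < length (xss ! i)"
  shows "path_join ys xss ! (off (map (path_homs X) xss) i + j) = xss ! i ! j"
proof -
  let ?o = "off (map tl xss)"
  have pos: "path_join ys xss ! (?o i + Suc j) = xss ! i ! Suc j" if "i < length xss" "Suc j < length (xss ! i)" for i j
  proof -
    have "concat (map tl xss) ! (?o i + j) = map tl xss ! i ! j"
      by (rule concat_nth_off) (use that in auto)
    thus ?thesis using that by (simp add: path_join_def nth_tl)
  qed
  \<comment> \<open>Block starts, by induction on \<open>i\<close>. A block with a single vertex
    writes nothing into the join, but then the two vertices of \<open>ys\<close> coincide; otherwise
    the next start is the last entry written by block \<open>i\<close>.\<close>
  have zero: "path_join ys xss ! ?o i = ys ! i" if "i \<le> length xss" for i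
    using that
  proof (induction i)
    case 0 thus ?case using ys(1) by (simp add: path_join_def hd_conv_nth)
  next
    case (Suc i)
    hence i: "i < length xss" by simp
    note D = pathsD[OF step_paths_nth[OF ys(2) i]]
    show ?case
    proof (cases "length (xss ! i) = 1")
      case True
      hence "ys ! i = ys ! Suc i" using D(3,4) by (cases "xss ! i") auto
      moreover have "?o (Suc i) = ?o i" using i True by (simp add: off_Suc)
      ultimately show ?thesis using Suc by simp
    next
      case False
      then obtain n where n: "length (xss ! i) = Suc (Suc n)" using D(1) by (cases "xss ! i"; cases "tl (xss ! i)") auto
      have "?o (Suc i) = ?o i + Suc n" using i n by (simp add: off_Suc)
      moreover have "xss ! i ! Suc n = ys ! Suc i" using D(1,4) n by (simp add: last_conv_nth)
      ultimately show ?thesis using pos[OF i, of n] n by simp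
    qed
  qed
  show ?thesis
  proof (cases j)
    case 0
    have "xss ! i ! 0 = ys ! i" using pathsD(1,3)[OF step_paths_nth[OF ys(2) i]] by (simp add: hd_conv_nth)
    thus ?thesis using zero[of i] i 0 by (simp add: off_path_homs)
  next
    case (Suc j')
    thus ?thesis using pos[OF i, of j'] j by (simp add: off_path_homs)
  qed
qed

context line_cat
begin

definition path_mor :: "('u, 'o) vgraph \<Rightarrow> 'u list \<Rightarrow> ('u, 'o, 'm) vgraph_mor" where
  "path_mor X xs = line_mor (path_homs X xs) X (\<lambda>i. xs ! i) (\<lambda>i. Ide V (path_homs X xs ! i))"

lemma path_mor_hom:
  assumes X: "X \<in> vgraphs U V" and xs: "xs \<in> paths (verts X) a b"
  shows "path_mor X xs \<in> Hom G (line (path_homs X xs)) X"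
  unfolding path_mor_def
proof (rule line_mor_hom[OF path_homs_lists[OF X pathsD(2)[OF xs]] X])
  have l: "0 < length xs" using pathsD(1)[OF xs] by simp
  show v: "xs ! i \<in> verts X" if "i \<le> length (path_homs X xs)" for i
  proof -
    have "i < length xs" using that l unfolding path_homs_length by linarith
    thus ?thesis using pathsD(2)[OF xs] nth_mem by blast
  qed
  fix i assume i: "i < length (path_homs X xs)"
  hence "path_homs X xs ! i = homs X (xs ! i, xs ! Suc i)" by (simp add: path_homs_nth path_homs_length)
  moreover have "homs X (xs ! i, xs ! Suc i) \<in> Obj V" using i by (intro vgraph_homs[OF X] v) auto
  ultimately show "Ide V (path_homs X xs ! i) \<in> Hom V (path_homs X xs ! i) (homs X (xs ! i, xs ! Suc i))"
    using ide_in by simp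
qed

lemma path_mor_simps:
  "i < length xs \<Longrightarrow> vmap (path_mor X xs) (e i) = xs ! i"
  "Suc i < length xs \<Longrightarrow> hmap (path_mor X xs) (e i, e (Suc i)) = Ide V (homs X (xs ! i, xs ! Suc i))"
  "source (path_mor X xs) = line (path_homs X xs)"
proof -
  show "source (path_mor X xs) = line (path_homs X xs)" by (simp add: path_mor_def)
  show "vmap (path_mor X xs) (e i) = xs ! i" if "i < length xs"
    using that by (simp add: path_mor_def path_homs_length)
  show "hmap (path_mor X xs) (e i, e (Suc i)) = Ide V (homs X (xs ! i, xs ! Suc i))" if i: "Suc i < length xs"
    unfolding path_homs_nth[OF i, symmetric] path_mor_def using i by (intro line_mor_simps(2)) (simp add: path_homs_length)
qed

lemma path_mor_ends:
  assumes xs: "xs \<in> paths S a b"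
  shows "vmap (path_mor X xs) (e 0) = a" "vmap (path_mor X xs) (e (length xs - Suc 0)) = b"
  using pathsD(1,3,4)[OF xs] by (auto simp: path_mor_simps hd_conv_nth last_conv_nth)

lemma path_mor_nat:
  assumes f: "f \<in> Hom G X Y" and xs: "xs \<in> paths (verts X) a b"
  shows "f \<odot> path_mor X xs = path_mor Y (map (vmap f) xs) \<odot> line_map (map (hmap f) (steps xs))"
proof -
  note F = graph_homD[OF f] and xS = pathsD(2)[OF xs]
  have fxs: "map (vmap f) xs \<in> paths (verts Y) (vmap f a) (vmap f b)" using path_map[of xs _ a b "vmap f", OF xs F(5)] .
  have s: "map (hmap f) (steps xs) \<in> Hom (seq_cat V) (path_homs X xs) (path_homs Y (map (vmap f) xs))"
  proof -
    have "map (hmap f) (steps xs) \<in> Hom (seq_cat V) (map (homs X) (steps xs))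
      (map (\<lambda>p. homs Y (vmap f (fst p), vmap f (snd p))) (steps xs))"
      by (rule seq_hom_map) (use F(6) xS steps_set in fastforce)
    thus ?thesis by (simp add: path_homs_def steps_map comp_def case_prod_beta)
  qed
  note l = line_map_hom[OF s]
  have len: "0 < length xs" using pathsD(1)[OF xs] by simp
  show ?thesis
  proof (rule line_hom_eqI[OF G.comp_in[OF path_mor_hom[OF F(3) xs] f] G.comp_in[OF l path_mor_hom[OF F(4) fxs]]])
    fix i assume "i \<le> length (path_homs X xs)"
    hence i: "i < length xs" "i \<le> length xs - 1" using len unfolding path_homs_length by linarith+
    show "vmap (f \<odot> path_mor X xs) (e i) = vmap (path_mor Y (map (vmap f) xs) \<odot> line_map (map (hmap f) (steps xs))) (e i)"
      using i by (simp add: path_mor_simps line_map_simps[OF s] path_homs_length)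
  next
    fix i assume "i < length (path_homs X xs)"
    hence i: "Suc i < length xs" "i < length xs - 1" "i \<le> length xs - 1" "Suc i \<le> length xs - 1" by (auto simp: path_homs_length)
    have v: "xs ! i \<in> verts X" "xs ! Suc i \<in> verts X" using i(1) xS by auto
    note h = F(6)[OF v]
    show "hmap (f \<odot> path_mor X xs) (e i, e (Suc i)) = hmap (path_mor Y (map (vmap f) xs) \<odot> line_map (map (hmap f) (steps xs))) (e i, e (Suc i))"
      using i by (simp add: path_mor_simps line_map_simps[OF s] path_homs_length steps_length steps_nth ide_left[OF h] ide_right[OF h])
  qed
qed

text \<open>The line of a joined path is the line of a concatenation, by
  \<open>path_homs_join\<close>. Restricting to block \<open>i\<close> recovers the map of the
  refining path because identities on homs compose to identities.\<close>

lemma path_mor_segment: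
  assumes X: "X \<in> vgraphs U V" and ys: "ys \<in> paths (verts X) a b" "step_paths (verts X) ys xss" and i: "i < length xss"
  shows "path_mor X (path_join ys xss) \<odot> segment (map (path_homs X) xss) i = path_mor X (xss ! i)"
proof -
  let ?Xss = "map (path_homs X) xss" and ?j = "path_join ys xss"
  note j = conjunct1[OF path_join[OF ys]] and ph = path_homs_join[OF ys, of X]
  note xi = step_paths_nth[OF ys(2) i]
  have Xss: "?Xss \<in> lists (lists (Obj V))"
  proof (rule in_listsI, rule ballI)
    fix Xs assume "Xs \<in> set ?Xss"
    then obtain xs where xs: "xs \<in> set xss" "Xs = path_homs X xs" by auto
    obtain c d where "xs \<in> paths (verts X) c d" using step_paths_mem[OF ys(2) xs(1)] .
    thus "Xs \<in> lists (Obj V)" using path_homs_lists[OF X pathsD(2)] xs(2) by blast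
  qed
  have iX: "i < length ?Xss" using i by simp
  have s: "segment ?Xss i \<in> Hom G (line (path_homs X (xss ! i))) (line (path_homs X ?j))"
    using segment_hom[OF Xss iX] i ph by simp
  have len: "0 < length (xss ! i)" using pathsD(1)[OF xi] by simp
  have jl: "length ?j = Suc (length (concat ?Xss))" using ph[symmetric] pathsD(1)[OF j] by (simp add: path_homs_length)
  note nth = path_join_nth[OF pathsD(1)[OF ys(1)] ys(2) i, of _ X]
  show ?thesis
  proof (rule line_hom_eqI[OF G.comp_in[OF s path_mor_hom[OF X j]] path_mor_hom[OF X xi]])
    fix l assume "l \<le> length (path_homs X (xss ! i))"
    hence l: "l < length (xss ! i)" "l \<le> length (?Xss ! i)"
      using len i unfolding path_homs_length by (linarith, simp add: path_homs_length)
    have "off ?Xss i + l < length ?j" using off_le[OF iX l(2)] jl by simp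
    thus "vmap (path_mor X ?j \<odot> segment ?Xss i) (e l) = vmap (path_mor X (xss ! i)) (e l)"
      using l i graph_homD(1)[OF s] nth[OF l(1)] by (simp add: segment_simps(1)[OF l(2)] path_mor_simps)
  next
    fix l assume "l < length (path_homs X (xss ! i))"
    hence l: "Suc l < length (xss ! i)" "Suc l \<le> length (?Xss ! i)" "l < length (?Xss ! i)" using i
      by (auto simp: path_homs_length)
    have b: "Suc (off ?Xss i + l) < length ?j" using off_le[OF iX l(2)] jl by simp
    have v: "xss ! i ! l \<in> verts X" "xss ! i ! Suc l \<in> verts X" using l(1) pathsD(2)[OF xi] by auto
    note o = ide_in[OF vgraph_homs[OF X v]]
    have n: "?j ! (off ?Xss i + l) = xss ! i ! l" "?j ! Suc (off ?Xss i + l) = xss ! i ! Suc l"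
      using nth[of l] nth[OF l(1)] l(1) by auto
    have ls: "l \<le> length (?Xss ! i)" using l(3) by simp
    have sh: "hmap (segment ?Xss i) (e l, e (Suc l)) = Ide V (homs X (xss ! i ! l, xss ! i ! Suc l))"
      using segment_simps(2)[OF l(3)] i l(1) by (simp add: path_homs_nth)
    show "hmap (path_mor X ?j \<odot> segment ?Xss i) (e l, e (Suc l)) = hmap (path_mor X (xss ! i)) (e l, e (Suc l))"
      using l i graph_homD(1)[OF s] n b ide_left[OF o]
      by (simp add: segment_simps(1)[OF l(2)] segment_simps(1)[OF ls] sh path_mor_simps)
  qed
qed

end

section \<open>Evaluating a monad along paths\<close>

context set_monad
begin

definition jota :: "('u, 'o) vgraph \<Rightarrow> 'u list \<Rightarrow> 'm" where
  "jota X xs = hmap (Ta (path_mor X xs)) (e 0, e (length xs - 1))"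

lemma path_tensor_psi:
  "X \<in> vgraphs U V \<Longrightarrow> set xs \<subseteq> verts X \<Longrightarrow> path_tensor psi X xs = point (path_homs X xs)"
  by (simp add: path_tensor_def psi_simps(1) path_homs_lists)

lemma jota_hom:
  assumes X: "X \<in> vgraphs U V" and xs: "xs \<in> paths (verts X) a b"
  shows "jota X xs \<in> Hom V (path_tensor psi X xs) (homs (To X) (a, b))"
  using point_hom[OF path_mor_hom[OF X xs]] path_mor_ends[OF xs, of X] path_tensor_psi[OF X pathsD(2)[OF xs]]
  by (simp add: jota_def path_homs_length)

text \<open>Composing with \<open>g\<close> after \<open>Ta (path_mor X xs)\<close> and evaluating
  at the ends factors through \<open>jota\<close>, since the path map sends the ends of its line to
  \<open>a\<close> and \<open>b\<close>.\<close>

lemma jota_comp: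
  assumes X: "X \<in> vgraphs U V" and xs: "xs \<in> paths (verts X) a b"
  shows "hmap (g \<odot> Ta (path_mor X xs)) (e 0, e (length (path_homs X xs))) = hmap g (a, b) \<cdot> jota X xs"
  using hmap_comp_To[OF Ta_hom[OF path_mor_hom[OF X xs]] path_homs_lists[OF X pathsD(2)[OF xs]], of g]
    path_mor_ends[OF xs, of X]
  by (simp add: jota_def path_homs_length vmap_Ta[OF path_mor_hom[OF X xs]])

text \<open>The image under \<open>T\<close> of \<open>path_mor_nat\<close>, evaluated at the end
  vertices.\<close>

lemma jota_nat:
  assumes f: "f \<in> Hom G X Y" and xs: "xs \<in> paths (verts X) a b"
  shows "hmap (Ta f) (a, b) \<cdot> jota X xs = jota Y (map (vmap f) xs) \<cdot> tens_arr psi (map (hmap f) (steps xs))"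
proof -
  note F = graph_homD[OF f] and xS = pathsD(2)[OF xs]
  have fxs: "map (vmap f) xs \<in> paths (verts Y) (vmap f a) (vmap f b)" using path_map[of xs _ a b "vmap f", OF xs F(5)] .
  have s: "map (hmap f) (steps xs) \<in> Hom (seq_cat V) (path_homs X xs) (path_homs Y (map (vmap f) xs))"
  proof -
    have "map (hmap f) (steps xs) \<in> Hom (seq_cat V) (map (homs X) (steps xs))
      (map (\<lambda>p. homs Y (vmap f (fst p), vmap f (snd p))) (steps xs))"
      by (rule seq_hom_map) (use F(6) xS steps_set in fastforce)
    thus ?thesis by (simp add: path_homs_def steps_map comp_def case_prod_beta)
  qed
  note l = line_map_hom[OF s] and pX = path_mor_hom[OF F(3) xs] and pY = path_mor_hom[OF F(4) fxs]
  have "Ta f \<odot> Ta (path_mor X xs) = Ta (path_mor Y (map (vmap f) xs)) \<odot> Ta (line_map (map (hmap f) (steps xs)))"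
    unfolding Ta_comp[OF pX f, symmetric] Ta_comp[OF l pY, symmetric] path_mor_nat[OF f xs] ..
  from arg_cong[OF this, of "\<lambda>k. hmap k (e 0, e (length (path_homs X xs)))"]
  show ?thesis unfolding jota_comp[OF F(3) xs] hmap_comp_To[OF Ta_hom[OF l] path_homs_lists[OF F(3) xS]]
    by (simp add: vmap_Ta[OF l] line_map_simps[OF s] psi_simps(2)[OF s] jota_def path_homs_length)
qed

end

locale set_monad_dist = set_monad U V e T
  for U :: "'u set set" and V :: "('o, 'm) cat" (structure) and e :: "nat \<Rightarrow> 'u" and T :: "('u, 'o, 'm) graph_monad" +
  assumes psi_dist: "distributive_multitensor U V psi"
begin

sublocale A: dist_mult U V psi
  by (intro dist_mult.intro extensive_cat_axioms multitensor_psi dist_mult_axioms.intro psi_dist)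

abbreviation \<Gamma> :: "('u, 'o) vgraph \<Rightarrow> ('u, 'o) vgraph" where "\<Gamma> \<equiv> Gamma_graph V psi"
abbreviation pinj :: "('u, 'o) vgraph \<Rightarrow> 'u list \<Rightarrow> 'm" where "pinj \<equiv> path_inj V psi"

definition eps :: "('u, 'o) vgraph \<Rightarrow> ('u, 'o, 'm) vgraph_mor" where
  "eps = (\<lambda>X\<in>vgraphs U V. graph_mor (\<Gamma> X) (To X) (\<lambda>a. a)
     (\<lambda>a b. cotuple V (paths (verts X) a b) (path_tensor psi X) (homs (To X) (a, b)) (jota X)))"

lemma eps_hom:
  assumes X: "X \<in> vgraphs U V"
  shows "eps X \<in> Hom G (\<Gamma> X) (To X)" "vmap (eps X) = (\<lambda>a\<in>verts X. a)"
    "xs \<in> paths (verts X) a b \<Longrightarrow> hmap (eps X) (a, b) \<cdot> pinj X xs = jota X xs"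
proof -
  let ?c = "\<lambda>a b. cotuple V (paths (verts X) a b) (path_tensor psi X) (homs (To X) (a, b)) (jota X)"
  have eq: "eps X = graph_mor (\<Gamma> X) (To X) (\<lambda>a. a) ?c" using X by (simp add: eps_def)
  have c: "?c a b \<in> Hom V (homs (\<Gamma> X) (a, b)) (homs (To X) (a, b))"
    "\<And>xs. xs \<in> paths (verts X) a b \<Longrightarrow> ?c a b \<cdot> pinj X xs = jota X xs"
    if ab: "a \<in> verts X" "b \<in> verts X" for a b
  proof -
    note cop = chosen_coprod_is_coproduct[OF A.Gamma_coproduct[OF X ab]]
    have o: "homs (To X) (a, b) \<in> Obj V" using vgraph_homs[OF To_in[OF X]] ab verts_To[OF X] by simp
    note ct = cotuple[OF cop o jota_hom[OF X]]
    show "?c a b \<in> Hom V (homs (\<Gamma> X) (a, b)) (homs (To X) (a, b))" using ct(1) ab by (simp add: Gamma_graph_def)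
    show "\<And>xs. xs \<in> paths (verts X) a b \<Longrightarrow> ?c a b \<cdot> pinj X xs = jota X xs"
      using ct(2) by (simp add: A.path_inj_eq[of _ X a b])
  qed
  show "eps X \<in> Hom G (\<Gamma> X) (To X)" unfolding eq
    by (rule graph_mor_hom) (use A.Gamma_graph_in[OF X] To_in[OF X] verts_To[OF X] c in auto)
  show "vmap (eps X) = (\<lambda>a\<in>verts X. a)" unfolding eq by (simp add: graph_mor_def)
  assume xs: "xs \<in> paths (verts X) a b"
  show "hmap (eps X) (a, b) \<cdot> pinj X xs = jota X xs"
    unfolding eq using c(2)[OF pathsD(5,6)[OF xs] xs] pathsD(5,6)[OF xs] by simp
qed

lemma eps_hmap:
  assumes "X \<in> vgraphs U V" "a \<in> verts X" "b \<in> verts X"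
  shows "hmap (eps X) (a, b) \<in> Hom V (homs (\<Gamma> X) (a, b)) (homs (To X) (a, b))"
  using graph_homD(6)[OF eps_hom(1)[OF assms(1)]] assms eps_hom(2)[OF assms(1)] by simp

lemma eps_naturality:
  assumes f: "f \<in> Hom G X Y"
  shows "Ta f \<odot> eps X = eps Y \<odot> Gamma_mor V psi f"
proof -
  note F = graph_homD[OF f] and Af = A.Gamma_mor[OF f]
  note eX = eps_hom[OF F(3)] and eY = eps_hom[OF F(4)]
  show ?thesis
  proof (rule A.Gamma_hom_eqI[OF F(3) G.comp_in[OF eX(1) Ta_hom[OF f]] G.comp_in[OF Af(1) eY(1)]])
    note s = graph_homD(1)[OF eX(1)] graph_homD(1)[OF Af(1)]
    show "vmap (Ta f \<odot> eps X) a = vmap (eps Y \<odot> Gamma_mor V psi f) a" if "a \<in> verts X" for a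
      using that s by (simp add: eX(2) eY(2) Af(2) vmap_Ta[OF f] F(5))
    fix a b xs assume ab: "a \<in> verts X" "b \<in> verts X" and xs: "xs \<in> paths (verts X) a b"
    have fxs: "map (vmap f) xs \<in> paths (verts Y) (vmap f a) (vmap f b)" using path_map[of xs _ a b "vmap f", OF xs F(5)] .
    note i = A.inj_hom[OF F(3) xs] and i' = A.inj_hom[OF F(4) fxs]
    have t: "tens_arr psi (map (hmap f) (steps xs)) \<in> Hom V (path_tensor psi X xs) (path_tensor psi Y (map (vmap f) xs))"
      using A.tens_hom[OF A.hmap_steps_hom[OF f pathsD(2)[OF xs]]] by (simp add: path_tensor_def)
    have tf: "hmap (Ta f) (a, b) \<in> Hom V (homs (To X) (a, b)) (homs (To Y) (vmap f a, vmap f b))"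
      using graph_homD(6)[OF Ta_hom[OF f]] ab verts_To[OF F(3)] vmap_Ta[OF f] by simp
    have af: "hmap (Gamma_mor V psi f) (a, b) \<in> Hom V (homs (\<Gamma> X) (a, b)) (homs (\<Gamma> Y) (vmap f a, vmap f b))"
      using graph_homD(6)[OF Af(1)] ab Af(2) by simp
    note ey = eps_hmap[OF F(4) F(5)[OF ab(1)] F(5)[OF ab(2)]]
    show "hmap (Ta f \<odot> eps X) (a, b) \<cdot> pinj X xs = hmap (eps Y \<odot> Gamma_mor V psi f) (a, b) \<cdot> pinj X xs"
      using ab s comp_assoc_hom[OF i eps_hmap[OF F(3) ab] tf] comp_assoc_hom[OF i af ey] eX(3)[OF xs] jota_nat[OF f xs]
        Af(3)[OF xs] comp_ext[OF t i' ey eY(3)[OF fxs]]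
      by (simp add: eX(2) Af(2))
  qed
qed

lemma eps_natural: "nat_trans G G (Gamma_functor U V psi) (endo T) eps"
proof (rule nat_transI[OF A.cat_functor_Gamma F.cat_functor_axioms])
  show "eps \<in> extensional (Obj G)" by (simp add: eps_def)
  show "eps X \<in> Hom G (obj_map (Gamma_functor U V psi) X) (To X)" if "X \<in> Obj G" for X
    using eps_hom(1)[of X] that by simp
  show "Ta f \<odot> eps X = eps Y \<odot> arr_map (Gamma_functor U V psi) f" if f: "f \<in> Hom G X Y" for f X Y
    using eps_naturality[OF f] f by simp
qed

text \<open>On a hom the unit of \<Gamma> enters the summand of a one-step path, where the claim is
  naturality of the unit of \<open>T\<close> at the map of that path.\<close>

lemma eps_unit:
  assumes X: "X \<in> vgraphs U V"
  shows "eps X \<odot> Gamma_unit U V psi X = munit T X"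
proof -
  note t = eps_hom[OF X] and u = A.unit_hom_graph[OF X] and m = munit_hom[OF X]
  show ?thesis
  proof (rule graph_hom_eqI[OF G.comp_in[OF u(1) t(1)] m])
    note s = graph_homD(1)[OF u(1)]
    fix a b assume ab: "a \<in> verts X" "b \<in> verts X"
    show "vmap (eps X \<odot> Gamma_unit U V psi X) a = vmap (munit T X) a"
      using ab s by (simp add: t(2) u(2) vmap_munit[OF X])
    have xs: "[a, b] \<in> paths (verts X) a b" using ab by (simp add: paths_def)
    note h = vgraph_homs[OF X ab]
    have l: "line [homs X (a, b)] \<in> vgraphs U V" using h by (intro line_in) simp
    have i: "pinj X [a, b] \<in> Hom V (tens psi [homs X (a, b)]) (homs (\<Gamma> X) (a, b))"
      using A.inj_hom[OF X xs] by (simp add: path_tensor_def)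
    have p: "path_mor X [a, b] \<in> Hom G (line [homs X (a, b)]) X" using path_mor_hom[OF X xs] by simp
    have mu: "hmap (munit T X) (a, b) \<in> Hom V (homs X (a, b)) (homs (To X) (a, b))"
      using graph_homD(6)[OF m ab] vmap_munit[OF X] ab by simp
    have "hmap (Ta (path_mor X [a, b]) \<odot> munit T (line [homs X (a, b)])) (e 0, e 1) = hmap (munit T X \<odot> path_mor X [a, b]) (e 0, e 1)"
      unfolding munit_nat[OF p] ..
    hence "jota X [a, b] \<cdot> tunit psi (homs X (a, b)) = hmap (munit T X) (a, b)"
      using graph_homD(1)[OF munit_hom[OF l]] graph_homD(1)[OF p] h ide_right[OF mu]
        path_mor_simps(1)[of 0 "[a, b]" X] path_mor_simps(1)[of "Suc 0" "[a, b]" X] path_mor_simps(2)[of 0 "[a, b]" X]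
      by (simp add: jota_def psi_simps(3) vmap_munit[OF l])
    thus "hmap (eps X \<odot> Gamma_unit U V psi X) (a, b) = hmap (munit T X) (a, b)"
      using ab s comp_ext[OF A.unit_hom[OF h] i eps_hmap[OF X ab] t(3)[OF xs]]
      by (simp add: u(2,3))
  qed
qed

text \<open>The right side is first rewritten with the Kleisli extension of \<open>eps X\<close>. On
  the summand of a refined path each side becomes the extension of a map out of the line on the
  block values, evaluated at its ends: one map goes through \<open>kappa\<close> and the joined
  path, the other through the outer path and the injections of the refining paths. These two maps
  agree step by step.\<close>

lemma eps_mult:
  assumes X: "X \<in> vgraphs U V"
  shows "eps X \<odot> Gamma_mult U V psi X = mmult T X \<odot> (Ta (eps X) \<odot> eps (\<Gamma> X))"
proof -
  note GX = A.Gamma_graph_in[OF X]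
  note t = eps_hom[OF X] and tG = eps_hom[OF GX]
  note Te = Ta_hom[OF t(1)] and mA = A.mult_hom_graph[OF X] and mT = mmult_hom[OF X]
  have lft: "mmult T X \<odot> (Ta (eps X) \<odot> eps (\<Gamma> X)) = lift X (eps X) \<odot> eps (\<Gamma> X)"
    unfolding lift_def using G.comp_assoc_hom[OF tG(1) Te mT] by simp
  note le = lift_hom[OF t(1) X]
  show ?thesis unfolding lft
  proof (rule A.double_hom_eqI[OF X G.comp_in[OF mA(1) t(1)] G.comp_in[OF tG(1) le]])
    note s = graph_homD(1)[OF mA(1)] graph_homD(1)[OF tG(1)]
    show "vmap (eps X \<odot> Gamma_mult U V psi X) a = vmap (lift X (eps X) \<odot> eps (\<Gamma> X)) a" if "a \<in> verts X" for a
      using that s by (simp add: mA(2) tG(2) vmap_lift[OF t(1) X])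
    fix a b ys xss assume ab: "a \<in> verts X" "b \<in> verts X" and ys: "ys \<in> paths (verts X) a b" "step_paths (verts X) ys xss"
    let ?J = "pinj (\<Gamma> X) ys \<cdot> tens_arr psi (map (pinj X) xss)"
    let ?Xss = "map (path_homs X) xss" and ?j = "path_join ys xss"
    have abG: "a \<in> verts (\<Gamma> X)" "b \<in> verts (\<Gamma> X)" using ab by auto
    have ysG: "ys \<in> paths (verts (\<Gamma> X)) a b" using ys by simp
    note Xss = A.path_homs_map_in[OF X ys(2)]
    note j = conjunct1[OF path_join[OF ys]] and ph = path_homs_join[OF ys, of X]
    have pt: "map (path_tensor psi X) xss = map point ?Xss"
    proof -
      have "path_tensor psi X xs = point (path_homs X xs)" if xs: "xs \<in> set xss" for xs
      proof -
        obtain c d where "xs \<in> paths (verts X) c d" using step_paths_mem[OF ys(2) xs] .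
        thus ?thesis using path_tensor_psi[OF X pathsD(2)] by blast
      qed
      thus ?thesis by simp
    qed
    have J: "?J \<in> Hom V (tens psi (map point ?Xss)) (homs (\<Gamma> (\<Gamma> X)) (a, b))"
      using coproductD(3)[OF A.double_coproduct[OF X ab], of "(ys, xss)"] ys
      unfolding A.double_paths_def A.double_inj_def A.double_tensor_def pt[symmetric] by simp
    have jl: "length xss = length ys - 1" by (rule step_paths_length[OF ys(2)])
    have ysl: "0 < length ys" using pathsD(1)[OF ys(1)] by simp
    have jlen: "length ?j = Suc (length (concat ?Xss))" using ph[symmetric] pathsD(1)[OF j] by (simp add: path_homs_length)
    note pj = path_mor_hom[OF X j]
    have pj': "path_mor X ?j \<in> Hom G (line (concat ?Xss)) X" using pj ph by simp
    note kX = kappa_hom[OF Xss]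
    note c = lists_concat[OF Xss] and mp = map_point[OF Xss]
    note l = line_in[OF c]
    have sj: "tsubst psi ?Xss \<in> Hom V (tens psi (map point ?Xss)) (path_tensor psi X ?j)"
    proof -
      have eq: "map point ?Xss = map (tens psi) ?Xss" using Xss by (auto simp: psi_simps(1))
      show ?thesis unfolding eq using A.subst_hom[OF Xss] ph by (simp add: path_tensor_def)
    qed
    have L1: "hmap (eps X) (a, b) \<cdot> (hmap (Gamma_mult U V psi X) (a, b) \<cdot> ?J) = jota X ?j \<cdot> tsubst psi ?Xss"
      unfolding mA(3)[OF ys] by (rule comp_ext[OF sj A.inj_hom[OF X j] eps_hmap[OF X ab] t(3)[OF j]])
    have "Ta (path_mor X ?j) \<odot> lift (line (concat ?Xss)) (kappa ?Xss) = lift X (Ta (path_mor X ?j) \<odot> kappa ?Xss)"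
      by (rule Ta_lift[OF kX pj'])
    from arg_cong[OF this, of "\<lambda>h. hmap h (e 0, e (length (map point ?Xss)))"]
    have L2: "jota X ?j \<cdot> tsubst psi ?Xss = hmap (lift X (Ta (path_mor X ?j) \<odot> kappa ?Xss)) (e 0, e (length xss))"
      unfolding hmap_comp_To[OF lift_hom[OF kX l] mp]
      using Xss off_length[of ?Xss] by (simp add: psi_simps(4) vmap_lift[OF kX l] kappa_simps jota_def jlen)
    note pp = A.map_pinj_hom[OF X ys]
    have pp': "map (pinj X) xss \<in> Hom (seq_cat V) (map point ?Xss) (path_homs (\<Gamma> X) ys)" using pp unfolding pt .
    note lp = line_map_hom[OF pp'] and py = path_mor_hom[OF GX ysG]
    have tp: "tens_arr psi (map (pinj X) xss) \<in> Hom V (tens psi (map point ?Xss)) (path_tensor psi (\<Gamma> X) ys)"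
      using A.tens_hom[OF pp'] by (simp add: path_tensor_def)
    have R1: "hmap (eps (\<Gamma> X)) (a, b) \<cdot> ?J = jota (\<Gamma> X) ys \<cdot> tens_arr psi (map (pinj X) xss)"
      by (rule comp_ext[OF tp A.inj_hom[OF GX ysG] eps_hmap[OF GX abG] tG(3)[OF ysG]])
    \<comment> \<open>The outer path in \<open>\<Gamma> X\<close>, with each hom of its line
      restricted to the summand of the chosen refining path.\<close>
    let ?k = "path_mor (\<Gamma> X) ys \<odot> line_map (map (pinj X) xss)"
    note k = G.comp_in[OF lp py]
    have R2: "jota (\<Gamma> X) ys \<cdot> tens_arr psi (map (pinj X) xss) = hmap (Ta ?k) (e 0, e (length xss))"
      using hmap_comp_To[OF Ta_hom[OF lp] mp, of "Ta (path_mor (\<Gamma> X) ys)"]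
      by (simp add: Ta_comp[OF lp py] vmap_Ta[OF lp] line_map_simps[OF pp'] psi_simps(2)[OF pp'] jota_def jl)
    have vk: "vmap ?k (e i) = ys ! i" if "i < length ys" for i
      using that jl by (simp add: line_map_simps[OF pp'] path_mor_simps)
    have ends: "vmap ?k (e 0) = a" "vmap ?k (e (length xss)) = b"
      using vk[of 0] vk[of "length xss"] jl pathsD(1,3,4)[OF ys(1)] by (auto simp: hd_conv_nth last_conv_nth)
    have R3: "hmap (lift X (eps X)) (a, b) \<cdot> hmap (Ta ?k) (e 0, e (length xss)) = hmap (lift X (eps X \<odot> ?k)) (e 0, e (length xss))"
      using hmap_comp_To[OF Ta_hom[OF k] mp, of "lift X (eps X)"] ends by (simp add: lift_Ta[OF t(1) k X] vmap_Ta[OF k])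
    \<comment> \<open>Both sides send vertex \<open>i\<close> to \<open>ys ! i\<close>, and their
      value on step \<open>i\<close> is \<open>jota X (xss ! i)\<close>: on the left by
      \<open>path_mor_segment\<close>, on the right by the definition of \<open>eps\<close> on
      summands.\<close>
    have "Ta (path_mor X ?j) \<odot> kappa ?Xss = eps X \<odot> ?k"
    proof (rule line_hom_eqI[OF G.comp_in[OF kX Ta_hom[OF pj']] G.comp_in[OF k t(1)]])
      note sk = graph_homD(1)[OF k]
      fix i assume "i \<le> length (map point ?Xss)"
      hence i: "i \<le> length xss" by simp
      have "?j ! off ?Xss i = ys ! i"
      \<comment> \<open>The last vertex starts no block, so it is found as the last vertex of the
        joined path.\<close>
      proof (cases "i < length xss")
        case True
        note xi = step_paths_nth[OF ys(2) True]
        show ?thesis using path_join_nth[OF pathsD(1)[OF ys(1)] ys(2) True, of 0 X] pathsD(1,3)[OF xi] by (simp add: hd_conv_nth)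
      next
        case False
        hence "i = length xss" using i by simp
        thus ?thesis using off_length[of ?Xss] jlen pathsD(1,4)[OF j] pathsD(1,4)[OF ys(1)] jl by (simp add: last_conv_nth)
      qed
      moreover have "off ?Xss i < length ?j" using off_le_length[of i ?Xss] i jlen by simp
      moreover have iy: "i < length ys" using i jl ysl by linarith
      moreover have "ys ! i \<in> verts X" using iy pathsD(2)[OF ys(1)] by auto
      ultimately show "vmap (Ta (path_mor X ?j) \<odot> kappa ?Xss) (e i) = vmap (eps X \<odot> ?k) (e i)"
        using i sk vk[of i] by (simp add: kappa_simps vmap_Ta[OF pj'] path_mor_simps t(2) del: graph_comp_simps)
          (simp add: kappa_simps vmap_Ta[OF pj'] path_mor_simps t(2))
    next
      note sk = graph_homD(1)[OF k]
      fix i assume "i < length (map point ?Xss)"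
      hence i: "i < length xss" by simp
      have iX: "i < length ?Xss" using i by simp
      note xi = step_paths_nth[OF ys(2) i]
      note Xi = path_homs_lists[OF X pathsD(2)[OF xi]]
      have sg: "segment ?Xss i \<in> Hom G (line (path_homs X (xss ! i))) (line (concat ?Xss))" using segment_hom[OF Xss iX] i by simp
      have iy: "i < length ys" "Suc i < length ys" using i jl by auto
      have "Ta (path_mor X ?j) \<odot> Ta (segment ?Xss i) = Ta (path_mor X (xss ! i))"
        unfolding Ta_comp[OF sg pj', symmetric] path_mor_segment[OF X ys i] ..
      from arg_cong[OF this, of "\<lambda>h. hmap h (e 0, e (length (path_homs X (xss ! i))))"]
      have L: "hmap (Ta (path_mor X ?j)) (e (off ?Xss i), e (off ?Xss (Suc i))) \<cdot> hmap (Ta (segment ?Xss i)) (e 0, e (length (?Xss ! i))) = jota X (xss ! i)"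
        unfolding hmap_comp_To[OF Ta_hom[OF sg] Xi] vmap_Ta[OF sg]
        using i segment_simps(1)[of 0 ?Xss i] segment_simps(1)[of "length (path_homs X (xss ! i))" ?Xss i]
        by (simp add: off_Suc jota_def path_homs_length)
      have ii: "pinj X (xss ! i) \<in> Hom V (path_tensor psi X (xss ! i)) (homs (\<Gamma> X) (ys ! i, ys ! Suc i))"
        by (rule A.inj_hom[OF X xi])
      have kh: "hmap ?k (e i, e (Suc i)) = pinj X (xss ! i)"
        using i iy ide_left[OF ii] by (simp add: line_map_simps[OF pp'] path_mor_simps)
      show "hmap (Ta (path_mor X ?j) \<odot> kappa ?Xss) (e i, e (Suc i)) = hmap (eps X \<odot> ?k) (e i, e (Suc i))"
      proof -
        have "hmap (Ta (path_mor X ?j) \<odot> kappa ?Xss) (e i, e (Suc i)) = jota X (xss ! i)"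
          using i L by (simp add: kappa_simps)
        moreover have "hmap (eps X \<odot> ?k) (e i, e (Suc i)) = hmap (eps X) (vmap ?k (e i), vmap ?k (e (Suc i))) \<cdot> hmap ?k (e i, e (Suc i))"
          using i sk by (intro graph_comp_simps(2)) auto
        ultimately show ?thesis unfolding kh vk[OF iy(1)] vk[OF iy(2)] using t(3)[OF xi] by simp
      qed
    qed
    hence "hmap (eps X) (a, b) \<cdot> (hmap (Gamma_mult U V psi X) (a, b) \<cdot> ?J) = hmap (lift X (eps X)) (a, b) \<cdot> (hmap (eps (\<Gamma> X)) (a, b) \<cdot> ?J)"
      unfolding L1 L2 R1 R2 R3 by simp
    moreover have "hmap (lift X (eps X)) (a, b) \<in> Hom V (homs (To (\<Gamma> X)) (a, b)) (homs (To X) (a, b))"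
      using graph_homD(6)[OF le] ab verts_To[OF GX] vmap_lift[OF t(1) X] t(2) by simp
    ultimately show "hmap (eps X \<odot> Gamma_mult U V psi X) (a, b) \<cdot> ?J = hmap (lift X (eps X) \<odot> eps (\<Gamma> X)) (a, b) \<cdot> ?J"
      using ab s comp_assoc_hom[OF J A.mult_hmap[OF X ab] eps_hmap[OF X ab]] comp_assoc_hom[OF J eps_hmap[OF GX abG]]
      by (simp add: mA(2) tG(2))
  qed
qed

lemma eps_monad_morphism: "monad_morphism G (Gamma U V psi) T eps"
proof (rule monad_morphism.intro[OF A.monad_Gamma T.monad_axioms], rule monad_morphism_axioms.intro)
  show "nat_trans G G (endo (Gamma U V psi)) (endo T) eps" using eps_natural by (simp add: Gamma_def)
  fix X assume "X \<in> Obj G"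
  hence X: "X \<in> vgraphs U V" by simp
  show "eps X \<odot> munit (Gamma U V psi) X = munit T X" using eps_unit[OF X] by (simp add: Gamma_def)
  show "eps X \<odot> mmult (Gamma U V psi) X = mmult T X \<odot> (Ta (eps X) \<odot> eps (obj_map (endo (Gamma U V psi)) X))"
    using eps_mult[OF X] X by (simp add: Gamma_def)
qed

end

section \<open>Monad morphisms\<close>

lemma monad_morphismI:
  assumes "monad C S" "monad C T" "nat_trans C C (endo S) (endo T) \<gamma>"
    "\<And>X. X \<in> Obj C \<Longrightarrow> \<gamma> X \<cdot>\<^bsub>C\<^esub> munit S X = munit T X"
    "\<And>X. X \<in> Obj C \<Longrightarrow> \<gamma> X \<cdot>\<^bsub>C\<^esub> mmult S X
        = mmult T X \<cdot>\<^bsub>C\<^esub> (arr_map (endo T) (\<gamma> X) \<cdot>\<^bsub>C\<^esub> \<gamma> (obj_map (endo S) X))"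
  shows "monad_morphism C S T \<gamma>"
  using assms by (simp add: monad_morphism_def monad_morphism_axioms_def)

context monad
begin

sublocale F: cat_functor C C "endo T" by (rule endofunctor)

lemma unit_hom: "X \<in> Obj C \<Longrightarrow> munit T X \<in> Hom C X (obj_map (endo T) X)"
  using nat_trans.component[OF unit_natural] by (simp add: id_functor_def)

lemma mult_hom: "X \<in> Obj C \<Longrightarrow> mmult T X \<in> Hom C (obj_map (endo T) (obj_map (endo T) X)) (obj_map (endo T) X)"
  using nat_trans.component[OF mult_natural] by (simp add: comp_functor_def)

lemma monad_morphism_id: "monad_morphism C T T (id_trans C C (endo T))"
proof (rule monad_morphismI[OF monad_axioms monad_axioms nat_trans_id[OF endofunctor]])
  fix X assume X: "X \<in> Obj C"
  show "id_trans C C (endo T) X \<cdot> munit T X = munit T X"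
    using X F.C.ide_left[OF unit_hom[OF X]] by (simp add: id_trans_apply)
  show "id_trans C C (endo T) X \<cdot> mmult T X =
    mmult T X \<cdot> (arr_map (endo T) (id_trans C C (endo T) X) \<cdot> id_trans C C (endo T) (obj_map (endo T) X))"
    using X mult_hom[OF X] by (simp add: id_trans_apply F.map_ide F.C.ide_left F.C.ide_right)
qed

end

lemma monad_morphism_comp:
  assumes "monad_morphism C S T \<gamma>" "monad_morphism C T R \<delta>"
  shows "monad_morphism C S R (vert_comp C C \<delta> \<gamma>)"
proof -
  interpret C: category C using assms(1) by (simp add: monad_morphism_def monad_def cat_functor_def)
  interpret \<gamma>: monad_morphism C S T \<gamma> by fact
  interpret \<delta>: monad_morphism C T R \<delta> by fact
  interpret ng: nat_trans C C "endo S" "endo T" \<gamma> by (rule \<gamma>.natural)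
  interpret nd: nat_trans C C "endo T" "endo R" \<delta> by (rule \<delta>.natural)
  let ?S = "obj_map (endo S)" and ?T = "obj_map (endo T)" and ?R = "obj_map (endo R)"
  show ?thesis
  proof (rule monad_morphismI[OF \<gamma>.S.monad_axioms \<delta>.T.monad_axioms nat_trans_vert_comp[OF \<gamma>.natural \<delta>.natural]])
    fix X assume X: "X \<in> Obj C"
    note gX = ng.component[OF X] and dX = nd.component[OF X]
    note SX = \<gamma>.S.F.obj_in[OF X]
    show "vert_comp C C \<delta> \<gamma> X \<cdot>\<^bsub>C\<^esub> munit S X = munit R X"
      using X C.comp_assoc_hom[OF \<gamma>.S.unit_hom[OF X] gX dX] \<gamma>.map_unit[OF X] \<delta>.map_unit[OF X]
      by (simp add: vert_comp_apply)
    note gS = ng.component[OF SX] and dT = nd.component[OF \<gamma>.T.F.obj_in[OF X]] and dS = nd.component[OF SX]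
    note Tg = \<gamma>.T.F.arr_map[OF gX] and Rg = \<delta>.T.F.arr_map[OF gX] and Rd = \<delta>.T.F.arr_map[OF dX]
    note mS = \<gamma>.S.mult_hom[OF X] and mT = \<gamma>.T.mult_hom[OF X] and mR = \<delta>.T.mult_hom[OF X]
    have "(\<delta> X \<cdot>\<^bsub>C\<^esub> \<gamma> X) \<cdot>\<^bsub>C\<^esub> mmult S X = \<delta> X \<cdot>\<^bsub>C\<^esub> (mmult T X \<cdot>\<^bsub>C\<^esub> (arr_map (endo T) (\<gamma> X) \<cdot>\<^bsub>C\<^esub> \<gamma> (?S X)))"
      using C.comp_assoc_hom[OF mS gX dX] \<gamma>.map_mult[OF X] by simp
    also have "\<dots> = (mmult R X \<cdot>\<^bsub>C\<^esub> (arr_map (endo R) (\<delta> X) \<cdot>\<^bsub>C\<^esub> \<delta> (?T X))) \<cdot>\<^bsub>C\<^esub> (arr_map (endo T) (\<gamma> X) \<cdot>\<^bsub>C\<^esub> \<gamma> (?S X))"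
      by (rule C.comp_ext[OF C.comp_in[OF gS Tg] mT dX \<delta>.map_mult[OF X]])
    also have "\<dots> = mmult R X \<cdot>\<^bsub>C\<^esub> (arr_map (endo R) (\<delta> X) \<cdot>\<^bsub>C\<^esub> ((\<delta> (?T X) \<cdot>\<^bsub>C\<^esub> arr_map (endo T) (\<gamma> X)) \<cdot>\<^bsub>C\<^esub> \<gamma> (?S X)))"
      using mR Rd dT Tg gS by (simp add: C.comp_assoc Hom_def)
    also have "\<delta> (?T X) \<cdot>\<^bsub>C\<^esub> arr_map (endo T) (\<gamma> X) = arr_map (endo R) (\<gamma> X) \<cdot>\<^bsub>C\<^esub> \<delta> (?S X)"
      using nd.naturality[OF gX] by simp
    also have "mmult R X \<cdot>\<^bsub>C\<^esub> (arr_map (endo R) (\<delta> X) \<cdot>\<^bsub>C\<^esub> ((arr_map (endo R) (\<gamma> X) \<cdot>\<^bsub>C\<^esub> \<delta> (?S X)) \<cdot>\<^bsub>C\<^esub> \<gamma> (?S X)))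
      = mmult R X \<cdot>\<^bsub>C\<^esub> ((arr_map (endo R) (\<delta> X) \<cdot>\<^bsub>C\<^esub> arr_map (endo R) (\<gamma> X)) \<cdot>\<^bsub>C\<^esub> (\<delta> (?S X) \<cdot>\<^bsub>C\<^esub> \<gamma> (?S X)))"
      using Rd dS Rg gS by (simp add: C.comp_assoc Hom_def)
    finally show "vert_comp C C \<delta> \<gamma> X \<cdot>\<^bsub>C\<^esub> mmult S X
      = mmult R X \<cdot>\<^bsub>C\<^esub> (arr_map (endo R) (vert_comp C C \<delta> \<gamma> X) \<cdot>\<^bsub>C\<^esub> vert_comp C C \<delta> \<gamma> (?S X))"
      using X \<delta>.T.F.map_comp[OF gX dX] by (simp add: vert_comp_apply)
  qed
qed

lemma monad_morphism_inverse:
  assumes "monad_morphism C S T \<gamma>" "\<And>X. X \<in> Obj C \<Longrightarrow> is_iso C (\<gamma> X)"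
  obtains \<delta> where "monad_morphism C T S \<delta>" "vert_comp C C \<delta> \<gamma> = id_trans C C (endo S)"
    "vert_comp C C \<gamma> \<delta> = id_trans C C (endo T)"
proof -
  interpret C: category C using assms(1) by (simp add: monad_morphism_def monad_def cat_functor_def)
  interpret \<gamma>: monad_morphism C S T \<gamma> by fact
  interpret ng: nat_trans C C "endo S" "endo T" \<gamma> by (rule \<gamma>.natural)
  obtain \<delta> where n: "nat_trans C C (endo T) (endo S) \<delta>"
    and inv: "\<And>X. X \<in> Obj C \<Longrightarrow> \<delta> X \<cdot>\<^bsub>C\<^esub> \<gamma> X = Ide C (obj_map (endo S) X)"
    "\<And>X. X \<in> Obj C \<Longrightarrow> \<gamma> X \<cdot>\<^bsub>C\<^esub> \<delta> X = Ide C (obj_map (endo T) X)"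
    using nat_iso_inverse[OF \<gamma>.natural assms(2)] by metis
  interpret nd: nat_trans C C "endo T" "endo S" \<delta> by (rule n)
  let ?S = "obj_map (endo S)" and ?T = "obj_map (endo T)"
  have "monad_morphism C T S \<delta>"
  proof (rule monad_morphismI[OF \<gamma>.T.monad_axioms \<gamma>.S.monad_axioms n])
    fix X assume X: "X \<in> Obj C"
    note gX = ng.component[OF X] and dX = nd.component[OF X]
    note SX = \<gamma>.S.F.obj_in[OF X] and TX = \<gamma>.T.F.obj_in[OF X]
    show "\<delta> X \<cdot>\<^bsub>C\<^esub> munit T X = munit S X"
      using C.comp_ext[OF \<gamma>.S.unit_hom[OF X] gX dX inv(1)[OF X]] \<gamma>.map_unit[OF X] C.ide_left[OF \<gamma>.S.unit_hom[OF X]] by simp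
    note gS = ng.component[OF SX] and dT = nd.component[OF TX] and gT = ng.component[OF TX]
    note Tg = \<gamma>.T.F.arr_map[OF gX] and Sd = \<gamma>.S.F.arr_map[OF dX] and Td = \<gamma>.T.F.arr_map[OF dX]
    note mS = \<gamma>.S.mult_hom[OF X] and mT = \<gamma>.T.mult_hom[OF X]
    let ?r = "arr_map (endo T) (\<gamma> X) \<cdot>\<^bsub>C\<^esub> \<gamma> (?S X)" and ?s = "arr_map (endo S) (\<delta> X) \<cdot>\<^bsub>C\<^esub> \<delta> (?T X)"
    have "?r \<cdot>\<^bsub>C\<^esub> ?s = arr_map (endo T) (\<gamma> X) \<cdot>\<^bsub>C\<^esub> ((\<gamma> (?S X) \<cdot>\<^bsub>C\<^esub> arr_map (endo S) (\<delta> X)) \<cdot>\<^bsub>C\<^esub> \<delta> (?T X))"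
      using Tg gS Sd dT by (simp add: C.comp_assoc Hom_def)
    also have "\<gamma> (?S X) \<cdot>\<^bsub>C\<^esub> arr_map (endo S) (\<delta> X) = arr_map (endo T) (\<delta> X) \<cdot>\<^bsub>C\<^esub> \<gamma> (?T X)"
      using ng.naturality[OF dX] by simp
    also have "arr_map (endo T) (\<gamma> X) \<cdot>\<^bsub>C\<^esub> ((arr_map (endo T) (\<delta> X) \<cdot>\<^bsub>C\<^esub> \<gamma> (?T X)) \<cdot>\<^bsub>C\<^esub> \<delta> (?T X))
      = (arr_map (endo T) (\<gamma> X) \<cdot>\<^bsub>C\<^esub> arr_map (endo T) (\<delta> X)) \<cdot>\<^bsub>C\<^esub> (\<gamma> (?T X) \<cdot>\<^bsub>C\<^esub> \<delta> (?T X))"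
      using Tg gT Td dT by (simp add: C.comp_assoc Hom_def)
    also have "\<dots> = Ide C (?T (?T X))"
      using \<gamma>.T.F.map_comp[OF dX gX] inv(2)[OF X] inv(2)[OF TX] C.ide_left[OF C.ide_in[OF \<gamma>.T.F.obj_in[OF TX]]] TX
      by (simp add: \<gamma>.T.F.map_ide)
    finally have rs: "?r \<cdot>\<^bsub>C\<^esub> ?s = Ide C (?T (?T X))" .
    have s: "?s \<in> Hom C (?T (?T X)) (?S (?S X))" by (rule C.comp_in[OF dT Sd])
    have r: "?r \<in> Hom C (?S (?S X)) (?T (?T X))" by (rule C.comp_in[OF gS Tg])
    have "\<delta> X \<cdot>\<^bsub>C\<^esub> mmult T X = \<delta> X \<cdot>\<^bsub>C\<^esub> ((mmult T X \<cdot>\<^bsub>C\<^esub> ?r) \<cdot>\<^bsub>C\<^esub> ?s)"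
      using C.comp_assoc_hom[OF s r mT] rs C.ide_right[OF mT] by simp
    also have "mmult T X \<cdot>\<^bsub>C\<^esub> ?r = \<gamma> X \<cdot>\<^bsub>C\<^esub> mmult S X" using \<gamma>.map_mult[OF X] by simp
    also have "\<delta> X \<cdot>\<^bsub>C\<^esub> ((\<gamma> X \<cdot>\<^bsub>C\<^esub> mmult S X) \<cdot>\<^bsub>C\<^esub> ?s) = (\<delta> X \<cdot>\<^bsub>C\<^esub> \<gamma> X) \<cdot>\<^bsub>C\<^esub> (mmult S X \<cdot>\<^bsub>C\<^esub> ?s)"
      using C.comp_assoc_hom[OF s mS gX] C.comp_assoc_hom[OF C.comp_in[OF s mS] gX dX] by simp
    finally show "\<delta> X \<cdot>\<^bsub>C\<^esub> mmult T X = mmult S X \<cdot>\<^bsub>C\<^esub> ?s"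
      using inv(1)[OF X] C.ide_left[OF C.comp_in[OF s mS]] by simp
  qed
  moreover have "vert_comp C C \<delta> \<gamma> = id_trans C C (endo S)" "vert_comp C C \<gamma> \<delta> = id_trans C C (endo T)"
    using inv by (auto simp: vert_comp_def id_trans_def)
  ultimately show thesis using that by blast
qed

lemma (in category) graph_isoI:
  assumes f: "f \<in> Hom (graph_cat U C) X Y" and v: "verts Y = verts X" "\<And>a. a \<in> verts X \<Longrightarrow> vmap f a = a"
    and iso: "\<And>a b. a \<in> verts X \<Longrightarrow> b \<in> verts X \<Longrightarrow> is_iso C (hmap f (a, b))"
  shows "is_iso (graph_cat U C) f"
proof -
  interpret G: category "graph_cat U C" by (rule category_graph_cat)
  note F = graph_homD[OF f]
  have h: "hmap f (a, b) \<in> Hom C (homs X (a, b)) (homs Y (a, b))" if "a \<in> verts X" "b \<in> verts X" for a b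
    using F(6)[OF that] v that by simp
  have "\<exists>g. g \<in> Hom C (homs Y (a, b)) (homs X (a, b)) \<and> g \<cdot> hmap f (a, b) = Ide C (homs X (a, b))
    \<and> hmap f (a, b) \<cdot> g = Ide C (homs Y (a, b))" if ab: "a \<in> verts X" "b \<in> verts X" for a b
    using iso_inverse[OF iso[OF ab] h[OF ab]] by metis
  then obtain g where g: "\<And>a b. a \<in> verts X \<Longrightarrow> b \<in> verts X \<Longrightarrow> g a b \<in> Hom C (homs Y (a, b)) (homs X (a, b))"
    "\<And>a b. a \<in> verts X \<Longrightarrow> b \<in> verts X \<Longrightarrow> g a b \<cdot> hmap f (a, b) = Ide C (homs X (a, b))"
    "\<And>a b. a \<in> verts X \<Longrightarrow> b \<in> verts X \<Longrightarrow> hmap f (a, b) \<cdot> g a b = Ide C (homs Y (a, b))" by metis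
  let ?g = "graph_mor Y X (\<lambda>a. a) g"
  have gh: "?g \<in> Hom (graph_cat U C) Y X" by (rule graph_mor_hom) (use F v g(1) in auto)
  have "?g \<cdot>\<^bsub>graph_cat U C\<^esub> f = Ide (graph_cat U C) X"
    by (rule graph_hom_eqI[OF G.comp_in[OF f gh] graph_ide_hom[OF F(3)]]) (use F(1) v g in \<open>auto simp: graph_ide\<close>)
  moreover have "f \<cdot>\<^bsub>graph_cat U C\<^esub> ?g = Ide (graph_cat U C) Y"
    by (rule graph_hom_eqI[OF G.comp_in[OF gh f] graph_ide_hom[OF F(4)]]) (use v g in \<open>auto simp: graph_ide\<close>)
  ultimately show ?thesis using G.is_isoI[OF f gh] by blast
qed

text \<open>Pastes the square with a square of isomorphisms on the corner \<open>B\<close>. It is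
  used to replace the value recovered from a line by the tensor itself, along
  \<open>eta\<close>.\<close>

lemma (in category) pullback_corner:
  assumes pb: "is_pullback C p q f g" and i: "i \<in> Hom C B' B" and j: "j \<in> Hom C B B'"
    and ij: "i \<cdot> j = Ide C B" "j \<cdot> i = Ide C B'" and B: "Dom C g = B"
  shows "is_pullback C p (j \<cdot> q) f (g \<cdot> i)"
proof -
  note D = pullbackD[OF pb]
  let ?D = "Cod C f"
  have f: "f \<in> Hom C (Dom C f) ?D" and g: "g \<in> Hom C B ?D" using D B by (auto simp: Hom_def)
  have o: "?D \<in> Obj C" using hom_obj(2)[OF g] .
  have "is_pullback C g j (Ide C ?D) (g \<cdot> i)"
  proof (rule pullback_iso[OF g comp_in[OF i g] j ide_in[OF o]])
    show "is_iso C j" by (rule is_isoI[OF j i ij])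
    show "is_iso C (Ide C ?D)" by (rule is_iso_ide[OF o])
    show "Ide C ?D \<cdot> g = (g \<cdot> i) \<cdot> j" using comp_assoc_hom[OF j i g] ij(1) ide_left[OF g] ide_right[OF g] by simp
  qed
  from pullback_paste[OF pb this] show ?thesis using ide_left[OF f] by simp
qed

section \<open>Operads: from cartesian squares to coproduct decompositions\<close>

context dist_line
begin

definition eta_inv :: "'o list \<Rightarrow> 'm" where
  "eta_inv = (SOME \<theta>. multitensor_map V P.psi A \<theta> \<and>
    vert_comp (seq_cat V) V \<theta> eta = id_trans (seq_cat V) V (tensor A) \<and>
    vert_comp (seq_cat V) V eta \<theta> = id_trans (seq_cat V) V (tensor P.psi) \<and>
    (\<forall>Xs\<in>lists (Obj V). is_iso V (\<theta> Xs)))"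

lemma eta_inv:
  shows "multitensor_map V P.psi A eta_inv"
    "Xs \<in> lists (Obj V) \<Longrightarrow> eta_inv Xs \<cdot> eta Xs = Ide V (tens A Xs)"
    "Xs \<in> lists (Obj V) \<Longrightarrow> eta Xs \<cdot> eta_inv Xs = Ide V (P.point Xs)"
    "Xs \<in> lists (Obj V) \<Longrightarrow> is_iso V (eta_inv Xs)"
proof -
  obtain \<theta> where "multitensor_map V P.psi A \<theta>"
    "vert_comp (seq_cat V) V \<theta> eta = id_trans (seq_cat V) V (tensor A)"
    "vert_comp (seq_cat V) V eta \<theta> = id_trans (seq_cat V) V (tensor P.psi)"
    "\<And>Xs. Xs \<in> lists (Obj V) \<Longrightarrow> is_iso V (\<theta> Xs)"
    using multitensor_map_inverse[OF eta_multitensor_map eta_iso] by metis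
  hence "\<exists>\<theta>. multitensor_map V P.psi A \<theta> \<and>
    vert_comp (seq_cat V) V \<theta> eta = id_trans (seq_cat V) V (tensor A) \<and>
    vert_comp (seq_cat V) V eta \<theta> = id_trans (seq_cat V) V (tensor P.psi) \<and>
    (\<forall>Xs\<in>lists (Obj V). is_iso V (\<theta> Xs))" by blast
  from someI_ex[OF this] have *: "multitensor_map V P.psi A eta_inv"
    "vert_comp (seq_cat V) V eta_inv eta = id_trans (seq_cat V) V (tensor A)"
    "vert_comp (seq_cat V) V eta eta_inv = id_trans (seq_cat V) V (tensor P.psi)"
    "\<forall>Xs\<in>lists (Obj V). is_iso V (eta_inv Xs)" unfolding eta_inv_def by blast+
  show "multitensor_map V P.psi A eta_inv" by fact
  assume X: "Xs \<in> lists (Obj V)"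
  show "eta_inv Xs \<cdot> eta Xs = Ide V (tens A Xs)"
    using fun_cong[OF *(2), of Xs] X by (simp add: vert_comp_apply id_trans_apply)
  show "eta Xs \<cdot> eta_inv Xs = Ide V (P.point Xs)"
    using fun_cong[OF *(3), of Xs] X by (simp add: vert_comp_apply id_trans_apply P.psi_simps(1))
  show "is_iso V (eta_inv Xs)" using * X by blast
qed

lemma eta_inv_hom: "Xs \<in> lists (Obj V) \<Longrightarrow> eta_inv Xs \<in> Hom V (P.point Xs) (tens A Xs)"
  using multitensor_map.comp_hom[OF eta_inv(1)] by (simp add: P.psi_simps(1))

lemma eta_inv_cartesian: "cartesian_trans (seq_cat V) V (tensor P.psi) (tensor A) eta_inv"
  by (rule nat_trans_iso_cartesian[OF multitensor_map.natural[OF eta_inv(1)]]) (simp add: eta_inv(4))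

text \<open>The map of a path carries the full path of its line to \<open>xs\<close>, with
  identities on the homs. Thus evaluation of \<Gamma> along the path, preceded by
  \<open>eta\<close>, is the injection of the summand \<open>xs\<close>.\<close>

lemma Gamma_path_mor_eta:
  assumes X: "X \<in> vgraphs U V" and xs: "xs \<in> paths (verts X) a b"
  shows "hmap (Gamma_mor V A (path_mor X xs)) (e 0, e (length xs - 1)) \<cdot> eta (path_homs X xs) = pinj X xs"
proof -
  note p = path_mor_hom[OF X xs] and i = A.inj_hom[OF X xs]
  note xl = path_homs_lists[OF X pathsD(2)[OF xs]]
  have len: "0 < length xs" using pathsD(1)[OF xs] by simp
  have 1: "map (vmap (path_mor X xs)) (interval 0 (length (path_homs X xs))) = xs"
    using len by (intro nth_equalityI) (auto simp: path_homs_length interval_simps path_mor_simps)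
  have 2: "map (hmap (path_mor X xs)) (steps (interval 0 (length (path_homs X xs)))) = map (Ide V) (path_homs X xs)"
    unfolding map_hmap_full[OF p] by (rule nth_equalityI) (simp_all add: path_homs_length path_mor_simps path_homs_nth)
  show ?thesis using A.Gamma_mor(3)[OF p full_path] xl ide_right[OF i] A.tens_ide[OF xl]
    unfolding 1 2 by (simp add: eta_def path_homs_length path_tensor_def)
qed

end

locale operad = dist_line U V e E + M: set_monad_map U V e T "Gamma U V E" \<tau>
  for U :: "'u set set" and V :: "('o, 'm) cat" (structure) and e :: "nat \<Rightarrow> 'u" and E :: "('o, 'm) multitensor"
    and T :: "('u, 'o, 'm) graph_monad" and \<tau> :: "('u, 'o) vgraph \<Rightarrow> ('u, 'o, 'm) vgraph_mor" +
  assumes cart: "cartesian_trans (graph_cat U V) (graph_cat U V) (endo T) (endo (Gamma U V E)) \<tau>"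
begin

text \<open>\<open>M.psi_map\<close> ends in the multitensor recovered from \<Gamma>E; the inverse
  of \<open>eta\<close> identifies that multitensor with \<open>E\<close>.\<close>

definition alpha :: "'o list \<Rightarrow> 'm" where
  "alpha = vert_comp (seq_cat V) V eta_inv M.psi_map"

lemma alpha_multitensor_map: "multitensor_map V M.S.psi E alpha"
  unfolding alpha_def by (rule multitensor_map_comp[OF M.psi_map_multitensor_map eta_inv(1)])

lemma alpha_cartesian: "cartesian_trans (seq_cat V) V (tensor M.S.psi) (tensor E) alpha"
  unfolding alpha_def by (rule cartesian_vert_comp[OF M.psi_map_cartesian[OF cart] eta_inv_cartesian])

lemma psi_dist: "distributive_multitensor U V M.S.psi"
  by (rule cartesian_over_distributive[OF A.dist alpha_cartesian])

sublocale D: set_monad_dist U V e T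
  by unfold_locales (rule psi_dist)

lemma alpha_dist_map: "dist_map U V M.S.psi E alpha"
  by (intro dist_map.intro D.A.dist_mult_axioms A.dist_mult_axioms alpha_multitensor_map)

text \<open>The square of \<tau> at the map of the path is a pullback of graphs, hence of homs at
  the end vertices. Replacing its lower corner along \<open>eta\<close> turns the side coming from
  \<Gamma>E into the coproduct injection of \<open>xs\<close>.\<close>

lemma jota_pullback:
  assumes X: "X \<in> vgraphs U V" and xs: "xs \<in> paths (verts X) a b"
  shows "is_pullback V (M.S.jota X xs) (alpha (path_homs X xs)) (hmap (\<tau> X) (a, b)) (pinj X xs)"
proof -
  note p = path_mor_hom[OF X xs] and xl = path_homs_lists[OF X pathsD(2)[OF xs]]
  have ends: "e 0 \<in> verts (line (path_homs X xs))" "e (length xs - 1) \<in> verts (line (path_homs X xs))"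
    by (auto simp: path_homs_length)
  have "is_pullback V (M.S.jota X xs) (M.psi_map (path_homs X xs)) (hmap (\<tau> X) (a, b)) (hmap (Gamma_mor V E (path_mor X xs)) (e 0, e (length xs - 1)))"
    using M.gamma_pullback_hom[OF cart p ends] path_mor_ends[OF xs, of X] p xl
    by (simp add: M.S.jota_def M.psi_map_def path_homs_length)
  moreover have "Dom V (hmap (Gamma_mor V E (path_mor X xs)) (e 0, e (length xs - 1))) = P.point (path_homs X xs)"
  proof -
    have "e 0 \<in> verts (\<Gamma> (line (path_homs X xs)))" "e (length xs - 1) \<in> verts (\<Gamma> (line (path_homs X xs)))"
      using ends by auto
    from graph_homD(6)[OF A.Gamma_mor(1)[OF p] this] show ?thesis
      using point_Gamma[OF xl] by (simp add: Hom_def path_homs_length)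
  qed
  ultimately have "is_pullback V (M.S.jota X xs) (eta_inv (path_homs X xs) \<cdot> M.psi_map (path_homs X xs)) (hmap (\<tau> X) (a, b))
    (hmap (Gamma_mor V E (path_mor X xs)) (e 0, e (length xs - 1)) \<cdot> eta (path_homs X xs))"
    by (rule pullback_corner[OF _ eta_hom[OF xl] eta_inv_hom[OF xl] eta_inv(3)[OF xl] eta_inv(2)[OF xl]])
  thus ?thesis using xl unfolding Gamma_path_mor_eta[OF X xs] by (simp add: alpha_def vert_comp_apply)
qed

text \<open>By \<open>jota_pullback\<close> the maps \<open>jota\<close> are pullbacks along \<tau>
  of the injections for \<Gamma>E, so universality of coproducts applies.\<close>

lemma jota_coproduct:
  assumes X: "X \<in> vgraphs U V" and ab: "a \<in> verts X" "b \<in> verts X"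
  shows "is_coproduct V (paths (verts X) a b) (path_tensor M.S.psi X) (homs (M.S.To X) (a, b)) (M.S.jota X)"
proof (rule coproduct_universal[OF small_paths[OF vgraph_small[OF X]] A.Gamma_coproduct[OF X ab]])
  show "hmap (\<tau> X) (a, b) \<in> Hom V (homs (M.S.To X) (a, b)) (homs (\<Gamma> X) (a, b))"
    using graph_homD(6)[OF M.gamma_hom[OF X]] ab X M.S.verts_To[OF X] M.vmap_gamma[OF X] by simp
  fix xs assume xs: "xs \<in> paths (verts X) a b"
  show "is_pullback V (M.S.jota X xs) (alpha (path_homs X xs)) (hmap (\<tau> X) (a, b)) (pinj X xs)" by (rule jota_pullback[OF X xs])
  show "Dom V (M.S.jota X xs) = path_tensor M.S.psi X xs" by (rule HomD(2)[OF M.S.jota_hom[OF X xs]])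
qed

lemma eps_iso:
  assumes X: "X \<in> vgraphs U V"
  shows "is_iso (graph_cat U V) (D.eps X)"
proof (rule graph_isoI[OF D.eps_hom(1)[OF X]])
  fix a b assume "a \<in> verts (Gamma_graph V M.S.psi X)" "b \<in> verts (Gamma_graph V M.S.psi X)"
  hence ab: "a \<in> verts X" "b \<in> verts X" by auto
  show "is_iso V (hmap (D.eps X) (a, b))"
    by (rule coproduct_iso[OF D.A.Gamma_coproduct[OF X ab] jota_coproduct[OF X ab] D.eps_hmap[OF X ab] D.eps_hom(3)[OF X]])
qed (use M.S.verts_To[OF X] D.eps_hom(2)[OF X] in auto)

text \<open>On the summand of a path this is the commutativity of the square in
  \<open>jota_pullback\<close>. It makes \<open>eps\<close> a morphism of operads.\<close>

lemma eps_over: "vert_comp (graph_cat U V) (graph_cat U V) \<tau> D.eps = Gamma_trans U V M.S.psi E alpha"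
proof -
  interpret a: dist_map U V M.S.psi E alpha by (rule alpha_dist_map)
  have nt: "nat_trans G G (endo T) (Gamma_functor U V E) \<tau>" using M.natural by (simp add: Gamma_def)
  show ?thesis
  proof (rule nat_trans_eqI[OF nat_trans_vert_comp[OF D.eps_natural nt] a.trans_natural])
    fix X assume "X \<in> Obj (graph_cat U V)"
    hence X: "X \<in> vgraphs U V" by simp
    note ee = D.eps_hom[OF X] and t = a.trans_hom[OF X]
    have ta: "\<tau> X \<in> Hom G (M.S.To X) (\<Gamma> X)" using M.gamma_hom[OF X] X by simp
    have "\<tau> X \<odot> D.eps X = Gamma_trans U V M.S.psi E alpha X"
    proof (rule D.A.Gamma_hom_eqI[OF X G.comp_in[OF ee(1) ta] t(1)])
      note s = graph_homD(1)[OF ee(1)]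
      show "vmap (\<tau> X \<odot> D.eps X) a = vmap (Gamma_trans U V M.S.psi E alpha X) a" if "a \<in> verts X" for a
        using that s by (simp add: ee(2) t(2) M.vmap_gamma[OF X])
      fix a b xs assume ab: "a \<in> verts X" "b \<in> verts X" and xs: "xs \<in> paths (verts X) a b"
      have th: "hmap (\<tau> X) (a, b) \<in> Hom V (homs (M.S.To X) (a, b)) (homs (\<Gamma> X) (a, b))"
        using graph_homD(6)[OF ta] ab M.S.verts_To[OF X] M.vmap_gamma[OF X] by simp
      show "hmap (\<tau> X \<odot> D.eps X) (a, b) \<cdot> path_inj V M.S.psi X xs = hmap (Gamma_trans U V M.S.psi E alpha X) (a, b) \<cdot> path_inj V M.S.psi X xs"
        using comp_assoc_hom[OF D.A.inj_hom[OF X xs] D.eps_hmap[OF X ab] th] ee(3)[OF xs] t(3)[OF xs]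
          pullbackD(9)[OF jota_pullback[OF X xs]] ab s by (simp add: ee(2))
    qed
    thus "vert_comp G G \<tau> D.eps X = Gamma_trans U V M.S.psi E alpha X" using X by (simp add: vert_comp_apply)
  qed
qed

end

section \<open>The categories of multitensors and of operads\<close>

lemma vert_comp_assoc:
  assumes "nat_trans C D F G \<alpha>" "nat_trans C D G H \<beta>" "nat_trans C D H K \<gamma>"
  shows "vert_comp C D (vert_comp C D \<gamma> \<beta>) \<alpha> = vert_comp C D \<gamma> (vert_comp C D \<beta> \<alpha>)"
proof -
  interpret D: category D using assms(1) by (simp add: nat_trans_def cat_functor_def)
  show ?thesis
    using D.comp_assoc_hom[OF nat_trans.component[OF assms(1)] nat_trans.component[OF assms(2)] nat_trans.component[OF
      assms(3)]]
    by (auto simp: vert_comp_def)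
qed

lemma vert_comp_id:
  assumes "nat_trans C D F G \<alpha>"
  shows "vert_comp C D \<alpha> (id_trans C D F) = \<alpha>" "vert_comp C D (id_trans C D G) \<alpha> = \<alpha>"
proof -
  interpret nat_trans C D F G \<alpha> by fact
  show "vert_comp C D \<alpha> (id_trans C D F) = \<alpha>" "vert_comp C D (id_trans C D G) \<alpha> = \<alpha>"
    using ext F.D.ide_left[OF component] F.D.ide_right[OF component] by (auto simp: vert_comp_def id_trans_def extensional_def)
qed

text \<open>The common shape of \<^term>\<open>Mult\<close> and \<^term>\<open>Op\<close>: structures \<open>a\<close> with an underlying functor
  \<open>F a\<close> and a structure map to a fixed one.\<close>

definition over_cat :: "('o1, 'm1) cat \<Rightarrow> ('o2, 'm2) cat \<Rightarrow> ('a \<Rightarrow> ('o1, 'm1, 'o2, 'm2) func)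
    \<Rightarrow> ('a \<Rightarrow> 'a \<Rightarrow> ('o1 \<Rightarrow> 'm2) \<Rightarrow> bool) \<Rightarrow> ('a \<times> ('o1 \<Rightarrow> 'm2)) set
    \<Rightarrow> ('a \<times> ('o1 \<Rightarrow> 'm2), ('a \<times> ('o1 \<Rightarrow> 'm2)) \<times> ('o1 \<Rightarrow> 'm2) \<times> ('a \<times> ('o1 \<Rightarrow> 'm2))) cat" where
  "over_cat K L F M S =
     \<lparr>Obj = S,
      Arr = {((A, \<alpha>), \<gamma>, (B, \<beta>)). (A, \<alpha>) \<in> S \<and> (B, \<beta>) \<in> S \<and> M A B \<gamma> \<and> vert_comp K L \<beta> \<gamma> = \<alpha>},
      Dom = (\<lambda>(a, \<gamma>, b). a),
      Cod = (\<lambda>(a, \<gamma>, b). b),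
      Ide = (\<lambda>(A, \<alpha>). ((A, \<alpha>), id_trans K L (F A), (A, \<alpha>))),
      Comp = (\<lambda>(b', \<delta>, c) (a, \<gamma>, b). (a, vert_comp K L \<delta> \<gamma>, c))\<rparr>"

lemma Mult_over_cat: "Mult V E = over_cat (seq_cat V) V tensor (multitensor_map V) (Mult_objects V E)"
  by (simp add: Mult_def over_cat_def)

lemma Op_over_cat:
  "Op U V T = over_cat (graph_cat U V) (graph_cat U V) endo (monad_morphism (graph_cat U V)) (Op_objects U V T)"
  by (simp add: Op_def over_cat_def Let_def)

lemma over_cat_hom:
  "f \<in> Hom (over_cat K L F M S) a b \<longleftrightarrow>
    (\<exists>\<gamma>. f = (a, \<gamma>, b) \<and> a \<in> S \<and> b \<in> S \<and> M (fst a) (fst b) \<gamma> \<and> vert_comp K L (snd b) \<gamma> = snd a)"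
  by (auto simp: Hom_def over_cat_def)

text \<open>The hypothesis of \<open>ident\<close> merely records that \<open>A\<close> occurs as
  the source of some morphism, which is how it is known to be a structure.\<close>

locale structures_over =
  fixes K :: "('o1, 'm1) cat" and L :: "('o2, 'm2) cat" and F :: "'a \<Rightarrow> ('o1, 'm1, 'o2, 'm2) func"
    and M :: "'a \<Rightarrow> 'a \<Rightarrow> ('o1 \<Rightarrow> 'm2) \<Rightarrow> bool" and S :: "('a \<times> ('o1 \<Rightarrow> 'm2)) set" and E :: 'a
  assumes nat: "M A B \<gamma> \<Longrightarrow> nat_trans K L (F A) (F B) \<gamma>"
    and ident: "M A B \<gamma> \<Longrightarrow> M A A (id_trans K L (F A))"
    and comp: "M A B \<gamma> \<Longrightarrow> M B C \<delta> \<Longrightarrow> M A C (vert_comp K L \<delta> \<gamma>)"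
    and obj: "a \<in> S \<Longrightarrow> M (fst a) E (snd a)"
begin

abbreviation OC where "OC \<equiv> over_cat K L F M S"

lemma OC_simps [simp]:
  "Obj OC = S" "Ide OC (A, \<alpha>) = ((A, \<alpha>), id_trans K L (F A), (A, \<alpha>))"
  "Comp OC (b', \<delta>, c) (a, \<gamma>, b) = (a, vert_comp K L \<delta> \<gamma>, c)"
  "Dom OC (a, \<gamma>, b) = a" "Cod OC (a, \<gamma>, b) = b"
  by (simp_all add: over_cat_def)

lemma category_over: "category OC"
proof
  fix f assume "f \<in> Arr OC"
  thus "Dom OC f \<in> Obj OC" "Cod OC f \<in> Obj OC" by (auto simp: over_cat_def)
next
  fix a assume "a \<in> Obj OC"
  hence a: "a \<in> S" by simp
  note o = obj[OF a]
  show "Ide OC a \<in> Hom OC a a"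
    unfolding over_cat_hom using a ident[OF o] vert_comp_id(1)[OF nat[OF o]] by (cases a) auto
next
  fix f a b assume f: "f \<in> Hom OC a b"
  then obtain \<gamma> where g: "f = (a, \<gamma>, b)" "M (fst a) (fst b) \<gamma>" unfolding over_cat_hom by auto
  show "f \<cdot>\<^bsub>OC\<^esub> Ide OC a = f" "Ide OC b \<cdot>\<^bsub>OC\<^esub> f = f"
    using vert_comp_id[OF nat[OF g(2)]] g(1) by (cases a; cases b; simp)+
next
  fix f a b g c assume "f \<in> Hom OC a b" "g \<in> Hom OC b c"
  then obtain \<gamma> \<delta> where g: "f = (a, \<gamma>, b)" "M (fst a) (fst b) \<gamma>" "g = (b, \<delta>, c)" "M (fst b) (fst c) \<delta>"
    "a \<in> S" "c \<in> S" "vert_comp K L (snd b) \<gamma> = snd a" "vert_comp K L (snd c) \<delta> = snd b" unfolding over_cat_hom by auto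
  show "g \<cdot>\<^bsub>OC\<^esub> f \<in> Hom OC a c" unfolding over_cat_hom
    using g comp[OF g(2,4)] vert_comp_assoc[OF nat[OF g(2)] nat[OF g(4)] nat[OF obj[OF g(6)]]] by auto
next
  fix f a b g c h d assume "f \<in> Hom OC a b" "g \<in> Hom OC b c" "h \<in> Hom OC c d"
  then obtain \<gamma> \<delta> \<epsilon> where "f = (a, \<gamma>, b)" "M (fst a) (fst b) \<gamma>" "g = (b, \<delta>, c)" "M (fst b) (fst c) \<delta>"
    "h = (c, \<epsilon>, d)" "M (fst c) (fst d) \<epsilon>" unfolding over_cat_hom by auto
  thus "h \<cdot>\<^bsub>OC\<^esub> (g \<cdot>\<^bsub>OC\<^esub> f) = h \<cdot>\<^bsub>OC\<^esub> g \<cdot>\<^bsub>OC\<^esub> f"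
    using vert_comp_assoc[OF nat nat nat] by simp
qed

text \<open>An inverse of the underlying map is automatically compatible with the structure maps:
  composing the triangle of \<gamma> with \<delta> cancels \<gamma>.\<close>

lemma over_isoI:
  assumes f: "(a, \<gamma>, b) \<in> Hom OC a b" and d: "M (fst b) (fst a) \<delta>"
    "vert_comp K L \<delta> \<gamma> = id_trans K L (F (fst a))" "vert_comp K L \<gamma> \<delta> = id_trans K L (F (fst b))"
  shows "is_iso OC (a, \<gamma>, b)"
proof -
  interpret C: category OC by (rule category_over)
  have g: "M (fst a) (fst b) \<gamma>" "a \<in> S" "b \<in> S" "vert_comp K L (snd b) \<gamma> = snd a" using f unfolding over_cat_hom by auto
  have "vert_comp K L (snd a) \<delta> = snd b"
    using vert_comp_assoc[OF nat[OF d(1)] nat[OF g(1)] nat[OF obj[OF g(3)]]] g(4) d(3) vert_comp_id(1)[OF nat[OF obj[OF g(3)]]] by simp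
  hence h: "(b, \<delta>, a) \<in> Hom OC b a" unfolding over_cat_hom using g d by auto
  show ?thesis by (rule C.is_isoI[OF f h]) (use d in \<open>cases a; cases b; simp\<close>)+
qed

end

lemma structures_over_Mult: "structures_over (seq_cat V) V tensor (multitensor_map V) (Mult_objects V E) E"
proof (rule structures_over.intro)
  show "nat_trans (seq_cat V) V (tensor A) (tensor B) \<gamma>" if "multitensor_map V A B \<gamma>" for A B \<gamma>
    by (rule multitensor_map.natural[OF that])
  show "multitensor_map V A A (id_trans (seq_cat V) V (tensor A))" if "multitensor_map V A B \<gamma>" for A B \<gamma>
    by (rule multitensor_map_id) (use that in \<open>simp add: multitensor_map_def\<close>)
qed (auto simp: Mult_objects_def intro: multitensor_map_comp)

lemma structures_over_Op: "structures_over (graph_cat U V) (graph_cat U V) endo (monad_morphism (graph_cat U V)) (Op_objects U V T) T"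
proof (rule structures_over.intro)
  let ?G = "graph_cat U V"
  show "nat_trans ?G ?G (endo A) (endo B) \<gamma>" if "monad_morphism ?G A B \<gamma>" for A B \<gamma>
    by (rule monad_morphism.natural[OF that])
  show "monad_morphism ?G A A (id_trans ?G ?G (endo A))" if "monad_morphism ?G A B \<gamma>" for A B \<gamma>
    by (rule monad.monad_morphism_id) (use that in \<open>simp add: monad_morphism_def\<close>)
qed (auto simp: Op_objects_def intro: monad_morphism_comp)

section \<open>The functor from multitensors to operads\<close>

context dist_line
begin

abbreviation "Ops \<equiv> Op_objects U V (Gamma U V A)"
abbreviation "OP \<equiv> Op U V (Gamma U V A)"

interpretation MM: structures_over "seq_cat V" V tensor "multitensor_map V" "Mult_objects V A" A
  by (rule structures_over_Mult)
interpretation OO: structures_over G G endo "monad_morphism G" "Ops" "Gamma U V A"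
  by (rule structures_over_Op)

lemma category_Mult: "category (Mult V A)"
  unfolding Mult_over_cat by (rule MM.category_over)

lemma category_Op: "category (OP)"
  unfolding Op_over_cat by (rule OO.category_over)

lemma Mult_hom:
  "f \<in> Hom (Mult V A) a b \<longleftrightarrow> (\<exists>\<gamma>. f = (a, \<gamma>, b) \<and> a \<in> Mult_objects V A \<and> b \<in> Mult_objects V A \<and>
    multitensor_map V (fst a) (fst b) \<gamma> \<and> vert_comp (seq_cat V) V (snd b) \<gamma> = snd a)"
  unfolding Mult_over_cat over_cat_hom ..

lemma Op_hom:
  "f \<in> Hom (OP) a b \<longleftrightarrow> (\<exists>\<gamma>. f = (a, \<gamma>, b) \<and> a \<in> Ops \<and>
    b \<in> Ops \<and> monad_morphism G (fst a) (fst b) \<gamma> \<and> vert_comp G G (snd b) \<gamma> = snd a)"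
  unfolding Op_over_cat over_cat_hom ..

lemma Mult_simps [simp]:
  "Obj (Mult V A) = Mult_objects V A" "Ide (Mult V A) (B, \<beta>) = ((B, \<beta>), id_trans (seq_cat V) V (tensor B), (B, \<beta>))"
  "Comp (Mult V A) (b', \<delta>, c) (a, \<gamma>, b) = (a, vert_comp (seq_cat V) V \<delta> \<gamma>, c)"
  by (simp_all add: Mult_def)

lemma Op_simps [simp]:
  "Obj (OP) = Ops"
  "Ide (OP) (T, \<tau>) = ((T, \<tau>), id_trans G G (endo T), (T, \<tau>))"
  "Comp (OP) (b', \<delta>, c) (a, \<gamma>, b) = (a, vert_comp G G \<delta> \<gamma>, c)"
  by (simp_all add: Op_def Let_def)

lemma Mult_dist_mult:
  assumes "b \<in> Mult_objects V A"
  shows "dist_mult U V (fst b)"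
proof -
  have b: "multitensor_map V (fst b) A (snd b)" "cartesian_trans (seq_cat V) V (tensor (fst b)) (tensor A) (snd b)"
    using assms by (auto simp: Mult_objects_def)
  show ?thesis
    using cartesian_over_distributive[OF A.dist b(2)] b(1)
    by (intro dist_mult.intro extensive_cat_axioms dist_mult_axioms.intro) (simp_all add: multitensor_map_def)
qed

lemma Mult_dist_map:
  assumes "b \<in> Mult_objects V A"
  shows "dist_map U V (fst b) A (snd b)"
  using assms by (intro dist_map.intro Mult_dist_mult A.dist_mult_axioms) (auto simp: Mult_objects_def)

lemma Mult_arr_dist_map:
  assumes "a \<in> Mult_objects V A" "b \<in> Mult_objects V A" "multitensor_map V (fst a) (fst b) \<gamma>"
  shows "dist_map U V (fst a) (fst b) \<gamma>"
  using assms by (intro dist_map.intro Mult_dist_mult)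

definition Gam :: "('o, 'm) mult_over \<Rightarrow> ('u, 'o, 'm) monad_over" where
  "Gam b = (Gamma U V (fst b), Gamma_trans U V (fst b) A (snd b))"

lemma Gamma_over_simps:
  "b \<in> Mult_objects V A \<Longrightarrow> obj_map (Gamma_over U V A) b = Gam b"
  "(a, \<gamma>, b) \<in> Hom (Mult V A) a b \<Longrightarrow>
    arr_map (Gamma_over U V A) (a, \<gamma>, b) = (Gam a, Gamma_trans U V (fst a) (fst b) \<gamma>, Gam b)"
  by (auto simp: Gamma_over_def Gam_def case_prod_unfold Hom_def)

lemma Gam_in:
  assumes "b \<in> Mult_objects V A"
  shows "Gam b \<in> Ops"
proof -
  interpret b: dist_map U V "fst b" A "snd b" by (rule Mult_dist_map[OF assms])
  have "cartesian_trans (seq_cat V) V (tensor (fst b)) (tensor A) (snd b)" using assms by (auto simp: Mult_objects_def)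
  thus ?thesis
    using b.A.monad_over_Set_Gamma b.trans_monad_morphism b.trans_cartesian b.trans_identity_on_objects
    by (simp add: Gam_def Op_objects_def Gamma_def)
qed

lemma Gam_arr:
  assumes f: "(a, \<gamma>, b) \<in> Hom (Mult V A) a b"
  shows "(Gam a, Gamma_trans U V (fst a) (fst b) \<gamma>, Gam b) \<in> Hom (OP) (Gam a) (Gam b)"
proof -
  have g: "a \<in> Mult_objects V A" "b \<in> Mult_objects V A" "multitensor_map V (fst a) (fst b) \<gamma>"
    "vert_comp (seq_cat V) V (snd b) \<gamma> = snd a" using f unfolding Mult_hom by auto
  note m = Mult_arr_dist_map[OF g(1-3)]
  show ?thesis unfolding Op_hom
    using Gam_in[OF g(1)] Gam_in[OF g(2)] dist_map.trans_monad_morphism[OF m] trans_vert_comp[OF m Mult_dist_map[OF g(2)]] g(4)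
    by (simp add: Gam_def)
qed

lemma cat_functor_Gamma_over: "cat_functor (Mult V A) (OP) (Gamma_over U V A)"
proof (rule cat_functor.intro[OF category_Mult category_Op], rule cat_functor_axioms.intro)
  show "obj_map (Gamma_over U V A) \<in> Obj (Mult V A) \<rightarrow>\<^sub>E Obj (OP)"
  proof (rule PiE_I)
    show "obj_map (Gamma_over U V A) b \<in> Obj (OP)" if "b \<in> Obj (Mult V A)" for b
      using that Gam_in by (simp add: Gamma_over_simps)
    show "obj_map (Gamma_over U V A) b = undefined" if "b \<notin> Obj (Mult V A)" for b
      using that by (simp add: Gamma_over_def Let_def)
  qed
  show "arr_map (Gamma_over U V A) \<in> extensional (Arr (Mult V A))" by (simp add: Gamma_over_def Let_def)
  show "arr_map (Gamma_over U V A) f \<in> Hom (OP) (obj_map (Gamma_over U V A) a) (obj_map (Gamma_over U V A) b)"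
    if f: "f \<in> Hom (Mult V A) a b" for f a b
  proof -
    obtain \<gamma> where g: "f = (a, \<gamma>, b)" "a \<in> Mult_objects V A" "b \<in> Mult_objects V A" using f unfolding Mult_hom by auto
    show ?thesis using Gam_arr[of a \<gamma> b] f g by (simp add: Gamma_over_simps)
  qed
  show "arr_map (Gamma_over U V A) (Ide (Mult V A) a) = Ide (OP) (obj_map (Gamma_over U V A) a)"
    if a: "a \<in> Obj (Mult V A)" for a
  proof -
    interpret a: dist_mult U V "fst a" using Mult_dist_mult a by simp
    have "Ide (Mult V A) a = (a, id_trans (seq_cat V) V (tensor (fst a)), a)" by (cases a) simp
    moreover have "Ide (Mult V A) a \<in> Hom (Mult V A) a a" by (rule category.ide_in[OF category_Mult a])
    ultimately have "arr_map (Gamma_over U V A) (Ide (Mult V A) a) = (Gam a, id_trans G G (Gamma_functor U V (fst a)), Gam a)"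
      using Gamma_over_simps(2)[of a _ a] a.trans_id by simp
    thus ?thesis using a by (simp add: Gamma_over_simps Gam_def Gamma_def[of U V "fst a"])
  qed
  show "arr_map (Gamma_over U V A) (g \<cdot>\<^bsub>Mult V A\<^esub> f) = arr_map (Gamma_over U V A) g \<cdot>\<^bsub>OP\<^esub> arr_map (Gamma_over U V A) f"
    if f: "f \<in> Hom (Mult V A) a b" and g: "g \<in> Hom (Mult V A) b c" for f g a b c
  proof -
    obtain \<gamma> where \<gamma>: "f = (a, \<gamma>, b)" "a \<in> Mult_objects V A" "b \<in> Mult_objects V A" "multitensor_map V (fst a) (fst b) \<gamma>"
      using f unfolding Mult_hom by auto
    obtain \<delta> where \<delta>: "g = (b, \<delta>, c)" "c \<in> Mult_objects V A" "multitensor_map V (fst b) (fst c) \<delta>"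
      using g unfolding Mult_hom by auto
    have "g \<cdot>\<^bsub>Mult V A\<^esub> f \<in> Hom (Mult V A) a c" by (rule category.comp_in[OF category_Mult f g])
    moreover have "g \<cdot>\<^bsub>Mult V A\<^esub> f = (a, vert_comp (seq_cat V) V \<delta> \<gamma>, c)" using \<gamma>(1) \<delta>(1) by simp
    ultimately show ?thesis
      using Gamma_over_simps(2) f g \<gamma>(1) \<delta>(1) trans_vert_comp[OF Mult_arr_dist_map[OF \<gamma>(2-4)] Mult_arr_dist_map[OF \<gamma>(3) \<delta>(2,3)]]
      by simp
  qed
qed

subsection \<open>The inverse functor\<close>

text \<open>This is \<open>psi_map\<close> for arbitrary families of graph maps, so that it can be
  written without naming the source and target monads.\<close>

definition ends :: "(('u, 'o) vgraph \<Rightarrow> ('u, 'o, 'm) vgraph_mor) \<Rightarrow> 'o list \<Rightarrow> 'm" where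
  "ends \<gamma> = (\<lambda>Xs\<in>lists (Obj V). hmap (\<gamma> (line Xs)) (e 0, e (length Xs)))"

text \<open>The second component is \<open>alpha\<close> of the operad, again written without
  reference to its locale.\<close>

definition Psi :: "('u, 'o, 'm) monad_over \<Rightarrow> ('o, 'm) mult_over" where
  "Psi p = (set_monad.psi U V e (fst p), vert_comp (seq_cat V) V eta_inv (ends (snd p)))"

definition Psi_over where
  "Psi_over = \<lparr>obj_map = (\<lambda>p\<in>Ops. Psi p),
     arr_map = (\<lambda>(a, \<gamma>, b)\<in>Arr (OP). (Psi a, ends \<gamma>, Psi b))\<rparr>"

lemma Psi_over_simps:
  "p \<in> Ops \<Longrightarrow> obj_map Psi_over p = Psi p"
  "(a, \<gamma>, b) \<in> Hom (OP) a b \<Longrightarrow> arr_map Psi_over (a, \<gamma>, b) = (Psi a, ends \<gamma>, Psi b)"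
  by (auto simp: Psi_over_def Hom_def)

lemma Op_set_monad: "p \<in> Ops \<Longrightarrow> set_monad U V e (fst p)"
  by (intro set_monad.intro line_cat_axioms set_monad_axioms.intro) (auto simp: Op_objects_def)

lemma Op_operad:
  assumes "p \<in> Ops"
  shows "operad U V e A (fst p) (snd p)"
proof -
  have p: "monad_morphism G (fst p) (Gamma U V A) (snd p)" "identity_on_objects U V (snd p)"
    "cartesian_trans G G (endo (fst p)) (endo (Gamma U V A)) (snd p)" using assms by (auto simp: Op_objects_def)
  show ?thesis
    by (intro operad.intro operad_axioms.intro set_monad_map.intro set_monad_map_axioms.intro dist_line_axioms
        Op_set_monad[OF assms] P.set_monad_axioms p)
qed

text \<open>Arrows of \<open>Op\<close> are only required to be monad morphisms over \<Gamma>. That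
  they fix vertices follows from the triangle, since both structure maps fix them.\<close>

lemma Op_identity_on_objects:
  assumes a: "a \<in> Ops" and b: "b \<in> Ops"
    and g: "monad_morphism G (fst a) (fst b) \<gamma>" "vert_comp G G (snd b) \<gamma> = snd a"
  shows "identity_on_objects U V \<gamma>"
  unfolding identity_on_objects_def
proof
  fix X assume X: "X \<in> Obj G"
  interpret a: operad U V e A "fst a" "snd a" by (rule Op_operad[OF a])
  interpret b: operad U V e A "fst b" "snd b" by (rule Op_operad[OF b])
  have X': "X \<in> vgraphs U V" using X by simp
  have gX: "\<gamma> X \<in> Hom G (a.M.S.To X) (b.M.S.To X)" using nat_trans.component[OF monad_morphism.natural[OF g(1)] X] .
  note D = graph_homD[OF gX]
  have v: "vmap (\<gamma> X) x = x" if x: "x \<in> verts X" for x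
  proof -
    have xs: "x \<in> verts (source (\<gamma> X))" using x D(1) a.M.S.verts_To[OF X'] by simp
    have "vmap (\<gamma> X) x \<in> verts X" using D(5)[of x] x a.M.S.verts_To[OF X'] b.M.S.verts_To[OF X'] by simp
    hence "vmap (\<gamma> X) x = vmap (snd b X \<odot> \<gamma> X) x" using xs b.M.vmap_gamma[OF X'] by simp
    also have "snd b X \<odot> \<gamma> X = snd a X" using fun_cong[OF g(2), of X] X by (simp add: vert_comp_apply)
    finally show ?thesis using a.M.vmap_gamma[OF X' x] by simp
  qed
  \<comment> \<open>Equality with the restricted identity also needs the default value off the
    vertices, which every arrow of the graph category has.\<close>
  have "vmap (\<gamma> X) \<in> extensional (verts X)"
    using arg_cong[OF graph_mor_eq[OF gX], of vmap] a.M.S.verts_To[OF X'] by (metis graph_mor_def restrict_extensional vgraph_mor.select_convs(3))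
  thus "vmap (\<gamma> X) = (\<lambda>a\<in>verts X. a)" using v by (auto simp: extensional_def)
qed

lemma Op_set_monad_map:
  assumes "a \<in> Ops" "b \<in> Ops"
    "monad_morphism G (fst a) (fst b) \<gamma>" "vert_comp G G (snd b) \<gamma> = snd a"
  shows "set_monad_map U V e (fst a) (fst b) \<gamma>"
  by (intro set_monad_map.intro set_monad_map_axioms.intro Op_set_monad assms(1,2,3) Op_identity_on_objects[OF assms])

lemma Psi_in:
  assumes "p \<in> Ops"
  shows "Psi p \<in> Mult_objects V A"
proof -
  interpret p: operad U V e A "fst p" "snd p" by (rule Op_operad[OF assms])
  show ?thesis using p.alpha_multitensor_map p.alpha_cartesian
    by (simp add: Psi_def Mult_objects_def p.alpha_def p.M.psi_map_def ends_def)
qed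

text \<open>The first factor fixes the end vertices, so both factors are evaluated at the same
  hom.\<close>

lemma ends_vert_comp:
  assumes ab: "set_monad_map U V e S T \<gamma>"
  shows "ends (vert_comp G G \<delta> \<gamma>) = vert_comp (seq_cat V) V (ends \<delta>) (ends \<gamma>)"
proof -
  interpret ab: set_monad_map U V e S T \<gamma> by fact
  have "hmap (vert_comp G G \<delta> \<gamma> (line Xs)) (e 0, e (length Xs))
    = hmap (\<delta> (line Xs)) (e 0, e (length Xs)) \<cdot> hmap (\<gamma> (line Xs)) (e 0, e (length Xs))" if X: "Xs \<in> lists (Obj V)" for Xs
    using ab.S.hmap_comp_To[OF ab.gamma_hom[OF line_in[OF X]] X, of "\<delta> (line Xs)"] ab.vmap_gamma[OF line_in[OF X]] line_in[OF X]
    by (simp add: vert_comp_apply)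
  thus ?thesis by (auto simp: ends_def vert_comp_def)
qed

lemma ends_id:
  assumes "set_monad U V e T"
  shows "ends (id_trans G G (endo T)) = id_trans (seq_cat V) V (tensor (set_monad.psi U V e T))"
proof -
  interpret set_monad U V e T by fact
  have "hmap (id_trans G G (endo T) (line Xs)) (e 0, e (length Xs)) = Ide V (point Xs)" if X: "Xs \<in> lists (Obj V)" for Xs
    using ends_To[OF X] line_in[OF X] by (simp add: id_trans_apply graph_ide point_def)
  thus ?thesis by (auto simp: ends_def id_trans_def psi_simps(1))
qed

lemma Psi_arr:
  assumes f: "(a, \<gamma>, b) \<in> Hom (OP) a b"
  shows "(Psi a, ends \<gamma>, Psi b) \<in> Hom (Mult V A) (Psi a) (Psi b)"
proof -
  have g: "a \<in> Ops" "b \<in> Ops" "monad_morphism G (fst a) (fst b) \<gamma>"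
    "vert_comp G G (snd b) \<gamma> = snd a" using f unfolding Op_hom by auto
  note m = Op_set_monad_map[OF g]
  interpret g: set_monad_map U V e "fst a" "fst b" \<gamma> by (rule m)
  interpret b: operad U V e A "fst b" "snd b" by (rule Op_operad[OF g(2)])
  have eg: "ends \<gamma> = g.psi_map" and eb: "ends (snd b) = b.M.psi_map" by (simp_all add: ends_def g.psi_map_def b.M.psi_map_def)
  have "ends (snd a) = vert_comp (seq_cat V) V (ends (snd b)) (ends \<gamma>)"
    using ends_vert_comp[OF m, of "snd b"] g(4) by simp
  hence "vert_comp (seq_cat V) V (vert_comp (seq_cat V) V eta_inv (ends (snd b))) (ends \<gamma>) = vert_comp (seq_cat V) V eta_inv (ends (snd a))"
    using vert_comp_assoc[OF g.psi_map_natural b.M.psi_map_natural multitensor_map.natural[OF eta_inv(1)]] eg eb by simp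
  thus ?thesis unfolding Mult_hom using Psi_in[OF g(1)] Psi_in[OF g(2)] g.psi_map_multitensor_map eg by (simp add: Psi_def)
qed

lemma cat_functor_Psi_over: "cat_functor (OP) (Mult V A) Psi_over"
proof (rule cat_functor.intro[OF category_Op category_Mult], rule cat_functor_axioms.intro)
  show "obj_map Psi_over \<in> Obj OP \<rightarrow>\<^sub>E Obj (Mult V A)" using Psi_in by (auto simp: Psi_over_def)
  show "arr_map Psi_over \<in> extensional (Arr OP)" by (simp add: Psi_over_def)
  show "arr_map Psi_over f \<in> Hom (Mult V A) (obj_map Psi_over a) (obj_map Psi_over b)" if f: "f \<in> Hom OP a b" for f a b
  proof -
    obtain \<gamma> where g: "f = (a, \<gamma>, b)" "a \<in> Ops" "b \<in> Ops" using f unfolding Op_hom by auto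
    show ?thesis using Psi_arr[of a \<gamma> b] f g by (simp add: Psi_over_simps)
  qed
  show "arr_map Psi_over (Ide OP a) = Ide (Mult V A) (obj_map Psi_over a)" if a: "a \<in> Obj OP" for a
  proof -
    have a': "a \<in> Ops" using a by simp
    have "Ide OP a = (a, id_trans G G (endo (fst a)), a)" by (cases a) simp
    moreover have "Ide OP a \<in> Hom OP a a" by (rule category.ide_in[OF category_Op a])
    ultimately have "arr_map Psi_over (Ide OP a) = (Psi a, id_trans (seq_cat V) V (tensor (set_monad.psi U V e (fst a))), Psi a)"
      using Psi_over_simps(2)[of a _ a] ends_id[OF Op_set_monad[OF a']] by simp
    thus ?thesis using a' by (simp add: Psi_over_simps Psi_def)
  qed
  show "arr_map Psi_over (g \<cdot>\<^bsub>OP\<^esub> f) = arr_map Psi_over g \<cdot>\<^bsub>Mult V A\<^esub> arr_map Psi_over f"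
    if f: "f \<in> Hom OP a b" and g: "g \<in> Hom OP b c" for f g a b c
  proof -
    obtain \<gamma> where \<gamma>: "f = (a, \<gamma>, b)" "a \<in> Ops" "b \<in> Ops"
      "monad_morphism G (fst a) (fst b) \<gamma>" "vert_comp G G (snd b) \<gamma> = snd a"
      using f unfolding Op_hom by auto
    obtain \<delta> where \<delta>: "g = (b, \<delta>, c)" "c \<in> Ops" "monad_morphism G (fst b) (fst c) \<delta>" "vert_comp G G (snd c) \<delta> = snd b"
      using g unfolding Op_hom by auto
    have "g \<cdot>\<^bsub>OP\<^esub> f \<in> Hom OP a c" by (rule category.comp_in[OF category_Op f g])
    moreover have "g \<cdot>\<^bsub>OP\<^esub> f = (a, vert_comp G G \<delta> \<gamma>, c)" using \<gamma>(1) \<delta>(1) by simp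
    ultimately show ?thesis
      using Psi_over_simps(2) f g \<gamma>(1) \<delta>(1) ends_vert_comp[OF Op_set_monad_map[OF \<gamma>(2-5)]]
      by simp
  qed
qed

subsection \<open>Unit and counit\<close>

lemma Mult_dist_line:
  assumes "b \<in> Mult_objects V A"
  shows "dist_line U V e (fst b)"
  by (intro dist_line.intro line_cat_axioms Mult_dist_mult assms)

text \<open>Naturality of the unit of the equivalence: \<open>Gamma_trans\<close> acts on the
  summand of the full path by \<gamma> at the homs along it, which are \<open>Xs\<close>
  itself.\<close>

lemma eta_trans:
  assumes "dist_line U V e B" "dist_line U V e C" "multitensor_map V B C \<gamma>"
  shows "vert_comp (seq_cat V) V (ends (Gamma_trans U V B C \<gamma>)) (dist_line.eta V e B) = vert_comp (seq_cat V) V (dist_line.eta V e C) \<gamma>"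
proof -
  interpret B: dist_line U V e B by fact
  interpret C: dist_line U V e C by fact
  interpret m: dist_map U V B C \<gamma> by (intro dist_map.intro B.A.dist_mult_axioms C.A.dist_mult_axioms assms)
  have "hmap (Gamma_trans U V B C \<gamma> (line Xs)) (e 0, e (length Xs)) \<cdot> B.eta Xs = C.eta Xs \<cdot> \<gamma> Xs" if X: "Xs \<in> lists (Obj V)" for Xs
    using m.trans_hom(3)[OF line_in[OF X] B.full_path] X B.full_homs[of Xs] B.eta_def C.eta_def by simp
  thus ?thesis by (auto simp: vert_comp_def ends_def)
qed

lemma eta_over:
  assumes b: "b \<in> Mult_objects V A"
  shows "(b, dist_line.eta V e (fst b), Psi (Gam b)) \<in> Hom (Mult V A) b (Psi (Gam b))"
    "is_iso (Mult V A) (b, dist_line.eta V e (fst b), Psi (Gam b))"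
proof -
  interpret b: dist_line U V e "fst b" by (rule Mult_dist_line[OF b])
  have m: "multitensor_map V (fst b) A (snd b)" using b by (auto simp: Mult_objects_def)
  interpret g: operad U V e A "Gamma U V (fst b)" "Gamma_trans U V (fst b) A (snd b)"
    using Op_operad[OF Gam_in[OF b]] by (simp add: Gam_def)
  have P: "Psi (Gam b) = (b.P.psi, vert_comp (seq_cat V) V eta_inv g.M.psi_map)"
    by (simp add: Psi_def Gam_def ends_def g.M.psi_map_def)
  have n: "vert_comp (seq_cat V) V g.M.psi_map b.eta = vert_comp (seq_cat V) V eta (snd b)"
    using eta_trans[OF b.dist_line_axioms dist_line_axioms m] by (simp add: ends_def g.M.psi_map_def)
  have "vert_comp (seq_cat V) V eta_inv eta = id_trans (seq_cat V) V (tensor A)"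
    using eta_inv(2) by (auto simp: vert_comp_def id_trans_def)
  \<comment> \<open>The triangle over \<open>A\<close>: \<open>eta\<close> is natural along the
    structure map of \<open>b\<close>, and for \<open>A\<close> it is cancelled by its
    inverse.\<close>
  hence "vert_comp (seq_cat V) V (vert_comp (seq_cat V) V eta_inv g.M.psi_map) b.eta = snd b"
    using vert_comp_assoc[OF b.eta_natural g.M.psi_map_natural multitensor_map.natural[OF eta_inv(1)]] n
      vert_comp_assoc[OF multitensor_map.natural[OF m] eta_natural multitensor_map.natural[OF eta_inv(1)]]
      vert_comp_id(2)[OF multitensor_map.natural[OF m]] by simp
  thus h: "(b, b.eta, Psi (Gam b)) \<in> Hom (Mult V A) b (Psi (Gam b))"
    unfolding Mult_hom using b Psi_in[OF Gam_in[OF b]] b.eta_multitensor_map P by simp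
  obtain \<delta> where "multitensor_map V b.P.psi (fst b) \<delta>"
    "vert_comp (seq_cat V) V \<delta> b.eta = id_trans (seq_cat V) V (tensor (fst b))"
    "vert_comp (seq_cat V) V b.eta \<delta> = id_trans (seq_cat V) V (tensor b.P.psi)"
    using multitensor_map_inverse[OF b.eta_multitensor_map b.eta_iso] by metis
  thus "is_iso (Mult V A) (b, b.eta, Psi (Gam b))"
    using MM.over_isoI[of b b.eta "Psi (Gam b)" \<delta>] h P unfolding Mult_over_cat by simp
qed

lemma eps_over:
  assumes p: "p \<in> Ops"
  shows "(Gam (Psi p), set_monad_dist.eps U V e (fst p), p) \<in> Hom (OP) (Gam (Psi p)) p"
    "is_iso (OP) (Gam (Psi p), set_monad_dist.eps U V e (fst p), p)"
proof -
  interpret p: operad U V e A "fst p" "snd p" by (rule Op_operad[OF p])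
  have P: "Gam (Psi p) = (Gamma U V p.M.S.psi, Gamma_trans U V p.M.S.psi A p.alpha)"
    by (simp add: Psi_def Gam_def ends_def p.M.psi_map_def p.alpha_def)
  show h: "(Gam (Psi p), p.D.eps, p) \<in> Hom (OP) (Gam (Psi p)) p"
    unfolding Op_hom using p Gam_in[OF Psi_in[OF p]] p.D.eps_monad_morphism P p.eps_over by simp
  obtain \<delta> where "monad_morphism G (fst p) (Gamma U V p.M.S.psi) \<delta>"
    "vert_comp G G \<delta> p.D.eps = id_trans G G (endo (Gamma U V p.M.S.psi))"
    "vert_comp G G p.D.eps \<delta> = id_trans G G (endo (fst p))"
    using monad_morphism_inverse[OF p.D.eps_monad_morphism] p.eps_iso by (metis graph_cat_simps(1))
  thus "is_iso (OP) (Gam (Psi p), p.D.eps, p)"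
    using OO.over_isoI[of "Gam (Psi p)" p.D.eps p \<delta>] h P unfolding Op_over_cat by simp
qed

text \<open>Naturality of the counit of the equivalence, checked on the summand of a path.\<close>

lemma eps_trans:
  assumes "set_monad_map U V e S T \<gamma>" "set_monad_dist U V e S" "set_monad_dist U V e T"
  shows "vert_comp G G (set_monad_dist.eps U V e T) (Gamma_trans U V (set_monad.psi U V e S) (set_monad.psi U V e T) (ends \<gamma>))
    = vert_comp G G \<gamma> (set_monad_dist.eps U V e S)"
proof -
  interpret S: set_monad_dist U V e S by fact
  interpret T: set_monad_dist U V e T by fact
  interpret g: set_monad_map U V e S T \<gamma> by fact
  have en: "ends \<gamma> = g.psi_map" by (simp add: ends_def g.psi_map_def)
  interpret m: dist_map U V S.psi T.psi "ends \<gamma>"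
    unfolding en by (intro dist_map.intro S.A.dist_mult_axioms T.A.dist_mult_axioms g.psi_map_multitensor_map)
  have "T.eps X \<odot> Gamma_trans U V S.psi T.psi (ends \<gamma>) X = \<gamma> X \<odot> S.eps X" if X: "X \<in> vgraphs U V" for X
  proof -
    note t = m.trans_hom[OF X] and eS = S.eps_hom[OF X] and eT = T.eps_hom[OF X] and gX = g.gamma_hom[OF X]
    note s = graph_homD(1)[OF t(1)] graph_homD(1)[OF eS(1)]
    show ?thesis
    proof (rule S.A.Gamma_hom_eqI[OF X G.comp_in[OF t(1) eT(1)] G.comp_in[OF eS(1) gX]])
      show "vmap (T.eps X \<odot> Gamma_trans U V S.psi T.psi (ends \<gamma>) X) a = vmap (\<gamma> X \<odot> S.eps X) a" if "a \<in> verts X" for a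
        using that s by (simp add: t(2) eS(2) eT(2) g.vmap_gamma[OF X])
      fix a b xs assume ab: "a \<in> verts X" "b \<in> verts X" and xs: "xs \<in> paths (verts X) a b"
      note xl = path_homs_lists[OF X pathsD(2)[OF xs]] and p = path_mor_hom[OF X xs]
      have th: "hmap (Gamma_trans U V S.psi T.psi (ends \<gamma>) X) (a, b) \<in> Hom V (homs (S.\<Gamma> X) (a, b)) (homs (T.\<Gamma> X) (a, b))"
        using graph_homD(6)[OF t(1)] ab t(2) by simp
      have gh: "hmap (\<gamma> X) (a, b) \<in> Hom V (homs (S.To X) (a, b)) (homs (T.To X) (a, b))"
        using graph_homD(6)[OF gX] ab S.verts_To[OF X] g.vmap_gamma[OF X] by simp
      have th': "ends \<gamma> (path_homs X xs) \<in> Hom V (path_tensor S.psi X xs) (path_tensor T.psi X xs)"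
        using g.psi_map_hom[OF xl] S.path_tensor_psi[OF X pathsD(2)[OF xs]] T.path_tensor_psi[OF X pathsD(2)[OF xs]] en by simp
      \<comment> \<open>Naturality of \<gamma> at the map of the path, evaluated at its end
        vertices.\<close>
      have j: "T.jota X xs \<cdot> ends \<gamma> (path_homs X xs) = hmap (\<gamma> X) (a, b) \<cdot> S.jota X xs"
        using g.hmap_gamma_comp[OF xl p] path_mor_ends[OF xs, of X]
        by (simp add: en S.jota_def T.jota_def path_homs_length)
      show "hmap (T.eps X \<odot> Gamma_trans U V S.psi T.psi (ends \<gamma>) X) (a, b) \<cdot> S.pinj X xs = hmap (\<gamma> X \<odot> S.eps X) (a, b) \<cdot> S.pinj X xs"
        using comp_assoc_hom[OF S.A.inj_hom[OF X xs] th T.eps_hmap[OF X ab]] comp_assoc_hom[OF th' T.A.inj_hom[OF X xs] T.eps_hmap[OF X ab]]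
          comp_assoc_hom[OF S.A.inj_hom[OF X xs] S.eps_hmap[OF X ab] gh] t(3)[OF xs] eS(3)[OF xs] eT(3)[OF xs] j ab s
        by (simp add: t(2) eS(2))
    qed
  qed
  thus ?thesis by (auto simp: vert_comp_def)
qed

lemma is_equivalence_Gamma_over: "is_equivalence (Mult V A) (OP) (Gamma_over U V A)"
proof -
  let ?F = "Gamma_over U V A"
  let ?unit = "\<lambda>b\<in>Mult_objects V A. (b, dist_line.eta V e (fst b), Psi (Gam b))"
  let ?counit = "\<lambda>p\<in>Ops. (Gam (Psi p), set_monad_dist.eps U V e (fst p), p)"
  have unit: "nat_iso (Mult V A) (Mult V A) (id_functor (Mult V A)) (comp_functor (Mult V A) Psi_over ?F) ?unit"
    unfolding nat_iso_def
  proof (intro conjI ballI nat_transI id_functor_cat_functor comp_functor_cat_functor[OF cat_functor_Gamma_over cat_functor_Psi_over] category_Mult)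
    show "?unit \<in> extensional (Obj (Mult V A))" by simp
    fix b assume "b \<in> Obj (Mult V A)"
    hence b: "b \<in> Mult_objects V A" by simp
    show "is_iso (Mult V A) (?unit b)" using eta_over(2)[OF b] b by simp
    show "?unit b \<in> Hom (Mult V A) (obj_map (id_functor (Mult V A)) b) (obj_map (comp_functor (Mult V A) Psi_over ?F) b)"
      using eta_over(1)[OF b] b Gam_in[OF b] by (simp add: id_functor_def comp_functor_def Gamma_over_simps Psi_over_simps)
  next
    fix f a b assume f: "f \<in> Hom (Mult V A) a b"
    then obtain \<gamma> where g: "f = (a, \<gamma>, b)" "a \<in> Mult_objects V A" "b \<in> Mult_objects V A" "multitensor_map V (fst a) (fst b) \<gamma>"
      unfolding Mult_hom by auto
    have "arr_map Psi_over (arr_map ?F f) = (Psi (Gam a), ends (Gamma_trans U V (fst a) (fst b) \<gamma>), Psi (Gam b))"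
      using f Gam_arr[of a \<gamma> b] g(1) by (simp add: Gamma_over_simps Psi_over_simps)
    thus "arr_map (comp_functor (Mult V A) Psi_over ?F) f \<cdot>\<^bsub>Mult V A\<^esub> ?unit a = ?unit b \<cdot>\<^bsub>Mult V A\<^esub> arr_map (id_functor (Mult V A)) f"
      using g eta_trans[OF Mult_dist_line[OF g(2)] Mult_dist_line[OF g(3)] g(4)] HomD(1)[OF f]
      by (simp add: id_functor_def comp_functor_def)
  qed
  have counit: "nat_iso OP OP (comp_functor OP ?F Psi_over) (id_functor OP) ?counit"
    unfolding nat_iso_def
  proof (intro conjI ballI nat_transI id_functor_cat_functor comp_functor_cat_functor[OF cat_functor_Psi_over cat_functor_Gamma_over] category_Op)
    show "?counit \<in> extensional (Obj OP)" by simp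
    fix p assume "p \<in> Obj OP"
    hence p: "p \<in> Ops" by simp
    show "is_iso OP (?counit p)" using eps_over(2)[OF p] p by simp
    show "?counit p \<in> Hom OP (obj_map (comp_functor OP ?F Psi_over) p) (obj_map (id_functor OP) p)"
      using eps_over(1)[OF p] p Psi_in[OF p] by (simp add: id_functor_def comp_functor_def Gamma_over_simps Psi_over_simps)
  next
    fix f p q assume f: "f \<in> Hom OP p q"
    then obtain \<gamma> where g: "f = (p, \<gamma>, q)" "p \<in> Ops" "q \<in> Ops"
      "monad_morphism G (fst p) (fst q) \<gamma>" "vert_comp G G (snd q) \<gamma> = snd p"
      unfolding Op_hom by auto
    interpret p: operad U V e A "fst p" "snd p" by (rule Op_operad[OF g(2)])
    interpret q: operad U V e A "fst q" "snd q" by (rule Op_operad[OF g(3)])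
    have "arr_map ?F (arr_map Psi_over f) = (Gam (Psi p), Gamma_trans U V p.M.S.psi q.M.S.psi (ends \<gamma>), Gam (Psi q))"
      using f Psi_arr[of p \<gamma> q] g(1) by (simp add: Gamma_over_simps Psi_over_simps) (simp add: Psi_def)
    thus "arr_map (id_functor OP) f \<cdot>\<^bsub>OP\<^esub> ?counit p = ?counit q \<cdot>\<^bsub>OP\<^esub> arr_map (comp_functor OP ?F Psi_over) f"
      using g eps_trans[OF Op_set_monad_map[OF g(2-5)] p.D.set_monad_dist_axioms q.D.set_monad_dist_axioms] HomD(1)[OF f]
      by (simp add: id_functor_def comp_functor_def)
  qed
  show ?thesis unfolding is_equivalence_def
    using cat_functor_Gamma_over cat_functor_Psi_over unit counit by blast
qed

end

theorem theorem6p1p1: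
  fixes U :: "'u set set"
    and V :: "('o, 'm) cat"
    and E :: "('o, 'm) multitensor"
  assumes "small_sets U"
    and "lextensive U V"
    and "multitensor V E"
    and "distributive_multitensor U V E"
    and "cartesian_multitensor V E"
  shows "is_equivalence (Mult V E) (Op U V (Gamma U V E)) (Gamma_over U V E)"
proof -
  interpret small_sets U by fact
  have ext: "extensive U V" using assms(2) by (simp add: lextensive_def)
  have cat: "category V" using ext by (simp add: extensive_def)
  have ec: "extensive_cat U V" by (intro extensive_cat.intro extensive_cat_axioms.intro cat assms(1) ext)
  \<comment> \<open>Smallness of arbitrarily long lines needs only finite sets of vertices, but all
    of them are drawn from one type, which must be infinite for \<open>e\<close> to exist.\<close>
  obtain J :: "'u set" where "infinite J" using small_infinite by blast
  then obtain e :: "nat \<Rightarrow> 'u" where "inj e" using infinite_countable_subset by blast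
  then interpret dist_line U V e E
    by (intro dist_line.intro line_cat.intro line_cat_axioms.intro dist_mult.intro dist_mult_axioms.intro ec assms)
  show ?thesis by (rule is_equivalence_Gamma_over)
qed

end
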